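(* In the setting described in the context, suppose $\bar u\in\mathcal U$ is a strict global minimizer of $\mathcal J$ over $\mathcal U$ (i.e. $\mathcal J(\bar u)<\mathcal J(u)$ for all $u\in\mathcal U\setminus\{\bar u\}$). Then the following are equivalent: (i) there exist $\delta>0$, $c>0$ such that $\mathcal J'(\bar u)v+\frac12\mathcal J''(\bar u)v^2\ge c\|z_v\|_{L^2(\Omega)}^2$ for all $v\in\mathcal U-\bar u$ with $\|z_v\|_{L^2(\Omega)}\le\delta$; (ii) there exists $\kappa>0$ such that for every $\eta\in L^2(\Omega)$ and every minimizer $u_\eta\in\mathcal U$ of the problem $(\mathcal P_\eta)$: $\min_{u\in\mathcal U}\frac12\int_\Omega|y_u-(y_d+\eta)|^2dx$, one has $\|y_{u_\eta}-y_{\bar u}\|_{L^2(\Omega)}\le\kappa\|\eta\|_{L^2(\Omega)}$.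
   Context: Let $d\in\{2,3\}$, $\Omega\subset\mathbb R^d$ a bounded Lipschitz domain, $\alpha<\beta$ reals, and $\mathcal U:=\{u\in L^1(\Omega): u(x)\in[\alpha,\beta]\text{ a.e.}\}$. For $u\in\mathcal U$, $y_u\in H^1_0(\Omega)\cap C(\bar\Omega)$ is the unique weak solution of $-\Delta y+y^3=u$ in $\Omega$, $y=0$ on $\partial\Omega$. Given $y_d\in L^2(\Omega)$, $\mathcal J(u):=\frac12\int_\Omega|y_u-y_d|^2dx$. The adjoint state $p_u\in H^1_0(\Omega)\cap C(\bar\Omega)$ is the weak solution of $-\Delta p+3y_u^2p=y_u-y_d$, $p=0$ on $\partial\Omega$, and $\mathcal J'(\bar u)v=\int_\Omega p_{\bar u}v\,dx$. For $v\in L^2(\Omega)$, $z_v\in H^1_0(\Omega)\cap C(\bar\Omega)$ is the weak solution of $-\Delta z+3y_{\bar u}^2z=v$, $z=0$ on $\partial\Omega$, and $\mathcal J''(\bar u)v^2=\int_\Omega(1-6y_{\bar u}p_{\bar u})z_v^2\,dx$. *)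

theory Defs
  imports "HOL-Analysis.Analysis"
begin

text \<open>Bounded Lipschitz domain: bounded, open, connected, and near every boundary point
  the set is (in suitable rotated coordinates with last axis e) the region strictly below
  the graph of a Lipschitz function defined on the hyperplane orthogonal to e.\<close>
definition lipschitz_domain :: "'a::euclidean_space set \<Rightarrow> bool" where
  "lipschitz_domain \<Omega> \<longleftrightarrow> bounded \<Omega> \<and> open \<Omega> \<and> connected \<Omega> \<and> \<Omega> \<noteq> {} \<and>
     (\<forall>x\<in>frontier \<Omega>. \<exists>r>0. \<exists>e::'a. \<exists>\<gamma>::'a \<Rightarrow> real. \<exists>L.
        norm e = 1 \<and> L-lipschitz_on {q. q \<bullet> e = 0} \<gamma> \<and>
        \<Omega> \<inter> ball x r = {p \<in> ball x r. p \<bullet> e < \<gamma> (p - (p \<bullet> e) *\<^sub>R e)})"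

definition pd :: "('a::euclidean_space \<Rightarrow> real) \<Rightarrow> 'a \<Rightarrow> 'a \<Rightarrow> real" where
  "pd f b x = frechet_derivative f (at x) b"

coinductive smooth :: "('a::euclidean_space \<Rightarrow> real) \<Rightarrow> bool" where
  "f differentiable_on UNIV \<Longrightarrow> (\<forall>b\<in>Basis. smooth (pd f b)) \<Longrightarrow> smooth f"

definition test_fun :: "'a::euclidean_space set \<Rightarrow> ('a \<Rightarrow> real) \<Rightarrow> bool" where
  "test_fun \<Omega> \<phi> \<longleftrightarrow> smooth \<phi> \<and> compact (closure {x. \<phi> x \<noteq> 0}) \<and> closure {x. \<phi> x \<noteq> 0} \<subseteq> \<Omega>"

definition weak_grad :: "'a::euclidean_space set \<Rightarrow> ('a \<Rightarrow> real) \<Rightarrow> ('a \<Rightarrow> 'a) \<Rightarrow> bool" where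
  "weak_grad \<Omega> y G \<longleftrightarrow> (\<forall>\<phi>. test_fun \<Omega> \<phi> \<longrightarrow> (\<forall>b\<in>Basis.
      (LINT x:\<Omega>|lebesgue. y x * pd \<phi> b x) = - (LINT x:\<Omega>|lebesgue. (G x \<bullet> b) * \<phi> x)))"

definition L2fun :: "'a::euclidean_space set \<Rightarrow> ('a \<Rightarrow> real) \<Rightarrow> bool" where
  "L2fun \<Omega> f \<longleftrightarrow> f \<in> borel_measurable lebesgue \<and> set_integrable lebesgue \<Omega> (\<lambda>x. (f x)\<^sup>2)"

definition L2norm :: "'a::euclidean_space set \<Rightarrow> ('a \<Rightarrow> real) \<Rightarrow> real" where
  "L2norm \<Omega> f = sqrt (LINT x:\<Omega>|lebesgue. (f x)\<^sup>2)"

definition Uad :: "'a::euclidean_space set \<Rightarrow> real \<Rightarrow> real \<Rightarrow> ('a \<Rightarrow> real) set" where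
  "Uad \<Omega> \<alpha> \<beta> = {u. u \<in> borel_measurable lebesgue \<and> set_integrable lebesgue \<Omega> u \<and>
                     (AE x in lebesgue. x \<in> \<Omega> \<longrightarrow> u x \<in> {\<alpha>..\<beta>})}"

text \<open>y in H^1_0 \<inter> C(closure Omega), represented by its extension by zero outside Omega
  (hence continuous on the whole space), with weak gradient G in L2, satisfying the weak
  formulation against all test functions.\<close>
definition weak_dirichlet ::
  "'a::euclidean_space set \<Rightarrow> ('a \<Rightarrow> real \<Rightarrow> real) \<Rightarrow> ('a \<Rightarrow> real) \<Rightarrow> ('a \<Rightarrow> real) \<Rightarrow> bool" where
  "weak_dirichlet \<Omega> N f y \<longleftrightarrow> continuous_on UNIV y \<and> (\<forall>x. x \<notin> \<Omega> \<longrightarrow> y x = 0) \<and>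
     (\<exists>G. G \<in> borel_measurable lebesgue \<and> set_integrable lebesgue \<Omega> (\<lambda>x. (norm (G x))\<^sup>2) \<and>
          weak_grad \<Omega> y G \<and>
          (\<forall>\<phi>. test_fun \<Omega> \<phi> \<longrightarrow>
             (LINT x:\<Omega>|lebesgue. (\<Sum>b\<in>Basis. (G x \<bullet> b) * pd \<phi> b x) + N x (y x) * \<phi> x)
             = (LINT x:\<Omega>|lebesgue. f x * \<phi> x)))"

definition sol :: "'a::euclidean_space set \<Rightarrow> ('a \<Rightarrow> real \<Rightarrow> real) \<Rightarrow> ('a \<Rightarrow> real) \<Rightarrow> 'a \<Rightarrow> real" where
  "sol \<Omega> N f = (THE y. weak_dirichlet \<Omega> N f y)"

definition state :: "'a::euclidean_space set \<Rightarrow> ('a \<Rightarrow> real) \<Rightarrow> 'a \<Rightarrow> real" where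
  "state \<Omega> u = sol \<Omega> (\<lambda>x t. t ^ 3) u"

definition adjoint :: "'a::euclidean_space set \<Rightarrow> ('a \<Rightarrow> real) \<Rightarrow> ('a \<Rightarrow> real) \<Rightarrow> 'a \<Rightarrow> real" where
  "adjoint \<Omega> yd u = sol \<Omega> (\<lambda>x t. 3 * (state \<Omega> u x)\<^sup>2 * t) (\<lambda>x. state \<Omega> u x - yd x)"

definition lin_state :: "'a::euclidean_space set \<Rightarrow> ('a \<Rightarrow> real) \<Rightarrow> ('a \<Rightarrow> real) \<Rightarrow> 'a \<Rightarrow> real" where
  "lin_state \<Omega> ubar v = sol \<Omega> (\<lambda>x t. 3 * (state \<Omega> ubar x)\<^sup>2 * t) v"

definition Jfun :: "'a::euclidean_space set \<Rightarrow> ('a \<Rightarrow> real) \<Rightarrow> ('a \<Rightarrow> real) \<Rightarrow> real" where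
  "Jfun \<Omega> yd u = 1/2 * (LINT x:\<Omega>|lebesgue. (state \<Omega> u x - yd x)\<^sup>2)"

definition J1 :: "'a::euclidean_space set \<Rightarrow> ('a \<Rightarrow> real) \<Rightarrow> ('a \<Rightarrow> real) \<Rightarrow> ('a \<Rightarrow> real) \<Rightarrow> real" where
  "J1 \<Omega> yd ubar v = (LINT x:\<Omega>|lebesgue. adjoint \<Omega> yd ubar x * v x)"

definition J2 :: "'a::euclidean_space set \<Rightarrow> ('a \<Rightarrow> real) \<Rightarrow> ('a \<Rightarrow> real) \<Rightarrow> ('a \<Rightarrow> real) \<Rightarrow> real" where
  "J2 \<Omega> yd ubar v = (LINT x:\<Omega>|lebesgue.
       (1 - 6 * state \<Omega> ubar x * adjoint \<Omega> yd ubar x) * (lin_state \<Omega> ubar v x)\<^sup>2)"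

end

theory Submission
 imports Defs "HOL-Complex_Analysis.Great_Picard"
begin

text \<open>Both conditions are equivalent to quadratic growth of the objective in the state,
 \<open>J(u) - J(ubar) \<ge> c \<parallel>y\<^sub>u - y\<^sub>b\<parallel>\<^sup>2\<close> for all admissible \<open>u\<close>. Growth gives stability by comparing a perturbed
 minimiser with \<open>ubar\<close>; conversely the perturbation \<open>(y\<^sub>u - y\<^sub>b) / (2 \<kappa>)\<close> has a minimiser, and stability
 applied to it gives growth. A Taylor expansion whose remainder is \<open>o(1) \<parallel>y\<^sub>u - y\<^sub>b\<parallel>\<^sup>2\<close> as
 \<open>y\<^sub>u \<rightarrow> y\<^sub>b\<close> uniformly identifies the second-order condition with growth near \<open>ubar\<close>; away from \<open>ubar\<close>
 growth follows from strict minimality and the compactness of the set of states.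

 The equations are solved in \<open>C\<^sub>0(\<Omega>)\<close> without Sobolev spaces: solutions are limits of whole-space
 problems with a penalty outside \<open>\<Omega>\<close>, built from the resolvent kernel, and the boundary values are
 controlled by barriers in the exterior balls of the Lipschitz domain. The weak gradient is recovered
 from an energy estimate and the Riesz representation theorem.\<close>

abbreviation cont :: "('a::topological_space => 'b::topological_space) => bool" where
 "cont f == continuous_on UNIV f"

lemmas b_integral_sum = Bochner_Integration.integral_sum
 and b_integrable_sum = Bochner_Integration.integrable_sum
 and b_integrable_bound = Bochner_Integration.integrable_bound
 and b_integral_cong = Bochner_Integration.integral_cong
 and b_integrable_add = Bochner_Integration.integrable_add
 and b_integrable_diff = Bochner_Integration.integrable_diff
 and b_integral_diff = Bochner_Integration.integral_diff

definition lap :: "('a::euclidean_space => real) => 'a => real" where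
 "lap f x = (\<Sum>b\<in>Basis. pd (pd f b) b x)"

definition flat_exp :: "nat => real => real" where
 "flat_exp m t = (if t > 0 then exp (- 1 / t) / t ^ m else 0)"

lemma flat_exp_tendsto_0: "((%h. flat_exp m h) \<longlongrightarrow> 0) (at 0)"
proof -
 have "((%x::real. x ^ m / exp x) \<longlongrightarrow> 0) at_top" by (rule tendsto_power_div_exp_0)
 from filterlim_compose[OF this filterlim_inverse_at_top_right]
 have 1: "((%h::real. inverse h ^ m / exp (inverse h)) \<longlongrightarrow> 0) (at_right 0)" .
 have r: "(flat_exp m \<longlongrightarrow> 0) (at_right 0)"
  by (rule Lim_transform_eventually[OF 1], unfold eventually_at_filter)
   (auto simp: flat_exp_def exp_minus field_simps)
 have l: "(flat_exp m \<longlongrightarrow> 0) (at_left 0)"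
  by (rule tendsto_eventually, unfold eventually_at_filter) (auto simp: flat_exp_def)
 from filterlim_split_at[OF l r] show ?thesis by simp
qed

lemma DERIV_flat_exp:
 "(flat_exp m has_real_derivative (flat_exp (m + 2) t - real m * flat_exp (m + 1) t)) (at t)"
proof -
 consider "t > 0" | "t < 0" | "t = 0" by linarith
 then show ?thesis
 proof cases
  case 1
  have "((%t. exp (- 1 / t) / t ^ m) has_real_derivative
    (flat_exp (m + 2) t - real m * flat_exp (m + 1) t)) (at t)"
   using 1 by (auto intro!: derivative_eq_intros simp: flat_exp_def field_simps power2_eq_square)
    (cases m; simp add: field_simps)
  then show ?thesis
  proof (rule DERIV_cong_ev[OF refl _ refl, THEN iffD1, rotated])
   have "\<forall>\<^sub>F x in nhds t. x > 0" using 1 by (rule eventually_nhds_in_open[OF open_greaterThan, of t 0, simplified])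
   then show "\<forall>\<^sub>F x in nhds t. exp (- 1 / x) / x ^ m = flat_exp m x"
    by eventually_elim (simp add: flat_exp_def)
  qed
 next
  case 2
  have "((%t. 0) has_real_derivative (flat_exp (m + 2) t - real m * flat_exp (m + 1) t)) (at t)"
   using 2 by (simp add: flat_exp_def)
  then show ?thesis
  proof (rule DERIV_cong_ev[OF refl _ refl, THEN iffD1, rotated])
   have "\<forall>\<^sub>F x in nhds t. x < 0" using 2 by (rule eventually_nhds_in_open[OF open_lessThan, of t 0, simplified])
   then show "\<forall>\<^sub>F x in nhds t. 0 = flat_exp m x"
    by eventually_elim (simp add: flat_exp_def)
  qed
 next
  case 3
  have "((%h. flat_exp m h / h) \<longlongrightarrow> 0) (at 0)"
   by (rule Lim_transform_eventually[OF flat_exp_tendsto_0[of "m+1"]])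
    (auto simp: flat_exp_def eventually_at_filter field_simps)
  then show ?thesis by (simp add: DERIV_def 3 flat_exp_def)
 qed
qed

text \<open>A class of functions closed under taking directional derivatives; it provides both the
 mollifier and all the barriers.\<close>
inductive elementary :: "('a::euclidean_space => real) => bool" where
 const: "elementary (%x. c)"
| coord: "elementary (%x. x \<bullet> v)"
| add: "elementary f ==> elementary g ==> elementary (%x. f x + g x)"
| mult: "elementary f ==> elementary g ==> elementary (%x. f x * g x)"
| exp: "elementary f ==> elementary (%x. exp (f x))"
| flat: "elementary f ==> elementary (%x. flat_exp m (f x))"

lemma elementary_derivative:
 "elementary f ==> EX D. (ALL x. (f has_derivative (%h. D h x)) (at x)) & (ALL h. elementary (D h))"
proof (induction rule: elementary.induct)
 case (const c)
 show ?case by (rule exI[of _ "%h x. 0"]) (auto intro: elementary.const)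
next
 case (coord v)
 show ?case by (rule exI[of _ "%h x. h \<bullet> v"]) (auto intro: elementary.const intro!: derivative_eq_intros)
next
 case (add f g)
 then obtain D E where D: "!!x. (f has_derivative (%h. D h x)) (at x)" "!!h. elementary (D h)"
  "!!x. (g has_derivative (%h. E h x)) (at x)" "!!h. elementary (E h)" by blast
 show ?case
  by (rule exI[of _ "%h x. D h x + E h x"])
   (use D in \<open>auto intro: elementary.add intro!: derivative_eq_intros\<close>)
next
 case (mult f g)
 then obtain D E where D: "!!x. (f has_derivative (%h. D h x)) (at x)" "!!h. elementary (D h)"
  "!!x. (g has_derivative (%h. E h x)) (at x)" "!!h. elementary (E h)" by blast
 show ?case
  by (rule exI[of _ "%h x. f x * E h x + D h x * g x"])
   (use D mult.hyps in \<open>auto intro!: has_derivative_mult elementary.add elementary.mult\<close>)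
next
 case (exp f)
 then obtain D where D: "!!x. (f has_derivative (%h. D h x)) (at x)" "!!h. elementary (D h)" by blast
 show ?case
  by (rule exI[of _ "%h x. D h x * exp (f x)"])
   (use D exp.hyps in \<open>auto intro: elementary.exp elementary.mult intro!: derivative_eq_intros\<close>)
next
 case (flat f m)
 then obtain D where D: "!!x. (f has_derivative (%h. D h x)) (at x)" "!!h. elementary (D h)" by blast
 have el: "elementary (%x. (flat_exp (m + 2) (f x) + (- real m) * flat_exp (m + 1) (f x)) * D h x)" for h
  by (intro elementary.add elementary.mult elementary.flat elementary.const D flat.hyps)
 have "((%x. flat_exp m (f x)) has_derivative
   (%h. (flat_exp (m + 2) (f x) + (- real m) * flat_exp (m + 1) (f x)) * D h x)) (at x)" for x
  using has_derivative_compose[OF D(1)[of x] DERIV_flat_exp[of m "f x", unfolded has_field_derivative_def]]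
  by (simp add: algebra_simps)
 with el show ?case by (intro exI[of _ "%h x. (flat_exp (m + 2) (f x) + (- real m) * flat_exp (m + 1) (f x)) * D h x"]) blast
qed

lemma pd_eq: "(f has_derivative D) (at x) ==> pd f b x = D b"
 unfolding pd_def using frechet_derivative_at by metis

lemma smooth_family:
 assumes "P f" "!!f x. P f ==> f differentiable (at x)" "!!f b. P f ==> b \<in> Basis ==> P (pd f b)"
 shows "smooth f"
 using assms(1)
proof (coinduct rule: smooth.coinduct)
 case (smooth f)
 then have "f differentiable_on UNIV" using assms(2) by (simp add: differentiable_on_def)
 then show ?case using assms(3)[OF smooth] by (intro exI[of _ f] conjI refl ballI disjI1)
qed

lemma elementary_smooth:
 assumes "elementary f" shows "smooth f"
proof (rule smooth_family[where P = elementary])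
 fix f :: "'a => real" and x b :: 'a assume "elementary f"
 then obtain D where D: "!!x. (f has_derivative (%h. D h x)) (at x)" "!!h. elementary (D h)"
  using elementary_derivative by blast
 then show "f differentiable (at x)" by (auto simp: differentiable_def)
 have "pd f b = D b" using pd_eq[OF D(1)] by auto
 with D show "elementary (pd f b)" by simp
qed fact

lemma smooth_differentiable: "smooth f ==> f differentiable (at x)"
 by (erule smooth.cases) (simp add: differentiable_on_def)

lemma smooth_pd: "smooth f ==> b \<in> Basis ==> smooth (pd f b)"
 by (erule smooth.cases) simp

lemma smooth_has_derivative: "smooth f ==> (f has_derivative (%h. pd f h x)) (at x)"
 unfolding pd_def using smooth_differentiable frechet_derivative_works by blast

lemma smooth_continuous: "smooth f ==> continuous_on S f"
 by (meson smooth_has_derivative continuous_at_imp_continuous_on has_derivative_continuous)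

lemma pd_basis_sum:
 assumes "f differentiable (at x)"
 shows "pd f h x = (\<Sum>b\<in>Basis. (h \<bullet> b) * pd f b x)"
proof -
 interpret linear "%h. pd f h x"
  using assms frechet_derivative_works has_derivative_linear unfolding pd_def by blast
 have "pd f (\<Sum>b\<in>Basis. (h \<bullet> b) *\<^sub>R b) x = (\<Sum>b\<in>Basis. (h \<bullet> b) * pd f b x)"
  by (subst sum) (simp add: scale)
 then show ?thesis by (simp add: euclidean_representation)
qed

lemma pd_add: "smooth f ==> smooth g ==> pd (%x. f x + g x) b = (%x. pd f b x + pd g b x)"
 by (rule ext, rule pd_eq[OF has_derivative_add]) (auto intro: smooth_has_derivative)

lemma smooth_add:
 assumes "smooth f" "smooth g" shows "smooth (%x. f x + g x)"
proof (rule smooth_family[where P = "%F. EX f g. F = (%x. f x + g x) & smooth f & smooth g"])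
 show "EX f' g'. (%x. f x + g x) = (%x. f' x + g' x) & smooth f' & smooth g'"
  by (rule exI[of _ f], rule exI[of _ g]) (simp add: assms)
next
 fix F :: "'a => real" and x b :: 'a assume "EX f g. F = (%x. f x + g x) & smooth f & smooth g"
 then obtain f g where F: "F = (%x. f x + g x)" "smooth f" "smooth g" by (elim exE conjE)
 show "F differentiable (at x)"
  unfolding F(1) by (intro differentiable_add smooth_differentiable F)
 assume b: "b \<in> Basis"
 show "EX f g. pd F b = (%x. f x + g x) & smooth f & smooth g"
  by (rule exI[of _ "pd f b"], rule exI[of _ "pd g b"])
   (simp add: F(1) pd_add[OF F(2,3)] smooth_pd[OF F(2) b] smooth_pd[OF F(3) b])
qed

lemma has_derivative_affine:
 assumes "smooth f"
 shows "((%x. k * f (c *\<^sub>R x + v)) has_derivative (%h. k * pd f (c *\<^sub>R h) (c *\<^sub>R x + v))) (at x)"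
 by (intro has_derivative_mult_right has_derivative_compose[OF _ smooth_has_derivative[OF assms]])
  (auto intro!: derivative_eq_intros)

lemma pd_affine:
 assumes "smooth f"
 shows "pd (%x. k * f (c *\<^sub>R x + v)) b = (%x. (k * c) * pd f b (c *\<^sub>R x + v))"
proof (rule ext, rule pd_eq[THEN trans])
 fix x
 show "((%x. k * f (c *\<^sub>R x + v)) has_derivative (%h. k * pd f (c *\<^sub>R h) (c *\<^sub>R x + v))) (at x)"
  by (rule has_derivative_affine[OF assms])
 show "k * pd f (c *\<^sub>R b) (c *\<^sub>R x + v) = k * c * pd f b (c *\<^sub>R x + v)"
  by (simp add: pd_basis_sum[OF smooth_differentiable[OF assms], of "c *\<^sub>R b"]
    pd_basis_sum[OF smooth_differentiable[OF assms], of b] sum_distrib_left algebra_simps)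
qed

lemma smooth_affine:
 assumes "smooth f" shows "smooth (%x. k * f (c *\<^sub>R x + v))"
proof (rule smooth_family[where P = "%F. EX k f. F = (%x. k * f (c *\<^sub>R x + v)) & smooth f"])
 show "EX k' f'. (%x. k * f (c *\<^sub>R x + v)) = (%x. k' * f' (c *\<^sub>R x + v)) & smooth f'"
  by (rule exI[of _ k], rule exI[of _ f]) (simp add: assms)
next
 fix F :: "'a => real" and x b :: 'a assume "EX k f. F = (%x. k * f (c *\<^sub>R x + v)) & smooth f"
 then obtain k f where F: "F = (%x. k * f (c *\<^sub>R x + v))" "smooth f" by (elim exE conjE)
 show "F differentiable (at x)"
  unfolding F(1) differentiable_def by (rule exI, rule has_derivative_affine[OF F(2)])
 assume b: "b \<in> Basis"
 show "EX k f. pd F b = (%x. k * f (c *\<^sub>R x + v)) & smooth f"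
  by (rule exI[of _ "k * c"], rule exI[of _ "pd f b"])
   (simp add: F(1) pd_affine[OF F(2)] smooth_pd[OF F(2) b])
qed

lemma smooth_cmult: "smooth f ==> smooth (%x. k * f x)"
 using smooth_affine[of f k 1 0] by simp

lemma pd_cmult: "smooth f ==> pd (%x. k * f x) b = (%x. k * pd f b x)"
 using pd_affine[of f k 1 0 b] by simp

lemma smooth_lap: "smooth f ==> continuous_on S (lap f)"
 unfolding lap_def[abs_def] by (intro continuous_on_sum smooth_continuous smooth_pd)

lemma lap_affine: "smooth f ==> lap (%x. k * f (c *\<^sub>R x + v)) = (%x. k * c\<^sup>2 * lap f (c *\<^sub>R x + v))"
 by (rule ext, simp only: lap_def sum_distrib_left, rule sum.cong)
  (simp_all add: pd_affine smooth_pd power2_eq_square)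

lemma lap_add: "smooth f ==> smooth g ==> lap (%x. f x + g x) = (%x. lap f x + lap g x)"
 by (rule ext, simp only: lap_def sum.distrib[symmetric], rule sum.cong) (simp_all add: pd_add smooth_pd)

lemma lap_cmult: "smooth f ==> lap (%x. k * f x) = (%x. k * lap f x)"
 using lap_affine[of f k 1 0] by simp

lemma pd_zero_outside:
 assumes "closed K" "!!x. x ~: K ==> f x = 0" "x ~: K"
 shows "pd f b x = 0"
proof -
 have "(f has_derivative (%h. 0)) (at x)"
 proof (rule has_derivative_transform_within_open)
  show "((%x. 0) has_derivative (%h. 0)) (at x)" by simp
  show "open (- K)" "x \<in> - K" using assms by auto
 qed (use assms in auto)
 from pd_eq[OF this] show ?thesis by simp
qed

lemma lap_zero_outside:
 assumes "closed K" "!!x. x ~: K ==> f x = 0" "x ~: K"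
 shows "lap f x = 0"
 unfolding lap_def using assms by (auto intro!: sum.neutral pd_zero_outside[of K])

lemma test_funI:
 assumes "smooth \<phi>" "compact K" "K \<subseteq> D" "!!x. x ~: K ==> \<phi> x = 0"
 shows "test_fun D \<phi>"
proof -
 have "closure {x. \<phi> x ~= 0} \<subseteq> K"
  using assms by (intro closure_minimal) (auto intro: compact_imp_closed)
 moreover have "compact (closure {x. \<phi> x ~= 0})"
  using compact_Int_closed[OF assms(2) closed_closure] calculation by (metis inf.absorb2)
 ultimately show ?thesis using assms by (auto simp: test_fun_def)
qed

lemma test_funE:
 assumes "test_fun D \<phi>"
 obtains K where "smooth \<phi>" "compact K" "K \<subseteq> D" "!!x. x ~: K ==> \<phi> x = 0"
  "!!x b. x ~: K ==> pd \<phi> b x = 0" "!!x. x ~: K ==> lap \<phi> x = 0"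
proof -
 let ?K = "closure {x. \<phi> x ~= 0}"
 have z: "\<phi> x = 0" if "x ~: ?K" for x
  using that subsetD[OF closure_subset, of x "{x. \<phi> x ~= 0}"] by auto
 show ?thesis
 proof (rule that[of ?K])
  show "smooth \<phi>" "compact ?K" "?K \<subseteq> D" using assms by (simp_all add: test_fun_def)
  show "\<phi> x = 0" if "x ~: ?K" for x using z[OF that] .
  show "pd \<phi> b x = 0" if "x ~: ?K" for x b using z that by (rule pd_zero_outside[OF closed_closure])
  show "lap \<phi> x = 0" if "x ~: ?K" for x using z that by (rule lap_zero_outside[OF closed_closure])
 qed
qed

lemma test_fun_smooth: "test_fun D \<phi> ==> smooth \<phi>"
 by (simp add: test_fun_def)

lemma test_fun_mono: "test_fun D \<phi> ==> D \<subseteq> D' ==> test_fun D' \<phi>"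
 by (auto simp: test_fun_def)

lemma test_fun_pd:
 assumes "test_fun D \<phi>" "b \<in> Basis" shows "test_fun D (pd \<phi> b)"
proof -
 obtain K where K: "smooth \<phi>" "compact K" "K \<subseteq> D" "!!x b. x ~: K ==> pd \<phi> b x = 0"
  by (rule test_funE[OF assms(1)]) (rule that, assumption+)
 show ?thesis using K(4) by (rule test_funI[OF smooth_pd[OF K(1) assms(2)] K(2,3)])
qed

lemma test_fun_add:
 assumes "test_fun D \<phi>" "test_fun D \<psi>" shows "test_fun D (%x. \<phi> x + \<psi> x)"
proof -
 obtain K where K: "smooth \<phi>" "compact K" "K \<subseteq> D" "!!x. x ~: K ==> \<phi> x = 0"
  by (rule test_funE[OF assms(1)]) (rule that, assumption+)
 obtain L where L: "smooth \<psi>" "compact L" "L \<subseteq> D" "!!x. x ~: L ==> \<psi> x = 0"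
  by (rule test_funE[OF assms(2)]) (rule that, assumption+)
 show ?thesis
  using K L by (intro test_funI[of _ "K \<union> L"] smooth_add compact_Un) simp_all
qed

lemma test_fun_cmult:
 assumes "test_fun D \<phi>" shows "test_fun D (%x. c * \<phi> x)"
proof -
 obtain K where K: "smooth \<phi>" "compact K" "K \<subseteq> D" "!!x. x ~: K ==> \<phi> x = 0"
  by (rule test_funE[OF assms(1)]) (rule that, assumption+)
 then show ?thesis by (intro test_funI[of _ K] smooth_cmult) simp_all
qed

lemma test_fun_outside:
 assumes "test_fun D \<phi>" "x ~: D" shows "\<phi> x = 0"
proof -
 obtain K where K: "smooth \<phi>" "compact K" "K \<subseteq> D" "!!x. x ~: K ==> \<phi> x = 0"
  by (rule test_funE[OF assms(1)]) (rule that, assumption+)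
 with assms(2) show ?thesis by (meson subsetD)
qed

lemma compact_support_bounded:
 fixes f :: "'a::euclidean_space => real"
 assumes "cont f" "compact K" "!!x. x ~: K ==> f x = 0"
 obtains C where "!!x. \<bar>f x\<bar> <= C" "0 <= C"
proof -
 have "bounded (f ` K)"
  using assms by (intro compact_imp_bounded compact_continuous_image continuous_on_subset[OF assms(1)]) auto
 then obtain C where C: "!!x. x \<in> K ==> \<bar>f x\<bar> <= C" unfolding bounded_iff by auto
 have "\<bar>f x\<bar> <= \<bar>C\<bar>" for x using C[of x] assms(3)[of x] by (cases "x \<in> K") simp_all
 then show ?thesis using that[of "\<bar>C\<bar>"] by simp
qed

lemma test_fun_bounded:
 assumes "test_fun D \<phi>" obtains C where "!!x. \<bar>\<phi> x\<bar> <= C" "0 <= C"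
proof -
 obtain K where K: "smooth \<phi>" "compact K" "!!x. x ~: K ==> \<phi> x = 0"
  by (rule test_funE[OF assms(1)]) (rule that, assumption+)
 show ?thesis using K(3) that by (rule compact_support_bounded[OF smooth_continuous[OF K(1)] K(2)])
qed

lemma integrable_compact_support:
 fixes f :: "'a::euclidean_space => real"
 assumes "cont f" "compact K" "!!x. x ~: K ==> f x = 0"
 shows "integrable lborel f"
proof -
 have "integrable lborel (%x. indicator K x *\<^sub>R f x)"
  using assms by (intro borel_integrable_compact) (auto intro: continuous_on_subset)
 moreover have "(%x. indicator K x *\<^sub>R f x) = f"
  using assms by (auto simp: indicator_def fun_eq_iff)
 ultimately show ?thesis by simp
qed

lemma line_derivative:
 assumes "!!x. f differentiable (at x)"
 shows "((%t. f (x + t *\<^sub>R v)) has_real_derivative pd f v (x + t *\<^sub>R v)) (at t)"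
proof -
 have D: "(f has_derivative (%h. pd f h y)) (at y)" for y
  unfolding pd_def using frechet_derivative_works assms by metis
 have "((%t. f (x + t *\<^sub>R v)) has_derivative (%s. pd f (s *\<^sub>R v) (x + t *\<^sub>R v))) (at t)"
  by (rule has_derivative_compose[OF _ D]) (auto intro!: derivative_eq_intros)
 moreover have "pd f (s *\<^sub>R v) y = pd f v y * s" for s y
  by (simp add: pd_basis_sum[OF assms, of "s *\<^sub>R v"]
    pd_basis_sum[OF assms, of "v"] sum_distrib_left sum_distrib_right algebra_simps)
 ultimately show ?thesis by (simp add: has_field_derivative_def)
qed

lemma deriv_under_integral:
 fixes f :: "real => 'b => real"
 assumes f: "!!s. integrable M (f s)"
  and D: "!!s z. \<bar>s - s0\<bar> <= 1 ==> ((%s. f s z) has_real_derivative f' s z) (at s)"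
  and m: "f' s0 \<in> borel_measurable M"
  and bd: "!!s z. \<bar>s - s0\<bar> <= 1 ==> \<bar>f' s z\<bar> <= w z" and w: "integrable M w"
 shows "((%s. \<integral>z. f s z \<partial>M) has_real_derivative (\<integral>z. f' s0 z \<partial>M)) (at s0)"
 unfolding DERIV_def tendsto_at_iff_sequentially
proof (intro allI impI)
 fix X :: "nat => real" assume X: "ALL i. X i \<in> UNIV - {0}" "X \<longlonglongrightarrow> 0"
 then obtain N where N: "!!n. n >= N ==> \<bar>X n\<bar> < 1"
  using LIMSEQ_D[of X 0 1] by auto
 have b: "\<bar>(f (s0 + X (n + N)) z - f s0 z) / X (n + N)\<bar> <= w z" for n z
 proof -
  have "norm (f (s0 + X (n + N)) z - f s0 z) <= w z * norm (s0 + X (n + N) - s0)"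
  proof (rule field_differentiable_bound[where S = "{s. \<bar>s - s0\<bar> <= 1}" and f' = "%s. f' s z"])
   have "{s. \<bar>s - s0\<bar> <= 1} = {s0 - 1..s0 + 1}" by auto
   then show "convex {s. \<bar>s - s0\<bar> <= 1}" by simp
  qed (use N[of "n + N"] bd D in \<open>auto intro: has_field_derivative_at_within\<close>)
  then show ?thesis using X(1) by (simp add: field_simps)
 qed
 have "(%n. \<integral>z. (f (s0 + X (n + N)) z - f s0 z) / X (n + N) \<partial>M) \<longlonglongrightarrow> (\<integral>z. f' s0 z \<partial>M)"
 proof (rule integral_dominated_convergence[where w = w])
  show "AE z in M. (%n. (f (s0 + X (n + N)) z - f s0 z) / X (n + N)) \<longlonglongrightarrow> f' s0 z"
  proof (rule AE_I2)
   fix z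
   have "((%h. (f (s0 + h) z - f s0 z) / h) \<longlongrightarrow> f' s0 z) (at 0)"
    using D[of s0 z] by (simp add: DERIV_def)
   then have "((%h. (f (s0 + h) z - f s0 z) / h) \<circ> X) \<longlonglongrightarrow> f' s0 z"
    using X unfolding tendsto_at_iff_sequentially by blast
   from LIMSEQ_ignore_initial_segment[OF this, of N]
   show "(%n. (f (s0 + X (n + N)) z - f s0 z) / X (n + N)) \<longlonglongrightarrow> f' s0 z" by (simp add: o_def)
  qed
 qed (use m w b f in auto)
 moreover have eq: "(\<integral>z. (f (s0 + X (n + N)) z - f s0 z) / X (n + N) \<partial>M)
   = ((\<integral>z. f (s0 + X (n + N)) z \<partial>M) - (\<integral>z. f s0 z \<partial>M)) / X (n + N)" for n
  using f by simp
 ultimately have "(%n. ((\<integral>z. f (s0 + X (n + N)) z \<partial>M) - (\<integral>z. f s0 z \<partial>M)) / X (n + N)) \<longlonglongrightarrow> (\<integral>z. f' s0 z \<partial>M)"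
  by (simp only: eq)
 then have "(%n. ((\<integral>z. f (s0 + X n) z \<partial>M) - (\<integral>z. f s0 z \<partial>M)) / X n) \<longlonglongrightarrow> (\<integral>z. f' s0 z \<partial>M)"
  by (rule LIMSEQ_offset)
 then show "((%h. ((\<integral>z. f (s0 + h) z \<partial>M) - (\<integral>z. f s0 z \<partial>M)) / h) \<circ> X) \<longlonglongrightarrow> (\<integral>z. f' s0 z \<partial>M)"
  by (simp add: o_def)
qed

lemma lborel_integral_affine:
 fixes f :: "'a::euclidean_space => real"
 assumes [measurable]: "f \<in> borel_measurable borel" and c: "c ~= 0"
 shows "(LBINT x. f x) = \<bar>c\<bar> ^ DIM('a) * (LBINT x. f (t + c *\<^sub>R x))"
 by (subst lborel_affine[OF c, of t]) (simp add: integral_density integral_distr)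

lemma lborel_integrable_affine:
 fixes f :: "'a::euclidean_space => real"
 assumes f: "integrable lborel f" and c: "c ~= 0"
 shows "integrable lborel (%x. f (t + c *\<^sub>R x))"
proof -
 have [measurable]: "f \<in> borel_measurable borel" using f by auto
 have "integrable (density (distr lborel borel (%x. t + c *\<^sub>R x)) (%_. ennreal (\<bar>c\<bar> ^ DIM('a)))) f"
  using f lborel_affine[OF c, of t] by simp
 then have "integrable lborel (%x. \<bar>c\<bar> ^ DIM('a) *\<^sub>R f (t + c *\<^sub>R x))"
  by (subst (asm) integrable_density) (simp_all add: integrable_distr_eq)
 then show ?thesis using c by simp
qed

lemma lborel_integral_shift:
 fixes f :: "'a::euclidean_space => real"
 assumes "f \<in> borel_measurable borel"
 shows "(LBINT x. f (x + v)) = (LBINT x. f x)"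
 using lborel_integral_affine[OF assms, of 1 v] by (simp add: add.commute)

lemma lborel_integral_reflect:
 fixes f :: "'a::euclidean_space => real"
 assumes "f \<in> borel_measurable borel"
 shows "(LBINT x. f (v - x)) = (LBINT x. f x)"
 using lborel_integral_affine[OF assms, of "-1" v] by simp

lemma borel_measurable_UNIV: "cont f ==> f \<in> borel_measurable borel"
 by (rule borel_measurable_continuous_onI)

lemma integral_pd_zero:
 fixes F :: "'a::euclidean_space => real"
 assumes F: "!!x. F differentiable (at x)" and c: "cont (pd F b)"
  and K: "compact K" "!!x. x ~: K ==> F x = 0"
 shows "(LBINT x. pd F b x) = 0"
proof -
 have cF: "cont F"
  using F by (simp add: continuous_at_imp_continuous_on differentiable_imp_continuous_within)
 have [measurable]: "F \<in> borel_measurable borel" "pd F b \<in> borel_measurable borel"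
  using cF c by (auto intro: borel_measurable_UNIV)
 have z: "pd F b x = 0" if "x ~: K" for x
  using K(2) that by (rule pd_zero_outside[OF compact_imp_closed[OF K(1)]])
 obtain C where C: "!!x. \<bar>pd F b x\<bar> <= C" "0 <= C" using z that by (rule compact_support_bounded[OF c K(1)])
 obtain R where R: "!!x. x \<in> K ==> norm x <= R" using compact_imp_bounded[OF K(1)] bounded_iff by blast
 have iF: "integrable lborel F" using K(2) by (rule integrable_compact_support[OF cF K(1)])
 define w where "w x = C * indicator (cball 0 (R + norm b)) x" for x :: 'a
 have "((%s. \<integral>x. F (x + s *\<^sub>R b) \<partial>lborel) has_real_derivative (LBINT x. pd F b (x + 0 *\<^sub>R b))) (at 0)"
 proof (rule deriv_under_integral[where w = w])
  show "integrable lborel (%x. F (x + s *\<^sub>R b))" for s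
   using lborel_integrable_affine[OF iF, of 1 "s *\<^sub>R b"] by (simp add: add.commute)
  show "((%s. F (x + s *\<^sub>R b)) has_real_derivative pd F b (x + s *\<^sub>R b)) (at s)" for s x
   by (rule line_derivative[OF F])
  show "\<bar>pd F b (x + s *\<^sub>R b)\<bar> <= w x" if "\<bar>s - 0\<bar> <= 1" for s x
  proof (cases "x + s *\<^sub>R b \<in> K")
   case True
   have "norm x <= norm (x + s *\<^sub>R b) + norm (s *\<^sub>R b)" by (metis add_diff_cancel norm_triangle_ineq4)
   also have "\<dots> <= R + norm b"
    using R[OF True] that mult_right_mono[of "\<bar>s\<bar>" 1 "norm b"] by (simp add: norm_scaleR)
   finally show ?thesis using C by (simp add: w_def)
  next
   case False
   then show ?thesis using z C by (simp add: w_def)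
  qed
  show "integrable lborel w" unfolding w_def[abs_def]
   by (intro integrable_mult_right integrable_real_indicator)
    (use emeasure_bounded_finite[OF bounded_cball, of "0::'a" "R + norm b"] in auto)
 qed measurable
 moreover have "(LBINT x. F (x + s *\<^sub>R b)) = (LBINT x. F x)" for s
  by (rule lborel_integral_shift) measurable
 ultimately have "((%s::real. (LBINT x. F x)) has_real_derivative (LBINT x. pd F b x)) (at 0)"
  by simp
 from DERIV_unique[OF this DERIV_const] show ?thesis .
qed

lemma pd_mult:
 assumes "f differentiable (at x)" "g differentiable (at x)"
 shows "pd (%x. f x * g x) b x = f x * pd g b x + pd f b x * g x"
  and "(%x. f x * g x) differentiable (at x)"
proof -
 have "((%x. f x * g x) has_derivative (%h. f x * pd g h x + pd f h x * g x)) (at x)"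
  unfolding pd_def using assms frechet_derivative_works by (intro has_derivative_mult) blast+
 then show "pd (%x. f x * g x) b x = f x * pd g b x + pd f b x * g x"
  "(%x. f x * g x) differentiable (at x)" by (auto intro: pd_eq simp: differentiable_def)
qed

lemma integration_by_parts:
 fixes f g :: "'a::euclidean_space => real"
 assumes f: "!!x. f differentiable (at x)" "cont (pd f b)"
  and g: "!!x. g differentiable (at x)" "cont (pd g b)"
  and K: "compact K" "!!x. x ~: K ==> f x = 0 \<or> g x = 0"
 shows "(LBINT x. f x * pd g b x) = - (LBINT x. pd f b x * g x)"
  (is ?A) and "integrable lborel (%x. f x * pd g b x)" (is ?B) and "integrable lborel (%x. pd f b x * g x)" (is ?C)
proof -
 have cont: "cont f" "cont g"
  using f g by (auto simp: continuous_at_imp_continuous_on differentiable_imp_continuous_within)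
 have cl: "closed K" using K(1) by (rule compact_imp_closed)
 have z: "f x * g x = 0" if "x ~: K" for x using K(2)[OF that] by auto
 have pz: "f x * pd g b x = 0 & pd f b x * g x = 0" if "x ~: K" for x
 proof (cases "f x = 0")
  case True
  have "pd (%x. f x * g x) b x = 0" by (rule pd_zero_outside[OF cl _ that]) (use z in auto)
  then show ?thesis using True by (simp add: pd_mult[OF f(1) g(1)])
 next
  case False
  then have "g x = 0" using K(2)[OF that] by auto
  moreover have "pd (%x. f x * g x) b x = 0" by (rule pd_zero_outside[OF cl _ that]) (use z in auto)
  ultimately show ?thesis by (simp add: pd_mult[OF f(1) g(1)])
 qed
 show ?B ?C
  by (intro integrable_compact_support[OF _ K(1)] continuous_intros cont f g; use pz in auto)+
 have "(LBINT x. pd (%x. f x * g x) b x) = 0"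
 proof (rule integral_pd_zero[OF pd_mult(2)[OF f(1) g(1)] _ K(1)])
  show "f x * g x = 0" if "x ~: K" for x by (rule z[OF that])
  show "cont (pd (%x. f x * g x) b)"
   unfolding pd_mult(1)[OF f(1) g(1), abs_def] by (intro continuous_intros cont f g)
 qed
 then have "(LBINT x. f x * pd g b x + pd f b x * g x) = 0" by (simp add: pd_mult[OF f(1) g(1)])
 with \<open>?B\<close> \<open>?C\<close> show ?A by simp
qed

lemma integral_lap_swap:
 assumes "smooth \<psi>" "test_fun D \<phi>"
 shows "(LBINT x. \<psi> x * lap \<phi> x) = (LBINT x. lap \<psi> x * \<phi> x)"
proof -
 obtain K where K: "smooth \<phi>" "compact K" "!!x. x ~: K ==> \<phi> x = 0" "!!x b. x ~: K ==> pd \<phi> b x = 0"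
  by (rule test_funE[OF assms(2)]) (rule that, assumption+)
 note s = smooth_differentiable smooth_continuous smooth_pd K(1) assms(1)
 have 1: "(LBINT x. \<psi> x * pd (pd \<phi> b) b x) = - (LBINT x. pd \<psi> b x * pd \<phi> b x)"
   "integrable lborel (%x. \<psi> x * pd (pd \<phi> b) b x)" if "b \<in> Basis" for b
  by (rule integration_by_parts[OF _ _ _ _ K(2)]; use that K in \<open>auto intro: s\<close>)+
 have 2: "(LBINT x. pd \<psi> b x * pd \<phi> b x) = - (LBINT x. pd (pd \<psi> b) b x * \<phi> x)"
   "integrable lborel (%x. pd (pd \<psi> b) b x * \<phi> x)" if "b \<in> Basis" for b
  by (rule integration_by_parts[OF _ _ _ _ K(2)]; use that K in \<open>auto intro: s\<close>)+
 have "(LBINT x. \<psi> x * lap \<phi> x) = (\<Sum>b\<in>Basis. \<integral>x. \<psi> x * pd (pd \<phi> b) b x \<partial>lborel)"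
  unfolding lap_def sum_distrib_left using 1 by (intro b_integral_sum)
 also have "\<dots> = (\<Sum>b\<in>Basis. \<integral>x. pd (pd \<psi> b) b x * \<phi> x \<partial>lborel)"
  using 1(1) 2(1) by (intro sum.cong) auto
 also have "\<dots> = (LBINT x. lap \<psi> x * \<phi> x)"
  unfolding lap_def sum_distrib_right using 2 by (intro b_integral_sum[symmetric])
 finally show ?thesis .
qed

lemma elementary_sum: "finite A ==> (!!i. i \<in> A ==> elementary (f i)) ==> elementary (%x. \<Sum>i\<in>A. f i x)"
 by (induction A rule: finite_induct) (auto intro: elementary.const elementary.add)

lemma elementary_sqdist: "elementary (%x. (x - a) \<bullet> (x - a))"
proof -
 have "elementary (%x. (\<Sum>b\<in>Basis. (x \<bullet> b) * (x \<bullet> b)) + (- 2 * (x \<bullet> a) + a \<bullet> a))"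
  by (intro elementary.add elementary.mult elementary_sum elementary.const elementary.coord) auto
 moreover have "(\<Sum>b\<in>Basis. (x \<bullet> b) * (x \<bullet> b)) + (- 2 * (x \<bullet> a) + a \<bullet> a) = (x - a) \<bullet> (x - a)" for x
  using euclidean_inner[of x x] by (simp add: inner_diff_left inner_diff_right inner_commute)
 ultimately show ?thesis by simp
qed

lemma lap_sqdist: "lap (%x::'a. (x - a) \<bullet> (x - a)) x = 2 * DIM('a::euclidean_space)"
proof -
 have "((%x::'a. (x - a) \<bullet> (x - a)) has_derivative (%h. 2 * ((x - a) \<bullet> h))) (at x)" for x
  by (auto intro!: derivative_eq_intros simp: inner_commute)
 then have 1: "pd (%x::'a. (x - a) \<bullet> (x - a)) b = (%x. 2 * ((x - a) \<bullet> b))" for b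
  by (auto dest: pd_eq)
 have D2: "((%x. 2 * ((x - a) \<bullet> b)) has_derivative (%h. 2 * (h \<bullet> b))) (at x)" for b x
  by (auto intro!: derivative_eq_intros)
 then have 2: "pd (%x. 2 * ((x - a) \<bullet> b)) b = (%x. 2)" if "b \<in> Basis" for b
  using that by (simp add: pd_eq[OF D2] fun_eq_iff)
 show ?thesis by (simp add: lap_def 1 2)
qed

lemma mollifier_exists:
 "\<exists>\<rho> :: 'a::euclidean_space => real. smooth \<rho> & (ALL x. 0 <= \<rho> x) & (ALL x. norm x >= 1 --> \<rho> x = 0) & (LBINT x. \<rho> x) = 1"
proof -
 define \<rho> :: "'a => real" where "\<rho> x = flat_exp 0 (1 + (-1) * ((x - 0) \<bullet> (x - 0)))" for x
 have "elementary \<rho>" unfolding \<rho>_def[abs_def]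
  by (intro elementary.flat elementary.add elementary.const elementary.mult elementary_sqdist)
 then have s: "smooth \<rho>" by (rule elementary_smooth)
 have nn: "0 <= \<rho> x" for x by (simp add: \<rho>_def flat_exp_def)
 have z: "\<rho> x = 0" if "norm x >= 1" for x
  using one_le_power[OF that, of 2] by (simp add: \<rho>_def flat_exp_def dot_square_norm)
 have i: "integrable lborel \<rho>"
  by (rule integrable_compact_support[OF smooth_continuous[OF s] compact_cball[of 0 1]]) (use z in auto)
 have "exp (- 4 / 3) * measure lborel (ball (0::'a) (1/2)) = (LBINT x. exp (- 4 / 3) * indicator (ball (0::'a) (1/2)) x)"
  by simp
 also have "\<dots> <= (LBINT x. \<rho> x)"
 proof (rule integral_mono)
  show "integrable lborel (%x. exp (- 4 / 3) * indicator (ball (0::'a) (1/2)) x :: real)"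
   by (intro integrable_mult_right integrable_real_indicator)
    (use emeasure_bounded_finite[OF bounded_ball, of "0::'a" "1/2"] in auto)
  fix x :: 'a
  show "exp (- 4 / 3) * indicator (ball (0::'a) (1/2)) x <= \<rho> x"
  proof (cases "norm x < 1/2")
   case True
   have le: "x \<bullet> x <= 1/4" using power_mono[of "norm x" "1/2" 2] True
    by (simp add: dot_square_norm power2_eq_square)
   have "- 4 / 3 <= - (1 / (1 - x \<bullet> x))" using le by (simp add: field_simps)
   then have "exp (- 4 / 3) <= exp (- (1 / (1 - x \<bullet> x)))" by (simp only: exp_le_cancel_iff)
   then show ?thesis using True le by (simp add: \<rho>_def flat_exp_def)
  qed (simp add: nn)
 qed (rule i)
 finally have c: "0 < (LBINT x. \<rho> x)"
  using mult_pos_pos[OF exp_gt_zero[of "- 4 / 3"] content_ball_pos[of "1/2" "0::'a"]] by linarith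
 show ?thesis
 proof (intro exI[of _ "%x. inverse (LBINT x. \<rho> x) * \<rho> x"] conjI allI impI)
  show "smooth (%x. inverse (LBINT x. \<rho> x) * \<rho> x)" by (rule smooth_cmult[OF s])
 qed (use c nn z in simp_all)
qed

definition mollifier :: "real => 'a::euclidean_space => real" where
 "mollifier \<epsilon> x = inverse (\<epsilon> ^ DIM('a)) * (SOME \<rho> :: 'a => real. smooth \<rho> & (ALL x. 0 <= \<rho> x) \<and>
   (ALL x. norm x >= 1 --> \<rho> x = 0) & (LBINT x. \<rho> x) = 1) (inverse \<epsilon> *\<^sub>R x + 0)"

lemma mollifier:
 assumes "\<epsilon> > 0"
 shows "smooth (mollifier \<epsilon> :: 'a::euclidean_space => real)"
  and "0 <= mollifier \<epsilon> (x::'a)" and "norm x >= \<epsilon> ==> mollifier \<epsilon> x = 0"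
  and "(LBINT x. mollifier \<epsilon> (x::'a)) = 1" and "(LBINT z. mollifier \<epsilon> (x - z)) = 1"
proof -
 define \<rho> :: "'a => real" where "\<rho> = (SOME \<rho>. smooth \<rho> & (ALL x. 0 <= \<rho> x) \<and>
   (ALL x. norm x >= 1 --> \<rho> x = 0) & (LBINT x. \<rho> x) = 1)"
 have \<rho>: "smooth \<rho>" "!!x. 0 <= \<rho> x" "!!x. norm x >= 1 ==> \<rho> x = 0" "(LBINT x. \<rho> x) = 1"
  using someI_ex[OF mollifier_exists[where 'a = 'a], folded \<rho>_def] by simp_all
 have eq: "mollifier \<epsilon> = (%x. inverse (\<epsilon> ^ DIM('a)) * \<rho> (inverse \<epsilon> *\<^sub>R x + 0))"
  by (simp add: mollifier_def[abs_def] \<rho>_def)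
 show 1: "smooth (mollifier \<epsilon> :: 'a => real)" unfolding eq by (rule smooth_affine[OF \<rho>(1)])
 show "0 <= mollifier \<epsilon> x" using \<rho>(2) assms by (simp add: eq)
 show "mollifier \<epsilon> x = 0" if "norm x >= \<epsilon>"
  using \<rho>(3)[of "inverse \<epsilon> *\<^sub>R x"] that assms by (simp add: eq field_simps)
 have m: "\<rho> \<in> borel_measurable borel" "(mollifier \<epsilon> :: 'a => real) \<in> borel_measurable borel"
  using \<rho>(1) 1 by (auto intro: borel_measurable_UNIV smooth_continuous)
 show 2: "(LBINT x. mollifier \<epsilon> (x::'a)) = 1"
  using lborel_integral_affine[OF m(1), of "inverse \<epsilon>" 0] assms \<rho>(4) by (simp add: eq power_inverse)
 show "(LBINT z. mollifier \<epsilon> (x - z)) = 1"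
  using lborel_integral_reflect[OF m(2), of x] 2 by simp
qed


definition conv :: "('a::euclidean_space => real) => ('a => real) => 'a => real" where
 "conv y \<rho> x = (LBINT z. y z * \<rho> (x - z))"

lemma conv_integrable:
 fixes y :: "'a::euclidean_space => real"
 assumes "cont y" "cont \<rho>" "!!x. norm x > r ==> \<rho> x = 0"
 shows "integrable lborel (%z. y z * \<rho> (x - z))"
proof (rule integrable_compact_support[OF _ compact_cball[of x r]])
 show "cont (%z. y z * \<rho> (x - z))"
  by (intro continuous_intros assms continuous_on_compose2[OF assms(2)]) auto
qed (use assms in \<open>auto simp: dist_norm\<close>)

lemma conv_has_derivative:
 fixes y :: "'a::euclidean_space => real"
 assumes y: "cont y" and \<rho>: "smooth \<rho>" "!!x. norm x > r ==> \<rho> x = 0"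
 shows "(conv y \<rho> has_derivative (%h. \<Sum>b\<in>Basis. (h \<bullet> b) * conv y (pd \<rho> b) x)) (at x)"
 unfolding has_derivative_at_alt
proof (intro conjI allI impI)
 show "bounded_linear (%h. \<Sum>b\<in>Basis. (h \<bullet> b) * conv y (pd \<rho> b) x)"
  by (intro bounded_linear_sum bounded_linear_mult_const bounded_linear_inner_left)
 have z: "pd \<rho> b w = 0" if "norm w > r" for b w
  by (rule pd_zero_outside[of "cball 0 r"]) (use that \<rho>(2) in auto)
 have cpd: "cont (pd \<rho> b)" if "b \<in> Basis" for b
  by (intro smooth_continuous smooth_pd \<rho> that)
 define Y where "Y = (LBINT z. indicator (cball x (r + 1)) z * \<bar>y z\<bar>)"
 have iY: "integrable lborel (%z. indicator (cball x (r + 1)) z * \<bar>y z\<bar>)"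
  using borel_integrable_compact[OF compact_cball[of x "r+1"], of "%z. \<bar>y z\<bar>"] y
  by (auto intro!: continuous_intros intro: continuous_on_subset)
 have Y0: "0 <= Y" unfolding Y_def by (intro integral_nonneg_AE) auto
 fix e :: real assume e: "e > 0"
 define e' where "e' = e / (DIM('a) * (Y + 1))"
 have "e' * DIM('a) = e / (Y + 1)" using Y0 by (simp add: e'_def)
 then have e': "e' > 0" "e' * DIM('a) * Y <= e" using e Y0 by (simp_all add: e'_def divide_le_eq mult_left_mono)
 have "\<exists>d>0. ALL a w. dist w a < d --> \<bar>pd \<rho> b w - pd \<rho> b a\<bar> < e'" if b: "b \<in> Basis" for b
 proof -
  have "uniformly_continuous_on (cball 0 (r + 2)) (pd \<rho> b)"
   using cpd[OF b] by (intro compact_uniformly_continuous) (auto intro: continuous_on_subset)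
  then obtain d where d: "d > 0" "!!a w. norm a <= r + 2 ==> norm w <= r + 2 ==> dist w a < d ==> \<bar>pd \<rho> b w - pd \<rho> b a\<bar> < e'"
   unfolding uniformly_continuous_on_def dist_real_def using e'(1) by (metis mem_cball_0)
  show ?thesis
  proof (intro exI[of _ "min d 1"] conjI allI impI)
   fix a w :: 'a assume aw: "dist w a < min d 1"
   then have "norm a <= norm w + 1" "norm w <= norm a + 1"
    using norm_triangle_ineq2[of a w] norm_triangle_ineq2[of w a] by (auto simp: dist_norm norm_minus_commute)
   then show "\<bar>pd \<rho> b w - pd \<rho> b a\<bar> < e'"
    using d(2)[of a w] aw z[of a b] z[of w b] e'(1) by (cases "norm a <= r + 2 & norm w <= r + 2") auto
  qed (use d in auto)
 qed
 then obtain d where d: "!!b. b \<in> Basis ==> d b > 0" "!!a w b. b \<in> Basis ==> dist w a < d b ==> \<bar>pd \<rho> b w - pd \<rho> b a\<bar> < e'"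
  by metis
 define \<delta> where "\<delta> = min 1 (Min (d ` Basis))"
 have \<delta>: "\<delta> > 0" "\<delta> <= 1" "!!b. b \<in> Basis ==> \<delta> <= d b"
  using d(1) by (auto simp: \<delta>_def intro: min.coboundedI2)
 show "\<exists>d>0. ALL x'. norm (x' - x) < d -->
   norm (conv y \<rho> x' - conv y \<rho> x - (\<Sum>b\<in>Basis. ((x' - x) \<bullet> b) * conv y (pd \<rho> b) x)) <= e * norm (x' - x)"
 proof (intro exI[of _ \<delta>] conjI allI impI)
  fix x' :: 'a assume x': "norm (x' - x) < \<delta>"
  define h where "h = x' - x"
  have "h \<in> ball 0 \<delta>" using x' by (simp add: h_def)
  have tay: "\<bar>\<rho> (a + h) - \<rho> a - (\<Sum>b\<in>Basis. (h \<bullet> b) * pd \<rho> b a)\<bar> <= e' * DIM('a) * norm h" for a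
  proof -
   have "EX t. 0 < t & t < 1 & \<rho> (a + 1 *\<^sub>R h) - \<rho> (a + 0 *\<^sub>R h) = (1 - 0) * pd \<rho> h (a + t *\<^sub>R h)"
    by (rule MVT2) (auto intro: line_derivative[OF smooth_differentiable[OF \<rho>(1)]])
   then obtain t where t: "0 < t" "t < 1" "\<rho> (a + h) - \<rho> a = pd \<rho> h (a + t *\<^sub>R h)" by auto
   have th: "dist (a + t *\<^sub>R h) a < d b" if "b \<in> Basis" for b
   proof -
    have "dist (a + t *\<^sub>R h) a = t * norm h" using t by (simp add: dist_norm)
    also have "\<dots> <= norm h" using t by (simp add: mult_left_le_one_le)
    also have "\<dots> < d b" using x' \<delta>(3)[OF that] by (simp add: h_def)
    finally show ?thesis .
   qed
   have "\<rho> (a + h) - \<rho> a - (\<Sum>b\<in>Basis. (h \<bullet> b) * pd \<rho> b a) =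
     (\<Sum>b\<in>Basis. (h \<bullet> b) * (pd \<rho> b (a + t *\<^sub>R h) - pd \<rho> b a))"
    unfolding t pd_basis_sum[OF smooth_differentiable[OF \<rho>(1)], of h] by (simp add: algebra_simps sum_subtractf)
   also have "\<bar>\<dots>\<bar> <= (\<Sum>b\<in>(Basis::'a set). norm h * e')"
    by (rule order_trans[OF sum_abs], rule sum_mono, unfold abs_mult, rule mult_mono)
     (use th d(2) Basis_le_norm in \<open>force intro: less_imp_le\<close>)+
   finally show ?thesis by (simp add: mult_ac)
  qed
  have i: "integrable lborel (%z. y z * \<rho> (x' - z))" "integrable lborel (%z. y z * \<rho> (x - z))"
   by (rule conv_integrable[OF y smooth_continuous[OF \<rho>(1)]]; use \<rho>(2) in auto)+
  have ib: "integrable lborel (%z. y z * pd \<rho> b (x - z))" if "b \<in> Basis" for b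
   by (rule conv_integrable[OF y cpd[OF that]]) (use z in auto)
  have isum: "integrable lborel (%z. \<Sum>b\<in>Basis. (h \<bullet> b) * (y z * pd \<rho> b (x - z)))"
   by (intro b_integrable_sum integrable_mult_right ib)
  have sumc: "(\<Sum>b\<in>Basis. (h \<bullet> b) * conv y (pd \<rho> b) x) = (LBINT z. (\<Sum>b\<in>Basis. (h \<bullet> b) * (y z * pd \<rho> b (x - z))))"
   unfolding conv_def using ib by (subst b_integral_sum) auto
  have "conv y \<rho> x' - conv y \<rho> x - (\<Sum>b\<in>Basis. (h \<bullet> b) * conv y (pd \<rho> b) x) =
   (LBINT z. y z * \<rho> (x' - z) - y z * \<rho> (x - z) - (\<Sum>b\<in>Basis. (h \<bullet> b) * (y z * pd \<rho> b (x - z))))"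
   unfolding sumc using i isum by (simp add: conv_def)
  also have "\<bar>\<dots>\<bar> <= (LBINT z. (e' * DIM('a) * norm h) * (indicator (cball x (r + 1)) z * \<bar>y z\<bar>))"
  proof (rule order_trans[OF integral_abs_bound], rule integral_mono)
   fix z
   have eq: "y z * \<rho> (x' - z) - y z * \<rho> (x - z) - (\<Sum>b\<in>Basis. (h \<bullet> b) * (y z * pd \<rho> b (x - z))) =
     y z * (\<rho> ((x - z) + h) - \<rho> (x - z) - (\<Sum>b\<in>Basis. (h \<bullet> b) * pd \<rho> b (x - z)))"
    by (simp add: h_def algebra_simps sum_distrib_left)
   show "\<bar>y z * \<rho> (x' - z) - y z * \<rho> (x - z) - (\<Sum>b\<in>Basis. (h \<bullet> b) * (y z * pd \<rho> b (x - z)))\<bar>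
    <= (e' * DIM('a) * norm h) * (indicator (cball x (r + 1)) z * \<bar>y z\<bar>)"
   proof (cases "z \<in> cball x (r + 1)")
    case True
    then show ?thesis unfolding eq abs_mult
     using mult_left_mono[OF tay[of "x - z"], of "\<bar>y z\<bar>"] by (simp add: mult_ac)
   next
    case False
    then have n: "norm (x - z) > r + 1" by (simp add: dist_norm)
    have "norm (x - z) <= norm (x' - z) + norm h"
     unfolding h_def using norm_triangle_ineq4[of "x' - z" "x' - x"] by simp
    then have "norm (x' - z) > r" using n x' \<delta> by (simp add: h_def)
    then show ?thesis using False n \<rho>(2) z by simp
   qed
  qed (use i isum iY in auto)
  also have "\<dots> = e' * DIM('a) * Y * norm h"
   by (simp only: Bochner_Integration.integral_mult_right_zero Y_def) (simp only: mult_ac)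
  also have "\<dots> <= e * norm h" by (intro mult_right_mono e') simp
  finally show "norm (conv y \<rho> x' - conv y \<rho> x - (\<Sum>b\<in>Basis. ((x' - x) \<bullet> b) * conv y (pd \<rho> b) x)) <= e * norm (x' - x)"
   by (simp add: h_def)
 qed (use \<delta> in auto)
qed

lemma pd_conv:
 fixes y :: "'a::euclidean_space => real"
 assumes y: "cont y" and \<rho>: "smooth \<rho>" "!!x. norm x > r ==> \<rho> x = 0" and b: "b \<in> Basis"
 shows "pd (conv y \<rho>) b = conv y (pd \<rho> b)"
proof
 fix x
 have "pd (conv y \<rho>) b x = (\<Sum>b'\<in>Basis. (b \<bullet> b') * conv y (pd \<rho> b') x)"
  using \<rho>(2) by (intro pd_eq conv_has_derivative[OF y \<rho>(1)]) auto
 also have "\<dots> = (\<Sum>b'\<in>Basis. if b' = b then conv y (pd \<rho> b') x else 0)"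
  using b by (intro sum.cong) (auto simp: inner_Basis)
 finally show "pd (conv y \<rho>) b x = conv y (pd \<rho> b) x" using b by simp
qed

lemma pd_support:
 fixes \<rho> :: "'a::euclidean_space => real"
 assumes "!!x. norm x > r ==> \<rho> x = 0" "norm x > r"
 shows "pd \<rho> b x = 0"
 by (rule pd_zero_outside[of "cball 0 r"]) (use assms in auto)

lemma smooth_conv:
 fixes y :: "'a::euclidean_space => real"
 assumes y: "cont y" and \<rho>: "smooth \<rho>" "!!x. norm x > r ==> \<rho> x = 0"
 shows "smooth (conv y \<rho>)"
proof (rule smooth_family[where P = "%F. \<exists>\<rho>. F = conv y \<rho> & smooth \<rho> & (ALL x. norm x > r --> \<rho> x = 0)"])
 show "\<exists>\<rho>'. conv y \<rho> = conv y \<rho>' & smooth \<rho>' & (ALL x. norm x > r --> \<rho>' x = 0)"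
  by (rule exI[of _ \<rho>]) (simp add: \<rho>)
next
 fix F :: "'a => real" and x b :: 'a
 assume "\<exists>\<rho>. F = conv y \<rho> & smooth \<rho> & (ALL x. norm x > r --> \<rho> x = 0)"
 then obtain \<rho> where F: "F = conv y \<rho>" "smooth \<rho>" "ALL x. norm x > r --> \<rho> x = 0" by (elim exE conjE)
 show "F differentiable (at x)"
  unfolding F(1) differentiable_def by (rule exI, rule conv_has_derivative[OF y F(2)]) (use F(3) in auto)
 assume b: "b \<in> Basis"
 show "\<exists>\<rho>. pd F b = conv y \<rho> & smooth \<rho> & (ALL x. norm x > r --> \<rho> x = 0)"
 proof (intro exI[of _ "pd \<rho> b"] conjI allI impI)
  show "pd F b = conv y (pd \<rho> b)" unfolding F(1) by (rule pd_conv[OF y F(2) _ b]) (use F(3) in auto)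
  show "smooth (pd \<rho> b)" by (rule smooth_pd[OF F(2) b])
  show "pd \<rho> b x = 0" if "norm x > r" for x using F(3) that by (intro pd_support[of r]) auto
 qed
qed

lemma lap_conv:
 fixes y :: "'a::euclidean_space => real"
 assumes y: "cont y" and \<rho>: "smooth \<rho>" "!!x. norm x > r ==> \<rho> x = 0"
 shows "lap (conv y \<rho>) x = (LBINT z. y z * lap (%z. \<rho> (x - z)) z)"
proof -
 have s: "smooth (pd \<rho> b)" "smooth (pd (pd \<rho> b) b)" if "b \<in> Basis" for b using \<rho> that by (auto intro: smooth_pd)
 have z: "pd \<rho> b x = 0" "pd (pd \<rho> b) b x = 0" if "norm x > r" for x b
  using \<rho>(2) that pd_support[of r \<rho>] pd_support[of r "pd \<rho> b"] by auto
 have "pd (pd (conv y \<rho>) b) b x = (LBINT z. y z * pd (pd \<rho> b) b (x - z))" if b: "b \<in> Basis" for b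
  using pd_conv[OF y \<rho>(1) _ b, of r] pd_conv[OF y s(1)[OF b] _ b, of r] z \<rho>(2) by (simp add: conv_def)
 moreover have "integrable lborel (%z. y z * pd (pd \<rho> b) b (x - z))" if b: "b \<in> Basis" for b
  by (rule conv_integrable[OF y smooth_continuous[OF s(2)[OF b]], of r]) (use z in auto)
 moreover have "lap (%z. \<rho> (x - z)) z = lap \<rho> (x - z)" for z
  using fun_cong[OF lap_affine[OF \<rho>(1), of 1 "-1" x], of z] by simp
 ultimately show ?thesis
  by (simp add: lap_def sum_distrib_left b_integral_sum)
qed

lemma conv_mollifier_le:
 fixes y :: "'a::euclidean_space => real"
 assumes y: "cont y" and \<epsilon>: "\<epsilon> > 0" and le: "!!z. norm (x - z) <= \<epsilon> ==> y z <= k"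
 shows "conv y (mollifier \<epsilon>) x <= k"
proof -
 note m = mollifier[OF \<epsilon>, where 'a = 'a]
 have "conv y (mollifier \<epsilon>) x <= (LBINT z. k * mollifier \<epsilon> (x - z))"
  unfolding conv_def
 proof (rule integral_mono)
  show "integrable lborel (%z. y z * mollifier \<epsilon> (x - z))" "integrable lborel (%z. k * mollifier \<epsilon> (x - z))"
   by (rule conv_integrable[of _ _ \<epsilon>]; use y m in \<open>auto intro: smooth_continuous\<close>)+
  show "y z * mollifier \<epsilon> (x - z) <= k * mollifier \<epsilon> (x - z)" for z
   using le[of z] m(2)[of "x - z"] m(3)[of "x - z"]
   by (cases "norm (x - z) <= \<epsilon>") (auto intro: mult_right_mono)
 qed
 then show ?thesis using m(5) by simp
qed

lemma conv_mollifier_ge: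
 fixes y :: "'a::euclidean_space => real"
 assumes y: "cont y" and \<epsilon>: "\<epsilon> > 0" and le: "!!z. norm (x - z) <= \<epsilon> ==> k <= y z"
 shows "k <= conv y (mollifier \<epsilon>) x"
 using conv_mollifier_le[of "%z. - y z" \<epsilon> x "- k"] assms by (auto simp: conv_def intro: continuous_intros)

lemma second_derivative_nonpos_at_max:
 fixes f :: "'a::euclidean_space => real"
 assumes f: "smooth f" and r: "r > 0" and mx: "!!z. norm (z - x) < r ==> f z <= f x" and b: "b \<in> Basis"
 shows "pd (pd f b) b x <= 0"
proof (rule ccontr)
 assume "\<not> ?thesis"
 then have pos: "pd (pd f b) b x > 0" by simp
 define g where "g t = f (x + t *\<^sub>R b)" for t
 define g' where "g' t = pd f b (x + t *\<^sub>R b)" for t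
 have g: "(g has_real_derivative g' t) (at t)" for t
  unfolding g_def[abs_def] g'_def by (rule line_derivative[OF smooth_differentiable[OF f]])
 have "(g' has_real_derivative pd (pd f b) b (x + 0 *\<^sub>R b)) (at 0)"
  unfolding g'_def[abs_def] by (rule line_derivative[OF smooth_differentiable[OF smooth_pd[OF f b]]])
 then have "(g' has_real_derivative pd (pd f b) b x) (at 0)" by simp
 from DERIV_pos_inc_right[OF this pos] obtain d where d: "d > 0" "!!h. 0 < h ==> h < d ==> g' 0 < g' h" by auto
 have mg: "g t <= g 0" if "\<bar>t\<bar> < r" for t using mx[of "x + t *\<^sub>R b"] that b by (simp add: g_def)
 have "g' 0 = 0" by (rule DERIV_local_max[OF g r]) (use mg in auto)
 define h where "h = min d r / 2"
 have h: "0 < h" "h < d" "h < r" using d r by (auto simp: h_def)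
 obtain t where "0 < t" "t < h" "g h - g 0 = (h - 0) * g' t"
  using MVT2[of 0 h g g'] g h by auto
 then have "g h > g 0" using d(2)[of t] h \<open>g' 0 = 0\<close> by (smt (verit) mult_pos_pos)
 with mg[of h] h show False by simp
qed

lemma maximum_principle:
 fixes w :: "'a::euclidean_space => real"
 assumes D: "open D" "bounded D" and w: "cont w"
  and bdry: "!!x. x \<in> frontier D ==> w x <= 0"
  and sub: "!!\<phi>. test_fun (D \<inter> {x. 0 < w x}) \<phi> ==> (!!x. 0 <= \<phi> x) ==> 0 <= (LBINT x. w x * lap \<phi> x)"
  and x: "x \<in> D"
 shows "w x <= 0"
proof (rule ccontr)
 assume "\<not> w x <= 0"
 then have pos: "w x > 0" by simp
 define P where "P = D \<inter> {x. 0 < w x}"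
 have oP: "open P" unfolding P_def using D w by (intro open_Int open_Collect_less continuous_intros) auto
 have cD: "compact (closure D)" using D by (simp add: compact_closure)
 obtain R where R: "!!z. z \<in> closure D ==> (z - x) \<bullet> (z - x) <= R" "R > 0"
 proof -
  have "bounded ((%z. (z - x) \<bullet> (z - x)) ` closure D)"
   by (intro compact_imp_bounded compact_continuous_image continuous_intros cD)
  then obtain B where B: "!!z. z \<in> closure D ==> \<bar>(z - x) \<bullet> (z - x)\<bar> <= B"
   unfolding bounded_iff real_norm_def by blast
  have "(z - x) \<bullet> (z - x) <= \<bar>B\<bar> + 1" if "z \<in> closure D" for z using B[OF that] by linarith
  then show ?thesis using that[of "\<bar>B\<bar> + 1"] by auto
 qed
 define \<theta> where "\<theta> = w x / (2 * R)"
 have \<theta>: "\<theta> > 0" "\<theta> * R < w x" using pos R by (auto simp: \<theta>_def field_simps)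
 define v where "v z = w z + \<theta> * ((z - x) \<bullet> (z - x))" for z
 have cv: "cont v" unfolding v_def[abs_def] by (intro continuous_intros w)
 have "\<exists>x1\<in>closure D. \<forall>z\<in>closure D. v z <= v x1"
  by (rule continuous_attains_sup[OF cD]) (use x closure_subset cv in \<open>auto intro: continuous_on_subset\<close>)
 then obtain x1 where x1: "x1 \<in> closure D" "!!z. z \<in> closure D ==> v z <= v x1" by blast
 have "v x1 >= w x" using x1(2)[of x] x closure_subset[of D] by (auto simp: v_def)
 moreover have "v x1 <= w x1 + \<theta> * R" using R(1)[OF x1(1)] \<theta>(1) by (simp add: v_def)
 ultimately have "w x1 > 0" using \<theta>(2) by linarith
 then have "x1 ~: frontier D" using bdry[of x1] by auto
 then have x1P: "x1 \<in> P" using \<open>w x1 > 0\<close> x1(1) D(1) by (auto simp: P_def frontier_def interior_open)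
 obtain r where r: "r > 0" "cball x1 (2 * r) \<subseteq> P"
 proof -
  obtain s where "s > 0" "cball x1 s \<subseteq> P" using oP x1P open_contains_cball by blast
  then show ?thesis using that[of "s/2"] by simp
 qed
 define Q where "Q z = \<theta> * ((z - x) \<bullet> (z - x)) + (- \<theta> / 2) * ((z - x1) \<bullet> (z - x1))" for z
 have sq: "smooth (%z::'a. (z - a) \<bullet> (z - a))" for a by (intro elementary_smooth elementary_sqdist)
 have sQ: "smooth Q" unfolding Q_def[abs_def] by (intro smooth_add smooth_cmult sq)
 have lQ: "lap Q z = \<theta> * DIM('a)" for z
  unfolding Q_def[abs_def]
  by (simp only: lap_add[OF smooth_cmult[OF sq] smooth_cmult[OF sq]] lap_cmult[OF sq] lap_sqdist)
 define v2 where "v2 z = w z + Q z" for z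
 have cv2: "cont v2" unfolding v2_def[abs_def] by (intro continuous_intros w smooth_continuous sQ)
 have v2le: "v2 z <= v x1 - \<theta> / 2 * (norm (z - x1))\<^sup>2" if "z \<in> D" for z
  using x1(2)[of z] that closure_subset[of D] by (auto simp: v2_def Q_def v_def dot_square_norm)
 have v2x1: "v2 x1 = v x1" by (simp add: v2_def Q_def v_def)
 define \<eta> where "\<eta> = \<theta> * r\<^sup>2 / 16"
 have \<eta>: "\<eta> > 0" using \<theta> r by (simp add: \<eta>_def)
 have "isCont v2 x1" using cv2 by (simp add: continuous_on_eq_continuous_at)
 then obtain d where d: "d > 0" "!!z. dist z x1 < d ==> dist (v2 z) (v2 x1) < \<eta>"
  unfolding continuous_at_eps_delta using \<eta> by blast
 define \<epsilon> where "\<epsilon> = min (r / 2) (d / 2)"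
 have \<epsilon>: "\<epsilon> > 0" "\<epsilon> <= r / 2" "\<epsilon> < d" using d r by (auto simp: \<epsilon>_def)
 note m = mollifier[OF \<epsilon>(1), where 'a = 'a]
 have mz: "norm x > \<epsilon> ==> mollifier \<epsilon> x = 0" for x :: 'a using m(3)[of x] by simp
 define F where "F = conv v2 (mollifier \<epsilon>)"
 have sF: "smooth F" unfolding F_def by (rule smooth_conv[OF cv2 m(1)]) (rule mz)
 have c1: "F x1 >= v x1 - \<eta>" unfolding F_def
 proof (rule conv_mollifier_ge[OF cv2 \<epsilon>(1)])
  fix z assume "norm (x1 - z) <= \<epsilon>"
  then show "v x1 - \<eta> <= v2 z" using d(2)[of z] \<epsilon> v2x1 by (auto simp: dist_norm norm_minus_commute dist_real_def)
 qed
 have c2: "F z <= v x1 - 2 * \<eta>" if z: "norm (z - x1) = r" for z unfolding F_def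
 proof (rule conv_mollifier_le[OF cv2 \<epsilon>(1)])
  fix z' assume z': "norm (z - z') <= \<epsilon>"
  have "norm (z' - x1) <= norm (z - x1) + norm (z - z')" using norm_triangle_ineq4[of "z - x1" "z - z'"] by simp
  then have "z' \<in> cball x1 (2 * r)" using z z' \<epsilon> r by (simp add: dist_norm norm_minus_commute)
  then have "z' \<in> D" using r by (auto simp: P_def)
  have "norm (z - x1) <= norm (z' - x1) + norm (z - z')" using norm_triangle_ineq[of "z' - x1" "z - z'"] by simp
  then have "r / 2 <= norm (z' - x1)" using z z' \<epsilon> by simp
  then have "(r / 2)\<^sup>2 <= (norm (z' - x1))\<^sup>2" using r by (intro power_mono) auto
  then have "\<theta> / 2 * (r / 2)\<^sup>2 <= \<theta> / 2 * (norm (z' - x1))\<^sup>2" using \<theta> by (intro mult_left_mono) auto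
  then show "v2 z' <= v x1 - 2 * \<eta>" using v2le[OF \<open>z' \<in> D\<close>] by (simp add: \<eta>_def power2_eq_square)
 qed
 have "\<exists>xs\<in>cball x1 r. \<forall>z\<in>cball x1 r. F z <= F xs"
  by (rule continuous_attains_sup) (use r smooth_continuous[OF sF] in auto)
 then obtain xs where xs: "xs \<in> cball x1 r" "!!z. z \<in> cball x1 r ==> F z <= F xs" by blast
 have "norm (xs - x1) ~= r" using c2[of xs] c1 xs(2)[of x1] r \<eta> by auto
 then have lt: "norm (xs - x1) < r" using xs(1) by (simp add: dist_norm norm_minus_commute)
 have "lap F xs <= 0" unfolding lap_def
 proof (rule sum_nonpos, rule second_derivative_nonpos_at_max[OF sF, of "r - norm (xs - x1)"])
  fix z assume "norm (z - xs) < r - norm (xs - x1)"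
  then have "norm (z - x1) < r" using norm_triangle_ineq[of "z - xs" "xs - x1"] by simp
  then show "F z <= F xs" by (intro xs) (simp add: dist_norm norm_minus_commute)
 qed (use lt in auto)
 define \<phi> where "\<phi> z = mollifier \<epsilon> (xs - z)" for z
 have tf: "test_fun P \<phi>"
 proof (rule test_funI[of _ "cball xs \<epsilon>"])
  show "smooth \<phi>" unfolding \<phi>_def[abs_def] using smooth_affine[OF m(1), of 1 "-1" xs] by simp
  show "cball xs \<epsilon> \<subseteq> P"
  proof
   fix z assume "z \<in> cball xs \<epsilon>"
   then have "norm (z - x1) <= 2 * r"
    using norm_triangle_ineq[of "z - xs" "xs - x1"] lt \<epsilon> by (simp add: dist_norm norm_minus_commute)
   then show "z \<in> P" using r by (auto simp: dist_norm norm_minus_commute)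
  qed
  show "\<phi> z = 0" if "z ~: cball xs \<epsilon>" for z using that mz by (simp add: \<phi>_def dist_norm)
 qed simp
 obtain K where K: "smooth \<phi>" "compact K" "!!x. x ~: K ==> lap \<phi> x = 0"
  by (rule test_funE[OF tf]) (rule that, assumption+)
 have "lap F xs = (LBINT z. v2 z * lap \<phi> z)"
  unfolding F_def \<phi>_def[abs_def] by (rule lap_conv[OF cv2 m(1)]) (rule mz)
 also have "\<dots> = (LBINT z. w z * lap \<phi> z) + (LBINT z. Q z * lap \<phi> z)"
  unfolding v2_def distrib_right
  by (intro Bochner_Integration.integral_add integrable_compact_support[OF _ K(2)] continuous_intros w
    smooth_continuous sQ smooth_lap K(1); use K(3) in simp)
 finally have e: "lap F xs = (LBINT z. w z * lap \<phi> z) + (LBINT z. Q z * lap \<phi> z)" .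
 have "(LBINT z. Q z * lap \<phi> z) = \<theta> * DIM('a)"
  using integral_lap_swap[OF sQ tf] m(5)[of xs] by (simp add: lQ \<phi>_def)
 moreover have "(LBINT z. w z * lap \<phi> z) >= 0"
  by (rule sub[folded P_def, OF tf]) (simp add: \<phi>_def m)
 moreover have "\<theta> * DIM('a) > 0" using \<theta> by simp
 ultimately have "lap F xs > 0" using e by linarith
 with \<open>lap F xs <= 0\<close> show False by simp
qed

lemma nn_integral_gaussian_1d:
 assumes a: "a > (0::real)"
 shows "(\<integral>\<^sup>+t. ennreal (exp (- a * t\<^sup>2)) \<partial>lborel) < \<infinity>"
proof -
 have le: "exp (- a * t\<^sup>2) <= exp (1 / (4 * a)) * exp (- \<bar>t\<bar>)" for t
 proof -
  have "0 <= a * (\<bar>t\<bar> - 1 / (2 * a))\<^sup>2" using a by simp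
  also have "\<dots> = a * t\<^sup>2 - \<bar>t\<bar> + 1 / (4 * a)" using a by (simp add: power2_eq_square field_simps)
  finally show ?thesis by (simp flip: exp_add)
 qed
 have lim: "((%t::real. - exp (- t)) \<longlongrightarrow> 0) at_top"
  using tendsto_minus[OF filterlim_compose[OF exp_at_bot filterlim_uminus_at_bot_at_top]] by simp
 have 1: "(\<integral>\<^sup>+t. ennreal (exp (- t)) * indicator {0..} t \<partial>lborel) = ennreal (0 - - exp (- 0))" for t :: real
  by (rule nn_integral_FTC_atLeast[where F = "%t. - exp (- t)"])
   (auto intro!: derivative_eq_intros lim)
 have 2: "(\<integral>\<^sup>+t. ennreal (exp t) * indicator {..0} t \<partial>lborel) = (\<integral>\<^sup>+t. ennreal (exp (- t)) * indicator {0..} t \<partial>lborel)"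
  by (subst nn_integral_real_affine[where c = "-1" and t = 0])
   (auto intro!: nn_integral_cong simp: indicator_def)
 have "(\<integral>\<^sup>+t. ennreal (exp (- a * t\<^sup>2)) \<partial>lborel) \<le>
   (\<integral>\<^sup>+t. ennreal (exp (1 / (4 * a))) * (ennreal (exp (- t)) * indicator {0..} t + ennreal (exp t) * indicator {..0} t) \<partial>lborel)"
 proof (rule nn_integral_mono)
  fix t :: real
  have "ennreal (exp (- a * t\<^sup>2)) <= ennreal (exp (1 / (4 * a)) * exp (- \<bar>t\<bar>))"
   by (rule ennreal_leI[OF le])
  also have "\<dots> = ennreal (exp (1 / (4 * a))) * ennreal (exp (- \<bar>t\<bar>))" by (simp add: ennreal_mult)
  also have "\<dots> <= ennreal (exp (1 / (4 * a))) * (ennreal (exp (- t)) * indicator {0..} t + ennreal (exp t) * indicator {..0} t)"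
   by (rule mult_left_mono) (auto simp: indicator_def)
  finally show "ennreal (exp (- a * t\<^sup>2)) <= \<dots>" .
 qed
 also have "\<dots> = ennreal (exp (1 / (4 * a))) * (1 + 1)"
  by (simp add: nn_integral_cmult nn_integral_add 1 2)
 also have "\<dots> < \<infinity>" by (simp add: ennreal_mult_less_top)
 finally show ?thesis .
qed

lemma ennreal_prod_less_top: "finite A ==> (!!i. i \<in> A ==> f i < (top::ennreal)) ==> prod f A < top"
 by (induction A rule: finite_induct) (auto simp: ennreal_mult_less_top)

lemma integrable_gaussian:
 assumes a: "a > (0::real)"
 shows "integrable lborel (%x::'a::euclidean_space. exp (- a * (x \<bullet> x)))"
proof (rule integrableI_bounded)
 have eq: "ennreal (norm (exp (- a * (x \<bullet> x)))) = (\<Prod>b\<in>Basis. ennreal (exp (- a * (x \<bullet> b)\<^sup>2)))" for x :: 'a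
 proof -
  have "- a * (x \<bullet> x) = (\<Sum>b\<in>Basis. - a * (x \<bullet> b)\<^sup>2)"
   using euclidean_inner[of x x] by (simp add: sum_distrib_left power2_eq_square sum_negf)
  then show ?thesis by (simp add: exp_sum prod_ennreal abs_prod)
 qed
 have "(\<integral>\<^sup>+x. (\<Prod>b\<in>Basis. ennreal (exp (- a * (x \<bullet> b)\<^sup>2))) \<partial>(lborel::'a measure)) =
   (\<Prod>b\<in>(Basis::'a set). \<integral>\<^sup>+t. ennreal (exp (- a * t\<^sup>2)) \<partial>lborel)"
  by (rule nn_integral_lborel_prod) auto
 also have "\<dots> < top"
  using nn_integral_gaussian_1d[OF a] by (intro ennreal_prod_less_top) (auto simp: infinity_ennreal_def)
 finally show "(\<integral>\<^sup>+x. ennreal (norm (exp (- a * (x \<bullet> x)))) \<partial>(lborel::'a measure)) < \<infinity>" unfolding eq by simp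
qed measurable

definition gauss :: "'a::euclidean_space => real" where
 "gauss x = inverse (LBINT z. exp (- (1/4) * ((z - 0) \<bullet> (z - (0::'a))))) * exp (- (1/4) * ((x - 0) \<bullet> (x - 0)))"

lemma gauss_total_pos: "0 < (LBINT z. exp (- (1/4) * ((z - 0) \<bullet> (z - (0::'a::euclidean_space)))))"
proof -
 have i: "integrable lborel (%z::'a. exp (- (1/4) * ((z - 0) \<bullet> (z - 0))))" using integrable_gaussian[of "1/4"] by simp
 have "exp (- (1/4)) * measure lborel (ball (0::'a) 1) = (LBINT x. exp (- (1/4)) * indicator (ball (0::'a) 1) x)" by simp
 also have "\<dots> <= (LBINT z. exp (- (1/4) * ((z - 0) \<bullet> (z - (0::'a)))))"
 proof (rule integral_mono[OF _ i])
  show "integrable lborel (%x. exp (- (1/4)) * indicator (ball (0::'a) 1) x :: real)"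
   by (intro integrable_mult_right integrable_real_indicator)
    (use emeasure_bounded_finite[OF bounded_ball, of "0::'a" "1"] in auto)
  fix x :: 'a
  show "exp (- (1/4)) * indicator (ball (0::'a) 1) x <= exp (- (1/4) * ((x - 0) \<bullet> (x - 0)))"
   using power_le_one[of "norm x" 2] by (auto simp: indicator_def dot_square_norm)
 qed
 finally show ?thesis
  using mult_pos_pos[OF exp_gt_zero[of "- (1/4)"] content_ball_pos[of 1 "0::'a"]] by linarith
qed

lemma gauss:
 fixes x y :: "'a::euclidean_space"
 shows gauss_nonneg: "0 <= gauss x" and gauss_smooth: "smooth (gauss :: 'a => real)"
  and gauss_le: "gauss x <= gauss (0::'a)" and gauss_integrable: "integrable lborel (gauss :: 'a => real)"
  and gauss_integral: "(LBINT z. gauss (z::'a)) = 1"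
  and pd_gauss: "pd gauss b x = - ((x \<bullet> b) / 2) * gauss x"
  and gauss_moment: "integrable lborel (%z::'a. norm z * gauss z)"
  and gauss_lipschitz: "\<bar>gauss x - gauss y\<bar> <= gauss (0::'a) * norm (x - y)"
  and gauss_minus: "gauss (- x) = gauss x"
proof -
 define Z where "Z = (LBINT z. exp (- (1/4) * ((z - 0) \<bullet> (z - (0::'a)))))"
 have Z: "Z > 0" unfolding Z_def by (rule gauss_total_pos)
 have eq: "gauss = (%x::'a. inverse Z * exp (- (1/4) * ((x - 0) \<bullet> (x - 0))))"
  by (simp add: gauss_def[abs_def] Z_def)
 have i: "integrable lborel (%z::'a. exp (- (1/4) * ((z - 0) \<bullet> (z - 0))))" using integrable_gaussian[of "1/4"] by simp
 show "0 <= gauss x" using Z by (simp add: eq)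
 have "elementary (gauss :: 'a => real)" unfolding eq
  by (intro elementary.exp elementary.mult elementary.const elementary_sqdist)
 then show s: "smooth (gauss :: 'a => real)" by (rule elementary_smooth)
 show "gauss x <= gauss (0::'a)" using Z by (simp add: eq)
 show "integrable lborel (gauss :: 'a => real)" unfolding eq by (intro integrable_mult_right i)
 show "(LBINT z. gauss (z::'a)) = 1" unfolding eq using Z by (simp add: Z_def)
 have "((%x. inverse Z * exp (- (1/4) * ((x - 0) \<bullet> (x - 0)))) has_derivative (%h. - ((x \<bullet> h) / 2) * gauss x)) (at x)"
  by (auto intro!: derivative_eq_intros simp: eq inner_commute)
 then have "(gauss has_derivative (%h. - ((x \<bullet> h) / 2) * gauss x)) (at x)" by (simp only: eq)
 then show "pd gauss b x = - ((x \<bullet> b) / 2) * gauss x" by (rule pd_eq)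
 show "integrable lborel (%z::'a. norm z * gauss z)"
 proof (rule b_integrable_bound)
  show "integrable lborel (%z::'a. (2 * inverse Z) * exp (- (1/8) * (z \<bullet> z)))"
   by (intro integrable_mult_right integrable_gaussian) simp
  show "AE z::'a in lborel. norm (norm z * gauss z) <= norm ((2 * inverse Z) * exp (- (1/8) * (z \<bullet> z)))"
  proof (rule AE_I2)
   fix z :: 'a
   have "0 <= (norm z / 2 - 1)\<^sup>2" by simp
   also have "\<dots> <= 2 * (1 + (norm z)\<^sup>2 / 8) - norm z" by (simp add: power2_eq_square algebra_simps)
   finally have "norm z <= 2 * (1 + (norm z)\<^sup>2 / 8)" by simp
   also have "\<dots> <= 2 * exp ((norm z)\<^sup>2 / 8)" by (intro mult_left_mono exp_ge_add_one_self) simp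
   also have "\<dots> = 2 * exp ((1/8) * (z \<bullet> z))" by (simp add: dot_square_norm)
   finally have "norm z * exp (- (1/4) * (z \<bullet> z)) <= 2 * exp ((1/8) * (z \<bullet> z)) * exp (- (1/4) * (z \<bullet> z))"
    by (intro mult_right_mono) auto
   also have "\<dots> = 2 * exp (- (1/8) * (z \<bullet> z))" by (simp add: mult.assoc flip: exp_add)
   finally have "inverse Z * (norm z * exp (- (1/4) * (z \<bullet> z))) <= inverse Z * (2 * exp (- (1/8) * (z \<bullet> z)))"
    using Z by (intro mult_left_mono) auto
   then show "norm (norm z * gauss z) <= norm ((2 * inverse Z) * exp (- (1/8) * (z \<bullet> z)))"
    using Z by (simp add: eq abs_mult mult_ac)
  qed
 qed (use borel_measurable_UNIV[OF smooth_continuous[OF s]] in measurable)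
 have L: "\<bar>exp (- (1/4) * s\<^sup>2) - exp (- (1/4) * t\<^sup>2)\<bar> <= 1 * \<bar>s - t\<bar>" for s t :: real
 proof -
  have "norm (exp (- (1/4) * s\<^sup>2) - exp (- (1/4) * t\<^sup>2)) <= 1 * norm (s - t)"
  proof (rule field_differentiable_bound[where S = UNIV and f' = "%u. - (u / 2) * exp (- (1/4) * u\<^sup>2)"])
   fix u :: real
   show "((%u. exp (- (1/4) * u\<^sup>2)) has_field_derivative - (u / 2) * exp (- (1/4) * u\<^sup>2)) (at u within UNIV)"
    by (auto intro!: derivative_eq_intros)
   have "0 <= (\<bar>u\<bar> / 2 - 1 / 2)\<^sup>2" by simp
   then have "\<bar>u\<bar> / 2 <= 1 + (1/4) * u\<^sup>2" by (simp add: power2_eq_square algebra_simps)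
   also have "\<dots> <= exp ((1/4) * u\<^sup>2)" by (rule exp_ge_add_one_self)
   finally have "\<bar>u\<bar> / 2 * exp (- (1/4) * u\<^sup>2) <= exp ((1/4) * u\<^sup>2) * exp (- (1/4) * u\<^sup>2)"
    by (intro mult_right_mono) auto
   also have "\<dots> = 1" by (simp flip: exp_add)
   finally show "norm (- (u / 2) * exp (- (1/4) * u\<^sup>2)) <= 1" by (simp add: abs_mult)
  qed auto
  then show ?thesis by simp
 qed
 have "\<bar>gauss x - gauss y\<bar> = inverse Z * \<bar>exp (- (1/4) * (norm x)\<^sup>2) - exp (- (1/4) * (norm y)\<^sup>2)\<bar>"
  using Z by (simp add: eq dot_square_norm abs_mult flip: right_diff_distrib)
 also have "\<dots> <= inverse Z * norm (x - y)"
  using L[of "norm x" "norm y"] norm_triangle_ineq3[of x y] Z by (intro mult_left_mono) auto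
 finally show "\<bar>gauss x - gauss y\<bar> <= gauss (0::'a) * norm (x - y)" by (simp add: eq)
 show "gauss (- x) = gauss x" by (simp add: eq)
qed

lemma gauss_measurable[measurable]: "gauss \<in> borel_measurable borel"
 by (intro borel_measurable_UNIV smooth_continuous gauss_smooth)

text \<open>The heat kernel at time \<open>s\<^sup>2\<close>. At the junk value \<open>s = 0\<close> it vanishes.\<close>
definition heat :: "real => 'a::euclidean_space => real" where
 "heat s x = inverse (s ^ DIM('a)) * gauss (inverse s *\<^sub>R x)"

lemma heat_nonneg: "0 <= s ==> 0 <= heat s x" by (simp add: heat_def gauss_nonneg)

lemma heat_measurable[measurable]: "(%(s, x). heat s x) \<in> borel_measurable (borel \<Otimes>\<^sub>M borel)"
 unfolding heat_def by measurable

lemma heat_measurable'[measurable]: "heat s \<in> borel_measurable borel"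
 unfolding heat_def[abs_def] by measurable

lemma heat_minus: "heat s (- x) = heat s x" by (simp add: heat_def gauss_minus)

lemma heat_integral:
 fixes \<psi> :: "'a::euclidean_space => real"
 assumes s: "s > 0" and [measurable]: "\<psi> \<in> borel_measurable borel"
 shows "(LBINT x. heat s x * \<psi> x) = (LBINT z. gauss z * \<psi> (s *\<^sub>R z))"
proof -
 have "(LBINT x. heat s x * \<psi> x) = \<bar>s\<bar> ^ DIM('a) * (LBINT x. heat s (0 + s *\<^sub>R x) * \<psi> (0 + s *\<^sub>R x))"
  by (rule lborel_integral_affine) (use s in auto)
 also have "\<dots> = (LBINT x. \<bar>s\<bar> ^ DIM('a) * (heat s (s *\<^sub>R x) * \<psi> (s *\<^sub>R x)))" by simp
 also have "\<dots> = (LBINT z. gauss z * \<psi> (s *\<^sub>R z))"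
  by (rule b_integral_cong) (use s in \<open>auto simp: heat_def field_simps\<close>)
 finally show ?thesis .
qed

lemma heat_integrable: "s > 0 ==> integrable lborel (heat s)"
 unfolding heat_def[abs_def]
 using lborel_integrable_affine[OF gauss_integrable, of "inverse s" 0] by (intro integrable_mult_right) simp

lemma heat_integral_1: "s > 0 ==> (LBINT x. heat s x) = 1"
 using heat_integral[of s "%_. 1"] by (simp add: gauss_integral)

definition hweight :: "real => real => real" where
 "hweight \<mu> s = 2 * s * exp (- \<mu> * s\<^sup>2) * indicator {0..} s"

lemma hweight_nonneg: "0 <= hweight \<mu> s" by (simp add: hweight_def indicator_def)

lemma hweight_measurable[measurable]: "hweight \<mu> \<in> borel_measurable borel"
 unfolding hweight_def[abs_def] by measurable

lemma exp_square_at_top: assumes "\<mu> > 0" shows "((%s::real. exp (- \<mu> * s\<^sup>2)) \<longlongrightarrow> 0) at_top"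
proof -
 have "LIM s at_top. - \<mu> * s\<^sup>2 :> at_bot"
  by (intro filterlim_tendsto_neg_mult_at_bot[OF tendsto_const] filterlim_pow_at_top filterlim_ident) (use assms in auto)
 then show ?thesis by (rule filterlim_compose[OF exp_at_bot])
qed

lemma hweight:
 assumes "\<mu> > 0"
 shows hweight_integrable: "integrable lborel (hweight \<mu>)" and hweight_integral: "(LBINT s. hweight \<mu> s) = 1 / \<mu>"
proof -
 have D: "((%s. - exp (- \<mu> * s\<^sup>2) / \<mu>) has_real_derivative 2 * s * exp (- \<mu> * s\<^sup>2)) (at s)" for s
  using assms by (auto intro!: derivative_eq_intros)
 have lim: "((%s::real. - exp (- \<mu> * s\<^sup>2) / \<mu>) \<longlongrightarrow> - 0 / \<mu>) at_top"
  by (intro tendsto_intros exp_square_at_top assms) (use assms in auto)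
 have "(\<integral>\<^sup>+s. ennreal (2 * s * exp (- \<mu> * s\<^sup>2)) * indicator {0..} s \<partial>lborel) = ennreal (- 0 / \<mu> - (- exp (- \<mu> * 0\<^sup>2) / \<mu>))"
  by (rule nn_integral_FTC_atLeast[OF _ D _ lim]) auto
 moreover have "ennreal (2 * s * exp (- \<mu> * s\<^sup>2)) * indicator {0..} s = ennreal (hweight \<mu> s)" for s
  by (auto simp: hweight_def indicator_def)
 ultimately have "(\<integral>\<^sup>+s. ennreal (hweight \<mu> s) \<partial>lborel) = ennreal (1 / \<mu>)" by simp
 then have "has_bochner_integral lborel (hweight \<mu>) (1 / \<mu>)"
  using assms by (intro has_bochner_integral_nn_integral) (auto simp: hweight_nonneg)
 then show "integrable lborel (hweight \<mu>)" "(LBINT s. hweight \<mu> s) = 1 / \<mu>"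
  by (auto simp: has_bochner_integral_iff)
qed

lemma heat_pair_integrable:
 fixes \<psi> :: "'a::euclidean_space => real"
 assumes \<mu>: "\<mu> > 0" and [measurable]: "v \<in> borel_measurable borel" and v: "!!s. 0 <= v s" "!!s. v s <= hweight \<mu> s"
  and [measurable]: "\<psi> \<in> borel_measurable borel" and C: "!!x. \<bar>\<psi> x\<bar> <= C"
 shows "integrable (lborel \<Otimes>\<^sub>M lborel) (%(s, x). v s * heat s x * \<psi> x)" (is ?A)
  and "integrable lborel (%x. v s * heat s x * \<psi> x)" (is ?B)
proof -
 have v0: "v s = 0" if "s <= 0" for s
  using v[of s] that by (cases "s = 0") (auto simp: hweight_def indicator_def)
 have bd: "\<bar>v s * heat s x * \<psi> x\<bar> <= v s * C * heat s x" if "s > 0" for s x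
  using mult_left_mono[OF C[of x], of "v s * heat s x"] v[of s] heat_nonneg[of s x] that by (simp add: abs_mult mult_ac)
 have C0: "0 <= C" by (rule order_trans[OF abs_ge_zero C])
 have i: "integrable lborel (%x. v s * heat s x * \<psi> x)" for s
 proof (cases "s > 0")
  case True
  show ?thesis
   by (rule b_integrable_bound[OF integrable_mult_right[OF heat_integrable[OF True], of "v s * C"]])
    (use bd[OF True] in \<open>auto intro!: AE_I2 order_trans[OF _ abs_ge_self]\<close>)
 qed (simp add: v0)
 show ?B by (rule i)
 show ?A
 proof (rule lborel_pair.Fubini_integrable)
  show "(%(s, x). v s * heat s x * \<psi> x) \<in> borel_measurable (lborel \<Otimes>\<^sub>M lborel)" by measurable
  show "AE s in lborel. integrable lborel (%x. case (s, x) of (s, x) => v s * heat s x * \<psi> x)" using i by simp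
  show "integrable lborel (%s. \<integral>x. norm (case (s, x) of (s, x) => v s * heat s x * \<psi> x) \<partial>lborel)"
  proof (rule b_integrable_bound[OF integrable_mult_right[OF hweight_integrable[OF \<mu>], of C]])
   show "AE s in lborel. norm (LBINT x. norm (case (s, x) of (s, x) => v s * heat s x * \<psi> x)) <= norm (C * hweight \<mu> s)"
   proof (rule AE_I2)
    fix s
    show "norm (LBINT x. norm (case (s, x) of (s, x) => v s * heat s x * \<psi> x)) <= norm (C * hweight \<mu> s)"
    proof (cases "s > 0")
     case True
     have "(LBINT x. norm (v s * heat s x * \<psi> x)) <= (LBINT x. (v s * C) * heat s (x::'a))"
      by (rule integral_mono) (use i[of s] heat_integrable[OF True, where 'a = 'a] bd[OF True] in auto)
     also have "\<dots> <= C * hweight \<mu> s"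
      using v[of s] heat_integral_1[OF True, where 'a = 'a] C0 by (simp add: mult_left_mono mult.commute)
     finally show ?thesis using C0 hweight_nonneg[of \<mu> s] by (simp add: integral_nonneg_AE)
    qed (simp add: v0)
   qed
  qed measurable
 qed
qed

definition resolvent :: "real => 'a::euclidean_space => real" where
 "resolvent \<mu> x = (LBINT s. hweight \<mu> s * heat s x)"

lemma resolvent_nonneg: "0 <= resolvent \<mu> x"
 unfolding resolvent_def
 by (intro integral_nonneg_AE AE_I2) (auto simp: hweight_def indicator_def heat_nonneg)

lemma resolvent_minus: "resolvent \<mu> (- x) = resolvent \<mu> x"
 by (simp add: resolvent_def heat_minus)

lemma resolvent_measurable[measurable]: "resolvent \<mu> \<in> borel_measurable borel"
proof -
 have "(%x. \<integral>s. hweight \<mu> s * heat s x \<partial>lborel) \<in> borel_measurable (borel :: 'a measure)"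
  by (rule lborel.borel_measurable_lebesgue_integral) measurable
 then show ?thesis by (simp add: resolvent_def[abs_def])
qed

lemma resolvent_against_bounded:
 fixes \<psi> :: "'a::euclidean_space => real"
 assumes \<mu>: "\<mu> > 0" and [measurable]: "\<psi> \<in> borel_measurable borel" and C: "!!x. \<bar>\<psi> x\<bar> <= C"
 shows "(LBINT x. resolvent \<mu> x * \<psi> x) = (LBINT s. hweight \<mu> s * (LBINT z. gauss z * \<psi> (s *\<^sub>R z)))"
  and "integrable lborel (%x. resolvent \<mu> x * \<psi> x)"
  and "integrable lborel (%s. hweight \<mu> s * (LBINT z. gauss z * \<psi> (s *\<^sub>R z)))"
proof -
 have P: "integrable (lborel \<Otimes>\<^sub>M lborel) (%(s, x). hweight \<mu> s * heat s x * \<psi> x)"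
  by (rule heat_pair_integrable[OF \<mu>]) (use C hweight_nonneg in auto)
 have e1: "(LBINT s. hweight \<mu> s * heat s x * \<psi> x) = resolvent \<mu> x * \<psi> x" for x
  by (simp add: resolvent_def)
 have e2: "(LBINT x. hweight \<mu> s * heat s x * \<psi> x) = hweight \<mu> s * (LBINT z. gauss z * \<psi> (s *\<^sub>R z))" for s
 proof (cases "s > 0")
  case True
  then show ?thesis using heat_integral[OF True, of \<psi>] by (simp add: mult.assoc)
 qed (auto simp: hweight_def indicator_def)
 show "(LBINT x. resolvent \<mu> x * \<psi> x) = (LBINT s. hweight \<mu> s * (LBINT z. gauss z * \<psi> (s *\<^sub>R z)))"
  by (rule trans[OF lborel_pair.integral_snd[OF P, unfolded e1] lborel_pair.integral_fst[OF P, unfolded e2, symmetric]])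
 show "integrable lborel (%x. resolvent \<mu> x * \<psi> x)" using lborel_pair.integrable_snd[OF P] by (simp only: e1)
 show "integrable lborel (%s. hweight \<mu> s * (LBINT z. gauss z * \<psi> (s *\<^sub>R z)))"
  using lborel_pair.integrable_fst[OF P] by (simp only: e2)
qed

lemma resolvent_integrable: "\<mu> > 0 ==> integrable lborel (resolvent \<mu>)"
 using resolvent_against_bounded(2)[of \<mu> "%_. 1" 1] by simp

lemma resolvent_integral: "\<mu> > 0 ==> (LBINT x. resolvent \<mu> (x::'a::euclidean_space)) = 1 / \<mu>"
 using resolvent_against_bounded(1)[of \<mu> "%_::'a. 1" 1] by (simp add: gauss_integral hweight_integral)

lemma integrable_gauss_bounded:
 fixes \<psi> :: "'a::euclidean_space => real"
 assumes [measurable]: "\<psi> \<in> borel_measurable borel" and "!!x. \<bar>\<psi> x\<bar> <= C"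
 shows "integrable lborel (%z. gauss z * \<psi> (s *\<^sub>R z))"
 by (rule b_integrable_bound[OF integrable_mult_left[OF gauss_integrable, of C]])
  (use assms gauss_nonneg in \<open>auto simp: abs_mult intro!: mult_left_mono order_trans[OF _ abs_ge_self[of C]]\<close>)

lemma isCont_gauss_average:
 fixes \<psi> :: "'a::euclidean_space => real"
 assumes c: "cont \<psi>" and C: "!!x. \<bar>\<psi> x\<bar> <= C"
 shows "isCont (%s. \<integral>z. gauss z * \<psi> (s *\<^sub>R z) \<partial>lborel) s"
 unfolding continuous_at_sequentially
proof (intro allI impI)
 fix X :: "nat => real" assume X: "X \<longlonglongrightarrow> s"
 have [measurable]: "\<psi> \<in> borel_measurable borel" by (rule borel_measurable_UNIV[OF c])
 have "(%n. \<integral>z. gauss z * \<psi> (X n *\<^sub>R z) \<partial>lborel) \<longlonglongrightarrow> (LBINT z. gauss z * \<psi> (s *\<^sub>R z))"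
 proof (rule integral_dominated_convergence[where w = "%z. gauss z * C"])
  show "AE z in lborel. (%n. gauss z * \<psi> (X n *\<^sub>R z)) \<longlonglongrightarrow> gauss z * \<psi> (s *\<^sub>R z)"
  proof (rule AE_I2, rule tendsto_mult_left)
   fix z
   have "isCont \<psi> (s *\<^sub>R z)" using c by (simp add: continuous_on_eq_continuous_at)
   moreover have "(%n. X n *\<^sub>R z) \<longlonglongrightarrow> s *\<^sub>R z" by (intro tendsto_intros X)
   ultimately show "(%n. \<psi> (X n *\<^sub>R z)) \<longlonglongrightarrow> \<psi> (s *\<^sub>R z)" by (rule isCont_tendsto_compose)
  qed
 qed (use C gauss_nonneg gauss_integrable in
   \<open>auto simp: abs_mult abs_of_nonneg[OF gauss_nonneg] intro!: AE_I2 mult_left_mono\<close>)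
 then show "((%s. \<integral>z. gauss z * \<psi> (s *\<^sub>R z) \<partial>lborel) \<circ> X) \<longlonglongrightarrow> (LBINT z. gauss z * \<psi> (s *\<^sub>R z))"
  by (simp add: o_def)
qed

text \<open>The heat equation in integrated form; Gaussian integration by parts replaces the time
 derivative of the kernel by the Laplacian of the test function.\<close>
lemma DERIV_gauss_average:
 fixes \<phi> :: "'a::euclidean_space => real"
 assumes \<phi>: "test_fun UNIV \<phi>" and s: "s > 0"
 shows "((%s. \<integral>z. gauss z * \<phi> (s *\<^sub>R z) \<partial>lborel) has_real_derivative
  2 * s * (LBINT z. gauss z * lap \<phi> (s *\<^sub>R z))) (at s)"
proof -
 obtain K where K: "smooth \<phi>" "compact K" "!!x. x ~: K ==> \<phi> x = 0"
   "!!x b. x ~: K ==> pd \<phi> b x = 0" "!!x. x ~: K ==> lap \<phi> x = 0"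
  by (rule test_funE[OF \<phi>]) (rule that, assumption+)
 have sp: "smooth (pd \<phi> b)" "smooth (pd (pd \<phi> b) b)" if "b \<in> Basis" for b using that K by (auto intro: smooth_pd)
 have tfb: "test_fun UNIV (pd \<phi> b)" "test_fun UNIV (pd (pd \<phi> b) b)" if "b \<in> Basis" for b
  using \<phi> that by (auto intro: test_fun_pd)
 have [measurable]: "\<phi> \<in> borel_measurable borel" by (intro borel_measurable_UNIV smooth_continuous K)
 have mb: "pd \<phi> b \<in> borel_measurable borel" "pd (pd \<phi> b) b \<in> borel_measurable borel" if "b \<in> Basis" for b
  using sp[OF that] by (auto intro!: borel_measurable_UNIV smooth_continuous)
 have "EX C. \<forall>b\<in>Basis. ALL x. \<bar>pd \<phi> b x\<bar> <= C b" 
 proof (intro bchoice ballI)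
  fix b :: 'a assume "b \<in> Basis"
  then show "EX C. ALL x. \<bar>pd \<phi> b x\<bar> <= C" using test_fun_bounded[OF tfb(1)] by metis
 qed
 then obtain C where C: "!!b x. b \<in> Basis ==> \<bar>pd \<phi> b x\<bar> <= C b" by blast
 have C2: "EX c. ALL x. \<bar>pd (pd \<phi> b) b x\<bar> <= c" if "b \<in> Basis" for b using test_fun_bounded[OF tfb(2)[OF that]] by metis
 obtain C0 where C0: "!!x. \<bar>\<phi> x\<bar> <= C0" using test_fun_bounded[OF \<phi>] by metis
 have dir: "pd \<phi> z (s *\<^sub>R z) = (\<Sum>b\<in>Basis. (z \<bullet> b) * pd \<phi> b (s *\<^sub>R z))" for s z
  by (rule pd_basis_sum[OF smooth_differentiable[OF K(1)]])
 have "((%s. \<integral>z. gauss z * \<phi> (s *\<^sub>R z) \<partial>lborel) has_real_derivative (LBINT z. gauss z * pd \<phi> z (s *\<^sub>R z))) (at s)"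
 proof (rule deriv_under_integral[where w = "%z. (\<Sum>b\<in>Basis. C b) * (norm z * gauss z)"])
  show "integrable lborel (%z. gauss z * \<phi> (s *\<^sub>R z))" for s by (rule integrable_gauss_bounded[OF _ C0]) measurable
  show "((%s. gauss z * \<phi> (s *\<^sub>R z)) has_real_derivative gauss z * pd \<phi> z (s *\<^sub>R z)) (at s)" for s z
   using line_derivative[OF smooth_differentiable[OF K(1)], of 0 z s] by (intro DERIV_cmult) simp
  show "(%z. gauss z * pd \<phi> z (s *\<^sub>R z)) \<in> borel_measurable lborel"
   unfolding dir measurable_lborel1
   by (intro borel_measurable_times borel_measurable_sum gauss_measurable borel_measurable_inner
     measurable_ident measurable_compose[OF _ mb(1)] borel_measurable_const) auto
  show "\<bar>gauss z * pd \<phi> z (s *\<^sub>R z)\<bar> <= (\<Sum>b\<in>Basis. C b) * (norm z * gauss z)" for s z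
  proof -
   have "\<bar>pd \<phi> z (s *\<^sub>R z)\<bar> <= (\<Sum>b\<in>Basis. norm z * C b)"
    unfolding dir by (rule order_trans[OF sum_abs], rule sum_mono, unfold abs_mult, rule mult_mono)
     (auto simp: C Basis_le_norm)
   then have "\<bar>pd \<phi> z (s *\<^sub>R z)\<bar> <= (\<Sum>b\<in>Basis. C b) * norm z" by (simp add: sum_distrib_left mult.commute)
   from mult_left_mono[OF this gauss_nonneg[of z]] show ?thesis by (simp add: abs_mult gauss_nonneg mult_ac)
  qed
  show "integrable lborel (%z. (\<Sum>b\<in>Basis. C b) * (norm z * gauss z))" by (intro integrable_mult_right gauss_moment)
 qed
 also have "(LBINT z. gauss z * pd \<phi> z (s *\<^sub>R z)) = (\<Sum>b\<in>Basis. \<integral>z. (2 * s) * (gauss z * pd (pd \<phi> b) b (s *\<^sub>R z)) \<partial>lborel)"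
 proof -
  have cs: "compact ((%x. inverse s *\<^sub>R x) ` K)" by (intro compact_continuous_image continuous_intros K)
  have b: "(LBINT z. gauss z * ((z \<bullet> b) * pd \<phi> b (s *\<^sub>R z))) = (LBINT z. (2 * s) * (gauss z * pd (pd \<phi> b) b (s *\<^sub>R z)))"
    "integrable lborel (%z. gauss z * ((z \<bullet> b) * pd \<phi> b (s *\<^sub>R z)))" if b: "b \<in> Basis" for b
  proof -
   define h where "h z = 1 * pd \<phi> b (s *\<^sub>R z + 0)" for z
   have sh: "smooth h" unfolding h_def[abs_def] by (rule smooth_affine[OF sp(1)[OF b]])
   have ph: "pd h b = (%z. s * pd (pd \<phi> b) b (s *\<^sub>R z))"
    unfolding h_def[abs_def] pd_affine[OF sp(1)[OF b]] by simp
   have hz: "h z = 0" if "z ~: (%x. inverse s *\<^sub>R x) ` K" for z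
   proof -
    have "s *\<^sub>R z ~: K"
    proof
     assume "s *\<^sub>R z \<in> K"
     then have "inverse s *\<^sub>R (s *\<^sub>R z) \<in> (%x. inverse s *\<^sub>R x) ` K" by (rule imageI)
     with that s show False by simp
    qed
    then show ?thesis by (simp add: h_def K)
   qed
   note ibp = integration_by_parts[of gauss b h, OF smooth_differentiable[OF gauss_smooth]
     smooth_continuous[OF smooth_pd[OF gauss_smooth b]] smooth_differentiable[OF sh]
     smooth_continuous[OF smooth_pd[OF sh b]] cs]
   have 1: "(LBINT z. gauss z * pd h b z) = - (LBINT z. pd gauss b z * h z)"
    "integrable lborel (%z. pd gauss b z * h z)" by (rule ibp; use hz in auto)+
   have e: "gauss z * ((z \<bullet> b) * pd \<phi> b (s *\<^sub>R z)) = (- 2) * (pd gauss b z * h z)" for z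
    by (simp add: pd_gauss h_def)
   show "integrable lborel (%z. gauss z * ((z \<bullet> b) * pd \<phi> b (s *\<^sub>R z)))"
    unfolding e by (intro integrable_mult_right 1)
   have "(LBINT z. gauss z * ((z \<bullet> b) * pd \<phi> b (s *\<^sub>R z))) = 2 * (LBINT z. gauss z * pd h b z)"
    unfolding e 1(1) by simp
   also have "\<dots> = (LBINT z. (2 * s) * (gauss z * pd (pd \<phi> b) b (s *\<^sub>R z)))"
    unfolding ph by (simp add: mult_ac flip: Bochner_Integration.integral_mult_right_zero)
   finally show "(LBINT z. gauss z * ((z \<bullet> b) * pd \<phi> b (s *\<^sub>R z))) = (LBINT z. (2 * s) * (gauss z * pd (pd \<phi> b) b (s *\<^sub>R z)))" .
  qed
  have "(LBINT z. gauss z * pd \<phi> z (s *\<^sub>R z)) = (\<Sum>b\<in>Basis. \<integral>z. gauss z * ((z \<bullet> b) * pd \<phi> b (s *\<^sub>R z)) \<partial>lborel)"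
   unfolding dir sum_distrib_left by (rule b_integral_sum) (rule b(2))
  also have "\<dots> = (\<Sum>b\<in>Basis. \<integral>z. (2 * s) * (gauss z * pd (pd \<phi> b) b (s *\<^sub>R z)) \<partial>lborel)"
   by (rule sum.cong[OF refl]) (rule b(1))
  finally show ?thesis .
 qed
 also have "\<dots> = 2 * s * (LBINT z. gauss z * lap \<phi> (s *\<^sub>R z))"
 proof -
  have i: "integrable lborel (%z. gauss z * pd (pd \<phi> b) b (s *\<^sub>R z))" if b: "b \<in> Basis" for b
  proof -
   obtain c where "!!x. \<bar>pd (pd \<phi> b) b x\<bar> <= c" using C2[OF b] by blast
   then show ?thesis using mb(2)[OF b] by (intro integrable_gauss_bounded)
  qed
  have "(LBINT z. gauss z * lap \<phi> (s *\<^sub>R z)) = (\<Sum>b\<in>Basis. \<integral>z. gauss z * pd (pd \<phi> b) b (s *\<^sub>R z) \<partial>lborel)"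
   unfolding lap_def sum_distrib_left using i by (rule b_integral_sum)
  then show ?thesis by (simp add: sum_distrib_left)
 qed
 finally show ?thesis .
qed

lemma resolvent_fundamental:
 fixes \<phi> :: "'a::euclidean_space => real"
 assumes \<mu>: "\<mu> > 0" and \<phi>: "test_fun UNIV \<phi>"
 shows "(LBINT x. resolvent \<mu> x * (\<mu> * \<phi> x - lap \<phi> x)) = \<phi> 0"
proof -
 obtain K where K: "smooth \<phi>" "compact K" "!!x. x ~: K ==> \<phi> x = 0" "!!x. x ~: K ==> lap \<phi> x = 0"
  by (rule test_funE[OF \<phi>]) (rule that, assumption+)
 have c: "cont \<phi>" "cont (lap \<phi>)" using K by (auto intro: smooth_continuous smooth_lap)
 have [measurable]: "\<phi> \<in> borel_measurable borel" "lap \<phi> \<in> borel_measurable borel" using c by (auto intro: borel_measurable_UNIV)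
 obtain C where C: "!!x. \<bar>\<phi> x\<bar> <= C" "0 <= C" using K(3) that by (rule compact_support_bounded[OF c(1) K(2)])
 obtain L where L: "!!x. \<bar>lap \<phi> x\<bar> <= L" "0 <= L" using K(4) that by (rule compact_support_bounded[OF c(2) K(2)])
 define A where "A s = (LBINT z. gauss z * \<phi> (s *\<^sub>R z))" for s
 define B where "B s = (LBINT z. gauss z * lap \<phi> (s *\<^sub>R z))" for s
 have iA: "integrable lborel (%z. gauss z * \<phi> (s *\<^sub>R z))" for s by (rule integrable_gauss_bounded[OF _ C(1)]) measurable
 have iB: "integrable lborel (%z. gauss z * lap \<phi> (s *\<^sub>R z))" for s by (rule integrable_gauss_bounded[OF _ L(1)]) measurable
 define f where "f s = 2 * s * exp (- \<mu> * s\<^sup>2) * (\<mu> * A s - B s)" for s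
 have bdpsi: "\<bar>\<mu> * \<phi> x - lap \<phi> x\<bar> <= \<mu> * C + L" for x
 proof -
  have "\<mu> * \<bar>\<phi> x\<bar> <= \<mu> * C" using C(1) \<mu> by (intro mult_left_mono) auto
  then have "\<bar>\<mu> * \<phi> x\<bar> <= \<mu> * C" using \<mu> by (simp add: abs_mult)
  then show ?thesis using abs_triangle_ineq4[of "\<mu> * \<phi> x" "lap \<phi> x"] L(1)[of x] by linarith
 qed
 have avg: "(LBINT z. gauss z * (\<mu> * \<phi> (s *\<^sub>R z) - lap \<phi> (s *\<^sub>R z))) = \<mu> * A s - B s" for s
 proof -
  have "(LBINT z. gauss z * (\<mu> * \<phi> (s *\<^sub>R z) - lap \<phi> (s *\<^sub>R z))) = (LBINT z. \<mu> * (gauss z * \<phi> (s *\<^sub>R z)) - gauss z * lap \<phi> (s *\<^sub>R z))"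
   by (simp add: algebra_simps)
  also have "\<dots> = \<mu> * A s - B s" using iA iB by (simp add: A_def B_def)
  finally show ?thesis .
 qed
 note R = resolvent_against_bounded[OF \<mu> _ bdpsi]
 have m: "(%x. \<mu> * \<phi> x - lap \<phi> x) \<in> borel_measurable borel" by measurable
 have fw: "hweight \<mu> s * (\<mu> * A s - B s) = indicator {0<..} s *\<^sub>R f s" for s
  by (cases "s = 0") (auto simp: hweight_def f_def indicator_def)
 have cA: "isCont A s" for s unfolding A_def[abs_def] by (rule isCont_gauss_average[OF c(1) C(1)])
 have cB: "isCont B s" for s unfolding B_def[abs_def] by (rule isCont_gauss_average[OF c(2) L(1)])
 have A0: "A 0 = \<phi> 0" by (simp add: A_def gauss_integral)
 have bA: "\<bar>A s\<bar> <= C" for s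
 proof -
  have "\<bar>A s\<bar> <= (LBINT z. \<bar>gauss z * \<phi> (s *\<^sub>R z)\<bar>)" unfolding A_def by (rule integral_abs_bound)
  also have "\<dots> <= (LBINT z. gauss (z::'a) * C)"
   by (rule integral_mono[OF integrable_abs[OF iA]])
    (use gauss_integrable C in \<open>auto simp: abs_mult abs_of_nonneg[OF gauss_nonneg] gauss_nonneg intro!: mult_left_mono\<close>)
  finally show ?thesis by (simp add: gauss_integral)
 qed
 define F where "F s = - exp (- \<mu> * s\<^sup>2) * A s" for s
 have "(LBINT s=0..\<infinity>. f s) = 0 - (- \<phi> 0)"
 proof (rule interval_integral_FTC_integrable[where F = F])
  fix s assume "0 < ereal s"
  then have s: "s > 0" by simp
  have "(F has_real_derivative f s) (at s)"
   unfolding F_def[abs_def] f_def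
   by (rule derivative_eq_intros DERIV_gauss_average[OF \<phi> s, folded A_def[abs_def] B_def] refl)+
    (simp add: algebra_simps)
  then show "(F has_vector_derivative f s) (at s)" by (simp add: has_real_derivative_iff_has_vector_derivative)
  show "isCont f s" unfolding f_def[abs_def] by (intro continuous_intros cA cB)
 next
  show "set_integrable lborel (einterval 0 \<infinity>) f"
   using R(3)[OF m] unfolding avg fw set_integrable_def zero_ereal_def by simp
  have "isCont F 0" unfolding F_def[abs_def] by (intro continuous_intros cA)
  then have "(F \<longlongrightarrow> - \<phi> 0) (at_right 0)" by (simp add: F_def A0 isCont_def filterlim_at_split)
  then show "((F \<circ> real_of_ereal) \<longlongrightarrow> - \<phi> 0) (at_right 0)" by (simp add: zero_ereal_def ereal_tendsto_simps)
  have "(F \<longlongrightarrow> 0) at_top"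
  proof (rule Lim_null_comparison)
   show "\<forall>\<^sub>F s in at_top. norm (F s) <= exp (- \<mu> * s\<^sup>2) * C"
    using bA by (auto simp: F_def abs_mult intro!: always_eventually)
   show "((%s. exp (- \<mu> * s\<^sup>2) * C) \<longlongrightarrow> 0) at_top"
    using tendsto_mult_right[OF exp_square_at_top[OF \<mu>], of C] by simp
  qed
  then show "((F \<circ> real_of_ereal) \<longlongrightarrow> 0) (at_left \<infinity>)" by (simp add: ereal_tendsto_simps)
 qed simp
 moreover have "(LBINT s=0..\<infinity>. f s) = (LBINT s. hweight \<mu> s * (\<mu> * A s - B s))"
  unfolding fw interval_lebesgue_integral_0_infty set_lebesgue_integral_def ..
 ultimately show ?thesis using R(1)[OF m] unfolding avg by simp
qed

lemma resolvent_le_nn: "ennreal (resolvent \<mu> x) <= (\<integral>\<^sup>+s. ennreal (hweight \<mu> s * heat s x) \<partial>lborel)"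
proof (cases "integrable lborel (%s. hweight \<mu> s * heat s x)")
 case True
 have "0 <= hweight \<mu> s * heat s x" for s by (auto simp: hweight_def indicator_def heat_nonneg)
 then show ?thesis using True by (simp add: resolvent_def nn_integral_eq_integral)
qed (simp add: resolvent_def not_integrable_integral_eq)

lemma heat_le: "s > 0 ==> heat s (x::'a::euclidean_space) <= inverse (s ^ DIM('a)) * gauss (0::'a)"
 unfolding heat_def by (intro mult_left_mono gauss_le) auto

lemma nn_heat: "s > 0 ==> (\<integral>\<^sup>+x. ennreal (heat s (x::'a::euclidean_space)) \<partial>lborel) = 1"
 using nn_integral_eq_integral[OF heat_integrable[where 'a = 'a], of s] heat_integral_1[of s, where 'a = 'a] by (simp add: heat_nonneg)

lemma resolvent_square_integrable:
 assumes \<mu>: "\<mu> > 0" and dim: "DIM('a::euclidean_space) \<in> {2, 3}"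
 shows "integrable lborel (%x::'a. (resolvent \<mu> x)\<^sup>2)"
proof (rule integrableI_bounded)
 define k where "k s x = ennreal (hweight \<mu> s * heat s x)" for s and x :: 'a
 define q where "q s = inverse (sqrt s ^ DIM('a))" for s
 define G where "G = gauss (0::'a)"
 have G0: "G >= 0" by (simp add: G_def gauss_nonneg)
 define m where "m s = hweight \<mu> s * q s" for s
 have m0: "0 <= m s" for s
  by (cases "s >= 0") (auto simp: m_def q_def hweight_def indicator_def)
 have [measurable]: "(%(s, x). k s x) \<in> borel_measurable (borel \<Otimes>\<^sub>M borel)" unfolding k_def by measurable
 have [measurable]: "m \<in> borel_measurable borel" unfolding m_def[abs_def] q_def by measurable
 have qsq: "inverse (s ^ DIM('a)) = q s * q s" if "s > 0" for s
 proof -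
  have "s ^ DIM('a) = sqrt s ^ DIM('a) * sqrt s ^ DIM('a)" using that by (simp flip: power_mult_distrib)
  then show ?thesis by (simp add: q_def)
 qed
 have qmono: "q t <= q s" if "0 < s" "s <= t" for s t
  unfolding q_def using that by (intro le_imp_inverse_le power_mono) auto
 have qpos: "0 <= q s" if "s > 0" for s using that by (simp add: q_def)
 have pair_le: "(\<integral>\<^sup>+x. k s x * k t x \<partial>lborel) <= ennreal (G * (m s * m t))" if st: "0 < s" "s <= t" for s t
 proof -
  have "k s x * k t x <= ennreal (hweight \<mu> s * (hweight \<mu> t * (q s * q t * G))) * ennreal (heat s x)" for x
  proof -
   have "heat t x <= q t * q t * G" using heat_le[of t x] st by (simp add: qsq G_def)
   also have "\<dots> <= q s * q t * G" using qmono[OF st] qpos[of t] st G0 by (intro mult_right_mono) auto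
   finally have "hweight \<mu> s * heat s x * (hweight \<mu> t * heat t x) <= hweight \<mu> s * heat s x * (hweight \<mu> t * (q s * q t * G))"
    using hweight_nonneg[of \<mu>] heat_nonneg[of s x] st by (intro mult_left_mono) auto
   then have "ennreal (hweight \<mu> s * heat s x * (hweight \<mu> t * heat t x)) <= ennreal (hweight \<mu> s * heat s x * (hweight \<mu> t * (q s * q t * G)))"
    by (rule ennreal_leI)
   moreover have "k s x * k t x = ennreal (hweight \<mu> s * heat s x * (hweight \<mu> t * heat t x))"
    using hweight_nonneg[of \<mu>] heat_nonneg[of s x] heat_nonneg[of t x] st
    unfolding k_def by (subst ennreal_mult[symmetric]) auto
   moreover have "ennreal (hweight \<mu> s * heat s x * (hweight \<mu> t * (q s * q t * G))) =
     ennreal (hweight \<mu> s * (hweight \<mu> t * (q s * q t * G))) * ennreal (heat s x)"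
    using hweight_nonneg[of \<mu>] heat_nonneg[of s x] st qpos G0 by (subst ennreal_mult[symmetric]) (auto simp: mult_ac)
   ultimately show ?thesis by simp
  qed
  then have "(\<integral>\<^sup>+x. k s x * k t x \<partial>lborel) <= (\<integral>\<^sup>+x. ennreal (hweight \<mu> s * (hweight \<mu> t * (q s * q t * G))) * ennreal (heat s (x::'a)) \<partial>lborel)"
   by (rule nn_integral_mono)
  also have "\<dots> = ennreal (hweight \<mu> s * (hweight \<mu> t * (q s * q t * G)))"
   using st by (simp add: nn_integral_cmult nn_heat)
  finally show ?thesis by (simp add: m_def mult_ac)
 qed
 have kz: "k s x = 0" if "s <= 0" for s x using that by (auto simp: k_def hweight_def indicator_def)
 have pair: "(\<integral>\<^sup>+x. k s x * k t x \<partial>lborel) <= ennreal (G * (m s * m t))" for s t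
 proof (cases "0 < s & 0 < t")
  case True
  then show ?thesis using pair_le[of s t] pair_le[of t s] by (cases "s <= t") (auto simp: mult.commute)
 qed (auto simp: kz not_less)
 have finm: "(\<integral>\<^sup>+s. ennreal (m s) \<partial>lborel) < \<infinity>"
 proof -
  have "ennreal (m s) <= 2 * (ennreal (s powr (-1/2)) * indicator {0..1} s) + ennreal (hweight \<mu> s)" for s
  proof -
   consider "s <= 0" | "0 < s" "s <= 1" | "s > 1" by linarith
   then show ?thesis
   proof cases
    case 1
    then have "m s = 0" by (auto simp: m_def hweight_def indicator_def)
    then show ?thesis by simp
   next
    case 2
    have "m s <= 2 * s * q s"
     unfolding m_def hweight_def using 2 \<mu> qpos[of s] by (intro mult_right_mono) auto
    also have "\<dots> <= 2 * (s powr (-1/2))"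
    proof -
     have p: "s powr (-1/2) = inverse (sqrt s)" using 2 by (simp add: powr_minus powr_half_sqrt)
     have r: "0 < sqrt s" "sqrt s <= 1" "s = sqrt s * sqrt s" using 2 by auto
     have "DIM('a) = 2 \<or> DIM('a) = 3" using dim by auto
     then show ?thesis
     proof
      assume d: "DIM('a) = 2"
      have "2 * s * q s = 2" using 2 by (simp add: q_def d)
      moreover have "1 <= inverse (sqrt s)" using r by (simp add: one_le_inverse)
      ultimately show ?thesis unfolding p by simp
     next
      assume d: "DIM('a) = 3"
      have "s * q s = inverse (sqrt s)" using 2 by (simp add: q_def d power3_eq_cube field_simps)
      then show ?thesis unfolding p by simp
     qed
    qed
    finally have "ennreal (m s) <= ennreal (2 * (s powr (-1/2)))" by (rule ennreal_leI)
    also have "\<dots> = 2 * (ennreal (s powr (-1/2)) * indicator {0..1} s)" using 2 by (simp add: ennreal_mult)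
    finally show ?thesis by (simp add: add_increasing2)
   next
    case 3
    have "q s <= 1" unfolding q_def using 3 by (intro inverse_le_1_iff[THEN iffD2] disjI2 one_le_power) auto
    then have "m s <= hweight \<mu> s" unfolding m_def using hweight_nonneg[of \<mu> s] by (simp add: mult_left_le)
    then show ?thesis by (simp add: add_increasing ennreal_leI)
   qed
  qed
  then have "(\<integral>\<^sup>+s. ennreal (m s) \<partial>lborel) <= (\<integral>\<^sup>+s. 2 * (ennreal (s powr (-1/2)) * indicator {0..1} s) + ennreal (hweight \<mu> s) \<partial>lborel)"
   by (rule nn_integral_mono)
  also have "\<dots> = 2 * (\<integral>\<^sup>+s. ennreal (s powr (-1/2)) * indicator {0..1} s \<partial>lborel) + (\<integral>\<^sup>+s. ennreal (hweight \<mu> s) \<partial>lborel)"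
   by (simp add: nn_integral_add nn_integral_cmult)
  also have "(\<integral>\<^sup>+s. ennreal (s powr (-1/2)) * indicator {0..1} s \<partial>lborel) = ennreal (1 powr (-1/2 + 1) / (-1/2 + 1))"
   by (rule nn_integral_has_integral_lebesgue'[OF _ has_integral_powr_from_0]) auto
  also have "(\<integral>\<^sup>+s. ennreal (hweight \<mu> s) \<partial>lborel) = ennreal (1 / \<mu>)"
   using nn_integral_eq_integral[OF hweight_integrable[OF \<mu>]] hweight_integral[OF \<mu>] by (simp add: hweight_nonneg)
  finally show ?thesis by (auto simp: ennreal_mult_less_top intro: le_less_trans)
 qed
 have "(\<integral>\<^sup>+x. ennreal (norm ((resolvent \<mu> x)\<^sup>2)) \<partial>(lborel::'a measure)) <= (\<integral>\<^sup>+x. (\<integral>\<^sup>+s. (\<integral>\<^sup>+t. k s x * k t x \<partial>lborel) \<partial>lborel) \<partial>lborel)"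
 proof (rule nn_integral_mono)
  fix x :: 'a
  have "ennreal (norm ((resolvent \<mu> x)\<^sup>2)) = ennreal (resolvent \<mu> x) * ennreal (resolvent \<mu> x)"
   using resolvent_nonneg[of \<mu> x] by (simp add: power2_eq_square ennreal_mult)
  also have "\<dots> <= (\<integral>\<^sup>+s. k s x \<partial>lborel) * (\<integral>\<^sup>+t. k t x \<partial>lborel)"
   unfolding k_def by (intro mult_mono resolvent_le_nn) auto
  also have "\<dots> = (\<integral>\<^sup>+s. (\<integral>\<^sup>+t. k s x * k t x \<partial>lborel) \<partial>lborel)"
   by (simp add: nn_integral_cmult nn_integral_multc)
  finally show "ennreal (norm ((resolvent \<mu> x)\<^sup>2)) <= (\<integral>\<^sup>+s. (\<integral>\<^sup>+t. k s x * k t x \<partial>lborel) \<partial>lborel)" .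
 qed
 also have "\<dots> = (\<integral>\<^sup>+s. (\<integral>\<^sup>+x. (\<integral>\<^sup>+t. k s x * k t x \<partial>lborel) \<partial>lborel) \<partial>lborel)"
  by (rule lborel_pair.Fubini') measurable
 also have "\<dots> = (\<integral>\<^sup>+s. (\<integral>\<^sup>+t. (\<integral>\<^sup>+x. k s x * k t x \<partial>lborel) \<partial>lborel) \<partial>lborel)"
  by (rule nn_integral_cong, rule lborel_pair.Fubini') measurable
 also have "\<dots> <= (\<integral>\<^sup>+s. (\<integral>\<^sup>+t. ennreal (G * (m s * m t)) \<partial>lborel) \<partial>lborel)"
  by (intro nn_integral_mono pair)
 also have "\<dots> = (\<integral>\<^sup>+s. (\<integral>\<^sup>+t. (ennreal G * ennreal (m s)) * ennreal (m t) \<partial>lborel) \<partial>lborel)"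
  by (intro nn_integral_cong) (simp add: ennreal_mult m0 G0 mult.assoc)
 also have "\<dots> = ennreal G * (\<integral>\<^sup>+s. ennreal (m s) \<partial>lborel) * (\<integral>\<^sup>+t. ennreal (m t) \<partial>lborel)"
  by (simp add: nn_integral_cmult nn_integral_multc)
 also have "\<dots> < \<infinity>" using finm by (auto simp: ennreal_mult_less_top)
 finally show "(\<integral>\<^sup>+x. ennreal (norm ((resolvent \<mu> x)\<^sup>2)) \<partial>(lborel::'a measure)) < \<infinity>" .
qed measurable

lemma resolvent_lipschitz_approx:
 assumes \<mu>: "\<mu> > 0" and \<eta>: "\<eta> > 0"
 shows "\<exists>\<kappa> :: 'a::euclidean_space => real. EX L. \<kappa> \<in> borel_measurable borel & integrable lborel \<kappa> & 0 <= L \<and>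
   (ALL x y. \<bar>\<kappa> x - \<kappa> y\<bar> <= L * norm (x - y)) & (LBINT x. \<bar>resolvent \<mu> x - \<kappa> x\<bar>) <= \<eta>"
proof -
 define \<tau> where "\<tau> = sqrt \<eta>"
 have \<tau>: "\<tau> > 0" "\<tau>\<^sup>2 = \<eta>" using \<eta> by (auto simp: \<tau>_def)
 define v where "v s = hweight \<mu> s * indicator {\<tau><..} s" for s
 define u where "u s = hweight \<mu> s * indicator {..\<tau>} s" for s
 have uv: "hweight \<mu> s = u s + v s" for s by (auto simp: u_def v_def indicator_def)
 have [measurable]: "u \<in> borel_measurable borel" "v \<in> borel_measurable borel" unfolding u_def[abs_def] v_def[abs_def] by measurable
 have v: "0 <= v s" "v s <= hweight \<mu> s" "0 <= u s" "u s <= hweight \<mu> s" for s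
  using hweight_nonneg[of \<mu> s] by (auto simp: u_def v_def indicator_def)
 have vz: "v s = 0" if "s <= \<tau>" for s using that by (simp add: v_def)
 define G where "G = gauss (0::'a)"
 define \<kappa> where "\<kappa> x = (LBINT s. v s * heat s x)" for x :: 'a
 have iv: "integrable lborel v"
  by (rule b_integrable_bound[OF hweight_integrable[OF \<mu>]])
   (use v in \<open>auto intro!: AE_I2 order_trans[OF _ abs_ge_self]\<close>)
 have Pv: "integrable (lborel \<Otimes>\<^sub>M lborel) (%(s, x::'a). v s * heat s x)"
  using heat_pair_integrable(1)[OF \<mu>, of v "%_. 1" 1] v by simp
 have Pu: "integrable (lborel \<Otimes>\<^sub>M lborel) (%(s, x::'a). u s * heat s x)"
  using heat_pair_integrable(1)[OF \<mu>, of u "%_. 1" 1] v by simp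
 have i\<kappa>: "integrable lborel \<kappa>" unfolding \<kappa>_def[abs_def] by (rule lborel_pair.integrable_snd[OF Pv])
 have ivh: "integrable lborel (%s. v s * heat s x)" for x :: 'a
 proof (rule b_integrable_bound[OF integrable_mult_left[OF iv, of "inverse (\<tau> ^ DIM('a)) * G"]])
  show "AE s in lborel. norm (v s * heat s x) <= norm (v s * (inverse (\<tau> ^ DIM('a)) * G))"
  proof (rule AE_I2)
   fix s
   show "norm (v s * heat s x) <= norm (v s * (inverse (\<tau> ^ DIM('a)) * G))"
   proof (cases "s <= \<tau>")
    case False
    then have s: "s > 0" using \<tau> by simp
    have "heat s x <= inverse (s ^ DIM('a)) * G" using heat_le[OF s, of x] by (simp add: G_def)
    also have "\<dots> <= inverse (\<tau> ^ DIM('a)) * G"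
     using False \<tau> by (intro mult_right_mono le_imp_inverse_le power_mono) (auto simp: G_def gauss_nonneg)
    finally show ?thesis
     using v[of s] heat_nonneg[of s x] s \<tau>(1) gauss_nonneg[of "0::'a", folded G_def]
     by (simp add: abs_mult mult_left_mono)
   qed (simp add: vz)
  qed
 qed measurable
 define L where "L = (1 / \<mu>) * (inverse (\<tau> ^ Suc DIM('a)) * G)"
 have "\<bar>\<kappa> x - \<kappa> y\<bar> <= L * norm (x - y)" for x y :: 'a
 proof -
  have "\<bar>\<kappa> x - \<kappa> y\<bar> = \<bar>LBINT s. v s * heat s x - v s * heat s y\<bar>" unfolding \<kappa>_def using ivh by simp
  also have "\<dots> <= (LBINT s. v s * (inverse (\<tau> ^ Suc DIM('a)) * G * norm (x - y)))"
  proof (rule order_trans[OF integral_abs_bound], rule integral_mono)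
   fix s
   show "\<bar>v s * heat s x - v s * heat s y\<bar> <= v s * (inverse (\<tau> ^ Suc DIM('a)) * G * norm (x - y))"
   proof (cases "s <= \<tau>")
    case False
    then have s: "s > 0" using \<tau> by simp
    have "\<bar>heat s x - heat s y\<bar> = inverse (s ^ DIM('a)) * \<bar>gauss (inverse s *\<^sub>R x) - gauss (inverse s *\<^sub>R y)\<bar>"
     using s by (simp add: heat_def abs_mult flip: right_diff_distrib)
    also have "\<dots> <= inverse (s ^ DIM('a)) * (G * norm (inverse s *\<^sub>R x - inverse s *\<^sub>R y))"
     by (rule mult_left_mono) (use gauss_lipschitz[of "inverse s *\<^sub>R x" "inverse s *\<^sub>R y"] s in \<open>simp_all add: G_def\<close>)
    also have "\<dots> = inverse (s ^ Suc DIM('a)) * (G * norm (x - y))"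
     using s by (simp flip: scaleR_right_diff_distrib)
    also have "\<dots> <= inverse (\<tau> ^ Suc DIM('a)) * (G * norm (x - y))"
     using False \<tau> by (intro mult_right_mono le_imp_inverse_le power_mono zero_less_power mult_nonneg_nonneg) (auto simp: G_def gauss_nonneg)
    finally have "v s * \<bar>heat s x - heat s y\<bar> <= v s * (inverse (\<tau> ^ Suc DIM('a)) * (G * norm (x - y)))"
     using v by (intro mult_left_mono) auto
    then show ?thesis using v(1)[of s] by (simp add: abs_mult mult.assoc flip: right_diff_distrib)
   qed (simp add: vz)
  qed (use ivh iv in auto)
  also have "\<dots> = (LBINT s. v s) * (inverse (\<tau> ^ Suc DIM('a)) * G * norm (x - y))" by simp
  also have "\<dots> <= (1 / \<mu>) * (inverse (\<tau> ^ Suc DIM('a)) * G * norm (x - y))"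
  proof (rule mult_right_mono)
   show "(LBINT s. v s) <= 1 / \<mu>"
    unfolding hweight_integral[OF \<mu>, symmetric] using iv hweight_integrable[OF \<mu>] v by (intro integral_mono) auto
  qed (use \<tau> in \<open>auto simp: G_def gauss_nonneg intro!: mult_nonneg_nonneg\<close>)
  finally show ?thesis by (simp add: L_def mult_ac)
 qed
 moreover have "0 <= L" using \<mu> \<tau> by (auto simp: L_def G_def gauss_nonneg intro!: mult_nonneg_nonneg)
 moreover have "(LBINT x. \<bar>resolvent \<mu> x - \<kappa> x\<bar>) <= \<eta>"
 proof -
  have "AE x::'a in lborel. integrable lborel (%s. u s * heat s x)" by (rule lborel_pair.AE_integrable_snd[OF Pu])
  then have ae: "AE x::'a in lborel. \<bar>resolvent \<mu> x - \<kappa> x\<bar> = (LBINT s. u s * heat s x)"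
  proof eventually_elim
   case (elim x)
   have "resolvent \<mu> x = (LBINT s. u s * heat s x + v s * heat s x)"
    unfolding resolvent_def uv by (simp add: distrib_right)
   also have "\<dots> = (LBINT s. u s * heat s x) + \<kappa> x" using elim ivh by (simp add: \<kappa>_def)
   finally have "resolvent \<mu> x - \<kappa> x = (LBINT s. u s * heat s x)" by simp
   moreover have "0 <= u s * heat s x" for s
    using v(3)[of s] by (cases "0 <= s") (auto simp: heat_nonneg u_def hweight_def indicator_def)
   ultimately show ?case by (simp add: integral_nonneg_AE)
  qed
  have "(LBINT x. \<bar>resolvent \<mu> x - \<kappa> x\<bar>) = (LBINT x. (LBINT s. u s * heat s (x::'a)))"
   using ae i\<kappa> lborel_pair.integrable_snd[OF Pu] by (intro integral_cong_AE) auto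
  also have "\<dots> = (LBINT s. (LBINT x. u s * heat s (x::'a)))"
   unfolding lborel_pair.integral_snd[OF Pu] lborel_pair.integral_fst[OF Pu] ..
  also have "\<dots> = (LBINT s. u s)"
  proof (rule b_integral_cong)
   fix s
   show "(LBINT x. u s * heat s (x::'a)) = u s"
    using heat_integral_1[of s, where 'a = 'a] by (cases "s > 0") (auto simp: u_def hweight_def indicator_def)
  qed simp
  also have "\<dots> <= (LBINT s. 2 * s * indicator {0..\<tau>} s)"
  proof (rule integral_mono')
   show "integrable lborel (%s. 2 * s * indicator {0..\<tau>} s :: real)"
    by (rule integrable_FTC_Icc_nonneg[where F = "%s. s\<^sup>2"]) (use \<tau> in \<open>auto intro!: derivative_eq_intros\<close>)
   show "u s <= 2 * s * indicator {0..\<tau>} s" for s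
    using \<mu> by (auto simp: u_def hweight_def indicator_def mult_left_le)
  qed (auto simp: indicator_def)
  also have "\<dots> = \<tau>\<^sup>2 - 0\<^sup>2"
   by (rule integral_FTC_Icc_nonneg[where F = "%s. s\<^sup>2"]) (use \<tau> in \<open>auto intro!: derivative_eq_intros\<close>)
  finally show ?thesis using \<tau> by simp
 qed
 ultimately show ?thesis using i\<kappa> by (intro exI[of _ \<kappa>] exI[of _ L]) auto
qed

lemma Cauchy_Schwarz_integral:
 fixes f g :: "'b => real"
 assumes [measurable]: "f \<in> borel_measurable M" "g \<in> borel_measurable M"
  and f: "integrable M (%x. (f x)\<^sup>2)" and g: "integrable M (%x. (g x)\<^sup>2)"
 shows "integrable M (%x. f x * g x)"
  and "\<bar>\<integral>x. f x * g x \<partial>M\<bar> <= sqrt (\<integral>x. (f x)\<^sup>2 \<partial>M) * sqrt (\<integral>x. (g x)\<^sup>2 \<partial>M)"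
proof -
 show i: "integrable M (%x. f x * g x)"
 proof (rule b_integrable_bound[OF b_integrable_add[OF f g]])
  have "\<bar>a * b\<bar> <= a\<^sup>2 + b\<^sup>2" for a b :: real
   using sum_squares_bound[of a b] sum_squares_bound[of a "-b"] zero_le_power2[of a] zero_le_power2[of b]
   by (simp add: abs_le_iff)
  then show "AE x in M. norm (f x * g x) <= norm ((f x)\<^sup>2 + (g x)\<^sup>2)" by (auto intro!: AE_I2)
 qed measurable
 define a where "a = (\<integral>x. (f x)\<^sup>2 \<partial>M)"
 define b where "b = (\<integral>x. (g x)\<^sup>2 \<partial>M)"
 define c where "c = (\<integral>x. f x * g x \<partial>M)"
 have a0: "a >= 0" by (simp add: a_def)
 have "c\<^sup>2 <= a * b"
 proof (cases "a = 0")
  case True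
  then have "AE x in M. (f x)\<^sup>2 = 0" using integral_nonneg_eq_0_iff_AE[OF f] by (simp add: a_def)
  then have "AE x in M. f x * g x = 0" by eventually_elim simp
  then have "c = 0" unfolding c_def by (subst integral_cong_AE[of _ _ "%_. 0"]) auto
  then show ?thesis by (simp add: True)
 next
  case False
  define t where "t = c / a"
  have "0 <= (\<integral>x. (g x - t * f x)\<^sup>2 \<partial>M)" by simp
  also have "\<dots> = (\<integral>x. (g x)\<^sup>2 - 2 * t * (f x * g x) + t\<^sup>2 * (f x)\<^sup>2 \<partial>M)"
   by (simp add: power2_eq_square algebra_simps)
  also have "\<dots> = b - 2 * t * c + t\<^sup>2 * a" using f g i by (simp add: a_def b_def c_def)
  also have "\<dots> = b - c\<^sup>2 / a" using False by (simp add: t_def power2_eq_square field_simps)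
  finally show ?thesis using False a0 by (simp add: field_simps)
 qed
 then have "\<bar>c\<bar> <= sqrt (a * b)" by (metis real_sqrt_abs real_sqrt_le_mono)
 then show "\<bar>\<integral>x. f x * g x \<partial>M\<bar> <= sqrt (\<integral>x. (f x)\<^sup>2 \<partial>M) * sqrt (\<integral>x. (g x)\<^sup>2 \<partial>M)"
  by (simp add: a_def b_def c_def real_sqrt_mult)
qed

text \<open>The exterior condition says that every exterior or boundary point sees, at each small
 scale, an exterior ball of comparable size; this is all that is used of the Lipschitz boundary.\<close>
locale corkscrew_domain =
 fixes \<Omega> :: "'a::euclidean_space set"
 assumes dim: "DIM('a) \<in> {2, 3}" and open_dom: "open \<Omega>" and bounded_dom: "bounded \<Omega>"
  and corkscrew: "\<exists>\<sigma>>0. \<exists>\<tau>0>0. \<sigma> <= 1 & (ALL x. x ~: \<Omega> -->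
   (ALL \<tau>. 0 < \<tau> & \<tau> <= \<tau>0 --> (EX c. norm (c - x) = \<tau> & ball c (\<sigma> * \<tau>) \<inter> \<Omega> = {})))"
begin

definition L2supp :: "('a => real) => bool" where
 "L2supp f \<longleftrightarrow> f \<in> borel_measurable borel & (ALL x. x ~: \<Omega> --> f x = 0) & integrable lborel (%x. (f x)\<^sup>2)"

lemma L2supp_measurable: "L2supp f ==> f \<in> borel_measurable borel" by (simp add: L2supp_def)
lemma L2supp_outside: "L2supp f ==> x ~: \<Omega> ==> f x = 0" by (simp add: L2supp_def)
lemma L2supp_square: "L2supp f ==> integrable lborel (%x. (f x)\<^sup>2)" by (simp add: L2supp_def)

definition vol :: real where "vol = measure lborel \<Omega>"

lemma indicator_dom_integrable: "integrable lborel (indicator \<Omega> :: 'a => real)"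
 using emeasure_bounded_finite[OF bounded_dom] open_dom by (intro integrable_real_indicator) auto

lemma vol_nonneg: "0 <= vol" by (simp add: vol_def)

lemma L2supp_integrable:
 assumes "L2supp f" shows "integrable lborel f"
proof -
 have "integrable lborel (%x. indicator \<Omega> x * f x)"
 proof (rule Cauchy_Schwarz_integral)
  have "(indicator \<Omega> x :: real)\<^sup>2 = indicator \<Omega> x" for x by (simp add: indicator_def)
  then show "integrable lborel (%x. (indicator \<Omega> x :: real)\<^sup>2)" using indicator_dom_integrable by simp
 qed (use assms open_dom in \<open>auto simp: L2supp_def\<close>)
 moreover have "(%x. indicator \<Omega> x * f x) = f" using L2supp_outside[OF assms] by (auto simp: indicator_def fun_eq_iff)
 ultimately show ?thesis by simp
qed

lemma L2supp_bounded:
 assumes [measurable]: "f \<in> borel_measurable borel" and "!!x. x ~: \<Omega> ==> f x = 0" and b: "!!x. \<bar>f x\<bar> <= M"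
 shows "L2supp f"
 unfolding L2supp_def
proof (intro conjI allI impI)
 show "integrable lborel (%x. (f x)\<^sup>2)"
 proof (rule b_integrable_bound[OF integrable_mult_right[OF indicator_dom_integrable, of "M\<^sup>2"]])
  show "AE x in lborel. norm ((f x)\<^sup>2) <= norm (M\<^sup>2 * indicator \<Omega> x)"
   using assms(2) power_mono[OF b abs_ge_zero, of _ 2] by (intro AE_I2) (auto simp: indicator_def)
 qed measurable
qed (use assms in auto)

lemma L2supp_add:
 assumes "L2supp f" "L2supp g" shows "L2supp (%x. a * f x + b * g x)"
 unfolding L2supp_def
proof (intro conjI allI impI)
 note [measurable] = L2supp_measurable[OF assms(1)] L2supp_measurable[OF assms(2)]
 show "(%x. a * f x + b * g x) \<in> borel_measurable borel" by measurable
 show "a * f x + b * g x = 0" if "x ~: \<Omega>" for x using assms that by (simp add: L2supp_outside)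
 have i: "integrable lborel (%x. f x * g x)" by (rule Cauchy_Schwarz_integral) (use assms L2supp_square in auto)
 have "(%x. (a * f x + b * g x)\<^sup>2) = (%x. a\<^sup>2 * (f x)\<^sup>2 + b\<^sup>2 * (g x)\<^sup>2 + (2 * a * b) * (f x * g x))"
  by (auto simp: power2_eq_square algebra_simps)
 then show "integrable lborel (%x. (a * f x + b * g x)\<^sup>2)"
  using i assms by (simp add: L2supp_square)
qed

lemma L2supp_diff: "L2supp f ==> L2supp g ==> L2supp (%x. f x - g x)"
 using L2supp_add[of f g 1 "-1"] by simp

lemma L2supp_abs: "L2supp f ==> L2supp (%x. \<bar>f x\<bar>)"
 by (auto simp: L2supp_def)

definition potential :: "real => ('a => real) => 'a => real" where
 "potential \<mu> f x = (LBINT z. resolvent \<mu> (x - z) * f z)"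

definition Cres :: "real => real" where
 "Cres \<mu> = sqrt (LBINT x. (resolvent \<mu> (x::'a))\<^sup>2)"

lemma Cres_nonneg: "0 <= Cres \<mu>" by (simp add: Cres_def)

context
 fixes \<mu> :: real assumes \<mu>: "\<mu> > 0"
begin

lemma resolvent_shift_integrable:
 "integrable lborel (%z. resolvent \<mu> (x - z :: 'a))" "integrable lborel (%z. (resolvent \<mu> (x - z :: 'a))\<^sup>2)"
 using lborel_integrable_affine[OF resolvent_integrable[OF \<mu>], of "-1" x]
  lborel_integrable_affine[OF resolvent_square_integrable[OF \<mu> dim], of "-1" x] by simp_all

lemma resolvent_shift_integral:
 "(LBINT z. resolvent \<mu> (x - z :: 'a)) = 1 / \<mu>"
 "(LBINT z. (resolvent \<mu> (x - z :: 'a))\<^sup>2) = (LBINT x. (resolvent \<mu> (x::'a))\<^sup>2)"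
 using lborel_integral_reflect[of "resolvent \<mu>" x] lborel_integral_reflect[of "%z. (resolvent \<mu> (z::'a))\<^sup>2" x]
 by (simp_all add: resolvent_integral[OF \<mu>])

lemma potential_integrable:
 assumes "L2supp f" shows "integrable lborel (%z. resolvent \<mu> (x - z) * f z)"
proof -
 note [measurable] = L2supp_measurable[OF assms(1)]
 show ?thesis by (rule Cauchy_Schwarz_integral) (use resolvent_shift_integrable L2supp_square[OF assms] in auto)
qed

lemma potential_L2_bound:
 assumes "L2supp f" shows "\<bar>potential \<mu> f x\<bar> <= Cres \<mu> * sqrt (LBINT x. (f x)\<^sup>2)"
proof -
 note [measurable] = L2supp_measurable[OF assms(1)]
 have "\<bar>potential \<mu> f x\<bar> <= sqrt (LBINT z. (resolvent \<mu> (x - z))\<^sup>2) * sqrt (LBINT x. (f x)\<^sup>2)"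
  unfolding potential_def
  by (rule Cauchy_Schwarz_integral) (use resolvent_shift_integrable L2supp_square[OF assms] in auto)
 then show ?thesis by (simp add: Cres_def resolvent_shift_integral)
qed

lemma potential_linear:
 assumes "L2supp f" "L2supp g"
 shows "potential \<mu> (%z. a * f z + b * g z) x = a * potential \<mu> f x + b * potential \<mu> g x"
proof -
 have "potential \<mu> (%z. a * f z + b * g z) x = (LBINT z. a * (resolvent \<mu> (x - z) * f z) + b * (resolvent \<mu> (x - z) * g z))"
  unfolding potential_def by (simp add: algebra_simps)
 then show ?thesis using assms by (simp add: potential_def potential_integrable)
qed

lemma potential_diff:
 "L2supp f ==> L2supp g ==> potential \<mu> (%z. f z - g z) x = potential \<mu> f x - potential \<mu> g x"
 using potential_linear[of f g 1 "-1" x] by simp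

lemma potential_mono:
 assumes "L2supp f" "L2supp g" "!!z. f z <= g z" shows "potential \<mu> f x <= potential \<mu> g x"
 unfolding potential_def using assms
 by (intro integral_mono potential_integrable) (auto intro: mult_left_mono simp: resolvent_nonneg)

lemma potential_nonneg: "(!!z. 0 <= f z) ==> 0 <= potential \<mu> f x"
 unfolding potential_def by (auto intro!: integral_nonneg_AE AE_I2 simp: resolvent_nonneg)

lemma potential_bound:
 assumes "L2supp f" and F: "!!x. \<bar>f x\<bar> <= F" shows "\<bar>potential \<mu> f x\<bar> <= F / \<mu>"
proof -
 have "\<bar>potential \<mu> f x\<bar> <= (LBINT z. \<bar>resolvent \<mu> (x - z) * f z\<bar>)" unfolding potential_def by (rule integral_abs_bound)
 also have "\<dots> <= (LBINT z. resolvent \<mu> (x - z) * F)"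
  by (rule integral_mono[OF integrable_abs[OF potential_integrable[OF assms(1)]]])
   (use resolvent_shift_integrable[of x] F in \<open>auto simp: abs_mult abs_of_nonneg[OF resolvent_nonneg] intro!: mult_left_mono resolvent_nonneg\<close>)
 also have "\<dots> = F / \<mu>" by (simp add: resolvent_shift_integral)
 finally show ?thesis .
qed

lemma potential_equicontinuous:
 assumes "\<eta> > 0" "M >= 0"
 shows "\<exists>\<delta>>0. ALL f. L2supp f --> (ALL x. \<bar>f x\<bar> <= M) --> (ALL x y. norm (x - y) < \<delta> --> \<bar>potential \<mu> f x - potential \<mu> f y\<bar> <= \<eta>)"
proof -
 define \<eta>' where "\<eta>' = \<eta> / (4 * (M + 1))"
 have \<eta>': "\<eta>' > 0" "M * \<eta>' <= \<eta> / 4" using assms by (auto simp: \<eta>'_def field_simps)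
 obtain \<kappa> :: "'a => real" and L where \<kappa>: "\<kappa> \<in> borel_measurable borel" "integrable lborel \<kappa>" "0 <= L"
   "!!x y. \<bar>\<kappa> x - \<kappa> y\<bar> <= L * norm (x - y)" "(LBINT x. \<bar>resolvent \<mu> x - \<kappa> x\<bar>) <= \<eta>'"
  using resolvent_lipschitz_approx[OF \<mu> \<eta>'(1), where 'a = 'a] by blast
 note [measurable] = \<kappa>(1)
 define \<delta> where "\<delta> = \<eta> / (2 * (L * M * vol + 1))"
 have LMv: "0 <= L * M * vol" using \<kappa>(3) assms(2) vol_nonneg by simp
 have \<delta>: "\<delta> > 0" "L * M * vol * \<delta> <= \<eta> / 2" using assms LMv by (auto simp: \<delta>_def field_simps)
 have "\<bar>potential \<mu> f x - potential \<mu> f y\<bar> <= \<eta>" if f: "L2supp f" "!!x. \<bar>f x\<bar> <= M" and xy: "norm (x - y) < \<delta>" for f x y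
 proof -
  note [measurable] = L2supp_measurable[OF f(1)]
  have i\<kappa>: "integrable lborel (%z. \<kappa> (x - z))" for x
   using lborel_integrable_affine[OF \<kappa>(2), of "-1" x] by simp
  have i\<kappa>f: "integrable lborel (%z. \<kappa> (x - z) * f z)" for x
  proof (rule b_integrable_bound[OF integrable_mult_left[OF i\<kappa>, of x M]])
   show "AE z in lborel. norm (\<kappa> (x - z) * f z) <= norm (\<kappa> (x - z) * M)"
    using f(2) assms(2) by (intro AE_I2) (auto simp: abs_mult intro!: mult_left_mono)
  qed measurable
  have a: "\<bar>potential \<mu> f x - (LBINT z. \<kappa> (x - z) * f z)\<bar> <= \<eta> / 4" for x
  proof -
   have id: "integrable lborel (%z. \<bar>resolvent \<mu> z - \<kappa> z\<bar>)" using resolvent_integrable[OF \<mu>] \<kappa>(2) by auto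
   have idx: "integrable lborel (%z. \<bar>resolvent \<mu> (x - z) - \<kappa> (x - z)\<bar>)"
    using lborel_integrable_affine[OF id, of "-1" x] by simp
   have "\<bar>potential \<mu> f x - (LBINT z. \<kappa> (x - z) * f z)\<bar> = \<bar>LBINT z. resolvent \<mu> (x - z) * f z - \<kappa> (x - z) * f z\<bar>"
    unfolding potential_def using potential_integrable[OF f(1)] i\<kappa>f by simp
   also have "\<dots> <= (LBINT z. \<bar>resolvent \<mu> (x - z) - \<kappa> (x - z)\<bar> * M)"
    by (rule order_trans[OF integral_abs_bound],
      rule integral_mono[OF integrable_abs[OF b_integrable_diff[OF potential_integrable[OF f(1)] i\<kappa>f]]])
     (use idx f(2) in \<open>auto simp: abs_mult intro!: mult_left_mono simp flip: left_diff_distrib\<close>)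
   also have "\<dots> = (LBINT z. \<bar>resolvent \<mu> z - \<kappa> z\<bar>) * M"
    using lborel_integral_reflect[of "%z. \<bar>resolvent \<mu> z - \<kappa> z\<bar>" x] by simp
   also have "\<dots> <= \<eta>' * M" using \<kappa>(5) assms(2) by (rule mult_right_mono)
   finally show ?thesis using \<eta>'(2) by (simp add: mult.commute)
  qed
  have "\<bar>(LBINT z. \<kappa> (x - z) * f z) - (LBINT z. \<kappa> (y - z) * f z)\<bar> = \<bar>LBINT z. \<kappa> (x - z) * f z - \<kappa> (y - z) * f z\<bar>"
   using i\<kappa>f by simp
  also have "\<dots> <= (LBINT z. (L * norm (x - y) * M) * indicator \<Omega> z)"
  proof (rule order_trans[OF integral_abs_bound], rule integral_mono)
   fix z
   show "\<bar>\<kappa> (x - z) * f z - \<kappa> (y - z) * f z\<bar> <= (L * norm (x - y) * M) * indicator \<Omega> z"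
   proof (cases "z \<in> \<Omega>")
    case True
    have "\<bar>\<kappa> (x - z) - \<kappa> (y - z)\<bar> * \<bar>f z\<bar> <= (L * norm (x - y)) * M"
     using \<kappa>(4)[of "x - z" "y - z"] f(2)[of z] \<kappa>(3) by (intro mult_mono) auto
    then show ?thesis using True by (simp add: abs_mult flip: left_diff_distrib)
   qed (simp add: L2supp_outside[OF f(1)])
  qed (use i\<kappa>f indicator_dom_integrable in auto)
  also have "\<dots> = L * M * vol * norm (x - y)" using open_dom by (simp add: vol_def)
  also have "\<dots> <= L * M * vol * \<delta>" using xy LMv by (intro mult_left_mono) auto
  also have "\<dots> <= \<eta> / 2" by (rule \<delta>)
  finally show ?thesis using a[of x] a[of y] by linarith
 qed
 then show ?thesis using \<delta>(1) by (intro exI[of _ \<delta>]) blast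
qed

lemma potential_continuous_bounded:
 assumes f: "L2supp f" "!!x. \<bar>f x\<bar> <= M" shows "cont (potential \<mu> f)"
 unfolding continuous_on_iff
proof (intro ballI allI impI)
 fix x :: 'a and e :: real assume "e > 0"
 then obtain \<delta> where d: "\<delta> > 0" "!!f. L2supp f ==> (ALL x. \<bar>f x\<bar> <= M) ==> (ALL x y. norm (x - y) < \<delta> --> \<bar>potential \<mu> f x - potential \<mu> f y\<bar> <= e / 2)"
  using potential_equicontinuous[of "e / 2" M] order_trans[OF abs_ge_zero f(2)] by auto
 then show "\<exists>d>0. \<forall>x'\<in>UNIV. dist x' x < d --> dist (potential \<mu> f x') (potential \<mu> f x) < e"
  using f \<open>e > 0\<close> by (intro exI[of _ \<delta>]) (force simp: dist_norm)
qed

end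

definition clip :: "nat => ('a => real) => 'a => real" where
 "clip n f x = max (- real n) (min (real n) (f x))"

lemma clip: "\<bar>clip n f x\<bar> <= real n" "\<bar>clip n f x\<bar> <= \<bar>f x\<bar>" "\<bar>f x - clip n f x\<bar> <= \<bar>f x\<bar>" "0 <= f x ==> 0 <= clip n f x"
 by (auto simp: clip_def)

lemma clip_L2supp: assumes "L2supp f" shows "L2supp (clip n f)"
proof (rule L2supp_bounded[where M = "real n"])
 note [measurable] = L2supp_measurable[OF assms(1)]
 show "clip n f \<in> borel_measurable borel" unfolding clip_def[abs_def] by measurable
qed (use clip L2supp_outside[OF assms] in \<open>auto simp: clip_def\<close>)

lemma clip_tendsto: assumes "L2supp f" shows "(%n. sqrt (LBINT x. (f x - clip n f x)\<^sup>2)) \<longlonglongrightarrow> 0"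
proof -
 note [measurable] = L2supp_measurable[OF assms(1)] L2supp_measurable[OF clip_L2supp[OF assms]]
 have "(%n. (LBINT x. (f x - clip n f x)\<^sup>2)) \<longlonglongrightarrow> (\<integral>x. 0 \<partial>(lborel::'a measure))"
 proof (rule integral_dominated_convergence[where w = "%x. (f x)\<^sup>2"])
  show "AE x in lborel. (%n. (f x - clip n f x)\<^sup>2) \<longlonglongrightarrow> 0"
  proof (rule AE_I2, rule tendsto_eventually)
   fix x
   obtain N where "\<bar>f x\<bar> <= real N" using real_arch_simple by blast
   then show "\<forall>\<^sub>F n in sequentially. (f x - clip n f x)\<^sup>2 = 0"
    by (intro eventually_sequentiallyI[of N]) (auto simp: clip_def max_def min_def abs_le_iff)
  qed
  show "AE x in lborel. norm ((f x - clip n f x)\<^sup>2) <= (f x)\<^sup>2" for n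
   using power_mono[OF clip(3) abs_ge_zero, of f _ n 2] by (intro AE_I2) simp
 qed (use L2supp_square[OF assms] in measurable)
 from tendsto_real_sqrt[OF this] show ?thesis by simp
qed

context
 fixes \<mu> :: real assumes \<mu>: "\<mu> > 0"
begin

lemma potential_continuous:
 assumes f: "L2supp f" shows "cont (potential \<mu> f)"
proof (rule uniform_limit_theorem[where F = sequentially and f = "%n. potential \<mu> (clip n f)"])
 show "\<forall>\<^sub>F n in sequentially. cont (potential \<mu> (clip n f))"
  by (intro always_eventually allI potential_continuous_bounded[OF \<mu> clip_L2supp[OF f] clip(1)])
 show "uniform_limit UNIV (%n. potential \<mu> (clip n f)) (potential \<mu> f) sequentially"
  unfolding uniform_limit_iff
 proof (intro allI impI)
  fix e :: real assume e: "e > 0"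
  have "(%n. Cres \<mu> * sqrt (LBINT x. (f x - clip n f x)\<^sup>2)) \<longlonglongrightarrow> 0"
   using tendsto_mult_left[OF clip_tendsto[OF f], of "Cres \<mu>"] by simp
  then have "\<forall>\<^sub>F n in sequentially. Cres \<mu> * sqrt (LBINT x. (f x - clip n f x)\<^sup>2) < e"
   by (rule order_tendstoD) (rule e)
  then show "\<forall>\<^sub>F n in sequentially. \<forall>x\<in>UNIV. dist (potential \<mu> (clip n f) x) (potential \<mu> f x) < e"
  proof eventually_elim
   case (elim n)
   show ?case
   proof
    fix x
    have "\<bar>potential \<mu> f x - potential \<mu> (clip n f) x\<bar> <= Cres \<mu> * sqrt (LBINT x. (f x - clip n f x)\<^sup>2)"
     using potential_L2_bound[OF \<mu> L2supp_diff[OF f clip_L2supp[OF f]], of n x] potential_diff[OF \<mu> f clip_L2supp[OF f]] by simp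
    then show "dist (potential \<mu> (clip n f) x) (potential \<mu> f x) < e" using elim by (simp add: dist_real_def abs_minus_commute)
   qed
  qed
 qed
qed simp

lemma potential_fubini:
 assumes f: "L2supp f" and [measurable]: "g \<in> borel_measurable borel"
  and g: "!!z. integrable lborel (%x. resolvent \<mu> (x - z) * g x)" "!!z. (LBINT x. \<bar>resolvent \<mu> (x - z) * g x\<bar>) <= C"
 shows "(LBINT x. potential \<mu> f x * g x) = (LBINT z. f z * (LBINT x. resolvent \<mu> (x - z) * g x))"
proof -
 note [measurable] = L2supp_measurable[OF f]
 have "integrable (lborel \<Otimes>\<^sub>M lborel) (%(z, x). f z * (resolvent \<mu> (x - z) * g x))"
 proof (rule lborel_pair.Fubini_integrable)
  show "AE z in lborel. integrable lborel (%x. case (z, x) of (z, x) => f z * (resolvent \<mu> (x - z) * g x))"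
   using g(1) by simp
  show "integrable lborel (%z. \<integral>x. norm (case (z, x) of (z, x) => f z * (resolvent \<mu> (x - z) * g x)) \<partial>lborel)"
  proof (rule b_integrable_bound[OF integrable_mult_left[OF L2supp_integrable[OF f], of C]])
   show "AE z in lborel. norm (LBINT x. norm (case (z, x) of (z, x) => f z * (resolvent \<mu> (x - z) * g x))) <= norm (f z * C)"
   proof (rule AE_I2)
    fix z
    have "(LBINT x. norm (f z * (resolvent \<mu> (x - z) * g x))) = \<bar>f z\<bar> * (LBINT x. \<bar>resolvent \<mu> (x - z) * g x\<bar>)"
     by (simp add: abs_mult)
    also have "\<dots> <= \<bar>f z\<bar> * \<bar>C\<bar>" using g(2)[of z] by (intro mult_left_mono) auto
    finally show "norm (LBINT x. norm (case (z, x) of (z, x) => f z * (resolvent \<mu> (x - z) * g x))) <= norm (f z * C)"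
     by (simp add: abs_mult integral_nonneg_AE)
   qed
  qed measurable
 qed measurable
 note P = this
 have 1: "(LBINT z. f z * (resolvent \<mu> (x - z) * g x)) = potential \<mu> f x * g x" for x
  unfolding potential_def
  by (subst Bochner_Integration.integral_mult_left_zero[symmetric]) (simp only: mult_ac)
 have 2: "(LBINT x. f z * (resolvent \<mu> (x - z) * g x)) = f z * (LBINT x. resolvent \<mu> (x - z) * g x)" for z by simp
 show ?thesis
  by (rule trans[OF lborel_pair.integral_snd[OF P, unfolded 1] lborel_pair.integral_fst[OF P, unfolded 2, symmetric]])
qed

lemma potential_weak:
 assumes f: "L2supp f" and \<phi>: "test_fun UNIV \<phi>"
 shows "(LBINT x. potential \<mu> f x * (\<mu> * \<phi> x - lap \<phi> x)) = (LBINT x. f x * \<phi> x)"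
proof -
 obtain K where K: "smooth \<phi>" "compact K" "!!x. x ~: K ==> \<phi> x = 0" "!!x. x ~: K ==> lap \<phi> x = 0"
  by (rule test_funE[OF \<phi>]) (rule that, assumption+)
 define \<psi> where "\<psi> x = \<mu> * \<phi> x - lap \<phi> x" for x
 have c: "cont \<psi>" unfolding \<psi>_def[abs_def] by (intro continuous_intros smooth_continuous smooth_lap K)
 have m\<psi>[measurable]: "\<psi> \<in> borel_measurable borel" by (rule borel_measurable_UNIV[OF c])
 have z: "\<psi> x = 0" if "x ~: K" for x using K that by (simp add: \<psi>_def)
 obtain C where C: "!!x. \<bar>\<psi> x\<bar> <= C" "0 <= C" using z that by (rule compact_support_bounded[OF c K(2)])
 have s: "resolvent \<mu> (x - z) = resolvent \<mu> (z - x)" for x z :: 'a using resolvent_minus[of \<mu> "z - x"] by simp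
 have i: "integrable lborel (%x. resolvent \<mu> (x - z) * \<psi> x)" for z
 proof (rule b_integrable_bound[OF integrable_mult_left[OF resolvent_shift_integrable(1)[OF \<mu>, of z], of C]])
  show "AE x in lborel. norm (resolvent \<mu> (x - z) * \<psi> x) <= norm (resolvent \<mu> (z - x) * C)"
   using C by (intro AE_I2) (auto simp: abs_mult s[of _ z] intro!: mult_left_mono)
 qed measurable
 have b: "(LBINT x. \<bar>resolvent \<mu> (x - z) * \<psi> x\<bar>) <= C / \<mu>" for z
 proof -
  have "(LBINT x. \<bar>resolvent \<mu> (x - z) * \<psi> x\<bar>) <= (LBINT x. resolvent \<mu> (z - x) * C)"
   by (rule integral_mono[OF integrable_abs[OF i]])
    (use resolvent_shift_integrable(1)[OF \<mu>, of z] C in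
     \<open>auto simp: abs_mult s[of _ z] abs_of_nonneg[OF resolvent_nonneg] intro!: mult_left_mono resolvent_nonneg\<close>)
  then show ?thesis by (simp add: resolvent_shift_integral[OF \<mu>])
 qed
 have inner: "(LBINT x. resolvent \<mu> (x - z) * \<psi> x) = \<phi> z" for z
 proof -
  define \<phi>' where "\<phi>' x = 1 * \<phi> (1 *\<^sub>R x + z)" for x
  have "test_fun UNIV \<phi>'"
  proof (rule test_funI[of _ "(%x. x - z) ` K"])
   show "smooth \<phi>'" unfolding \<phi>'_def[abs_def] by (rule smooth_affine[OF K(1)])
   show "compact ((%x. x - z) ` K)" by (intro compact_continuous_image continuous_intros K)
   show "\<phi>' x = 0" if "x ~: (%x. x - z) ` K" for x
   proof -
    have "x + z ~: K" using that by (metis add_diff_cancel_right' image_eqI)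
    then show ?thesis by (simp add: \<phi>'_def K)
   qed
  qed simp
  moreover have "lap \<phi>' x = lap \<phi> (x + z)" for x
   unfolding \<phi>'_def[abs_def] lap_affine[OF K(1)] by simp
  ultimately have "(LBINT x. resolvent \<mu> x * \<psi> (x + z)) = \<phi> z"
   using resolvent_fundamental[OF \<mu>, of \<phi>'] by (simp add: \<phi>'_def \<psi>_def)
  then show ?thesis using lborel_integral_shift[of "%x. resolvent \<mu> (x - z) * \<psi> x" z] by simp
 qed
 show ?thesis using potential_fubini[OF f m\<psi> i b] unfolding inner by (simp add: \<psi>_def)
qed

lemma potential_symmetric:
 assumes f: "L2supp f" and g: "L2supp g"
 shows "(LBINT x. potential \<mu> f x * g x) = (LBINT x. f x * potential \<mu> g x)"
proof -
 have s: "resolvent \<mu> (x - z) = resolvent \<mu> (z - x)" for x z :: 'a using resolvent_minus[of \<mu> "z - x"] by simp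
 have i: "integrable lborel (%x. resolvent \<mu> (x - z) * g x)" for z
  unfolding s[of _ z] by (rule potential_integrable[OF \<mu> g])
 have "(LBINT x. \<bar>resolvent \<mu> (x - z) * g x\<bar>) = potential \<mu> (%x. \<bar>g x\<bar>) z" for z
  unfolding potential_def s[of _ z] by (simp add: abs_mult abs_of_nonneg[OF resolvent_nonneg])
 then have b: "(LBINT x. \<bar>resolvent \<mu> (x - z) * g x\<bar>) <= Cres \<mu> * sqrt (LBINT x. (g x)\<^sup>2)" for z
  using potential_L2_bound[OF \<mu> L2supp_abs[OF g], of z] by simp
 show ?thesis
  unfolding potential_fubini[OF f L2supp_measurable[OF g] i b] by (simp add: potential_def[of _ g] s)
qed

end

end

text \<open>The distributional pairing of \<open>c q - \<Delta> q\<close> with a test function.\<close>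
definition wpair :: "real => ('a::euclidean_space => real) => ('a => real) => real" where
 "wpair c q \<phi> = (LBINT x. q x * (c * \<phi> x - lap \<phi> x))"

lemma integrable_times_test:
 fixes q :: "'a::euclidean_space => real"
 assumes q: "cont q" and \<phi>: "test_fun D \<phi>"
 shows "integrable lborel (%x. q x * \<phi> x)" "integrable lborel (%x. q x * lap \<phi> x)"
  "integrable lborel (%x. q x * (c * \<phi> x - lap \<phi> x))" "integrable lborel \<phi>"
proof -
 obtain K where K: "smooth \<phi>" "compact K" "!!x. x ~: K ==> \<phi> x = 0" "!!x. x ~: K ==> lap \<phi> x = 0"
  by (rule test_funE[OF \<phi>]) (rule that, assumption+)
 note c = smooth_continuous[OF K(1)] smooth_lap[OF K(1)]
 show "integrable lborel (%x. q x * \<phi> x)"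
  by (rule integrable_compact_support[OF _ K(2)]) (auto intro!: continuous_intros q c simp: K)
 show "integrable lborel (%x. q x * lap \<phi> x)"
  by (rule integrable_compact_support[OF _ K(2)]) (auto intro!: continuous_intros q c simp: K)
 show "integrable lborel (%x. q x * (c * \<phi> x - lap \<phi> x))"
  by (rule integrable_compact_support[OF _ K(2)]) (auto intro!: continuous_intros q c simp: K)
 show "integrable lborel \<phi>"
  by (rule integrable_compact_support[OF _ K(2)]) (auto intro!: c simp: K)
qed

lemma wpair_linear:
 assumes "cont q" "cont r" "test_fun D \<phi>"
 shows "wpair c (%x. a * q x + b * r x) \<phi> = a * wpair c q \<phi> + b * wpair c r \<phi>"
proof -
 have "wpair c (%x. a * q x + b * r x) \<phi> = (LBINT x. a * (q x * (c * \<phi> x - lap \<phi> x)) + b * (r x * (c * \<phi> x - lap \<phi> x)))"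
  unfolding wpair_def by (simp add: algebra_simps)
 then show ?thesis using integrable_times_test(3)[OF assms(1,3), of c] integrable_times_test(3)[OF assms(2,3), of c]
  by (simp add: wpair_def)
qed

lemma wpair_diff:
 "cont q ==> cont r ==> test_fun D \<phi> ==>
  wpair c (%x. q x - r x) \<phi> = wpair c q \<phi> - wpair c r \<phi>"
 using wpair_linear[of q r D \<phi> c 1 "-1"] by simp

lemma wpair_change:
 assumes "cont q" "test_fun D \<phi>"
 shows "wpair c q \<phi> = wpair c' q \<phi> + (c - c') * (LBINT x. q x * \<phi> x)"
proof -
 have "wpair c q \<phi> = (LBINT x. q x * (c' * \<phi> x - lap \<phi> x) + (c - c') * (q x * \<phi> x))"
  unfolding wpair_def by (simp add: algebra_simps)
 then show ?thesis using integrable_times_test[OF assms] by (simp add: wpair_def)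
qed

lemma wpair_smooth:
 assumes "smooth \<psi>" "test_fun D \<phi>"
 shows "wpair c \<psi> \<phi> = (LBINT x. (c * \<psi> x - lap \<psi> x) * \<phi> x)"
proof -
 note c = smooth_continuous[OF assms(1)] smooth_lap[OF assms(1)]
 have "wpair c \<psi> \<phi> = (LBINT x. c * (\<psi> x * \<phi> x) - \<psi> x * lap \<phi> x)"
  unfolding wpair_def by (simp add: algebra_simps)
 also have "\<dots> = c * (LBINT x. \<psi> x * \<phi> x) - (LBINT x. lap \<psi> x * \<phi> x)"
  using integrable_times_test[OF c(1) assms(2)] integral_lap_swap[OF assms] by simp
 also have "\<dots> = (LBINT x. c * (\<psi> x * \<phi> x) - lap \<psi> x * \<phi> x)"
  using integrable_times_test[OF c(1) assms(2)] integrable_times_test[OF c(2) assms(2)] by simp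
 finally show ?thesis by (simp add: algebra_simps)
qed

lemma comparison_principle:
 fixes q :: "'a::euclidean_space => real"
 assumes D: "open D" "bounded D" and q: "cont q" and \<mu>: "\<mu> >= 0"
  and bdry: "!!x. x \<in> frontier D ==> q x <= 0"
  and sub: "!!\<phi>. test_fun (D \<inter> {x. 0 < q x}) \<phi> ==> (!!x. 0 <= \<phi> x) ==> wpair \<mu> q \<phi> <= 0"
  and x: "x \<in> D"
 shows "q x <= 0"
 using D q bdry _ x
proof (rule maximum_principle)
 fix \<phi> assume \<phi>: "test_fun (D \<inter> {x. 0 < q x}) \<phi>" "!!x. 0 <= \<phi> x"
 have nn: "0 <= (LBINT x. q x * \<phi> x)"
 proof (rule integral_nonneg_AE, rule AE_I2)
  fix x
  show "0 <= q x * \<phi> x" using \<phi>(2)[of x] test_fun_outside[OF \<phi>(1), of x] by (cases "0 < q x") auto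
 qed
 have "wpair 0 q \<phi> <= 0" using sub[OF \<phi>] wpair_change[OF q \<phi>(1), of \<mu> 0] mult_nonneg_nonneg[OF \<mu> nn] by simp
 then show "0 <= (LBINT x. q x * lap \<phi> x)" by (simp add: wpair_def)
qed

lemma integral_test_nonpos:
 fixes \<phi> :: "'a::euclidean_space => real"
 assumes "test_fun D \<phi>" "!!x. 0 <= \<phi> x" "!!x. x \<in> D ==> g x <= 0"
 shows "(LBINT x. g x * \<phi> x) <= 0"
proof -
 have "0 <= (LBINT x. - (g x * \<phi> x))"
 proof (rule integral_nonneg_AE, rule AE_I2)
  fix x
  show "0 <= - (g x * \<phi> x)"
   using assms(2)[of x] assms(3)[of x] test_fun_outside[OF assms(1), of x]
   by (cases "x \<in> D") (auto simp: mult_nonpos_nonneg)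
 qed
 then show ?thesis by simp
qed

lemma sup_contraction_fixpoint:
 fixes T :: "('a::euclidean_space => real) => 'a => real"
 assumes T: "!!y. cont y ==> bounded (range y) ==> cont (T y) & bounded (range (T y))"
  and q: "0 <= q" "q < 1"
  and c: "!!y y' d x. cont y ==> bounded (range y) ==> cont y' ==> bounded (range y')
    ==> (!!x. \<bar>y x - y' x\<bar> <= d) ==> \<bar>T y x - T y' x\<bar> <= q * d"
 shows "EX y. cont y & bounded (range y) & T y = y"
proof -
 define S :: "('a \<Rightarrow>\<^sub>C real) => ('a \<Rightarrow>\<^sub>C real)" where "S y = Bcontfun (T (apply_bcontfun y))" for y
 have yb: "cont (apply_bcontfun y)" "bounded (range (apply_bcontfun y))" for y :: "'a \<Rightarrow>\<^sub>C real"
  using apply_bcontfun[of y] by (auto simp: bcontfun_def)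
 have S: "apply_bcontfun (S y) = T (apply_bcontfun y)" for y
  unfolding S_def by (rule Bcontfun_inverse) (use T[OF yb[of y]] in \<open>auto simp: bcontfun_def\<close>)
 have "\<exists>!y. S y = y"
 proof (rule banach_fix_type[OF q])
  show "ALL y y'. dist (S y) (S y') <= q * dist y y'"
  proof (intro allI dist_bound)
   fix y y' x
   show "dist (apply_bcontfun (S y) x) (apply_bcontfun (S y') x) <= q * dist y y'"
    unfolding S dist_real_def using dist_bounded[of y _ y'] by (intro c yb) (simp add: dist_real_def)
  qed
 qed
 then obtain y where "S y = y" by blast
 then show ?thesis using S[of y] yb[of y] by (intro exI[of _ "apply_bcontfun y"]) auto
qed

context corkscrew_domain begin

definition C0dom :: "('a => real) => bool" where
 "C0dom y \<longleftrightarrow> cont y & (ALL x. x ~: \<Omega> --> y x = 0)"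

definition penalised :: "real => real => real => ('a => real) => ('a => real) => bool" where
 "penalised \<mu> n F f y \<longleftrightarrow> L2supp f & (ALL x. 0 <= f x & f x <= F) & cont y \<and>
  (ALL x. 0 <= y x & y x <= F / \<mu>) & L2supp (%x. f x + n * (indicator \<Omega> x * y x)) \<and>
  y = potential (\<mu> + n) (%x. f x + n * (indicator \<Omega> x * y x))"

lemma L2supp_indicator_times:
 assumes "cont y" "bounded (range y)" shows "L2supp (%x. indicator \<Omega> x * y x)"
proof -
 obtain B where B: "!!x. \<bar>y x\<bar> <= B" using assms(2) by (auto simp: bounded_iff)
 have [measurable]: "y \<in> borel_measurable borel" "\<Omega> \<in> sets borel" using assms open_dom by (auto intro: borel_measurable_UNIV)
 show ?thesis
 proof (rule L2supp_bounded[where M = "\<bar>B\<bar>"])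
  show "\<bar>indicator \<Omega> x * y x\<bar> <= \<bar>B\<bar>" for x using B[of x] by (auto simp: indicator_def)
 qed auto
qed

lemma penalised_exists:
 assumes \<mu>: "\<mu> > 0" and n: "n >= 0" and f: "L2supp f" "!!x. 0 <= f x" "!!x. f x <= F"
 shows "EX y. penalised \<mu> n F f y"
proof -
 define N where "N = \<mu> + n"
 have N: "N > 0" using \<mu> n by (simp add: N_def)
 define g where "g y x = f x + n * (indicator \<Omega> x * y x)" for y :: "'a => real" and x
 have gL: "L2supp (g y)" if "cont y" "bounded (range y)" for y
  using L2supp_add[OF f(1) L2supp_indicator_times[OF that], of 1 n] by (simp add: g_def[abs_def])
 have absf: "\<bar>f x\<bar> <= F" for x using f(2,3)[of x] by simp
 have F0: "F >= 0" using order_trans[OF f(2,3)] by blast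
 have "EX y. cont y & bounded (range y) & potential N (g y) = y"
 proof (rule sup_contraction_fixpoint[where q = "n / N"])
  fix y :: "'a => real" assume y: "cont y" "bounded (range y)"
  have "\<bar>potential N (g y) x\<bar> <= Cres N * sqrt (LBINT x. (g y x)\<^sup>2)" for x
   by (rule potential_L2_bound[OF N gL[OF y]])
  then show "cont (potential N (g y)) & bounded (range (potential N (g y)))"
   using potential_continuous[OF N gL[OF y]] by (auto simp: bounded_iff)
 next
  fix y y' :: "'a => real" and d x assume y: "cont y" "bounded (range y)" "cont y'" "bounded (range y')"
   and d: "!!x. \<bar>y x - y' x\<bar> <= d"
  have d0: "0 <= d" by (rule order_trans[OF abs_ge_zero d])
  have "\<bar>potential N (%x. g y x - g y' x) x\<bar> <= (n * d) / N"
  proof (rule potential_bound[OF N L2supp_diff[OF gL[OF y(1,2)] gL[OF y(3,4)]]])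
   fix x
   have "g y x - g y' x = n * (indicator \<Omega> x * (y x - y' x))" by (simp add: g_def algebra_simps)
   then show "\<bar>g y x - g y' x\<bar> <= n * d" using d[of x] n d0 by (auto simp: indicator_def abs_mult intro: mult_left_mono)
  qed
  then show "\<bar>potential N (g y) x - potential N (g y') x\<bar> <= n / N * d"
   using potential_diff[OF N gL[OF y(1,2)] gL[OF y(3,4)]] by simp
 qed (use n N \<mu> in \<open>auto simp: N_def\<close>)
 then obtain y where y: "cont y" "bounded (range y)" "potential N (g y) = y" by blast
 note gy = gL[OF y(1,2)]
 have bdd: "bdd_above (range (%x. y x))" "bdd_above (range (%x. - y x))"
  using y(2) by (auto simp: bounded_iff bdd_above_def abs_le_iff)
 define S where "S = (SUP x. - y x)"
 have S: "- y x <= S" for x unfolding S_def by (rule cSUP_upper2[OF bdd(2)]) auto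
 have "- y x <= n * max 0 S / N" for x
 proof -
  have L: "L2supp (%x. - (n * max 0 S) * indicator \<Omega> x)"
   using L2supp_indicator_times[of "%_. - (n * max 0 S)"] by (simp add: mult.commute)
  have "potential N (%x. - (n * max 0 S) * indicator \<Omega> x) x <= potential N (g y) x"
  proof (rule potential_mono[OF N L gy])
   fix z
   have "- max 0 S <= y z" using S[of z] by linarith
   then have "n * (- max 0 S) <= n * y z" using n by (rule mult_left_mono)
   then show "- (n * max 0 S) * indicator \<Omega> z <= g y z"
    using f(2)[of z] by (auto simp: g_def indicator_def add_increasing)
  qed
  moreover have "\<bar>potential N (%x. - (n * max 0 S) * indicator \<Omega> x) x\<bar> <= (n * max 0 S) / N"
   by (rule potential_bound[OF N L]) (use n in \<open>auto simp: indicator_def abs_mult\<close>)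
  ultimately show ?thesis using y(3) by (simp add: abs_le_iff)
 qed
 then have "S <= n * max 0 S / N" unfolding S_def by (intro cSUP_least) auto
 then have "S <= 0"
 proof (rule contrapos_pp)
  assume "\<not> S <= 0"
  then have "n * S / N < S" using N \<mu> by (simp add: N_def field_simps)
  then show "\<not> S <= n * max 0 S / N" using \<open>\<not> S <= 0\<close> by simp
 qed
 then have nn: "0 <= y x" for x using S[of x] by linarith
 define U where "U = (SUP x. y x)"
 have U: "y x <= U" for x unfolding U_def by (rule cSUP_upper2[OF bdd(1)]) auto
 have U0: "U >= 0" using nn U order_trans by blast
 have "y x <= (F + n * U) / N" for x
 proof -
  have "\<bar>potential N (g y) x\<bar> <= (F + n * U) / N"
  proof (rule potential_bound[OF N gy])
   fix z
   have "n * y z <= n * U" using U n by (intro mult_left_mono)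
   then show "\<bar>g y z\<bar> <= F + n * U"
    using f(2,3)[of z] mult_nonneg_nonneg[OF n nn[of z]] mult_nonneg_nonneg[OF n U0]
    by (auto simp: g_def indicator_def)
  qed
  then show ?thesis using y(3) by (simp add: abs_le_iff)
 qed
 then have "U <= (F + n * U) / N" unfolding U_def[symmetric] by (subst U_def) (intro cSUP_least, auto)
 then have "U <= F / \<mu>" using N \<mu> by (simp add: N_def field_simps)
 then have "y x <= F / \<mu>" for x using U[of x] by linarith
 then have "penalised \<mu> n F f y"
  using f y nn gy unfolding penalised_def N_def g_def[abs_def] by auto
 then show ?thesis by blast
qed

lemma penalised_weak:
 assumes p: "penalised \<mu> n F f y" and \<mu>: "\<mu> > 0" and n: "n >= 0" and \<phi>: "test_fun D \<phi>"
 shows "wpair (\<mu> + n) y \<phi> = (LBINT x. (f x + n * (indicator \<Omega> x * y x)) * \<phi> x)"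
 using potential_weak[of "\<mu> + n" "%x. f x + n * (indicator \<Omega> x * y x)" \<phi>] test_fun_mono[OF \<phi>, of UNIV] p \<mu> n
 unfolding penalised_def wpair_def by force

lemma integrable_L2supp_test:
 assumes "L2supp f" "test_fun D \<phi>" shows "integrable lborel (%x. f x * \<phi> x)"
proof -
 obtain C where C: "!!x. \<bar>\<phi> x\<bar> <= C" "0 <= C" by (rule test_fun_bounded[OF assms(2)]) (rule that, assumption+)
 note [measurable] = L2supp_measurable[OF assms(1)] borel_measurable_UNIV[OF smooth_continuous[OF test_fun_smooth[OF assms(2)]]]
 show ?thesis
  by (rule b_integrable_bound[OF integrable_mult_left[OF L2supp_integrable[OF assms(1)], of C]])
   (use C in \<open>auto simp: abs_mult intro!: AE_I2 mult_left_mono\<close>)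
qed

lemma penalised_inside:
 assumes p: "penalised \<mu> n F f y" and \<mu>: "\<mu> > 0" and n: "n >= 0" and \<phi>: "test_fun \<Omega> \<phi>"
 shows "wpair \<mu> y \<phi> = (LBINT x. f x * \<phi> x)"
proof -
 have c: "cont y" and f: "L2supp f" using p by (auto simp: penalised_def)
 have "(f x + n * (indicator \<Omega> x * y x)) * \<phi> x = f x * \<phi> x + n * (y x * \<phi> x)" for x
  using test_fun_outside[OF \<phi>, of x] by (cases "x \<in> \<Omega>") (auto simp: algebra_simps)
 then show ?thesis
  using penalised_weak[OF p \<mu> n \<phi>] wpair_change[OF c \<phi>, of "\<mu> + n" \<mu>]
   integrable_L2supp_test[OF f \<phi>] integrable_times_test(1)[OF c \<phi>] by simp
qed

lemma penalised_subsolution: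
 assumes p: "penalised \<mu> n F f y" and \<mu>: "\<mu> > 0" and n: "n >= 0" and \<phi>: "test_fun D \<phi>" "!!x. 0 <= \<phi> x"
 shows "wpair 0 y \<phi> <= (LBINT x. F * \<phi> x)"
proof -
 have c: "cont y" and f: "L2supp f" "!!x. f x <= F" "!!x. 0 <= y x"
  and g: "L2supp (%x. f x + n * (indicator \<Omega> x * y x))" using p by (auto simp: penalised_def)
 have i: "integrable lborel (%x. y x * \<phi> x)" by (rule integrable_times_test(1)[OF c \<phi>(1)])
 have "wpair 0 y \<phi> = (LBINT x. (f x + n * (indicator \<Omega> x * y x)) * \<phi> x - (\<mu> + n) * (y x * \<phi> x))"
  using penalised_weak[OF p \<mu> n \<phi>(1)] wpair_change[OF c \<phi>(1), of 0 "\<mu> + n"] i integrable_L2supp_test[OF g \<phi>(1)]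
  by (simp add: distrib_right left_diff_distrib)
 also have "\<dots> <= (LBINT x. F * \<phi> x)"
 proof (rule integral_mono)
  fix x
  have "n * (indicator \<Omega> x * y x) <= (\<mu> + n) * y x"
   using n \<mu> f(3)[of x] by (auto simp: indicator_def algebra_simps)
  then have "(f x + n * (indicator \<Omega> x * y x) - (\<mu> + n) * y x) * \<phi> x <= F * \<phi> x"
   using f(2)[of x] \<phi>(2)[of x] by (intro mult_right_mono) auto
  then show "(f x + n * (indicator \<Omega> x * y x)) * \<phi> x - (\<mu> + n) * (y x * \<phi> x) <= F * \<phi> x" by (simp add: algebra_simps)
 qed (use i integrable_L2supp_test[OF g \<phi>(1)] integrable_times_test(4)[OF c \<phi>(1)] in auto)
 finally show ?thesis .
qed

lemma penalised_outside:
 assumes p: "penalised \<mu> n F f y" and \<mu>: "\<mu> > 0" and n: "n >= 0" and \<phi>: "test_fun D \<phi>" and D: "D \<inter> \<Omega> = {}"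
 shows "wpair (\<mu> + n) y \<phi> = 0"
proof -
 have f: "L2supp (%x. f x + n * (indicator \<Omega> x * y x))" using p by (simp add: penalised_def)
 have e: "(f x + n * (indicator \<Omega> x * y x)) * \<phi> x = 0" for x
  using test_fun_outside[OF \<phi>, of x] D L2supp_outside[OF f, of x] by (cases "x \<in> \<Omega>") auto
 show ?thesis using penalised_weak[OF p \<mu> n \<phi>] unfolding e by simp
qed

end

lemma lap_gaussian:
 "lap (%x::'a::euclidean_space. exp ((- a) * ((x - c) \<bullet> (x - c)))) x =
  (4 * a\<^sup>2 * ((x - c) \<bullet> (x - c)) - 2 * a * DIM('a)) * exp ((- a) * ((x - c) \<bullet> (x - c)))"
proof -
 let ?g = "%x::'a. exp ((- a) * ((x - c) \<bullet> (x - c)))"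
 have D1: "(?g has_derivative (%h. (- (2 * a)) * ((x - c) \<bullet> h) * ?g x)) (at x)" for x
  by (auto intro!: derivative_eq_intros simp: inner_commute algebra_simps)
 have 1: "pd ?g b = (%x. (- (2 * a)) * ((x - c) \<bullet> b) * ?g x)" for b using pd_eq[OF D1] by blast
 have D2: "((%x. (- (2 * a)) * ((x - c) \<bullet> b) * ?g x) has_derivative
   (%h. (- (2 * a)) * ((x - c) \<bullet> b) * ((- (2 * a)) * ((x - c) \<bullet> h) * ?g x) + ((- (2 * a)) * (h \<bullet> b)) * ?g x)) (at x)" for b x
  by (rule has_derivative_mult[OF _ D1]) (auto intro!: derivative_eq_intros)
 have 2: "pd (pd ?g b) b x = (4 * a\<^sup>2 * (((x - c) \<bullet> b) * ((x - c) \<bullet> b)) - 2 * a) * ?g x" if "b \<in> Basis" for b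
  unfolding 1 pd_eq[OF D2] using that by (simp add: power2_eq_square algebra_simps)
 have "lap ?g x = (\<Sum>b\<in>Basis. (4 * a\<^sup>2 * (((x - c) \<bullet> b) * ((x - c) \<bullet> b)) - 2 * a) * ?g x)"
  unfolding lap_def by (rule sum.cong[OF refl]) (rule 2)
 also have "\<dots> = (4 * a\<^sup>2 * (\<Sum>b\<in>Basis. ((x - c) \<bullet> b) * ((x - c) \<bullet> b)) - 2 * a * DIM('a)) * ?g x"
  by (simp only: sum_distrib_right[symmetric] sum_subtractf sum_distrib_left sum_constant) (simp add: algebra_simps)
 finally show ?thesis using euclidean_inner[of "x - c" "x - c"] by simp
qed

lemma smooth_const: "smooth (%x::'a::euclidean_space. k)"
 by (rule elementary_smooth[OF elementary.const])

lemma lap_const: "lap (%x::'a::euclidean_space. k) x = 0"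
proof -
 have "pd (%x::'a. k) b = (%x. 0)" for b :: 'a and k :: real by (rule ext, rule pd_eq) simp
 then show ?thesis by (simp add: lap_def)
qed

lemma smooth_sqdist: "smooth (%x::'a::euclidean_space. (x - a) \<bullet> (x - a))"
 by (rule elementary_smooth[OF elementary_sqdist])

lemma smooth_gaussian: "smooth (%x::'a::euclidean_space. exp ((- a) * ((x - c) \<bullet> (x - c))))"
 by (intro elementary_smooth elementary.exp elementary.mult elementary.const elementary_sqdist)

context corkscrew_domain begin

text \<open>Inside an exterior ball the penalty term dominates and halves the solution near the centre.\<close>
lemma penalised_centre:
 assumes p: "penalised \<mu> n F f y" and \<mu>: "\<mu> > 0" and n: "n >= 0" and s: "s > 0"
  and ball: "ball c s \<inter> \<Omega> = {}" and m: "m >= 0" "!!z. norm (z - c) = s ==> y z <= m"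
  and large: "8 * real DIM('a) <= n * s\<^sup>2" and z: "norm (z - c) <= s / 2"
 shows "y z <= m / 2"
proof -
 define N where "N = \<mu> + n"
 have N: "N > 0" using \<mu> n by (simp add: N_def)
 have Ns: "8 * real DIM('a) <= N * s\<^sup>2" using large \<mu> s by (simp add: N_def distrib_right add_increasing)
 have c: "cont y" using p by (simp add: penalised_def)
 define \<psi> where "\<psi> z = (m / s\<^sup>2) * ((z - c) \<bullet> (z - c)) + (2 * DIM('a) * m / (N * s\<^sup>2))" for z
 have s\<psi>: "smooth \<psi>" unfolding \<psi>_def[abs_def] by (intro smooth_add smooth_cmult smooth_sqdist smooth_const)
 have l\<psi>: "lap \<psi> z = (m / s\<^sup>2) * (2 * DIM('a))" for z
  unfolding \<psi>_def[abs_def] lap_add[OF smooth_cmult[OF smooth_sqdist] smooth_const] lap_cmult[OF smooth_sqdist] lap_sqdist lap_const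
  by simp
 have "y z - \<psi> z <= 0"
 proof (rule comparison_principle[where D = "ball c s" and \<mu> = N])
  show "cont (%x. y x - \<psi> x)" by (intro continuous_intros c smooth_continuous s\<psi>)
  show "y x - \<psi> x <= 0" if "x \<in> frontier (ball c s)" for x
  proof -
   have nx: "norm (x - c) = s" using that s by (simp add: dist_norm norm_minus_commute)
   have "\<psi> x = m + 2 * DIM('a) * m / (N * s\<^sup>2)" using nx s by (simp add: \<psi>_def dot_square_norm)
   moreover have "0 <= 2 * DIM('a) * m / (N * s\<^sup>2)" using m N by simp
   ultimately show ?thesis using m(2)[OF nx] by linarith
  qed
  show "z \<in> ball c s" using z s by (simp add: dist_norm norm_minus_commute)
  fix \<phi> assume \<phi>: "test_fun (ball c s \<inter> {x. 0 < y x - \<psi> x}) \<phi>" "!!x. 0 <= \<phi> x"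
  have "wpair N (%x. y x - \<psi> x) \<phi> = wpair N y \<phi> - wpair N \<psi> \<phi>"
   by (rule wpair_diff[OF c smooth_continuous[OF s\<psi>] \<phi>(1)])
  moreover have "wpair N y \<phi> = 0" unfolding N_def by (rule penalised_outside[OF p \<mu> n \<phi>(1)]) (use ball in auto)
  moreover have "0 <= wpair N \<psi> \<phi>" unfolding wpair_smooth[OF s\<psi> \<phi>(1)]
  proof (rule integral_nonneg_AE, rule AE_I2)
   fix x
   have "N * \<psi> x = N * ((m / s\<^sup>2) * ((x - c) \<bullet> (x - c))) + lap \<psi> x"
    unfolding l\<psi> \<psi>_def using N s by (simp add: distrib_left)
   moreover have "0 <= N * ((m / s\<^sup>2) * ((x - c) \<bullet> (x - c)))" using N m by simp
   ultimately have "0 <= N * \<psi> x - lap \<psi> x" by linarith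
   then show "0 <= (N * \<psi> x - lap \<psi> x) * \<phi> x" using \<phi>(2)[of x] by simp
  qed
  ultimately show "wpair N (%x. y x - \<psi> x) \<phi> <= 0" by simp
 qed (use N in auto)
 moreover have "\<psi> z <= m / 2"
 proof -
  have "(norm (z - c))\<^sup>2 <= (s / 2)\<^sup>2" using z by (intro power_mono) auto
  then have "(m / s\<^sup>2) * (norm (z - c))\<^sup>2 <= (m / s\<^sup>2) * (s / 2)\<^sup>2" using m by (intro mult_left_mono) auto
  also have "\<dots> = m / 4" using s by (simp add: power2_eq_square)
  finally have 1: "(m / s\<^sup>2) * (norm (z - c))\<^sup>2 <= m / 4" .
  have "2 * DIM('a) * m / (N * s\<^sup>2) <= m / 4"
   using mult_right_mono[OF Ns m(1)] N s by (simp add: divide_le_eq field_simps)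
  then show ?thesis using 1 unfolding \<psi>_def dot_square_norm by linarith
 qed
 ultimately show ?thesis by linarith
qed

text \<open>A Gaussian barrier in the annulus transports the gain at the centre to a neighbourhood of
 the boundary point.\<close>
lemma penalised_annulus:
 assumes p: "penalised \<mu> n F f y" and \<mu>: "\<mu> > 0" and n: "n >= 0" and s: "0 < s" "s <= \<tau>"
  and m: "m >= 0" "!!z. norm (z - c) = 3 * \<tau> ==> y z <= m" and inner: "!!z. norm (z - c) <= s / 2 ==> y z <= m / 2"
  and z: "norm (z - c) <= 3 * \<tau> / 2"
 defines "a \<equiv> 2 * DIM('a) / s\<^sup>2"
 shows "y z <= m * (1 - (exp (- a * (9 * \<tau>\<^sup>2 / 4)) - exp (- a * (9 * \<tau>\<^sup>2))) / 2) + F * (9 * \<tau>\<^sup>2) / (2 * DIM('a))"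
proof -
 have \<tau>: "\<tau> > 0" using s by simp
 have c: "cont y" and F: "F >= 0"
  using p order_trans unfolding penalised_def by blast+
 have a: "a > 0" using s by (simp add: a_def)
 have d0: "real DIM('a) > 0" by simp
 define E where "E = exp (- a * (9 * \<tau>\<^sup>2))"
 define \<psi> where "\<psi> z = (- m / 2) * exp ((- a) * ((z - c) \<bullet> (z - c))) +
  ((- F / (2 * DIM('a))) * ((z - c) \<bullet> (z - c)) + (m + m * E / 2 + F * (9 * \<tau>\<^sup>2) / (2 * DIM('a))))" for z
 have s\<psi>: "smooth \<psi>" unfolding \<psi>_def[abs_def] by (intro smooth_add smooth_cmult smooth_sqdist smooth_const smooth_gaussian)
 have l\<psi>: "lap \<psi> z = (- m / 2) * ((4 * a\<^sup>2 * ((z - c) \<bullet> (z - c)) - 2 * a * DIM('a)) * exp ((- a) * ((z - c) \<bullet> (z - c)))) - F" for z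
  unfolding \<psi>_def[abs_def]
   lap_add[OF smooth_cmult[OF smooth_gaussian] smooth_add[OF smooth_cmult[OF smooth_sqdist] smooth_const]]
   lap_add[OF smooth_cmult[OF smooth_sqdist] smooth_const] lap_cmult[OF smooth_sqdist] lap_cmult[OF smooth_gaussian]
   lap_sqdist lap_const lap_gaussian by simp
 have \<psi>_eq: "\<psi> z = m * (1 - (exp ((- a) * (norm (z - c))\<^sup>2) - E) / 2) + F * (9 * \<tau>\<^sup>2 - (norm (z - c))\<^sup>2) / (2 * DIM('a))" for z
  by (simp add: \<psi>_def dot_square_norm field_simps)
 define D where "D = ball c (3 * \<tau>) - cball c (s / 2)"
 have D: "open D" "bounded D" by (auto simp: D_def)
 have E01: "0 < E" by (simp add: E_def)
 have half: "1 / 2 <= 1 - (e - E) / 2" if "e <= 1" for e :: real using that E01 by (simp add: field_simps)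
 have cmp: "y x - \<psi> x <= 0" if x: "x \<in> D" for x
 proof (rule comparison_principle[where D = D and \<mu> = 0, OF D _ _ _ _ x])
  show "cont (%x. y x - \<psi> x)" by (intro continuous_intros c smooth_continuous s\<psi>)
  show "y x - \<psi> x <= 0" if "x \<in> frontier D" for x
  proof -
   have "x \<in> frontier (ball c (3 * \<tau>)) \<union> frontier (cball c (s / 2))"
    using that frontier_Int_subset[of "ball c (3 * \<tau>)" "- cball c (s / 2)"] unfolding D_def Diff_eq by auto
   then consider "norm (x - c) = 3 * \<tau>" | "norm (x - c) = s / 2" using s \<tau> by (auto simp: dist_norm norm_minus_commute)
   then show ?thesis
   proof cases
    case 1
    have "\<psi> x = m" unfolding \<psi>_eq 1 by (simp add: E_def power2_eq_square)
    then show ?thesis using m(2)[OF 1] by simp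
   next
    case 2
    have "exp ((- a) * (norm (x - c))\<^sup>2) <= 1" using a by simp
    from mult_left_mono[OF half[OF this] m(1)]
    have "m * (1 / 2) <= m * (1 - (exp ((- a) * (norm (x - c))\<^sup>2) - E) / 2)" .
    moreover have "0 <= F * (9 * \<tau>\<^sup>2 - (norm (x - c))\<^sup>2) / (2 * DIM('a))"
    proof -
     have "(norm (x - c))\<^sup>2 <= \<tau>\<^sup>2" unfolding 2 using s by (intro power_mono) auto
     then have "0 <= 9 * \<tau>\<^sup>2 - (norm (x - c))\<^sup>2" using zero_le_power2[of \<tau>] by linarith
     then show ?thesis using F by simp
    qed
    ultimately have "m / 2 <= \<psi> x" unfolding \<psi>_eq by linarith
    then show ?thesis using inner[of x] 2 by simp
   qed
  qed
  fix \<phi> assume \<phi>: "test_fun (D \<inter> {x. 0 < y x - \<psi> x}) \<phi>" "!!x. 0 <= \<phi> x"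
  have i: "integrable lborel \<phi>" "integrable lborel (%x. lap \<psi> x * \<phi> x)"
   by (rule integrable_times_test[OF c \<phi>(1)], rule integrable_times_test[OF smooth_lap[OF s\<psi>] \<phi>(1)])
  have "wpair 0 (%x. y x - \<psi> x) \<phi> = wpair 0 y \<phi> - wpair 0 \<psi> \<phi>"
   by (rule wpair_diff[OF c smooth_continuous[OF s\<psi>] \<phi>(1)])
  also have "\<dots> <= (LBINT x. F * \<phi> x) + (LBINT x. lap \<psi> x * \<phi> x)"
   using penalised_subsolution[OF p \<mu> n \<phi>] wpair_smooth[OF s\<psi> \<phi>(1), of 0] by simp
  also have "\<dots> = (LBINT x. (F + lap \<psi> x) * \<phi> x)" using i by (simp add: distrib_right)
  also have "\<dots> <= 0"
  proof (rule integral_test_nonpos[OF \<phi>])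
   fix x assume "x \<in> D \<inter> {x. 0 < y x - \<psi> x}"
   then have "s / 2 <= norm (x - c)" by (simp add: D_def dist_norm norm_minus_commute)
   then have "(s / 2)\<^sup>2 <= (x - c) \<bullet> (x - c)" unfolding dot_square_norm using s by (intro power_mono) auto
   then have "2 * a * (s / 2)\<^sup>2 <= 2 * a * ((x - c) \<bullet> (x - c))" using a by (intro mult_left_mono) auto
   moreover have "2 * a * (s / 2)\<^sup>2 = DIM('a)" using s by (simp add: a_def power2_eq_square)
   ultimately have "2 * a * real DIM('a) <= 2 * a * (2 * a * ((x - c) \<bullet> (x - c)))" using a by (intro mult_left_mono) auto
   then have "0 <= 4 * a\<^sup>2 * ((x - c) \<bullet> (x - c)) - 2 * a * DIM('a)" by (simp add: power2_eq_square mult_ac)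
   then have "0 <= (m / 2) * ((4 * a\<^sup>2 * ((x - c) \<bullet> (x - c)) - 2 * a * DIM('a)) * exp ((- a) * ((x - c) \<bullet> (x - c))))"
    using m by (intro mult_nonneg_nonneg) auto
   then show "F + lap \<psi> x <= 0" unfolding l\<psi> by simp
  qed
  finally show "wpair 0 (%x. y x - \<psi> x) \<phi> <= 0" .
 qed auto
 have Ele: "E <= exp (- a * (9 * \<tau>\<^sup>2 / 4))" unfolding E_def using a by simp
 show ?thesis
 proof (cases "norm (z - c) <= s / 2")
  case True
  have "exp (- a * (9 * \<tau>\<^sup>2 / 4)) <= 1" using a by simp
  from mult_left_mono[OF half[OF this] m(1)]
  have "m * (1 / 2) <= m * (1 - (exp (- a * (9 * \<tau>\<^sup>2 / 4)) - E) / 2)" .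
  moreover have "0 <= F * (9 * \<tau>\<^sup>2) / (2 * DIM('a))" using F by simp
  ultimately show ?thesis using inner[OF True] unfolding E_def by linarith
 next
  case False
  then have "z \<in> D" using z \<tau> by (simp add: D_def dist_norm norm_minus_commute)
  then have "y z <= \<psi> z" using cmp by simp
  also have "\<dots> <= m * (1 - (exp (- a * (9 * \<tau>\<^sup>2 / 4)) - E) / 2) + F * (9 * \<tau>\<^sup>2) / (2 * DIM('a))"
  proof -
   have "(norm (z - c))\<^sup>2 <= (3 * \<tau> / 2)\<^sup>2" using z by (intro power_mono) auto
   then have "a * (norm (z - c))\<^sup>2 <= a * (9 * \<tau>\<^sup>2 / 4)" using a by (intro mult_left_mono) (auto simp: power2_eq_square)
   then have "exp (- a * (9 * \<tau>\<^sup>2 / 4)) <= exp ((- a) * (norm (z - c))\<^sup>2)" by simp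
   then have "m * (1 - (exp ((- a) * (norm (z - c))\<^sup>2) - E) / 2) <= m * (1 - (exp (- a * (9 * \<tau>\<^sup>2 / 4)) - E) / 2)"
    using m by (intro mult_left_mono) auto
   moreover have "F * (9 * \<tau>\<^sup>2 - (norm (z - c))\<^sup>2) / (2 * DIM('a)) <= F * (9 * \<tau>\<^sup>2) / (2 * DIM('a))"
    using F by (intro divide_right_mono mult_left_mono) auto
   ultimately show ?thesis unfolding \<psi>_eq by linarith
  qed
  finally show ?thesis unfolding E_def .
 qed
qed

lemma penalised_small_near_boundary:
 assumes \<mu>: "\<mu> > 0" and F: "F >= 0" and \<epsilon>: "\<epsilon> > 0"
 shows "\<exists>n0\<ge>0. \<forall>n\<ge>n0. ALL f y. penalised \<mu> n F f y --> (ALL x. x ~: \<Omega> --> y x <= \<epsilon>)"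
proof -
 define P where "P m \<longleftrightarrow> (\<exists>\<rho>>0. \<exists>n0\<ge>0. \<forall>n\<ge>n0. ALL f y. penalised \<mu> n F f y -->
   (ALL x z. x ~: \<Omega> --> norm (z - x) <= \<rho> --> y z <= m))" for m
 obtain \<sigma> \<tau>0 where \<sigma>: "\<sigma> > 0" "\<sigma> <= 1" "\<tau>0 > 0" "!!x \<tau>. x ~: \<Omega> ==> 0 < \<tau> ==> \<tau> <= \<tau>0 ==>
   (EX c. norm (c - x) = \<tau> & ball c (\<sigma> * \<tau>) \<inter> \<Omega> = {})"
  using corkscrew by auto
 define \<delta> where "\<delta> = exp (- (9 * DIM('a) / (2 * \<sigma>\<^sup>2))) - exp (- (18 * DIM('a) / \<sigma>\<^sup>2))"
 have \<delta>: "0 < \<delta>" "\<delta> < 1"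
 proof -
  have "- (18 * DIM('a) / \<sigma>\<^sup>2) < - (9 * DIM('a) / (2 * \<sigma>\<^sup>2))" using \<sigma> by (simp add: field_simps)
  then show "0 < \<delta>" by (simp add: \<delta>_def)
  have "exp (- (9 * DIM('a) / (2 * \<sigma>\<^sup>2))) <= 1" using \<sigma> by simp
  then show "\<delta> < 1" unfolding \<delta>_def using exp_gt_zero[of "- (18 * DIM('a) / \<sigma>\<^sup>2)"] by linarith
 qed
 define \<theta> where "\<theta> = 1 - \<delta> / 4"
 have \<theta>: "0 < \<theta>" "\<theta> < 1" using \<delta> by (auto simp: \<theta>_def)
 have step: "P (\<theta> * m)" if Pm: "P m" and m: "m > 0" for m
 proof -
  obtain \<rho> n0 where \<rho>: "\<rho> > 0" "n0 >= 0" "!!n f y x z. n >= n0 ==> penalised \<mu> n F f y ==> x ~: \<Omega> ==> norm (z - x) <= \<rho> ==> y z <= m"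
   using Pm unfolding P_def by blast
  define \<tau> where "\<tau> = min (min \<tau>0 (\<rho> / 4)) (sqrt (m * \<delta> * DIM('a) / (18 * (F + 1))))"
  have pos: "0 < m * \<delta> * DIM('a) / (18 * (F + 1))" using m \<delta> F by simp
  have \<tau>: "\<tau> > 0" "\<tau> <= \<tau>0" "4 * \<tau> <= \<rho>" "\<tau> <= sqrt (m * \<delta> * DIM('a) / (18 * (F + 1)))"
   using \<sigma> \<rho> pos by (auto simp: \<tau>_def)
  have \<tau>2: "F * (9 * \<tau>\<^sup>2) / (2 * DIM('a)) <= m * \<delta> / 4"
  proof -
   have "\<tau>\<^sup>2 <= (sqrt (m * \<delta> * DIM('a) / (18 * (F + 1))))\<^sup>2" using \<tau> by (intro power_mono) auto
   also have "\<dots> = m * \<delta> * DIM('a) / (18 * (F + 1))" using pos by (intro real_sqrt_pow2) simp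
   finally have "\<tau>\<^sup>2 * (18 * (F + 1)) <= m * \<delta> * DIM('a)" using F by (subst (asm) pos_le_divide_eq) auto
   moreover have "\<tau>\<^sup>2 * (18 * F) <= \<tau>\<^sup>2 * (18 * (F + 1))" by (intro mult_left_mono) auto
   ultimately have "\<tau>\<^sup>2 * (18 * F) <= m * \<delta> * DIM('a)" by linarith
   then show ?thesis by (simp add: divide_le_eq field_simps)
  qed
  define s where "s = \<sigma> * \<tau>"
  have s: "0 < s" "s <= \<tau>" using \<sigma> \<tau> by (auto simp: s_def mult_left_le_one_le)
  define n1 where "n1 = max n0 (8 * DIM('a) / s\<^sup>2)"
  have "y z <= \<theta> * m" if n: "n >= n1" and p: "penalised \<mu> n F f y" and x: "x ~: \<Omega>" and z: "norm (z - x) <= \<tau> / 2" for n f y x z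
  proof -
   have n': "n >= n0" "n >= 0" "8 * real DIM('a) <= n * s\<^sup>2" using n \<rho> s by (auto simp: n1_def pos_divide_le_eq)
   obtain c where c: "norm (c - x) = \<tau>" "ball c s \<inter> \<Omega> = {}" using \<sigma>(4)[OF x \<tau>(1,2)] by (auto simp: s_def)
   have near: "y z' <= m" if "norm (z' - c) <= 3 * \<tau>" for z'
   proof (rule \<rho>(3)[OF n'(1) p x])
    show "norm (z' - x) <= \<rho>" using norm_triangle_ineq[of "z' - c" "c - x"] that c \<tau> by simp
   qed
   have inner: "y z' <= m / 2" if "norm (z' - c) <= s / 2" for z'
    by (rule penalised_centre[OF p \<mu> n'(2) s(1) c(2) _ _ n'(3) that]) (use m near s \<tau> in auto)
   have "norm (z - c) <= 3 * \<tau> / 2" using norm_triangle_ineq[of "z - x" "x - c"] z c by (simp add: norm_minus_commute)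
   then have "y z <= m * (1 - (exp (- (2 * DIM('a) / s\<^sup>2) * (9 * \<tau>\<^sup>2 / 4)) - exp (- (2 * DIM('a) / s\<^sup>2) * (9 * \<tau>\<^sup>2))) / 2)
     + F * (9 * \<tau>\<^sup>2) / (2 * DIM('a))"
    by (intro penalised_annulus[OF p \<mu> n'(2) s, of m c z]) (use m near inner in auto)
   moreover have "exp (- (2 * DIM('a) / s\<^sup>2) * (9 * \<tau>\<^sup>2 / 4)) - exp (- (2 * DIM('a) / s\<^sup>2) * (9 * \<tau>\<^sup>2)) = \<delta>"
   proof -
    have "(2 * DIM('a) / s\<^sup>2) * (9 * \<tau>\<^sup>2 / 4) = 9 * DIM('a) / (2 * \<sigma>\<^sup>2)" "(2 * DIM('a) / s\<^sup>2) * (9 * \<tau>\<^sup>2) = 18 * DIM('a) / \<sigma>\<^sup>2"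
     using \<tau>(1) \<sigma>(1) by (simp_all add: s_def power_mult_distrib field_simps)
    then show ?thesis unfolding \<delta>_def by (simp only: mult_minus_left)
   qed
   ultimately have "y z <= m * (1 - \<delta> / 2) + m * \<delta> / 4" using \<tau>2 by simp
   then show ?thesis by (simp add: \<theta>_def algebra_simps)
  qed
  moreover have "n1 >= 0" using \<rho> by (simp add: n1_def)
  ultimately show ?thesis unfolding P_def using \<tau>(1) by (intro exI[of _ "\<tau> / 2"] conjI exI[of _ n1]) auto
 qed
 define M where "M = F / \<mu> + 1"
 have M: "M > 0" using F \<mu> by (simp add: M_def add_nonneg_pos)
 have iter: "P (\<theta> ^ k * M)" for k
 proof (induction k)
  case 0
  have "y z <= M" if "penalised \<mu> n F f y" for n f y z
  proof -
   have "y z <= F / \<mu>" using that by (simp add: penalised_def)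
   then show ?thesis by (simp add: M_def)
  qed
  then show ?case unfolding P_def by (intro exI[of _ 1] conjI exI[of _ 0]) auto
 next
  case (Suc k)
  then show ?case using step[OF Suc] \<theta> M by (simp add: mult.assoc)
 qed
 have "(%k. \<theta> ^ k * M) \<longlonglongrightarrow> 0 * M" using \<theta> by (intro tendsto_intros LIMSEQ_realpow_zero) auto
 then have "\<forall>\<^sub>F k in sequentially. \<theta> ^ k * M < \<epsilon>" using \<epsilon> by (auto intro: order_tendstoD)
 then obtain k where k: "\<theta> ^ k * M < \<epsilon>" by (auto simp: eventually_sequentially)
 obtain \<rho> n0 where \<rho>: "\<rho> > 0" "n0 >= 0" "!!n f y x z. n >= n0 ==> penalised \<mu> n F f y ==> x ~: \<Omega> ==> norm (z - x) <= \<rho> ==> y z <= \<theta> ^ k * M"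
  using iter[of k] unfolding P_def by blast
 have "y x <= \<epsilon>" if "n >= n0" "penalised \<mu> n F f y" "x ~: \<Omega>" for n f y x
  using \<rho>(3)[OF that, of x] k \<rho>(1) by simp
 then show ?thesis using \<rho>(2) by blast
qed

end

context corkscrew_domain begin

definition linsol :: "real => ('a => real) => ('a => real) => bool" where
 "linsol \<mu> f y \<longleftrightarrow> C0dom y & (ALL \<phi>. test_fun \<Omega> \<phi> --> wpair \<mu> y \<phi> = (LBINT x. f x * \<phi> x))"

lemma linsol_cont: "linsol \<mu> f y ==> cont y" by (simp add: linsol_def C0dom_def)
lemma linsol_outside: "linsol \<mu> f y ==> x ~: \<Omega> ==> y x = 0" by (simp add: linsol_def C0dom_def)
lemma linsol_weak: "linsol \<mu> f y ==> test_fun \<Omega> \<phi> ==> wpair \<mu> y \<phi> = (LBINT x. f x * \<phi> x)" by (simp add: linsol_def)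

lemma frontier_outside: "x \<in> frontier \<Omega> ==> x ~: \<Omega>"
 using open_dom by (simp add: frontier_def interior_open)

lemma C0dom_bounded: assumes "C0dom y" shows "bounded (range y)"
proof -
 have "compact (closure \<Omega>)" using bounded_dom by (simp add: compact_closure)
 moreover have "y x = 0" if "x ~: closure \<Omega>" for x
  using assms that closure_subset[of \<Omega>] by (auto simp: C0dom_def)
 ultimately obtain C where "!!x. \<bar>y x\<bar> <= C"
  using compact_support_bounded[of y "closure \<Omega>"] assms unfolding C0dom_def by blast
 then show ?thesis by (auto simp: bounded_iff)
qed

lemma C0dom_L2supp: assumes "C0dom y" shows "L2supp y"
proof -
 have "(%x. indicator \<Omega> x * y x) = y" using assms by (auto simp: C0dom_def indicator_def fun_eq_iff)
 then show ?thesis using L2supp_indicator_times[of y] C0dom_bounded[OF assms] assms by (simp add: C0dom_def)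
qed

lemma linsol_L2supp: "linsol \<mu> f y ==> L2supp y" by (simp add: linsol_def C0dom_L2supp)

lemma linsol_change:
 assumes "linsol \<mu> f y" "L2supp f" shows "linsol \<mu>' (%x. f x + (\<mu>' - \<mu>) * y x) y"
proof -
 have "wpair \<mu>' y \<phi> = (LBINT x. (f x + (\<mu>' - \<mu>) * y x) * \<phi> x)" if \<phi>: "test_fun \<Omega> \<phi>" for \<phi>
  using wpair_change[OF linsol_cont[OF assms(1)] \<phi>, of \<mu>' \<mu>] linsol_weak[OF assms(1) \<phi>]
   integrable_L2supp_test[OF assms(2) \<phi>] integrable_times_test(1)[OF linsol_cont[OF assms(1)] \<phi>]
  by (simp add: distrib_right mult.assoc)
 then show ?thesis using assms by (simp add: linsol_def)
qed

lemma linsol_linear: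
 assumes "linsol \<mu> f y" "linsol \<mu> g z" "L2supp f" "L2supp g"
 shows "linsol \<mu> (%x. a * f x + b * g x) (%x. a * y x + b * z x)"
proof -
 note c = linsol_cont[OF assms(1)] linsol_cont[OF assms(2)]
 have "wpair \<mu> (%x. a * y x + b * z x) \<phi> = (LBINT x. (a * f x + b * g x) * \<phi> x)" if \<phi>: "test_fun \<Omega> \<phi>" for \<phi>
  using wpair_linear[OF c \<phi>] linsol_weak[OF assms(1) \<phi>] linsol_weak[OF assms(2) \<phi>]
   integrable_L2supp_test[OF assms(3) \<phi>] integrable_L2supp_test[OF assms(4) \<phi>]
  by (simp add: distrib_right mult.assoc)
 then show ?thesis
  using assms by (auto simp: linsol_def C0dom_def intro!: continuous_intros)
qed

lemma linsol_diff:
 "linsol \<mu> f y ==> linsol \<mu> g z ==> L2supp f ==> L2supp g ==> linsol \<mu> (%x. f x - g x) (%x. y x - z x)"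
 using linsol_linear[of \<mu> f y g z 1 "-1"] by simp

lemma linsol_le_potential:
 assumes \<mu>: "\<mu> > 0" and y: "linsol \<mu> f y" and f: "L2supp f" "L2supp g" "!!x. f x <= g x" "!!x. 0 <= g x"
 shows "y x <= potential \<mu> g x"
proof (cases "x \<in> \<Omega>")
 case True
 have cp: "cont (potential \<mu> g)" by (rule potential_continuous[OF \<mu> f(2)])
 have "y x - potential \<mu> g x <= 0"
 proof (rule comparison_principle[OF open_dom bounded_dom _ less_imp_le[OF \<mu>] _ _ True])
  show "cont (%x. y x - potential \<mu> g x)" by (intro continuous_intros linsol_cont[OF y] cp)
  show "y x - potential \<mu> g x <= 0" if "x \<in> frontier \<Omega>" for x
   using linsol_outside[OF y frontier_outside[OF that]] potential_nonneg[OF \<mu>, of g x] f(4) by simp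
  fix \<phi> assume \<phi>: "test_fun (\<Omega> \<inter> {x. 0 < y x - potential \<mu> g x}) \<phi>" "!!x. 0 <= \<phi> x"
  have t: "test_fun \<Omega> \<phi>" "test_fun UNIV \<phi>" using \<phi>(1) by (auto intro: test_fun_mono)
  have "wpair \<mu> (%x. y x - potential \<mu> g x) \<phi> = wpair \<mu> y \<phi> - wpair \<mu> (potential \<mu> g) \<phi>"
   by (rule wpair_diff[OF linsol_cont[OF y] cp \<phi>(1)])
  also have "\<dots> = (LBINT x. f x * \<phi> x) - (LBINT x. g x * \<phi> x)"
   using linsol_weak[OF y t(1)] potential_weak[OF \<mu> f(2) t(2)] by (simp add: wpair_def)
  also have "\<dots> <= 0"
   using integral_mono[OF integrable_L2supp_test[OF f(1) t(1)] integrable_L2supp_test[OF f(2) t(1)]] \<phi>(2) f(3)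
   by (simp add: mult_right_mono)
  finally show "wpair \<mu> (%x. y x - potential \<mu> g x) \<phi> <= 0" .
 qed
 then show ?thesis by simp
next
 case False
 then show ?thesis using linsol_outside[OF y] potential_nonneg[OF \<mu>, of g x] f(4) by simp
qed

lemma linsol_abs_le_potential:
 assumes \<mu>: "\<mu> > 0" and y: "linsol \<mu> f y" and f: "L2supp f"
 shows "\<bar>y x\<bar> <= potential \<mu> (%x. \<bar>f x\<bar>) x"
proof -
 have "y x <= potential \<mu> (%x. \<bar>f x\<bar>) x"
  by (rule linsol_le_potential[OF \<mu> y f L2supp_abs[OF f]]) auto
 moreover have "linsol \<mu> (%x. - f x) (%x. - y x)" using linsol_linear[OF y y f f, of "-1" 0] by simp
 then have "- y x <= potential \<mu> (%x. \<bar>f x\<bar>) x"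
  by (rule linsol_le_potential[OF \<mu> _ _ L2supp_abs[OF f]]) (use L2supp_add[OF f f, of "-1" 0] in auto)
 ultimately show ?thesis by (simp add: abs_le_iff)
qed

lemma linsol_L2_bound:
 assumes \<mu>: "\<mu> > 0" and y: "linsol \<mu> f y" and f: "L2supp f"
 shows "\<bar>y x\<bar> <= Cres \<mu> * sqrt (LBINT x. (f x)\<^sup>2)"
 using order_trans[OF linsol_abs_le_potential[OF assms, of x] order_trans[OF abs_ge_self potential_L2_bound[OF \<mu> L2supp_abs[OF f], of x]]] by simp

lemma linsol_unique:
 assumes \<mu>: "\<mu> > 0" and "linsol \<mu> f y" "linsol \<mu> f z" "L2supp f" shows "y = z"
proof
 fix x
 have "linsol \<mu> (%x. 0) (%x. y x - z x)" using linsol_diff[OF assms(2,3,4,4)] by simp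
 then have "\<bar>y x - z x\<bar> <= 0"
  using linsol_L2_bound[OF \<mu>, of "%x. 0" "%x. y x - z x" x] by (simp add: L2supp_def)
 then show "y x = z x" by simp
qed

lemma integrable_test_pairing: "test_fun D \<phi> ==> integrable lborel (%x::'a. c * \<phi> x - lap \<phi> x)"
 using integrable_times_test(3)[of "%_. 1" D \<phi> c] by simp

lemma wpair_uniform_limit:
 fixes Y :: "nat => 'a => real"
 assumes c: "!!k. cont (Y k)" "cont y" and \<phi>: "test_fun D \<phi>"
  and u: "!!e. e > 0 ==> \<forall>\<^sub>F k in sequentially. ALL x. \<bar>Y k x - y x\<bar> <= (e::real)"
 shows "(%k. wpair \<mu> (Y k) \<phi>) \<longlonglongrightarrow> wpair \<mu> y \<phi>"
proof (rule tendstoI)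
 fix e :: real assume e: "e > 0"
 define I where "I = (LBINT x. \<bar>\<mu> * \<phi> x - lap \<phi> x\<bar>)"
 have I0: "0 <= I" by (simp add: I_def)
 have "\<forall>\<^sub>F k in sequentially. ALL x. \<bar>Y k x - y x\<bar> <= e / (2 * (I + 1))" using e I0 by (intro u) simp
 then show "\<forall>\<^sub>F k in sequentially. dist (wpair \<mu> (Y k) \<phi>) (wpair \<mu> y \<phi>) < e"
 proof eventually_elim
  case (elim k)
  have "\<bar>wpair \<mu> (Y k) \<phi> - wpair \<mu> y \<phi>\<bar> = \<bar>LBINT x. (Y k x - y x) * (\<mu> * \<phi> x - lap \<phi> x)\<bar>"
   using wpair_diff[OF c(1) c(2) \<phi>, of \<mu> k] by (simp add: wpair_def)
  also have "\<dots> <= (LBINT x. e / (2 * (I + 1)) * \<bar>\<mu> * \<phi> x - lap \<phi> x\<bar>)"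
  proof (rule order_trans[OF integral_abs_bound], rule integral_mono)
   show "integrable lborel (%x. \<bar>(Y k x - y x) * (\<mu> * \<phi> x - lap \<phi> x)\<bar>)"
    by (intro integrable_abs integrable_times_test(3)[OF _ \<phi>] continuous_intros c)
   show "\<bar>(Y k x - y x) * (\<mu> * \<phi> x - lap \<phi> x)\<bar> <= e / (2 * (I + 1)) * \<bar>\<mu> * \<phi> x - lap \<phi> x\<bar>" for x
    using elim unfolding abs_mult by (intro mult_right_mono) auto
  qed (intro integrable_mult_right integrable_abs integrable_test_pairing[OF \<phi>])
  also have "\<dots> = e / (2 * (I + 1)) * I" by (simp add: I_def)
  also have "\<dots> = e * (I / (2 * (I + 1)))" by simp
  also have "\<dots> < e * 1" using e I0 by (intro mult_strict_left_mono) (simp_all add: divide_less_eq)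
  finally have "\<bar>wpair \<mu> (Y k) \<phi> - wpair \<mu> y \<phi>\<bar> < e" by simp
  then show ?case by (simp add: dist_real_def)
 qed
qed

lemma uniformly_Cauchy_limit:
 fixes Y :: "nat => 'a => real"
 assumes c: "!!k. cont (Y k)"
  and u: "!!e. e > 0 ==> EX N. \<forall>j\<ge>N. \<forall>k\<ge>N. ALL x. \<bar>Y j x - Y k x\<bar> <= e"
 obtains y where "cont y" "!!e. e > 0 ==> \<forall>\<^sub>F k in sequentially. ALL x. \<bar>Y k x - y x\<bar> <= e"
  "!!x. (%k. Y k x) \<longlonglongrightarrow> y x"
proof -
 have "uniformly_Cauchy_on UNIV Y"
  unfolding uniformly_Cauchy_on_def
 proof (intro allI impI)
  fix e :: real assume e: "e > 0"
  obtain N where N: "\<forall>j\<ge>N. \<forall>k\<ge>N. ALL x. \<bar>Y j x - Y k x\<bar> <= e / 2" using u[of "e / 2"] e by auto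
  show "EX M. \<forall>x\<in>UNIV. \<forall>m\<ge>M. \<forall>n\<ge>M. dist (Y m x) (Y n x) < e"
  proof (intro exI[of _ N] ballI allI impI)
   fix x m n assume "N <= m" "N <= n"
   then have "\<bar>Y m x - Y n x\<bar> <= e / 2" using N by blast
   then show "dist (Y m x) (Y n x) < e" using e by (simp add: dist_real_def)
  qed
 qed
 then obtain y where y: "uniform_limit UNIV Y y sequentially"
  using Cauchy_uniformly_convergent uniformly_convergent_on_def by blast
 show ?thesis
 proof
  show "cont y"
   by (rule uniform_limit_theorem[OF _ y]) (use c in auto)
  show "\<forall>\<^sub>F k in sequentially. ALL x. \<bar>Y k x - y x\<bar> <= e" if "e > 0" for e
   using y that unfolding uniform_limit_iff dist_real_def by (auto elim!: allE[of _ e] eventually_mono intro: less_imp_le)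
  show "(%k. Y k x) \<longlonglongrightarrow> y x" for x by (rule tendsto_uniform_limitI[OF y]) simp
 qed
qed

lemma linsol_exists_nonneg:
 assumes \<mu>: "\<mu> > 0" and f: "L2supp f" "!!x. 0 <= f x" "!!x. f x <= F"
 shows "EX y. linsol \<mu> f y"
proof -
 have F: "F >= 0" using order_trans[OF f(2,3)] by blast
 have "EX Y. ALL k. penalised \<mu> (real k) F f (Y k)" using penalised_exists[OF \<mu> _ f] by (intro choice allI) simp
 then obtain Y where Y: "!!k. penalised \<mu> (real k) F f (Y k)" by blast
 have c: "cont (Y k)" and nn: "0 <= Y k x" for k x using Y[of k] by (auto simp: penalised_def)
 have far: "EX N. \<forall>k\<ge>N. ALL x. x ~: \<Omega> --> Y k x <= e" if e: "e > 0" for e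
 proof -
  obtain n0 where n0: "n0 >= 0" "!!n f y x. n >= n0 ==> penalised \<mu> n F f y ==> x ~: \<Omega> ==> y x <= e"
   using penalised_small_near_boundary[OF \<mu> F e] by blast
  obtain N where "n0 <= real N" using real_arch_simple by blast
  then have "Y k x <= e" if "k >= N" "x ~: \<Omega>" for k x using that by (intro n0(2)[OF _ Y]) auto
  then show ?thesis by blast
 qed
 have cmp: "Y j x - Y k x <= e" if e: "e > 0" and far: "!!x. x ~: \<Omega> ==> Y j x <= e" for e j k x
 proof (cases "x \<in> \<Omega>")
  case True
  have "(Y j x - Y k x) - e <= 0"
  proof (rule comparison_principle[OF open_dom bounded_dom _ less_imp_le[OF \<mu>] _ _ True])
   show "cont (%x. (Y j x - Y k x) - e)" by (intro continuous_intros c)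
   show "(Y j x - Y k x) - e <= 0" if "x \<in> frontier \<Omega>" for x
    using far[OF frontier_outside[OF that]] nn[of k x] by simp
   fix \<phi> assume \<phi>: "test_fun (\<Omega> \<inter> {x. 0 < (Y j x - Y k x) - e}) \<phi>" "!!x. 0 <= \<phi> x"
   have t: "test_fun \<Omega> \<phi>" using \<phi>(1) by (rule test_fun_mono) auto
   have "wpair \<mu> (%x. (Y j x - Y k x) - e) \<phi> = wpair \<mu> (%x. Y j x - Y k x) \<phi> - wpair \<mu> (%x. e) \<phi>"
    by (rule wpair_diff[OF _ _ t]) (intro continuous_intros c)+
   also have "wpair \<mu> (%x. Y j x - Y k x) \<phi> = wpair \<mu> (Y j) \<phi> - wpair \<mu> (Y k) \<phi>"
    by (rule wpair_diff[OF c c t])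
   also have "wpair \<mu> (Y j) \<phi> - wpair \<mu> (Y k) \<phi> - wpair \<mu> (%x. e) \<phi> = - (LBINT x. \<mu> * e * \<phi> x)"
    using penalised_inside[OF Y \<mu> _ t] wpair_smooth[OF smooth_const t, of \<mu> e] by (simp add: lap_const)
   also have "\<dots> <= 0" using \<phi>(2) \<mu> e by (simp add: integral_nonneg_AE)
   finally show "wpair \<mu> (%x. (Y j x - Y k x) - e) \<phi> <= 0" .
  qed
  then show ?thesis by simp
 next
  case False
  then show ?thesis using far[of x] nn[of k x] by simp
 qed
 have "EX N. \<forall>j\<ge>N. \<forall>k\<ge>N. ALL x. \<bar>Y j x - Y k x\<bar> <= e" if e: "e > 0" for e
 proof -
  obtain N where "!!k x. k >= N ==> x ~: \<Omega> ==> Y k x <= e" using far[OF e] by blast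
  then have "\<bar>Y j x - Y k x\<bar> <= e" if "j >= N" "k >= N" for j k x
   using cmp[OF e, of j x k] cmp[OF e, of k x j] that by (simp add: abs_le_iff)
  then show ?thesis by blast
 qed
 then obtain y where y: "cont y" "!!e. e > 0 ==> \<forall>\<^sub>F k in sequentially. ALL x. \<bar>Y k x - y x\<bar> <= e" "!!x. (%k. Y k x) \<longlonglongrightarrow> y x"
  using uniformly_Cauchy_limit[of Y] c by blast
 have "y x = 0" if x: "x ~: \<Omega>" for x
 proof (rule LIMSEQ_unique[OF y(3)])
  show "(%k. Y k x) \<longlonglongrightarrow> 0"
  proof (rule LIMSEQ_I)
   fix r :: real assume r: "r > 0"
   obtain N where "!!k x. k >= N ==> x ~: \<Omega> ==> Y k x <= r / 2" using far[of "r / 2"] r by auto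
   then show "EX no. \<forall>n\<ge>no. norm (Y n x - 0) < r" using x r nn by (intro exI[of _ N]) (force simp: abs_of_nonneg)
  qed
 qed
 moreover have "wpair \<mu> y \<phi> = (LBINT x. f x * \<phi> x)" if \<phi>: "test_fun \<Omega> \<phi>" for \<phi>
 proof (rule LIMSEQ_unique)
  show "(%k. wpair \<mu> (Y k) \<phi>) \<longlonglongrightarrow> wpair \<mu> y \<phi>" by (rule wpair_uniform_limit[OF c y(1) \<phi> y(2)])
  show "(%k. wpair \<mu> (Y k) \<phi>) \<longlonglongrightarrow> (LBINT x. f x * \<phi> x)" using penalised_inside[OF Y \<mu> _ \<phi>] by simp
 qed
 ultimately show ?thesis using y(1) by (intro exI[of _ y]) (simp add: linsol_def C0dom_def)
qed

lemma linsol_exists_bounded: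
 assumes \<mu>: "\<mu> > 0" and f: "L2supp f" "!!x. \<bar>f x\<bar> <= F"
 shows "EX y. linsol \<mu> f y"
proof -
 note [measurable] = L2supp_measurable[OF f(1)]
 have p: "L2supp (%x. max 0 (f x))" "L2supp (%x. max 0 (- f x))"
  by (rule L2supp_bounded[where M = F]; use f L2supp_outside[OF f(1)] order_trans[OF abs_ge_zero f(2)] in \<open>auto simp: abs_le_iff max_def\<close>)+
 obtain y where y: "linsol \<mu> (%x. max 0 (f x)) y"
  using linsol_exists_nonneg[OF \<mu> p(1), of F] f(2) order_trans[OF abs_ge_zero f(2)] by (auto simp: abs_le_iff)
 obtain z where z: "linsol \<mu> (%x. max 0 (- f x)) z"
  using linsol_exists_nonneg[OF \<mu> p(2), of F] f(2) order_trans[OF abs_ge_zero f(2)] by (auto simp: abs_le_iff)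
 have "linsol \<mu> (%x. max 0 (f x) - max 0 (- f x)) (%x. y x - z x)" by (rule linsol_diff[OF y z p])
 moreover have "max 0 (f x) - max 0 (- f x) = f x" for x by (simp add: max_def)
 ultimately show ?thesis by auto
qed

lemma linsol_exists:
 assumes \<mu>: "\<mu> > 0" and f: "L2supp f"
 shows "EX y. linsol \<mu> f y"
proof -
 have "EX Y. ALL k. linsol \<mu> (clip k f) (Y k)"
  using linsol_exists_bounded[OF \<mu> clip_L2supp[OF f] clip(1)] by (intro choice allI) blast
 then obtain Y where Y: "!!k. linsol \<mu> (clip k f) (Y k)" by blast
 note c = linsol_cont[OF Y]
 define a where "a k = sqrt (LBINT x. (f x - clip k f x)\<^sup>2)" for k
 have a0: "0 <= a k" for k by (simp add: a_def)
 have a: "a \<longlonglongrightarrow> 0" unfolding a_def[abs_def] by (rule clip_tendsto[OF f])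
 have dif: "\<bar>Y j x - Y k x\<bar> <= Cres \<mu> * (2 * (a j + a k))" for j k x
 proof -
  let ?u = "%x. f x - clip j f x" and ?v = "%x. f x - clip k f x"
  have L: "L2supp ?u" "L2supp ?v" by (intro L2supp_diff f clip_L2supp)+
  have ip: "\<integral>x. (clip j f x - clip k f x)\<^sup>2 \<partial>lborel <= (2 * (a j + a k))\<^sup>2"
  proof -
   have "(LBINT x. (clip j f x - clip k f x)\<^sup>2) <= (LBINT x. 2 * (?u x)\<^sup>2 + 2 * (?v x)\<^sup>2)"
   proof (rule integral_mono)
    show "integrable lborel (%x. (clip j f x - clip k f x)\<^sup>2)"
     by (rule L2supp_square[OF L2supp_diff[OF clip_L2supp[OF f] clip_L2supp[OF f]]])
    show "(clip j f x - clip k f x)\<^sup>2 <= 2 * (?u x)\<^sup>2 + 2 * (?v x)\<^sup>2" for x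
    proof -
     have "0 <= (?u x + ?v x)\<^sup>2" by simp
     then show ?thesis by (simp add: power2_eq_square algebra_simps)
    qed
   qed (use L2supp_square[OF L(1)] L2supp_square[OF L(2)] in auto)
   also have "\<dots> = 2 * (a j)\<^sup>2 + 2 * (a k)\<^sup>2"
    using L2supp_square[OF L(1)] L2supp_square[OF L(2)] by (simp add: a_def)
   also have "\<dots> <= (2 * (a j + a k))\<^sup>2"
    using mult_nonneg_nonneg[OF a0[of j] a0[of k]] zero_le_square[of "a j"] zero_le_square[of "a k"]
    by (simp add: power2_eq_square algebra_simps)
   finally show ?thesis .
  qed
  have "\<bar>Y j x - Y k x\<bar> <= Cres \<mu> * sqrt (LBINT x. (clip j f x - clip k f x)\<^sup>2)"
   by (rule linsol_L2_bound[OF \<mu> linsol_diff[OF Y Y] ]) (intro L2supp_diff clip_L2supp f)+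
  also have "\<dots> <= Cres \<mu> * (2 * (a j + a k))"
   using ip by (intro mult_left_mono Cres_nonneg real_le_lsqrt) (auto simp: a_def)
  finally show ?thesis .
 qed
 have "EX N. \<forall>j\<ge>N. \<forall>k\<ge>N. ALL x. \<bar>Y j x - Y k x\<bar> <= e" if e: "e > 0" for e
 proof -
  have "(%k. Cres \<mu> * (4 * a k)) \<longlonglongrightarrow> Cres \<mu> * (4 * 0)" by (intro tendsto_intros a)
  then have "\<forall>\<^sub>F k in sequentially. Cres \<mu> * (4 * a k) < e" using e by (auto intro: order_tendstoD)
  then obtain N where N: "!!k. k >= N ==> Cres \<mu> * (4 * a k) < e" by (auto simp: eventually_sequentially)
  have "\<bar>Y j x - Y k x\<bar> <= e" if "j >= N" "k >= N" for j k x
   using dif[of j x k] N[OF that(1)] N[OF that(2)] by (simp add: algebra_simps)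
  then show ?thesis by blast
 qed
 then obtain y where y: "cont y" "!!e. e > 0 ==> \<forall>\<^sub>F k in sequentially. ALL x. \<bar>Y k x - y x\<bar> <= e" "!!x. (%k. Y k x) \<longlonglongrightarrow> y x"
  using uniformly_Cauchy_limit[of Y] c by blast
 have "y x = 0" if x: "x ~: \<Omega>" for x
  using LIMSEQ_unique[OF y(3)[of x], of 0] linsol_outside[OF Y x] by simp
 moreover have "wpair \<mu> y \<phi> = (LBINT x. f x * \<phi> x)" if \<phi>: "test_fun \<Omega> \<phi>" for \<phi>
 proof (rule LIMSEQ_unique)
  show "(%k. wpair \<mu> (Y k) \<phi>) \<longlonglongrightarrow> wpair \<mu> y \<phi>" by (rule wpair_uniform_limit[OF c y(1) \<phi> y(2)])
  obtain C where C: "!!x. \<bar>\<phi> x\<bar> <= C" "0 <= C" by (rule test_fun_bounded[OF \<phi>]) (rule that, assumption+)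
  note [measurable] = L2supp_measurable[OF f] L2supp_measurable[OF clip_L2supp[OF f]] borel_measurable_UNIV[OF smooth_continuous[OF test_fun_smooth[OF \<phi>]]]
  have "(%k. \<integral>x. clip k f x * \<phi> x \<partial>lborel) \<longlonglongrightarrow> (LBINT x. f x * \<phi> x)"
  proof (rule integral_dominated_convergence[where w = "%x. \<bar>f x\<bar> * C"])
   show "AE x in lborel. (%k. clip k f x * \<phi> x) \<longlonglongrightarrow> f x * \<phi> x"
   proof (rule AE_I2, rule tendsto_eventually)
    fix x
    obtain N where "\<bar>f x\<bar> <= real N" using real_arch_simple by blast
    then show "\<forall>\<^sub>F k in sequentially. clip k f x * \<phi> x = f x * \<phi> x"
     by (intro eventually_sequentiallyI[of N]) (auto simp: clip_def max_def min_def abs_le_iff)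
   qed
   show "AE x in lborel. norm (clip k f x * \<phi> x) <= \<bar>f x\<bar> * C" for k
    using C clip(2)[of k f] by (auto simp: abs_mult intro!: AE_I2 mult_mono)
  qed (use L2supp_integrable[OF f] in auto)
  then show "(%k. wpair \<mu> (Y k) \<phi>) \<longlonglongrightarrow> (LBINT x. f x * \<phi> x)" using linsol_weak[OF Y \<phi>] by simp
 qed
 ultimately show ?thesis using y(1) by (intro exI[of _ y]) (simp add: linsol_def C0dom_def)
qed

end

lemma smooth_exp_coord: "smooth (%x::'a::euclidean_space. exp (k * (x \<bullet> b)))"
 by (intro elementary_smooth elementary.exp elementary.mult elementary.const elementary.coord)

lemma lap_exp_coord:
 assumes b: "b \<in> Basis"
 shows "lap (%x::'a::euclidean_space. exp (k * (x \<bullet> b))) x = k\<^sup>2 * exp (k * (x \<bullet> b))"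
proof -
 let ?g = "%x::'a. exp (k * (x \<bullet> b))"
 have D1: "(?g has_derivative (%h. (k * (h \<bullet> b)) * ?g x)) (at x)" for x
  by (auto intro!: derivative_eq_intros)
 have 1: "pd ?g b' = (%x. (k * (b' \<bullet> b)) * ?g x)" for b' using pd_eq[OF D1] by blast
 have D2: "((%x. (k * (b' \<bullet> b)) * ?g x) has_derivative (%h. (k * (b' \<bullet> b)) * ((k * (h \<bullet> b)) * ?g x))) (at x)" for b' x
  by (rule has_derivative_mult_right[OF D1])
 have "pd (pd ?g b') b' x = (if b' = b then k\<^sup>2 * ?g x else 0)" if "b' \<in> Basis" for b'
  unfolding 1 pd_eq[OF D2] using that b by (simp add: inner_Basis power2_eq_square)
 then have "lap ?g x = (\<Sum>b'\<in>Basis. if b' = b then k\<^sup>2 * ?g x else 0)"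
  unfolding lap_def by (intro sum.cong) auto
 then show ?thesis using b by simp
qed

context corkscrew_domain begin

lemma linsol_penalised_close:
 assumes \<mu>: "\<mu> > 0" and F: "F >= 0" and \<epsilon>: "\<epsilon> > 0"
 shows "\<exists>n\<ge>0. ALL f y Y. penalised \<mu> n F f Y --> linsol \<mu> f y --> (ALL x. \<bar>Y x - y x\<bar> <= \<epsilon>)"
proof -
 obtain n where n: "n >= 0" "!!f y x. penalised \<mu> n F f y ==> x ~: \<Omega> ==> y x <= \<epsilon>"
  using penalised_small_near_boundary[OF \<mu> F \<epsilon>] by blast
 have cmp: "u x - v x <= \<epsilon>" if c: "cont u" "cont v"
  and eq: "!!\<phi>. test_fun \<Omega> \<phi> ==> wpair \<mu> u \<phi> = wpair \<mu> v \<phi>" and far: "!!x. x ~: \<Omega> ==> u x - v x <= \<epsilon>" for u v x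
 proof (cases "x \<in> \<Omega>")
  case True
  have "(u x - v x) - \<epsilon> <= 0"
  proof (rule comparison_principle[OF open_dom bounded_dom _ less_imp_le[OF \<mu>] _ _ True])
   show "cont (%x. (u x - v x) - \<epsilon>)" by (intro continuous_intros c)
   show "(u x - v x) - \<epsilon> <= 0" if "x \<in> frontier \<Omega>" for x
    using far[OF frontier_outside[OF that]] by simp
   fix \<phi> assume \<phi>: "test_fun (\<Omega> \<inter> {x. 0 < (u x - v x) - \<epsilon>}) \<phi>" "!!x. 0 <= \<phi> x"
   have t: "test_fun \<Omega> \<phi>" using \<phi>(1) by (rule test_fun_mono) auto
   have "wpair \<mu> (%x. (u x - v x) - \<epsilon>) \<phi> = wpair \<mu> (%x. u x - v x) \<phi> - wpair \<mu> (%x. \<epsilon>) \<phi>"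
    by (rule wpair_diff[OF _ _ t]) (intro continuous_intros c)+
   also have "wpair \<mu> (%x. u x - v x) \<phi> = 0" using wpair_diff[OF c t] eq[OF t] by simp
   also have "0 - wpair \<mu> (%x. \<epsilon>) \<phi> = - (LBINT x. \<mu> * \<epsilon> * \<phi> x)"
    using wpair_smooth[OF smooth_const t, of \<mu> \<epsilon>] by (simp add: lap_const)
   also have "\<dots> <= 0" using \<phi>(2) \<mu> \<epsilon> by (simp add: integral_nonneg_AE)
   finally show "wpair \<mu> (%x. (u x - v x) - \<epsilon>) \<phi> <= 0" .
  qed
  then show ?thesis by simp
 qed (rule far)
 have "\<bar>Y x - y x\<bar> <= \<epsilon>" if p: "penalised \<mu> n F f Y" and l: "linsol \<mu> f y" for f y Y x
 proof -
  have cY: "cont Y" "!!x. 0 <= Y x" using p by (auto simp: penalised_def)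
  have eq: "wpair \<mu> Y \<phi> = wpair \<mu> y \<phi>" if "test_fun \<Omega> \<phi>" for \<phi>
   using penalised_inside[OF p \<mu> n(1) that] linsol_weak[OF l that] by simp
  have "Y x - y x <= \<epsilon>" by (rule cmp[OF cY(1) linsol_cont[OF l] eq]) (use n(2)[OF p] linsol_outside[OF l] in auto)
  moreover have "y x - Y x <= \<epsilon>"
  proof (rule cmp[OF linsol_cont[OF l] cY(1) eq[symmetric]])
   show "y x - Y x <= \<epsilon>" if "x ~: \<Omega>" for x using linsol_outside[OF l that] cY(2)[of x] \<epsilon> by simp
  qed
  ultimately show ?thesis by (simp add: abs_le_iff)
 qed
 then show ?thesis using n(1) by blast
qed

lemma integral_abs_le_sup:
 assumes f: "L2supp f" "!!x. \<bar>f x\<bar> <= F" and u: "cont u" "!!x. \<bar>u x\<bar> <= e"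
 shows "\<bar>LBINT x. f x * u x\<bar> <= F * e * vol" and "integrable lborel (%x. f x * u x)"
proof -
 note [measurable] = L2supp_measurable[OF f(1)] borel_measurable_UNIV[OF u(1)]
 have F0: "0 <= F" "0 <= e" using order_trans[OF abs_ge_zero f(2)] order_trans[OF abs_ge_zero u(2)] by auto
 have b: "\<bar>f x * u x\<bar> <= (F * e) * indicator \<Omega> x" for x
 proof (cases "x \<in> \<Omega>")
  case True
  then show ?thesis using mult_mono[OF f(2)[of x] u(2)[of x]] F0 by (simp add: abs_mult)
 qed (simp add: L2supp_outside[OF f(1)])
 show i: "integrable lborel (%x. f x * u x)"
  by (rule b_integrable_bound[OF integrable_mult_right[OF indicator_dom_integrable, of "F * e"]])
   (use b F0 in \<open>auto intro!: AE_I2 simp: abs_of_nonneg\<close>)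
 have "\<bar>LBINT x. f x * u x\<bar> <= (LBINT x. (F * e) * indicator \<Omega> x)"
  by (rule order_trans[OF integral_abs_bound], rule integral_mono[OF integrable_abs[OF i]])
   (use b indicator_dom_integrable in auto)
 then show "\<bar>LBINT x. f x * u x\<bar> <= F * e * vol" using open_dom by (simp add: vol_def)
qed

lemma linsol_symmetric_nonneg:
 assumes \<mu>: "\<mu> > 0" and f: "L2supp f" "!!x. 0 <= f x" "!!x. f x <= F" and g: "L2supp g" "!!x. 0 <= g x" "!!x. g x <= F"
  and y: "linsol \<mu> f y" and z: "linsol \<mu> g z"
 shows "(LBINT x. f x * z x) = (LBINT x. g x * y x)"
proof -
 have F: "F >= 0" using order_trans[OF f(2,3)] by blast
 have af: "\<bar>f x\<bar> <= F" "\<bar>g x\<bar> <= F" for x using f(2,3)[of x] g(2,3)[of x] by auto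
 have "\<bar>(LBINT x. f x * z x) - (LBINT x. g x * y x)\<bar> <= 0 + e" if e: "e > 0" for e
 proof -
  define \<epsilon> where "\<epsilon> = e / (2 * (F * vol + 1))"
  have Fv: "0 <= F * vol" using F vol_nonneg by simp
  have \<epsilon>: "\<epsilon> > 0" using e Fv by (simp add: \<epsilon>_def)
  have F\<epsilon>: "F * \<epsilon> * vol <= e / 2"
  proof -
   have "F * \<epsilon> * vol = (F * vol) * e / (2 * (F * vol + 1))" by (simp add: \<epsilon>_def)
   also have "\<dots> <= e / 2" using e Fv by (simp add: field_simps)
   finally show ?thesis .
  qed
  obtain n where n: "n >= 0" "!!f y Y x. penalised \<mu> n F f Y ==> linsol \<mu> f y ==> \<bar>Y x - y x\<bar> <= \<epsilon>"
   using linsol_penalised_close[OF \<mu> F \<epsilon>] by blast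
  obtain Y where Y: "penalised \<mu> n F f Y" using penalised_exists[OF \<mu> n(1) f] by blast
  obtain Z where Z: "penalised \<mu> n F g Z" using penalised_exists[OF \<mu> n(1) g] by blast
  define A where "A x = f x + n * (indicator \<Omega> x * Y x)" for x
  define B where "B x = g x + n * (indicator \<Omega> x * Z x)" for x
  have AB: "L2supp A" "L2supp B" "Y = potential (\<mu> + n) A" "Z = potential (\<mu> + n) B"
   "cont Y" "cont Z" "!!x. \<bar>Y x\<bar> <= F / \<mu>" "!!x. \<bar>Z x\<bar> <= F / \<mu>"
   using Y Z by (auto simp: penalised_def A_def[abs_def] B_def[abs_def] abs_of_nonneg)
  have sym: "(LBINT x. Y x * B x) = (LBINT x. A x * Z x)"
   using potential_symmetric[OF _ AB(1,2), of "\<mu> + n"] \<mu> n(1) AB(3,4) by simp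
  have i: "integrable lborel (%x. f x * Z x)" "integrable lborel (%x. g x * Y x)"
   "integrable lborel (%x. f x * z x)" "integrable lborel (%x. g x * y x)"
   using integral_abs_le_sup(2)[OF f(1) af(1) AB(6,8)] integral_abs_le_sup(2)[OF g(1) af(2) AB(5,7)]
    Cauchy_Schwarz_integral(1)[OF _ _ L2supp_square[OF f(1)] L2supp_square[OF linsol_L2supp[OF z]]]
    Cauchy_Schwarz_integral(1)[OF _ _ L2supp_square[OF g(1)] L2supp_square[OF linsol_L2supp[OF y]]]
    L2supp_measurable[OF f(1)] L2supp_measurable[OF g(1)] L2supp_measurable[OF linsol_L2supp[OF z]] L2supp_measurable[OF linsol_L2supp[OF y]]
   by simp_all
  have iYZ: "integrable lborel (%x. indicator \<Omega> x * Y x * Z x)"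
  proof (rule integral_abs_le_sup(2)[OF _ _ AB(6,8)])
   show "L2supp (%x. indicator \<Omega> x * Y x)" by (rule L2supp_indicator_times[OF AB(5)]) (use AB(7) in \<open>auto simp: bounded_iff\<close>)
   show "\<bar>indicator \<Omega> x * Y x\<bar> <= F / \<mu>" for x using AB(7)[of x] order_trans[OF abs_ge_zero AB(7)] by (auto simp: indicator_def)
  qed
  have "(LBINT x. Y x * B x) = (LBINT x. g x * Y x + n * (indicator \<Omega> x * Y x * Z x))"
   by (rule b_integral_cong) (auto simp: B_def algebra_simps)
  moreover have "(LBINT x. A x * Z x) = (LBINT x. f x * Z x + n * (indicator \<Omega> x * Y x * Z x))"
   by (rule b_integral_cong) (auto simp: A_def algebra_simps)
  ultimately have s2: "(LBINT x. g x * Y x) = (LBINT x. f x * Z x)" using sym i iYZ by simp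
  have c: "cont (%x. z x - Z x)" "cont (%x. Y x - y x)"
   by (intro continuous_intros AB linsol_cont[OF y] linsol_cont[OF z])+
  have 1: "\<bar>LBINT x. f x * (z x - Z x)\<bar> <= F * \<epsilon> * vol"
   by (rule integral_abs_le_sup(1)[OF f(1) af(1) c(1)]) (use n(2)[OF Z z] in \<open>simp add: abs_minus_commute\<close>)
  have 2: "\<bar>LBINT x. g x * (Y x - y x)\<bar> <= F * \<epsilon> * vol"
   by (rule integral_abs_le_sup(1)[OF g(1) af(2) c(2)]) (use n(2)[OF Y y] in simp)
  have "(LBINT x. f x * (z x - Z x)) = (LBINT x. f x * z x) - (LBINT x. f x * Z x)"
   "(LBINT x. g x * (Y x - y x)) = (LBINT x. g x * Y x) - (LBINT x. g x * y x)"
   using i by (simp_all add: right_diff_distrib)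
  then show ?thesis using 1 2 s2 F\<epsilon> by linarith
 qed
 then have "\<bar>(LBINT x. f x * z x) - (LBINT x. g x * y x)\<bar> <= 0" by (rule field_le_epsilon)
 then show ?thesis by simp
qed

lemma integrable_L2_product: "L2supp f ==> L2supp g ==> integrable lborel (%x. f x * g x)"
 using Cauchy_Schwarz_integral(1)[of f lborel g] by (simp add: L2supp_def)

lemma L2_product_bound:
 "L2supp f ==> L2supp g ==> \<bar>LBINT x. f x * g x\<bar> <= sqrt (LBINT x. (f x)\<^sup>2) * sqrt (LBINT x. (g x)\<^sup>2)"
 using Cauchy_Schwarz_integral(2)[of f lborel g] by (simp add: L2supp_def)

lemma linsol_symmetric_bounded:
 assumes \<mu>: "\<mu> > 0" and f: "L2supp f" "!!x. \<bar>f x\<bar> <= F" and g: "L2supp g" "!!x. \<bar>g x\<bar> <= F"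
  and y: "linsol \<mu> f y" and z: "linsol \<mu> g z"
 shows "(LBINT x. f x * z x) = (LBINT x. g x * y x)"
proof -
 define pos neg where "pos = (%(h::'a => real) x. max 0 (h x))" and "neg = (%(h::'a => real) x. max 0 (- h x))"
 have F0: "0 <= F" by (rule order_trans[OF abs_ge_zero f(2)])
 have p: "L2supp (pos h)" "L2supp (neg h)" "0 <= pos h x" "0 <= neg h x" "pos h x <= F" "neg h x <= F" "pos h x - neg h x = h x"
  if h: "L2supp h" "!!x. \<bar>h x\<bar> <= F" for h x
 proof -
  note [measurable] = L2supp_measurable[OF h(1)]
  show "L2supp (pos h)" "L2supp (neg h)" unfolding pos_def neg_def
   by (rule L2supp_bounded[where M = F]; use h L2supp_outside[OF h(1)] F0 in \<open>auto simp: abs_le_iff max_def\<close>)+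
  show "0 <= pos h x" "0 <= neg h x" "pos h x <= F" "neg h x <= F" "pos h x - neg h x = h x"
   using h(2)[of x] F0 by (auto simp: pos_def neg_def max_def abs_le_iff)
 qed
 note pf = p[OF f] and pg = p[OF g]
 obtain y1 where y1: "linsol \<mu> (pos f) y1" using linsol_exists[OF \<mu> pf(1)] by blast
 obtain y2 where y2: "linsol \<mu> (neg f) y2" using linsol_exists[OF \<mu> pf(2)] by blast
 obtain z1 where z1: "linsol \<mu> (pos g) z1" using linsol_exists[OF \<mu> pg(1)] by blast
 obtain z2 where z2: "linsol \<mu> (neg g) z2" using linsol_exists[OF \<mu> pg(2)] by blast
 have ye: "y = (%x. y1 x - y2 x)"
  using linsol_unique[OF \<mu> y _ f(1)] linsol_diff[OF y1 y2 pf(1,2)] pf(7) by simp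
 have ze: "z = (%x. z1 x - z2 x)"
  using linsol_unique[OF \<mu> z _ g(1)] linsol_diff[OF z1 z2 pg(1,2)] pg(7) by simp
 note sy = linsol_L2supp[OF y1] linsol_L2supp[OF y2] linsol_L2supp[OF z1] linsol_L2supp[OF z2]
 note s = linsol_symmetric_nonneg[OF \<mu> pf(1,3,5) pg(1,3,5) y1 z1] linsol_symmetric_nonneg[OF \<mu> pf(1,3,5) pg(2,4,6) y1 z2]
  linsol_symmetric_nonneg[OF \<mu> pf(2,4,6) pg(1,3,5) y2 z1] linsol_symmetric_nonneg[OF \<mu> pf(2,4,6) pg(2,4,6) y2 z2]
 have fz: "f x * z x = (pos f x * z1 x - pos f x * z2 x) - (neg f x * z1 x - neg f x * z2 x)" for x
 proof -
  have 1: "f x = pos f x - neg f x" using pf(7)[of x] by simp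
  have 2: "z x = z1 x - z2 x" by (simp only: ze)
  have "f x * z x = (pos f x - neg f x) * (z1 x - z2 x)" by (rule arg_cong2[OF 1 2])
  then show ?thesis by (simp add: left_diff_distrib right_diff_distrib)
 qed
 have gy: "g x * y x = (pos g x * y1 x - neg g x * y1 x) - (pos g x * y2 x - neg g x * y2 x)" for x
 proof -
  have 1: "g x = pos g x - neg g x" using pg(7)[of x] by simp
  have 2: "y x = y1 x - y2 x" by (simp only: ye)
  have "g x * y x = (pos g x - neg g x) * (y1 x - y2 x)" by (rule arg_cong2[OF 1 2])
  then show ?thesis by (simp add: left_diff_distrib right_diff_distrib)
 qed
 note i = integrable_L2_product[OF pf(1) sy(3)] integrable_L2_product[OF pf(1) sy(4)] integrable_L2_product[OF pf(2) sy(3)]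
  integrable_L2_product[OF pf(2) sy(4)] integrable_L2_product[OF pg(1) sy(1)] integrable_L2_product[OF pg(2) sy(1)]
  integrable_L2_product[OF pg(1) sy(2)] integrable_L2_product[OF pg(2) sy(2)]
 show ?thesis unfolding fz gy
  by (simp only: b_integral_diff b_integrable_diff i s)
qed

lemma linsol_symmetric:
 assumes \<mu>: "\<mu> > 0" and f: "L2supp f" and g: "L2supp g" and y: "linsol \<mu> f y" and z: "linsol \<mu> g z"
 shows "(LBINT x. f x * z x) = (LBINT x. g x * y x)"
proof -
 have "EX Y. ALL k. linsol \<mu> (clip k f) (Y k)" using linsol_exists[OF \<mu> clip_L2supp[OF f]] by (intro choice allI) blast
 then obtain Y where Y: "!!k. linsol \<mu> (clip k f) (Y k)" by blast
 have "EX Z. ALL k. linsol \<mu> (clip k g) (Z k)" using linsol_exists[OF \<mu> clip_L2supp[OF g]] by (intro choice allI) blast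
 then obtain Z where Z: "!!k. linsol \<mu> (clip k g) (Z k)" by blast
 have lim: "(%k. \<integral>x. clip k f x * Z k x \<partial>lborel) \<longlonglongrightarrow> (LBINT x. f x * z x)"
  if f: "L2supp f" and g: "L2supp g" and z: "linsol \<mu> g z" and Z: "!!k. linsol \<mu> (clip k g) (Z k)" for f g z Z
 proof -
  define n where "n h = sqrt (LBINT x. (h x)\<^sup>2)" for h :: "'a => real"
  have n0: "0 <= n h" for h by (simp add: n_def)
  have nclip: "n (clip k f) <= n f" for k
   unfolding n_def by (intro real_sqrt_le_mono integral_mono L2supp_square clip_L2supp f)
    (use clip(2)[of k f] in \<open>simp add: abs_le_square_iff\<close>)
  define nI where "nI = n (indicator \<Omega>)"
  have IL: "L2supp (indicator \<Omega>)" using L2supp_indicator_times[of "%_. 1"] by simp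
  have bound: "\<bar>(LBINT x. clip k f x * Z k x) - (LBINT x. f x * z x)\<bar> \<le>
    n f * (Cres \<mu> * n (%x. g x - clip k g x) * nI) + n (%x. f x - clip k f x) * n z" for k
  proof -
   have Lc: "L2supp (clip k f)" "L2supp (Z k)" "L2supp z" "L2supp (%x. f x - clip k f x)" "L2supp (%x. Z k x - z x)"
    using f g z Z by (auto intro!: clip_L2supp linsol_L2supp[OF Z] linsol_L2supp[OF z] L2supp_diff)
   have d: "linsol \<mu> (%x. g x - clip k g x) (%x. z x - Z k x)" by (rule linsol_diff[OF z Z g clip_L2supp[OF g]])
   have ptw: "\<bar>Z k x - z x\<bar> <= Cres \<mu> * n (%x. g x - clip k g x)" for x
    using linsol_L2_bound[OF \<mu> d L2supp_diff[OF g clip_L2supp[OF g]], of x] by (simp add: n_def abs_minus_commute)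
   have nz: "n (%x. Z k x - z x) <= Cres \<mu> * n (%x. g x - clip k g x) * nI"
   proof -
    let ?c = "Cres \<mu> * n (%x. g x - clip k g x)"
    have c0: "0 <= ?c" using Cres_nonneg n0 by simp
    have "(LBINT x. (Z k x - z x)\<^sup>2) <= (LBINT x. ?c\<^sup>2 * (indicator \<Omega> x)\<^sup>2)"
    proof (rule integral_mono)
     show "(Z k x - z x)\<^sup>2 <= ?c\<^sup>2 * (indicator \<Omega> x)\<^sup>2" for x
     proof (cases "x \<in> \<Omega>")
      case True
      then show ?thesis using power_mono[OF ptw[of x] abs_ge_zero, of 2] by simp
     qed (simp add: linsol_outside[OF Z] linsol_outside[OF z])
    qed (use L2supp_square[OF Lc(5)] L2supp_square[OF IL] in auto)
    then have "n (%x. Z k x - z x) <= sqrt (?c\<^sup>2 * (LBINT x. (indicator \<Omega> x)\<^sup>2))"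
     unfolding n_def by (intro real_sqrt_le_mono) simp
    also have "\<dots> = ?c * nI" using c0 by (simp add: real_sqrt_mult nI_def n_def)
    finally show ?thesis .
   qed
   have e: "(LBINT x. clip k f x * Z k x) - (LBINT x. f x * z x) =
     (LBINT x. clip k f x * (Z k x - z x)) - (LBINT x. (f x - clip k f x) * z x)"
    using integrable_L2_product[OF Lc(1,2)] integrable_L2_product[OF Lc(1,3)] integrable_L2_product[OF f Lc(3)]
    by (simp add: right_diff_distrib left_diff_distrib)
   have "\<bar>LBINT x. clip k f x * (Z k x - z x)\<bar> <= n (clip k f) * n (%x. Z k x - z x)"
    unfolding n_def by (rule L2_product_bound[OF Lc(1,5)])
   also have "\<dots> <= n f * (Cres \<mu> * n (%x. g x - clip k g x) * nI)"
    using nclip nz n0 by (intro mult_mono) auto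
   finally have 1: "\<bar>LBINT x. clip k f x * (Z k x - z x)\<bar> <= n f * (Cres \<mu> * n (%x. g x - clip k g x) * nI)" .
   have 2: "\<bar>LBINT x. (f x - clip k f x) * z x\<bar> <= n (%x. f x - clip k f x) * n z"
    unfolding n_def by (rule L2_product_bound[OF Lc(4,3)])
   show ?thesis unfolding e using 1 2 by linarith
  qed
  have "(%k. n f * (Cres \<mu> * n (%x. g x - clip k g x) * nI) + n (%x. f x - clip k f x) * n z)
    \<longlonglongrightarrow> n f * (Cres \<mu> * 0 * nI) + 0 * n z"
   unfolding n_def by (intro tendsto_intros clip_tendsto f g)
  then have lim0: "(%k. n f * (Cres \<mu> * n (%x. g x - clip k g x) * nI) + n (%x. f x - clip k f x) * n z) \<longlonglongrightarrow> 0"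
   by simp
  have "(%k. (LBINT x. clip k f x * Z k x) - (LBINT x. f x * z x)) \<longlonglongrightarrow> 0"
  proof (rule Lim_null_comparison[OF _ lim0], rule always_eventually, rule allI)
   fix k
   show "norm ((LBINT x. clip k f x * Z k x) - (LBINT x. f x * z x)) \<le>
     n f * (Cres \<mu> * n (%x. g x - clip k g x) * nI) + n (%x. f x - clip k f x) * n z"
    unfolding real_norm_def by (rule bound)
  qed
  then show ?thesis by (simp add: LIM_zero_iff)
 qed
 have "(LBINT x. clip k f x * Z k x) = (LBINT x. clip k g x * Y k x)" for k
  by (rule linsol_symmetric_bounded[OF \<mu> clip_L2supp[OF f] clip(1) clip_L2supp[OF g] clip(1) Y Z])
 then show ?thesis using LIMSEQ_unique[OF lim[OF f g z Z]] lim[OF g f y Y] by simp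
qed

end

context corkscrew_domain begin

definition rad :: real where "rad = (SOME R. R > 0 & (\<forall>x\<in>closure \<Omega>. norm x <= R))"

lemma rad: "rad > 0" "x \<in> closure \<Omega> ==> norm x <= rad" "x \<in> \<Omega> ==> norm x <= rad"
 "x \<in> frontier \<Omega> ==> norm x <= rad"
proof -
 have "EX R. R > 0 & (\<forall>x\<in>closure \<Omega>. norm x <= R)"
  using bounded_closure[OF bounded_dom] by (auto simp: bounded_pos)
 from someI_ex[OF this, folded rad_def] have r: "rad > 0" "!!x. x \<in> closure \<Omega> ==> norm x <= rad" by auto
 then show "rad > 0" "x \<in> closure \<Omega> ==> norm x <= rad" "x \<in> \<Omega> ==> norm x <= rad" "x \<in> frontier \<Omega> ==> norm x <= rad"
  using closure_subset[of \<Omega>] by (auto simp: frontier_def)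
qed

lemma L2supp_const: "L2supp (%x. c * indicator \<Omega> x)"
 using L2supp_indicator_times[of "%_. c"] by (simp add: mult.commute)

lemma integral_const_test: "test_fun \<Omega> \<phi> ==> (LBINT x. c * indicator \<Omega> x * \<phi> x) = (LBINT x. c * \<phi> x)"
 by (rule b_integral_cong) (auto simp: indicator_def test_fun_outside)

lemma linsol_le_supersolution:
 assumes y: "linsol \<mu> g y" and \<mu>: "\<mu> >= 0" and g: "L2supp g" and h: "L2supp h" and \<psi>: "cont \<psi>"
  and bdry: "!!x. x \<in> frontier \<Omega> ==> 0 <= \<psi> x"
  and super: "!!\<phi>. test_fun \<Omega> \<phi> ==> (!!x. 0 <= \<phi> x) ==> (LBINT x. h x * \<phi> x) <= wpair \<mu> \<psi> \<phi>"
  and le: "!!x. x \<in> \<Omega> ==> \<psi> x < y x ==> g x <= h x" and x: "x \<in> \<Omega>"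
 shows "y x <= \<psi> x"
proof -
 have "y x - \<psi> x <= 0"
 proof (rule comparison_principle[OF open_dom bounded_dom _ \<mu> _ _ x])
  show "cont (%x. y x - \<psi> x)" by (intro continuous_intros linsol_cont[OF y] \<psi>)
  show "y x - \<psi> x <= 0" if "x \<in> frontier \<Omega>" for x
   using bdry[OF that] linsol_outside[OF y frontier_outside[OF that]] by simp
  fix \<phi> assume \<phi>: "test_fun (\<Omega> \<inter> {x. 0 < y x - \<psi> x}) \<phi>" "!!x. 0 <= \<phi> x"
  have t: "test_fun \<Omega> \<phi>" using \<phi>(1) by (rule test_fun_mono) auto
  have "(LBINT x. g x * \<phi> x) <= (LBINT x. h x * \<phi> x)"
  proof (rule integral_mono[OF integrable_L2supp_test[OF g t] integrable_L2supp_test[OF h t]])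
   fix x
   show "g x * \<phi> x <= h x * \<phi> x"
    using test_fun_outside[OF \<phi>(1), of x] \<phi>(2)[of x] le[of x]
    by (cases "x \<in> \<Omega> \<inter> {x. 0 < y x - \<psi> x}") (auto intro: mult_right_mono)
  qed
  then show "wpair \<mu> (%x. y x - \<psi> x) \<phi> <= 0"
   using wpair_diff[OF linsol_cont[OF y] \<psi> t, of \<mu>] linsol_weak[OF y t] super[OF t \<phi>(2)] by simp
 qed
 then show ?thesis by simp
qed

definition quad :: "real => 'a => real" where
 "quad \<kappa> x = (- \<kappa>) * ((x - 0) \<bullet> (x - 0)) + \<kappa> * rad\<^sup>2"

lemma quad_smooth: "smooth (quad \<kappa>)"
 unfolding quad_def[abs_def] by (intro smooth_add smooth_cmult smooth_sqdist smooth_const)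

lemma lap_quad: "lap (quad \<kappa>) x = - \<kappa> * (2 * DIM('a))"
 unfolding quad_def[abs_def] lap_add[OF smooth_cmult[OF smooth_sqdist] smooth_const] lap_cmult[OF smooth_sqdist] lap_sqdist lap_const
 by simp

lemma quad_bounds:
 assumes "\<kappa> >= 0" shows "norm x <= rad ==> 0 <= quad \<kappa> x" and "quad \<kappa> x <= \<kappa> * rad\<^sup>2"
proof -
 show "0 <= quad \<kappa> x" if "norm x <= rad"
 proof -
  have "\<kappa> * (norm x)\<^sup>2 <= \<kappa> * rad\<^sup>2" using that assms by (intro mult_left_mono power_mono) auto
  then show ?thesis by (simp add: quad_def dot_square_norm)
 qed
 show "quad \<kappa> x <= \<kappa> * rad\<^sup>2" using assms by (simp add: quad_def)
qed

lemma wpair_quad: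
 assumes "test_fun \<Omega> \<phi>" shows "wpair 0 (quad \<kappa>) \<phi> = (LBINT x. (\<kappa> * (2 * DIM('a))) * \<phi> x)"
 using wpair_smooth[OF quad_smooth assms, of 0 \<kappa>] by (simp add: lap_quad)

definition Kdom :: real where "Kdom = rad\<^sup>2 / (2 * DIM('a))"

lemma Kdom_nonneg: "0 <= Kdom" by (simp add: Kdom_def)

lemma poisson_upper:
 assumes y: "linsol 0 g y" and g: "L2supp g" and F: "F >= 0" and le: "!!x. x \<in> \<Omega> ==> 0 < y x ==> g x <= F"
 shows "y x <= F * Kdom"
proof (cases "x \<in> \<Omega>")
 case True
 define \<kappa> where "\<kappa> = F / (2 * DIM('a))"
 have \<kappa>: "\<kappa> >= 0" using F by (simp add: \<kappa>_def)
 have "y x <= quad \<kappa> x"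
 proof (rule linsol_le_supersolution[OF y _ g L2supp_const _ _ _ _ True])
  show "cont (quad \<kappa>)" by (rule smooth_continuous[OF quad_smooth])
  show "0 <= quad \<kappa> x" if "x \<in> frontier \<Omega>" for x by (rule quad_bounds(1)[OF \<kappa> rad(4)[OF that]])
  show "(LBINT x. F * indicator \<Omega> x * \<phi> x) <= wpair 0 (quad \<kappa>) \<phi>" if "test_fun \<Omega> \<phi>" for \<phi>
   using wpair_quad[OF that, of \<kappa>] integral_const_test[OF that, of F] by (simp add: \<kappa>_def)
  show "g x <= F * indicator \<Omega> x" if "x \<in> \<Omega>" "quad \<kappa> x < y x" for x
   using le[OF that(1)] that quad_bounds(1)[OF \<kappa> rad(3)[OF that(1)]] by simp
 qed simp
 also have "\<dots> <= F * Kdom" using quad_bounds(2)[OF \<kappa>, of x] by (simp add: \<kappa>_def Kdom_def)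
 finally show ?thesis .
qed (use linsol_outside[OF y] F Kdom_nonneg in simp)

lemma linsol_uminus: "linsol \<mu> f y ==> L2supp f ==> linsol \<mu> (%x. - f x) (%x. - y x)"
 using linsol_linear[of \<mu> f y f y "-1" 0] by simp

lemma L2supp_uminus: "L2supp f ==> L2supp (%x. - f x)"
 using L2supp_add[of f f "-1" 0] by simp

lemma poisson_abs:
 assumes y: "linsol 0 g y" and g: "L2supp g" and F: "F >= 0"
  and le: "!!x. x \<in> \<Omega> ==> 0 < y x ==> g x <= F" "!!x. x \<in> \<Omega> ==> y x < 0 ==> - F <= g x"
 shows "\<bar>y x\<bar> <= F * Kdom"
proof -
 have "y x <= F * Kdom" by (rule poisson_upper[OF y g F le(1)])
 moreover have "- y x <= F * Kdom"
  by (rule poisson_upper[OF linsol_uminus[OF y g] L2supp_uminus[OF g] F]) (use le(2) in force)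
 ultimately show ?thesis by (simp add: abs_le_iff)
qed

definition CL2 :: real where "CL2 = Cres 1 * (1 + Kdom)"

lemma poisson_L2_upper:
 assumes y: "linsol 0 g y" and g: "L2supp g" and h: "L2supp h" "!!x. 0 <= h x"
  and le: "!!x. x \<in> \<Omega> ==> 0 < y x ==> g x <= h x"
 shows "y x <= CL2 * sqrt (LBINT x. (h x)\<^sup>2)"
proof -
 define E where "E = potential 1 h"
 define S where "S = Cres 1 * sqrt (LBINT x. (h x)\<^sup>2)"
 have S0: "0 <= S" using Cres_nonneg by (simp add: S_def)
 have E: "cont E" "!!x. 0 <= E x" "!!x. E x <= S"
  using potential_continuous[OF _ h(1), of 1] potential_nonneg[of 1 h] h(2) potential_L2_bound[OF _ h(1), of 1]
  by (auto simp: E_def S_def abs_le_iff)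
 define \<kappa> where "\<kappa> = S / (2 * DIM('a))"
 have \<kappa>: "\<kappa> >= 0" using S0 by (simp add: \<kappa>_def)
 have cq: "cont (quad \<kappa>)" by (rule smooth_continuous[OF quad_smooth])
 have tot: "CL2 * sqrt (LBINT x. (h x)\<^sup>2) = S + S * Kdom" by (simp add: CL2_def S_def algebra_simps)
 show ?thesis
 proof (cases "x \<in> \<Omega>")
  case True
  have "y x <= 1 * E x + 1 * quad \<kappa> x"
  proof (rule linsol_le_supersolution[OF y _ g h(1) _ _ _ _ True])
   show "cont (%x. 1 * E x + 1 * quad \<kappa> x)" by (intro continuous_intros E cq)
   show "0 <= 1 * E x + 1 * quad \<kappa> x" if "x \<in> frontier \<Omega>" for x
    using quad_bounds[OF \<kappa>, of x] rad(4)[OF that] E(2)[of x] by simp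
   show "g x <= h x" if "x \<in> \<Omega>" "1 * E x + 1 * quad \<kappa> x < y x" for x
    using le[OF that(1)] that quad_bounds(1)[OF \<kappa> rad(3)[OF that(1)]] E(2)[of x] by simp
   fix \<phi> assume t: "test_fun \<Omega> \<phi>" "!!x. 0 <= \<phi> x"
   have w: "wpair 1 E \<phi> = (LBINT x. h x * \<phi> x)"
    using potential_weak[OF _ h(1), of 1 \<phi>] test_fun_mono[OF t(1), of UNIV] by (simp add: wpair_def E_def)
   have "(LBINT x. E x * \<phi> x) <= (LBINT x. S * \<phi> x)"
    using integrable_times_test[OF E(1) t(1)] E(3) t(2) by (intro integral_mono) (auto intro: mult_right_mono)
   then show "(LBINT x. h x * \<phi> x) <= wpair 0 (%x. 1 * E x + 1 * quad \<kappa> x) \<phi>"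
    unfolding wpair_linear[OF E(1) cq t(1)] using wpair_change[OF E(1) t(1), of 0 1] w wpair_quad[OF t(1), of \<kappa>]
    by (simp add: \<kappa>_def)
  qed simp
  also have "\<dots> <= S + S * Kdom" using E(3)[of x] quad_bounds(2)[OF \<kappa>, of x] by (simp add: \<kappa>_def Kdom_def)
  finally show ?thesis unfolding tot .
 next
  case False
  then show ?thesis unfolding tot using linsol_outside[OF y] S0 Kdom_nonneg by simp
 qed
qed

text \<open>Interpolation between the sup norm and the \<open>L\<^sup>2\<close> norm; \<open>\<mu>\<close> is at our disposal.\<close>
lemma poisson_interpolation_upper:
 assumes y: "linsol 0 g y" and g: "L2supp g" and \<mu>: "\<mu> > 0" and M: "M >= 0"
  and le: "!!x. x \<in> \<Omega> ==> 0 < y x ==> g x <= M"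
 shows "y x <= M / \<mu> + \<mu> * (Cres \<mu> * sqrt (LBINT x. (y x)\<^sup>2))"
proof -
 note Ly = linsol_L2supp[OF y]
 note [measurable] = L2supp_measurable[OF Ly]
 define p where "p x = max 0 (y x)" for x
 have Lp: "L2supp p"
  using Ly unfolding L2supp_def p_def[abs_def]
 proof (intro conjI allI impI)
  assume *: "y \<in> borel_measurable borel & (ALL x. x ~: \<Omega> --> y x = 0) & integrable lborel (%x. (y x)\<^sup>2)"
  show "integrable lborel (%x. (max 0 (y x))\<^sup>2)"
   by (rule b_integrable_bound[of _ "%x. (y x)\<^sup>2"]) (use * in \<open>auto intro!: AE_I2 simp: max_def\<close>)
 qed auto
 have np: "sqrt (LBINT x. (p x)\<^sup>2) <= sqrt (LBINT x. (y x)\<^sup>2)"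
  using L2supp_square[OF Lp] L2supp_square[OF Ly] by (intro real_sqrt_le_mono integral_mono) (auto simp: p_def max_def)
 define h where "h x = 1 * (M * indicator \<Omega> x) + \<mu> * p x" for x
 have Lh: "L2supp h" unfolding h_def[abs_def] by (intro L2supp_add L2supp_const Lp)
 have h0: "0 <= h x" for x using M \<mu> by (simp add: h_def p_def)
 have pn: "0 <= potential \<mu> h x" for x using h0 by (rule potential_nonneg[OF \<mu>])
 have ub: "potential \<mu> h x <= M / \<mu> + \<mu> * (Cres \<mu> * sqrt (LBINT x. (y x)\<^sup>2))" for x
 proof -
  have "potential \<mu> h x = 1 * potential \<mu> (%x. M * indicator \<Omega> x) x + \<mu> * potential \<mu> p x"
   unfolding h_def[abs_def] by (rule potential_linear[OF \<mu> L2supp_const Lp])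
  moreover have "\<bar>potential \<mu> (%x. M * indicator \<Omega> x) x\<bar> <= M / \<mu>"
   by (rule potential_bound[OF \<mu> L2supp_const]) (use M in \<open>auto simp: indicator_def\<close>)
  moreover have "\<mu> * potential \<mu> p x <= \<mu> * (Cres \<mu> * sqrt (LBINT x. (y x)\<^sup>2))"
  proof (rule mult_left_mono)
   have "\<bar>potential \<mu> p x\<bar> <= Cres \<mu> * sqrt (LBINT x. (p x)\<^sup>2)" by (rule potential_L2_bound[OF \<mu> Lp])
   also have "\<dots> <= Cres \<mu> * sqrt (LBINT x. (y x)\<^sup>2)" using np Cres_nonneg by (intro mult_left_mono)
   finally show "potential \<mu> p x <= Cres \<mu> * sqrt (LBINT x. (y x)\<^sup>2)" by simp
  qed (use \<mu> in simp)
  ultimately show ?thesis by (simp add: abs_le_iff)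
 qed
 show ?thesis
 proof (cases "x \<in> \<Omega>")
  case True
  have y': "linsol \<mu> (%x. g x + (\<mu> - 0) * y x) y" by (rule linsol_change[OF y g])
  have Lg: "L2supp (%x. g x + (\<mu> - 0) * y x)" using L2supp_add[OF g Ly, of 1 \<mu>] by simp
  have "y x <= potential \<mu> h x"
  proof (rule linsol_le_supersolution[OF y' less_imp_le[OF \<mu>] Lg Lh potential_continuous[OF \<mu> Lh] _ _ _ True])
   show "0 <= potential \<mu> h x" for x by (rule pn)
   show "(LBINT x. h x * \<phi> x) <= wpair \<mu> (potential \<mu> h) \<phi>" if "test_fun \<Omega> \<phi>" for \<phi>
    using potential_weak[OF \<mu> Lh, of \<phi>] test_fun_mono[OF that, of UNIV] by (simp add: wpair_def)
   show "g x + (\<mu> - 0) * y x <= h x" if "x \<in> \<Omega>" "potential \<mu> h x < y x" for x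
    using le[OF that(1)] that pn[of x] by (simp add: h_def p_def)
  qed
  then show ?thesis using ub[of x] by linarith
 next
  case False
  then show ?thesis using linsol_outside[OF y] M \<mu> Cres_nonneg[of \<mu>] by simp
 qed
qed

lemma linsol_contraction:
 assumes \<mu>: "\<mu> > 0"
 shows "\<exists>q\<ge>0. q < 1 & (ALL f y M. linsol \<mu> f y --> L2supp f --> (ALL x. \<bar>f x\<bar> <= M) --> (ALL x. \<bar>y x\<bar> <= q * (M / \<mu>)))"
proof -
 obtain b :: 'a where b: "b \<in> Basis" using nonempty_Basis by blast
 define k where "k = sqrt \<mu>"
 have k: "k > 0" "k\<^sup>2 = \<mu>" using \<mu> by (auto simp: k_def)
 define c where "c = exp (- k * rad)"
 define q where "q = 1 - exp (- 2 * k * rad)"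
 have q: "0 <= q" "q < 1" using k rad(1) by (auto simp: q_def)
 define s where "s x = 1 + (- c) * exp (k * (x \<bullet> b))" for x :: 'a
 have ss: "smooth s" unfolding s_def[abs_def] by (intro smooth_add smooth_const smooth_cmult smooth_exp_coord)
 have ls: "lap s x = - (\<mu> * (c * exp (k * (x \<bullet> b))))" for x
  unfolding s_def[abs_def] lap_add[OF smooth_const smooth_cmult[OF smooth_exp_coord]] lap_cmult[OF smooth_exp_coord]
   lap_exp_coord[OF b] lap_const by (simp add: k mult_ac)
 have sb: "0 <= s x" "s x <= q" if "norm x <= rad" for x
 proof -
  have xb: "\<bar>x \<bullet> b\<bar> <= rad" using Basis_le_norm[OF b, of x] that by simp
  have e: "c * exp (k * (x \<bullet> b)) = exp (k * (x \<bullet> b - rad))" by (simp add: c_def right_diff_distrib flip: exp_add)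
  have "k * (x \<bullet> b - rad) <= 0" using xb k by (simp add: mult_le_0_iff abs_le_iff)
  then have "exp (k * (x \<bullet> b - rad)) <= 1" by simp
  then show "0 <= s x" using e by (simp add: s_def)
  have "- (x \<bullet> b) <= rad" using xb by (simp add: abs_le_iff)
  then have "k * (- 2 * rad) <= k * (x \<bullet> b - rad)" using k by (intro mult_left_mono) auto
  then have "exp (- 2 * k * rad) <= exp (k * (x \<bullet> b - rad))" by (simp add: mult_ac)
  then show "s x <= q" using e by (simp add: s_def q_def)
 qed
 have up: "y x <= q * (M / \<mu>)" if y: "linsol \<mu> f y" and f: "L2supp f" "!!x. \<bar>f x\<bar> <= M" for f y M x
 proof -
  have M: "M >= 0" by (rule order_trans[OF abs_ge_zero f(2)])
  show ?thesis
  proof (cases "x \<in> \<Omega>")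
   case True
   have "y x <= (M / \<mu>) * s x"
   proof (rule linsol_le_supersolution[OF y less_imp_le[OF \<mu>] f(1) L2supp_const _ _ _ _ True])
    show "cont (%x. (M / \<mu>) * s x)" by (intro continuous_intros smooth_continuous ss)
    show "0 <= (M / \<mu>) * s x" if "x \<in> frontier \<Omega>" for x using sb(1)[OF rad(4)[OF that]] M \<mu> by simp
    show "f x <= M * indicator \<Omega> x" if "x \<in> \<Omega>" for x using f(2)[of x] that by (simp add: abs_le_iff)
    show "(LBINT x. M * indicator \<Omega> x * \<phi> x) <= wpair \<mu> (%x. (M / \<mu>) * s x) \<phi>" if t: "test_fun \<Omega> \<phi>" for \<phi>
    proof -
     have "\<mu> * ((M / \<mu>) * s x) - lap (%x. (M / \<mu>) * s x) x = M" for x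
     proof -
      have "lap (%x. (M / \<mu>) * s x) x = (M / \<mu>) * lap s x" by (simp only: lap_cmult[OF ss])
      then show ?thesis unfolding ls s_def using \<mu> by (simp add: field_simps)
     qed
     then show ?thesis
      using wpair_smooth[OF smooth_cmult[OF ss, of "M / \<mu>"] t, of \<mu>] integral_const_test[OF t, of M] by simp
    qed
   qed
   also have "\<dots> <= (M / \<mu>) * q" using sb(2)[OF rad(3)[OF True]] M \<mu> by (intro mult_left_mono) auto
   finally show ?thesis by (simp add: mult.commute)
  qed (use linsol_outside[OF y] q M \<mu> in simp)
 qed
 have "\<bar>y x\<bar> <= q * (M / \<mu>)" if y: "linsol \<mu> f y" and f: "L2supp f" "!!x. \<bar>f x\<bar> <= M" for f y M x
  using up[OF y f, of x] up[OF linsol_uminus[OF y f(1)] L2supp_uminus[OF f(1)], of M x] f(2) by (simp add: abs_le_iff)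
 then show ?thesis using q by blast
qed

lemma semilinear_exists:
 assumes f: "L2supp f" and \<Lambda>: "\<Lambda> > 0"
  and mono: "!!x s t. s <= t ==> 0 <= N x t - N x s" and lip: "!!x s t. s <= t ==> N x t - N x s <= \<Lambda> * (t - s)"
  and zero: "!!x. N x 0 = 0" and meas: "!!y. cont y ==> (%x. N x (y x)) \<in> borel_measurable borel"
 shows "EX y. linsol 0 (%x. f x - N x (y x)) y"
proof -
 have lip2: "\<bar>(\<Lambda> * t - N x t) - (\<Lambda> * s - N x s)\<bar> <= \<Lambda> * \<bar>t - s\<bar>" for x s t
  using mono[of s t x] lip[of s t x] mono[of t s x] lip[of t s x] by (cases "s <= t") (auto simp: algebra_simps abs_le_iff)
 obtain q where q: "q >= 0" "q < 1" "!!f y M x. linsol \<Lambda> f y ==> L2supp f ==> (!!x. \<bar>f x\<bar> <= M) ==> \<bar>y x\<bar> <= q * (M / \<Lambda>)"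
  using linsol_contraction[OF \<Lambda>] by blast
 define r where "r y x = indicator \<Omega> x * (\<Lambda> * y x - N x (y x))" for y :: "'a => real" and x
 have rL: "L2supp (r y)" if y: "cont y" "bounded (range y)" for y
 proof -
  obtain B where B: "!!x. \<bar>y x\<bar> <= B" using y(2) by (auto simp: bounded_iff)
  have [measurable]: "y \<in> borel_measurable borel" "(%x. N x (y x)) \<in> borel_measurable borel" "\<Omega> \<in> sets borel"
   using y open_dom by (auto intro: borel_measurable_UNIV meas)
  show ?thesis
  proof (rule L2supp_bounded[where M = "\<Lambda> * B"])
   show "r y \<in> borel_measurable borel" unfolding r_def[abs_def] by measurable
   show "\<bar>r y x\<bar> <= \<Lambda> * B" for x
   proof -
    have "\<bar>\<Lambda> * y x - N x (y x)\<bar> <= \<Lambda> * \<bar>y x\<bar>" using lip2[of "y x" x 0] zero by simp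
    also have "\<dots> <= \<Lambda> * B" using B \<Lambda> by (intro mult_left_mono) auto
    finally show ?thesis using order_trans[OF abs_ge_zero B] \<Lambda> by (auto simp: r_def indicator_def)
   qed
  qed (simp add: r_def)
 qed
 define g where "g y x = 1 * f x + 1 * r y x" for y x
 have gL: "L2supp (g y)" if y: "cont y" "bounded (range y)" for y
  unfolding g_def[abs_def] by (rule L2supp_add[OF f rL[OF y]])
 define T where "T y = (SOME z. linsol \<Lambda> (g y) z)" for y
 have T: "linsol \<Lambda> (g y) (T y)" if y: "cont y" "bounded (range y)" for y
  unfolding T_def by (rule someI_ex[OF linsol_exists[OF \<Lambda> gL[OF y]]])
 have "EX y. cont y & bounded (range y) & T y = y"
 proof (rule sup_contraction_fixpoint[OF _ q(1,2)])
  fix y :: "'a => real" assume y: "cont y" "bounded (range y)"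
  show "cont (T y) & bounded (range (T y))"
   using T[OF y] C0dom_bounded by (auto simp: linsol_def C0dom_def)
 next
  fix y y' :: "'a => real" and d x assume y: "cont y" "bounded (range y)" and y': "cont y'" "bounded (range y')"
   and d: "!!x. \<bar>y x - y' x\<bar> <= d"
  have d0: "0 <= d" by (rule order_trans[OF abs_ge_zero d])
  have "\<bar>T y x - T y' x\<bar> <= q * (\<Lambda> * d / \<Lambda>)"
  proof (rule q(3)[OF linsol_diff[OF T[OF y] T[OF y'] gL[OF y] gL[OF y']] L2supp_diff[OF gL[OF y] gL[OF y']]])
   fix x
   have "g y x - g y' x = indicator \<Omega> x * ((\<Lambda> * y x - N x (y x)) - (\<Lambda> * y' x - N x (y' x)))"
    by (simp add: g_def r_def right_diff_distrib)
   moreover have "\<bar>(\<Lambda> * y x - N x (y x)) - (\<Lambda> * y' x - N x (y' x))\<bar> <= \<Lambda> * d"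
    using lip2[of "y x" x "y' x"] mult_left_mono[OF d[of x], of \<Lambda>] \<Lambda> by linarith
   ultimately show "\<bar>g y x - g y' x\<bar> <= \<Lambda> * d" using d0 \<Lambda> by (auto simp: indicator_def)
  qed
  then show "\<bar>T y x - T y' x\<bar> <= q * d" using \<Lambda> by simp
 qed
 then obtain y where y: "cont y" "bounded (range y)" "T y = y" by blast
 have "linsol \<Lambda> (g y) y" using T[OF y(1,2)] y(3) by simp
 from linsol_change[OF this gL[OF y(1,2)], of 0] have l: "linsol 0 (%x. g y x + (0 - \<Lambda>) * y x) y" .
 have "g y x + (0 - \<Lambda>) * y x = f x - N x (y x)" for x
  using linsol_outside[OF l, of x] L2supp_outside[OF f, of x] zero[of x] by (cases "x \<in> \<Omega>") (auto simp: g_def r_def)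
 then show ?thesis using l by auto
qed

lemma semilinear_unique:
 assumes y: "linsol 0 (%x. f x - N x (y x)) y" "L2supp (%x. f x - N x (y x))"
  and z: "linsol 0 (%x. f x - N x (z x)) z" "L2supp (%x. f x - N x (z x))"
  and mono: "!!x s t. x \<in> \<Omega> ==> s <= t ==> N x s <= N x t"
 shows "y = z"
proof
 fix x
 have "\<bar>y x - z x\<bar> <= 0 * Kdom"
 proof (rule poisson_abs[OF linsol_diff[OF y(1) z(1) y(2) z(2)] L2supp_diff[OF y(2) z(2)]])
  show "f x - N x (y x) - (f x - N x (z x)) <= 0" if "x \<in> \<Omega>" "0 < y x - z x" for x
   using mono[of x "z x" "y x"] that by simp
  show "- 0 <= f x - N x (y x) - (f x - N x (z x))" if "x \<in> \<Omega>" "y x - z x < 0" for x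
   using mono[of x "y x" "z x"] that by simp
 qed simp
 then show "y x = z x" by simp
qed

lemma poisson_equicontinuous:
 assumes M: "M >= 0" and \<eta>: "\<eta> > 0"
 shows "\<exists>\<delta>>0. ALL g y. linsol 0 g y --> L2supp g --> (ALL x. \<bar>g x\<bar> <= M) --> (ALL x x'. norm (x - x') < \<delta> --> \<bar>y x - y x'\<bar> <= \<eta>)"
proof -
 define F where "F = M + M * Kdom"
 have F: "F >= 0" using M Kdom_nonneg by (simp add: F_def)
 obtain n where n: "n >= 0" "!!f y Y x. penalised 1 n F f Y ==> linsol 1 f y ==> \<bar>Y x - y x\<bar> <= \<eta> / 8"
  using linsol_penalised_close[of 1 F "\<eta> / 8"] F \<eta> by auto
 obtain \<delta> where \<delta>: "\<delta> > 0" "!!f x y. L2supp f ==> (!!x. \<bar>f x\<bar> <= F + n * F) ==> norm (x - y) < \<delta> ==>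
   \<bar>potential (1 + n) f x - potential (1 + n) f y\<bar> <= \<eta> / 8"
  using potential_equicontinuous[of "1 + n" "\<eta> / 8" "F + n * F"] n(1) F \<eta> by auto
 have pos: "\<bar>y x - y x'\<bar> <= 3 * \<eta> / 8" if f: "L2supp f" "!!x. 0 <= f x" "!!x. f x <= F" and y: "linsol 1 f y" and xx: "norm (x - x') < \<delta>" for f y x x'
 proof -
  obtain Y where Y: "penalised 1 n F f Y" using penalised_exists[OF _ n(1) f, of 1] by auto
  define A where "A x = f x + n * (indicator \<Omega> x * Y x)" for x
  have A: "L2supp A" "Y = potential (1 + n) A" "!!x. 0 <= Y x" "!!x. Y x <= F"
   using Y by (auto simp: penalised_def A_def[abs_def])
  have "\<bar>A x\<bar> <= F + n * F" for x
  proof -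
   have "n * (indicator \<Omega> x * Y x) <= n * F" using A(3,4)[of x] n(1) F by (intro mult_left_mono) (auto simp: indicator_def)
   moreover have "0 <= n * (indicator \<Omega> x * Y x)" using A(3)[of x] n(1) by simp
   ultimately show ?thesis using f(2,3)[of x] by (simp add: A_def)
  qed
  then have "\<bar>Y x - Y x'\<bar> <= \<eta> / 8" using \<delta>(2)[OF A(1) _ xx] A(2) by simp
  then show ?thesis using n(2)[OF Y y, of x] n(2)[OF Y y, of x'] by linarith
 qed
 have "\<bar>y x - y x'\<bar> <= \<eta>" if y: "linsol 0 g y" and g: "L2supp g" "!!x. \<bar>g x\<bar> <= M" and xx: "norm (x - x') < \<delta>" for g y x x'
 proof -
  have yb: "\<bar>y x\<bar> <= M * Kdom" for x by (rule poisson_abs[OF y g(1) M]) (use g(2) in \<open>auto simp: abs_le_iff minus_le_iff\<close>)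
  define f where "f x = g x + (1 - 0) * y x" for x
  have lf: "linsol 1 f y" unfolding f_def[abs_def] by (rule linsol_change[OF y g(1)])
  have Lf: "L2supp f" unfolding f_def[abs_def] using L2supp_add[OF g(1) linsol_L2supp[OF y], of 1 1] by simp
  have fb: "\<bar>f x\<bar> <= F" for x using g(2)[of x] yb[of x] by (simp add: f_def F_def)
  note [measurable] = L2supp_measurable[OF Lf]
  have p: "L2supp (%x. max 0 (f x))" "L2supp (%x. max 0 (- f x))"
   by (rule L2supp_bounded[where M = F]; use fb F L2supp_outside[OF Lf] in \<open>auto simp: abs_le_iff max_def\<close>)+
  obtain y1 where y1: "linsol 1 (%x. max 0 (f x)) y1" using linsol_exists[OF _ p(1), of 1] by auto
  obtain y2 where y2: "linsol 1 (%x. max 0 (- f x)) y2" using linsol_exists[OF _ p(2), of 1] by auto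
  have "max 0 (f x) - max 0 (- f x) = f x" for x by (simp add: max_def)
  then have "linsol 1 f (%x. y1 x - y2 x)" using linsol_diff[OF y1 y2 p] by simp
  then have "y = (%x. y1 x - y2 x)" using linsol_unique[OF _ lf _ Lf] by simp
  then have "y x - y x' = (y1 x - y1 x') - (y2 x - y2 x')" by simp
  moreover have "\<bar>y1 x - y1 x'\<bar> <= 3 * \<eta> / 8" by (rule pos[OF p(1) _ _ y1 xx]) (use fb F in \<open>auto simp: abs_le_iff\<close>)
  moreover have "\<bar>y2 x - y2 x'\<bar> <= 3 * \<eta> / 8"
   by (rule pos[OF p(2) _ _ y2 xx]) (use fb F in \<open>auto simp: abs_le_iff minus_le_iff\<close>)
  ultimately show ?thesis using \<eta> by linarith
 qed
 then show ?thesis using \<delta>(1) by (intro exI[of _ \<delta>]) blast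
qed

end

lemma L2_complete:
 fixes v :: "nat => 'b => real"
 assumes m[measurable]: "!!k. v k \<in> borel_measurable M" and sq: "!!k. integrable M (%x. (v k x)\<^sup>2)"
  and cau: "!!e. e > 0 ==> EX N. \<forall>j\<ge>N. \<forall>k\<ge>N. (\<integral>x. (v j x - v k x)\<^sup>2 \<partial>M) <= e"
 obtains g r where "g \<in> borel_measurable M" "integrable M (%x. (g x)\<^sup>2)"
  "(%k. \<integral>x. (v k x - g x)\<^sup>2 \<partial>M) \<longlonglongrightarrow> 0" "AE x in M. (%k. v (r k) x) \<longlonglongrightarrow> g x"
proof -
 have dsq: "integrable M (%x. (v j x - v k x)\<^sup>2)" for j k
 proof -
  have "integrable M (%x. v j x * v k x)" by (rule Cauchy_Schwarz_integral(1)[OF m m sq sq])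
  moreover have "(%x. (v j x - v k x)\<^sup>2) = (%x. (v j x)\<^sup>2 + (v k x)\<^sup>2 - 2 * (v j x * v k x))"
   by (auto simp: power2_eq_square algebra_simps)
  ultimately show ?thesis using sq by simp
 qed
 have "\<forall>k::nat. EX N. \<forall>i\<ge>N. \<forall>j\<ge>N. (\<integral>x. (v i x - v j x)\<^sup>2 \<partial>M) <= (1/4)^k" using cau by simp
 then obtain N where N: "!!k i j. i >= N k ==> j >= N k ==> (\<integral>x. (v i x - v j x)\<^sup>2 \<partial>M) <= (1/4)^k" by metis
 define r where "r k = k + (\<Sum>i\<le>k. N i)" for k
 have rN: "r k >= N k" "r (Suc k) >= N k" for k
 proof -
  have "N k <= (\<Sum>i\<le>k. N i)" by (rule member_le_sum) auto
  then show "r k >= N k" "r (Suc k) >= N k" by (auto simp: r_def)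
 qed
 have rk: "r k >= k" for k by (simp add: r_def)
 define D where "D k x = v (r (Suc k)) x - v (r k) x" for k x
 have [measurable]: "D k \<in> borel_measurable M" for k unfolding D_def[abs_def] by measurable
 have nnD: "(\<integral>\<^sup>+x. ennreal (2 ^ k * (D k x)\<^sup>2) \<partial>M) <= ennreal ((1/2)^k)" for k
 proof -
  have "(\<integral>\<^sup>+x. ennreal (2 ^ k * (D k x)\<^sup>2) \<partial>M) = ennreal (\<integral>x. 2 ^ k * (D k x)\<^sup>2 \<partial>M)"
   using dsq by (intro nn_integral_eq_integral) (auto simp: D_def)
  also have "(\<integral>x. 2 ^ k * (D k x)\<^sup>2 \<partial>M) <= 2 ^ k * (1/4)^k"
   using N[OF rN(2) rN(1), of k] by (simp add: D_def)
  also have "2 ^ k * (1/4)^k = (1/2 :: real)^k" by (simp flip: power_mult_distrib)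
  finally show ?thesis by (simp add: ennreal_leI)
 qed
 have "(\<integral>\<^sup>+x. (\<Sum>k. ennreal (2 ^ k * (D k x)\<^sup>2)) \<partial>M) = (\<Sum>k. \<integral>\<^sup>+x. ennreal (2 ^ k * (D k x)\<^sup>2) \<partial>M)"
  by (rule nn_integral_suminf) measurable
 also have "\<dots> <= (\<Sum>k. ennreal ((1/2)^k))" by (rule suminf_le[OF nnD]) auto
 also have "\<dots> = ennreal (\<Sum>k. (1/2)^k)" by (rule suminf_ennreal2) (auto intro: summable_geometric)
 also have "\<dots> < \<infinity>" by simp
 finally have fin: "(\<integral>\<^sup>+x. (\<Sum>k. ennreal (2 ^ k * (D k x)\<^sup>2)) \<partial>M) < \<infinity>" .
 have "(%x. \<Sum>k. ennreal (2 ^ k * (D k x)\<^sup>2)) \<in> borel_measurable M" by measurable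
 then have "AE x in M. (\<Sum>k. ennreal (2 ^ k * (D k x)\<^sup>2)) ~= \<infinity>"
  by (rule nn_integral_PInf_AE) (use fin in simp)
 then have conv: "AE x in M. convergent (%k. v (r k) x)"
 proof eventually_elim
  case (elim x)
  then have s: "summable (%k. 2 ^ k * (D k x)\<^sup>2)" by (intro summable_suminf_not_top) auto
  from summable_imp_Bseq[OF s] obtain B where B: "B > 0" "!!k. norm (2 ^ k * (D k x)\<^sup>2) <= B" by (auto elim: BseqE)
  have b: "norm (D k x) <= sqrt B * (1 / sqrt 2) ^ k" for k
  proof -
   have "(D k x)\<^sup>2 <= B * (1/2)^k" using B(2)[of k] by (simp add: field_simps)
   then have "sqrt ((D k x)\<^sup>2) <= sqrt (B * (1/2)^k)" by (rule real_sqrt_le_mono)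
   then have "\<bar>D k x\<bar> <= sqrt (B * (1/2)^k)" by (simp only: real_sqrt_abs)
   then show ?thesis by (simp add: real_sqrt_mult real_sqrt_power real_sqrt_divide)
  qed
  have sg: "summable (%k. sqrt B * (1 / sqrt 2) ^ k)" by (intro summable_mult summable_geometric) simp
  have "summable (%k. D k x)" by (rule summable_comparison_test'[OF sg, of 0]) (rule b)
  then have "convergent (%n. \<Sum>k<n. D k x)" by (simp add: summable_iff_convergent)
  moreover have "(\<Sum>k<n. D k x) = v (r n) x - v (r 0) x" for n unfolding D_def by (rule sum_lessThan_telescope)
  ultimately have "convergent (%n. v (r n) x - v (r 0) x)" by simp
  then have "convergent (%n. (v (r n) x - v (r 0) x) + v (r 0) x)" by (intro convergent_add convergent_const)
  then show ?case by simp
 qed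
 define g where "g x = lim (%k. v (r k) x)" for x
 have [measurable]: "g \<in> borel_measurable M" unfolding g_def[abs_def] by measurable
 have lim: "AE x in M. (%k. v (r k) x) \<longlonglongrightarrow> g x"
  using conv by eventually_elim (simp add: g_def convergent_LIMSEQ_iff)
 have fatou: "(\<integral>\<^sup>+x. ennreal ((v j x - g x)\<^sup>2) \<partial>M) <= ennreal e"
  if N: "!!k. k >= N ==> (\<integral>x. (v j x - v k x)\<^sup>2 \<partial>M) <= e" for j N e
 proof -
  have "(\<integral>\<^sup>+x. ennreal ((v j x - g x)\<^sup>2) \<partial>M) = (\<integral>\<^sup>+x. liminf (%k. ennreal ((v j x - v (r k) x)\<^sup>2)) \<partial>M)"
  proof (rule nn_integral_cong_AE)
   show "AE x in M. ennreal ((v j x - g x)\<^sup>2) = liminf (%k. ennreal ((v j x - v (r k) x)\<^sup>2))"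
    using lim
   proof eventually_elim
    case (elim x)
    have "(%k. ennreal ((v j x - v (r k) x)\<^sup>2)) \<longlonglongrightarrow> ennreal ((v j x - g x)\<^sup>2)"
     by (intro tendsto_ennrealI tendsto_intros elim)
    from lim_imp_Liminf[OF _ this] show ?case by simp
   qed
  qed
  also have "\<dots> <= liminf (%k. \<integral>\<^sup>+x. ennreal ((v j x - v (r k) x)\<^sup>2) \<partial>M)"
   by (rule nn_integral_liminf) measurable
  also have "\<dots> <= ennreal e"
  proof (rule Liminf_le)
   show "\<forall>\<^sub>F k in sequentially. (\<integral>\<^sup>+x. ennreal ((v j x - v (r k) x)\<^sup>2) \<partial>M) <= ennreal e"
   proof (rule eventually_sequentiallyI[of N])
    fix k assume "N <= k"
    then have "(\<integral>x. (v j x - v (r k) x)\<^sup>2 \<partial>M) <= e" using rk[of k] by (intro N) simp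
    moreover have "(\<integral>\<^sup>+x. ennreal ((v j x - v (r k) x)\<^sup>2) \<partial>M) = ennreal (\<integral>x. (v j x - v (r k) x)\<^sup>2 \<partial>M)"
     by (rule nn_integral_eq_integral[OF dsq]) auto
    ultimately show "(\<integral>\<^sup>+x. ennreal ((v j x - v (r k) x)\<^sup>2) \<partial>M) <= ennreal e" by (simp add: ennreal_leI)
   qed
  qed simp
  finally show ?thesis .
 qed
 have fin: "integrable M (%x. (v j x - g x)\<^sup>2) & (\<integral>x. (v j x - g x)\<^sup>2 \<partial>M) <= e"
  if N: "!!k. k >= N ==> (\<integral>x. (v j x - v k x)\<^sup>2 \<partial>M) <= e" and e: "e > 0" for j N e
 proof
  have f: "(\<integral>\<^sup>+x. ennreal ((v j x - g x)\<^sup>2) \<partial>M) <= ennreal e" using N by (rule fatou)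
  show "integrable M (%x. (v j x - g x)\<^sup>2)"
   by (rule integrableI_bounded) (use f in \<open>auto intro: le_less_trans\<close>)
  then show "(\<integral>x. (v j x - g x)\<^sup>2 \<partial>M) <= e"
   using f e nn_integral_eq_integral[of M "%x. (v j x - g x)\<^sup>2"] by simp
 qed
 have to0: "(%k. \<integral>x. (v k x - g x)\<^sup>2 \<partial>M) \<longlonglongrightarrow> 0"
 proof (rule LIMSEQ_I)
  fix e :: real assume e: "e > 0"
  obtain N where "!!j k. j >= N ==> k >= N ==> (\<integral>x. (v j x - v k x)\<^sup>2 \<partial>M) <= e / 2" using cau[of "e / 2"] e by auto
  then have "(\<integral>x. (v j x - g x)\<^sup>2 \<partial>M) <= e / 2" if "j >= N" for j using fin[of N j "e / 2"] that e by auto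
  then show "EX no. \<forall>n\<ge>no. norm ((\<integral>x. (v n x - g x)\<^sup>2 \<partial>M) - 0) < e"
   using e by (intro exI[of _ N]) (force simp: abs_of_nonneg)
 qed
 have gsq: "integrable M (%x. (g x)\<^sup>2)"
 proof -
  obtain N where "!!j k. j >= N ==> k >= N ==> (\<integral>x. (v j x - v k x)\<^sup>2 \<partial>M) <= 1" using cau[of 1] by auto
  then have i: "integrable M (%x. (v N x - g x)\<^sup>2)" using fin[of N N 1] by auto
  show ?thesis
  proof (rule b_integrable_bound)
   show "integrable M (%x. 2 * (v N x)\<^sup>2 + 2 * (v N x - g x)\<^sup>2)" using i sq by simp
   show "AE x in M. norm ((g x)\<^sup>2) <= norm (2 * (v N x)\<^sup>2 + 2 * (v N x - g x)\<^sup>2)"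
   proof (rule AE_I2)
    fix x
    have "0 <= (2 * v N x - g x)\<^sup>2" by simp
    then show "norm ((g x)\<^sup>2) <= norm (2 * (v N x)\<^sup>2 + 2 * (v N x - g x)\<^sup>2)"
     by (simp add: power2_eq_square algebra_simps)
   qed
  qed measurable
 qed
 show ?thesis by (rule that[OF _ gsq to0 lim]) measurable
qed

lemma L2_pairing_tendsto:
 fixes v :: "nat => 'b => real"
 assumes [measurable]: "!!k. v k \<in> borel_measurable M" "g \<in> borel_measurable M" "u \<in> borel_measurable M"
  and sq: "!!k. integrable M (%x. (v k x)\<^sup>2)" "integrable M (%x. (g x)\<^sup>2)" "integrable M (%x. (u x)\<^sup>2)"
  and lim: "(%k. \<integral>x. (v k x - g x)\<^sup>2 \<partial>M) \<longlonglongrightarrow> 0"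
 shows "(%k. \<integral>x. v k x * u x \<partial>M) \<longlonglongrightarrow> (\<integral>x. g x * u x \<partial>M)"
proof -
 have i: "integrable M (%x. v k x * u x)" "integrable M (%x. g x * u x)" "integrable M (%x. v k x * g x)" for k
  using sq by (auto intro: Cauchy_Schwarz_integral(1))
 have d: "integrable M (%x. (v k x - g x)\<^sup>2)" for k
 proof -
  have "(%x. (v k x - g x)\<^sup>2) = (%x. (v k x)\<^sup>2 + (g x)\<^sup>2 - 2 * (v k x * g x))" by (auto simp: power2_eq_square algebra_simps)
  then show ?thesis using sq i by simp
 qed
 have b: "norm ((\<integral>x. v k x * u x \<partial>M) - (\<integral>x. g x * u x \<partial>M)) <= sqrt (\<integral>x. (v k x - g x)\<^sup>2 \<partial>M) * sqrt (\<integral>x. (u x)\<^sup>2 \<partial>M)" for k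
 proof -
  have "(\<integral>x. v k x * u x \<partial>M) - (\<integral>x. g x * u x \<partial>M) = (\<integral>x. (v k x - g x) * u x \<partial>M)" using i by (simp add: left_diff_distrib)
  moreover have "\<bar>\<integral>x. (v k x - g x) * u x \<partial>M\<bar> <= sqrt (\<integral>x. (v k x - g x)\<^sup>2 \<partial>M) * sqrt (\<integral>x. (u x)\<^sup>2 \<partial>M)"
   by (rule Cauchy_Schwarz_integral(2)) (use d sq in auto)
  ultimately show ?thesis by simp
 qed
 have l: "(%k. sqrt (\<integral>x. (v k x - g x)\<^sup>2 \<partial>M) * sqrt (\<integral>x. (u x)\<^sup>2 \<partial>M)) \<longlonglongrightarrow> 0"
  using tendsto_mult_right[OF tendsto_real_sqrt[OF lim], of "sqrt (\<integral>x. (u x)\<^sup>2 \<partial>M)"] by simp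
 have "(%k. (\<integral>x. v k x * u x \<partial>M) - (\<integral>x. g x * u x \<partial>M)) \<longlonglongrightarrow> 0"
  by (rule Lim_null_comparison[OF _ l], rule always_eventually, rule allI, rule b)
 then show ?thesis by (simp add: LIM_zero_iff)
qed

text \<open>Almost minimal elements of a decreasing sequence of convex sets are Cauchy, by the parallelogram law.\<close>
lemma almost_minimal_Cauchy:
 fixes K :: "nat => ('b => real) set"
 assumes m: "!!n u. u \<in> K n ==> u \<in> borel_measurable M" and sq: "!!n u. u \<in> K n ==> integrable M (%x. (u x)\<^sup>2)"
  and dec: "!!n. K (Suc n) \<subseteq> K n" and ne: "!!n. \<exists>u\<in>K n. (\<integral>x. (u x)\<^sup>2 \<partial>M) <= B"
  and mid: "!!n u w. u \<in> K n ==> w \<in> K n ==> (%x. (u x + w x) / 2) \<in> K n"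
 obtains v d where "!!n. v n \<in> K n" "!!n u. u \<in> K n ==> d n <= (\<integral>x. (u x)\<^sup>2 \<partial>M)"
  "!!n. (\<integral>x. (v n x)\<^sup>2 \<partial>M) <= d n + 1 / real (Suc n)"
  "!!e. e > 0 ==> EX N. \<forall>j\<ge>N. \<forall>k\<ge>N. (\<integral>x. (v j x - v k x)\<^sup>2 \<partial>M) <= e"
proof -
 define S where "S n = (%u. \<integral>x. (u x)\<^sup>2 \<partial>M) ` K n" for n
 define d where "d n = Inf (S n)" for n
 have bdd: "bdd_below (S n)" for n by (rule bdd_belowI[of _ 0]) (auto simp: S_def)
 have Sne: "S n ~= {}" for n using ne[of n] by (auto simp: S_def)
 have dl: "d n <= (\<integral>x. (u x)\<^sup>2 \<partial>M)" if "u \<in> K n" for n u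
  unfolding d_def by (rule cInf_lower[OF _ bdd]) (use that in \<open>auto simp: S_def\<close>)
 have "\<exists>u\<in>K n. (\<integral>x. (u x)\<^sup>2 \<partial>M) <= d n + 1 / real (Suc n)" for n
 proof -
  have "\<exists>s\<in>S n. s < d n + 1 / real (Suc n)"
   unfolding d_def by (rule cInf_lessD[OF Sne]) simp
  then show ?thesis by (auto simp: S_def intro: less_imp_le)
 qed
 then obtain v where v: "!!n. v n \<in> K n" "!!n. (\<integral>x. (v n x)\<^sup>2 \<partial>M) <= d n + 1 / real (Suc n)" by metis
 have decr: "K k \<subseteq> K n" if "n <= k" for n k by (rule lift_Suc_antimono_le[where f = K, OF _ that]) (rule dec)
 have dmono: "d n <= d k" if "n <= k" for n k
  unfolding d_def by (rule cInf_superset_mono[OF Sne bdd]) (use decr[OF that] in \<open>auto simp: S_def\<close>)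
 have dB: "d n <= B" for n using ne[of n] dl by (meson order_trans)
 have "incseq d" unfolding incseq_def using dmono by blast
 then obtain L where "d \<longlonglongrightarrow> L" using incseq_convergent[of d B] dB by blast
 then have cd: "Cauchy d" by (rule LIMSEQ_imp_Cauchy)
 have par: "(\<integral>x. (v n x - v k x)\<^sup>2 \<partial>M) <= 2 * (d k - d n) + 4 / real (Suc n)" if nk: "n <= k" for n k
 proof -
  have vk: "v k \<in> K n" using v(1) decr[OF nk] by blast
  have i: "integrable M (%x. v n x * v k x)"
   by (rule Cauchy_Schwarz_integral(1)[OF m[OF v(1)] m[OF v(1)] sq[OF v(1)] sq[OF v(1)]])
  note s = sq[OF v(1), of n] sq[OF v(1), of k] i
  have 1: "(\<integral>x. (v n x - v k x)\<^sup>2 \<partial>M) = (\<integral>x. (v n x)\<^sup>2 \<partial>M) + (\<integral>x. (v k x)\<^sup>2 \<partial>M) - 2 * (\<integral>x. v n x * v k x \<partial>M)"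
  proof -
   have "(\<integral>x. (v n x - v k x)\<^sup>2 \<partial>M) = (\<integral>x. (v n x)\<^sup>2 + (v k x)\<^sup>2 - 2 * (v n x * v k x) \<partial>M)"
    by (rule b_integral_cong) (auto simp: power2_eq_square algebra_simps)
   then show ?thesis using s by simp
  qed
  have 2: "(\<integral>x. ((v n x + v k x) / 2)\<^sup>2 \<partial>M) = ((\<integral>x. (v n x)\<^sup>2 \<partial>M) + (\<integral>x. (v k x)\<^sup>2 \<partial>M) + 2 * (\<integral>x. v n x * v k x \<partial>M)) / 4"
  proof -
   have "(\<integral>x. ((v n x + v k x) / 2)\<^sup>2 \<partial>M) = (\<integral>x. ((v n x)\<^sup>2 + (v k x)\<^sup>2 + 2 * (v n x * v k x)) / 4 \<partial>M)"
    by (rule b_integral_cong) (auto simp: power2_eq_square field_simps)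
   then show ?thesis using s by simp
  qed
  have "d n <= (\<integral>x. ((v n x + v k x) / 2)\<^sup>2 \<partial>M)" by (rule dl[OF mid[OF v(1) vk]])
  then have 3: "4 * d n <= (\<integral>x. (v n x)\<^sup>2 \<partial>M) + (\<integral>x. (v k x)\<^sup>2 \<partial>M) + 2 * (\<integral>x. v n x * v k x \<partial>M)" unfolding 2 by simp
  have 4: "1 / real (Suc k) <= 1 / real (Suc n)" using nk by (simp add: frac_le)
  have key: "D <= 2 * (dk - dn) + 4 * a" if "4 * dn <= A + A' + 2 * P" "a' <= a" "D = A + A' - 2 * P" "A <= dn + a" "A' <= dk + a'"
   for A A' P D a a' dn dk :: real using that by argo
  from key[OF 3 4 1 v(2) v(2)] show ?thesis by simp
 qed
 have "EX N. \<forall>j\<ge>N. \<forall>k\<ge>N. (\<integral>x. (v j x - v k x)\<^sup>2 \<partial>M) <= e" if e: "e > 0" for e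
 proof -
  obtain N1 where N1: "!!j k. j >= N1 ==> k >= N1 ==> \<bar>d k - d j\<bar> < e / 4"
   using metric_CauchyD[OF cd, of "e / 4"] e by (auto simp: dist_real_def)
  obtain N2 where N2: "8 / e < real N2" using reals_Archimedean2 by blast
  define N where "N = max N1 N2"
  have "(\<integral>x. (v j x - v k x)\<^sup>2 \<partial>M) <= e" if "j >= N" "k >= N" "j <= k" for j k
  proof -
   have "8 / e < real (Suc j)" using N2 that by (simp add: N_def)
   then have "4 / real (Suc j) <= e / 2" using e by (simp add: field_simps)
   moreover have "d k - d j <= e / 4"
    by (rule order_trans[OF abs_ge_self less_imp_le[OF N1]]) (use that in \<open>auto simp: N_def\<close>)
   then have "2 * (d k - d j) <= e / 2" by simp
   ultimately have "2 * (d k - d j) + 4 / real (Suc j) <= e / 2 + e / 2" by (intro add_mono)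
   also have "\<dots> = e" by simp
   finally show ?thesis by (rule order_trans[OF par[OF that(3)]])
  qed
  note le = this
  have "(\<integral>x. (v j x - v k x)\<^sup>2 \<partial>M) <= e" if jk: "j >= N" "k >= N" for j k
  proof (cases "j <= k")
   case False
   have "(\<integral>x. (v j x - v k x)\<^sup>2 \<partial>M) = (\<integral>x. (v k x - v j x)\<^sup>2 \<partial>M)" by (simp only: power2_commute)
   then show ?thesis using le[of k j] jk False by simp
  qed (use le[OF jk] in simp)
  then show ?thesis by blast
 qed
 then show ?thesis using that[OF v(1) dl v(2)] by blast
qed

lemma riesz_representation:
 fixes V :: "('b => real) set"
 assumes m: "!!u. u \<in> V ==> u \<in> borel_measurable M" and sq: "!!u. u \<in> V ==> integrable M (%x. (u x)\<^sup>2)"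
  and lin: "!!u w a b. u \<in> V ==> w \<in> V ==> (%x. a * u x + b * w x) \<in> V"
  and l: "!!u w a b. u \<in> V ==> w \<in> V ==> lf (%x. a * u x + b * w x) = a * lf u + b * lf w"
  and bd: "!!u. u \<in> V ==> \<bar>lf u\<bar> <= C * sqrt (\<integral>x. (u x)\<^sup>2 \<partial>M)"
 shows "EX g. g \<in> borel_measurable M & integrable M (%x. (g x)\<^sup>2) & (\<forall>u\<in>V. (\<integral>x. g x * u x \<partial>M) = lf u)"
proof (cases "\<forall>u\<in>V. lf u = 0")
 case True
 then show ?thesis by (intro exI[of _ "%x. 0"]) auto
next
 case False
 then obtain u0 where u0: "u0 \<in> V" "lf u0 ~= 0" by blast
 define K where "K = {u \<in> V. lf u = 1}"
 define w where "w = (%x. (1 / lf u0) * u0 x + 0 * u0 x)"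
 have "w \<in> V" unfolding w_def by (rule lin[OF u0(1) u0(1)])
 moreover have "lf w = 1" unfolding w_def l[OF u0(1) u0(1)] using u0(2) by simp
 ultimately have wK: "w \<in> K" by (simp add: K_def)
 have KV: "u \<in> V" "lf u = 1" if "u \<in> K" for u using that by (auto simp: K_def)
 have mid: "(%x. (u x + w x) / 2) \<in> K" if "u \<in> K" "w \<in> K" for u w
 proof -
  have "(%x. (1/2) * u x + (1/2) * w x) \<in> V" by (rule lin[OF KV(1)[OF that(1)] KV(1)[OF that(2)]])
  moreover have "lf (%x. (1/2) * u x + (1/2) * w x) = 1"
   unfolding l[OF KV(1)[OF that(1)] KV(1)[OF that(2)]] using KV(2)[OF that(1)] KV(2)[OF that(2)] by simp
  moreover have "(%x. (1/2) * u x + (1/2) * w x) = (%x. (u x + w x) / 2)" by (simp add: add_divide_distrib)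
  ultimately show ?thesis unfolding K_def by simp
 qed
 obtain v d where v: "!!n. v n \<in> K" "!!n u. u \<in> K ==> d n <= (\<integral>x. (u x)\<^sup>2 \<partial>M)"
  "!!n. (\<integral>x. (v n x)\<^sup>2 \<partial>M) <= d n + 1 / real (Suc n)"
  "!!e. e > 0 ==> EX N. \<forall>j\<ge>N. \<forall>k\<ge>N. (\<integral>x. (v j x - v k x)\<^sup>2 \<partial>M) <= e"
 proof (rule almost_minimal_Cauchy[of "%n. K" M "\<integral>x. (w x)\<^sup>2 \<partial>M"])
  show "u \<in> borel_measurable M" if "u \<in> K" for n :: nat and u by (rule m[OF KV(1)[OF that]])
  show "integrable M (%x. (u x)\<^sup>2)" if "u \<in> K" for n :: nat and u by (rule sq[OF KV(1)[OF that]])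
  show "\<exists>u\<in>K. (\<integral>x. (u x)\<^sup>2 \<partial>M) <= (\<integral>x. (w x)\<^sup>2 \<partial>M)" for n :: nat using wK by (rule bexI[rotated]) simp
  show "(%x. (u x + w x) / 2) \<in> K" if "u \<in> K" "w \<in> K" for n :: nat and u w by (rule mid[OF that])
 qed (simp, rule that)
 have vm: "v n \<in> borel_measurable M" "integrable M (%x. (v n x)\<^sup>2)" for n using v(1) KV m sq by auto
 obtain g where g: "g \<in> borel_measurable M" "integrable M (%x. (g x)\<^sup>2)" "(%k. \<integral>x. (v k x - g x)\<^sup>2 \<partial>M) \<longlonglongrightarrow> 0"
 proof (rule L2_complete[OF vm])
  fix e :: real assume "e > 0"
  then show "EX N. \<forall>j\<ge>N. \<forall>k\<ge>N. (\<integral>x. (v j x - v k x)\<^sup>2 \<partial>M) <= e" by (rule v(4))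
 qed (rule that, assumption+)
 have pair: "(%k. \<integral>x. v k x * u x \<partial>M) \<longlonglongrightarrow> (\<integral>x. g x * u x \<partial>M)" if "u \<in> borel_measurable M" "integrable M (%x. (u x)\<^sup>2)" for u
  by (rule L2_pairing_tendsto[OF vm(1) g(1) that(1) vm(2) g(2) that(2) g(3)])
 have orth: "(\<integral>x. g x * u x \<partial>M) = 0" if u: "u \<in> V" "lf u = 0" for u
 proof -
  define U where "U = (\<integral>x. (u x)\<^sup>2 \<partial>M)"
  define I where "I = (\<integral>x. g x * u x \<partial>M)"
  have q: "0 <= 2 * t * I + t\<^sup>2 * U" for t
  proof (rule LIMSEQ_le_const)
   have "(%n. 1 / real (Suc n) + 2 * t * (\<integral>x. v n x * u x \<partial>M) + t\<^sup>2 * U) \<longlonglongrightarrow> 0 + 2 * t * I + t\<^sup>2 * U"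
    unfolding I_def by (intro tendsto_intros pair m[OF u(1)] sq[OF u(1)] lim_1_over_n[THEN LIMSEQ_Suc])
   then show "(%n. 1 / real (Suc n) + 2 * t * (\<integral>x. v n x * u x \<partial>M) + t\<^sup>2 * U) \<longlonglongrightarrow> 2 * t * I + t\<^sup>2 * U" by simp
   have "0 <= 1 / real (Suc n) + 2 * t * (\<integral>x. v n x * u x \<partial>M) + t\<^sup>2 * U" for n
   proof -
    have "(%x. 1 * v n x + t * u x) \<in> V" by (rule lin[OF KV(1)[OF v(1)] u(1)])
    moreover have "lf (%x. 1 * v n x + t * u x) = 1"
     unfolding l[OF KV(1)[OF v(1)] u(1)] using KV(2)[OF v(1)] u(2) by simp
    ultimately have "(%x. 1 * v n x + t * u x) \<in> K" unfolding K_def by blast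
    then have "d n <= (\<integral>x. (1 * v n x + t * u x)\<^sup>2 \<partial>M)" by (rule v(2))
    also have "\<dots> = (\<integral>x. (v n x)\<^sup>2 + 2 * t * (v n x * u x) + t\<^sup>2 * (u x)\<^sup>2 \<partial>M)"
     by (rule b_integral_cong) (auto simp: power2_eq_square algebra_simps)
    also have "\<dots> = (\<integral>x. (v n x)\<^sup>2 \<partial>M) + 2 * t * (\<integral>x. v n x * u x \<partial>M) + t\<^sup>2 * U"
     using Cauchy_Schwarz_integral(1)[OF vm(1) m[OF u(1)] vm(2) sq[OF u(1)], of n] vm(2)[of n] sq[OF u(1)] by (simp add: U_def)
    finally show ?thesis using v(3)[of n] by linarith
   qed
   then show "EX N. \<forall>n\<ge>N. 0 <= 1 / real (Suc n) + 2 * t * (\<integral>x. v n x * u x \<partial>M) + t\<^sup>2 * U" by blast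
  qed
  have "I = 0"
  proof (rule ccontr)
   assume I: "I ~= 0"
   have U0: "U >= 0" by (simp add: U_def)
   define r where "r = 1 / (U + 1)"
   have r: "r > 0" "r * U < 1" using U0 by (auto simp: r_def)
   define t where "t = - I * r"
   have "2 * t * I + t\<^sup>2 * U = (I\<^sup>2 * r) * (r * U - 2)" by (simp add: t_def power2_eq_square algebra_simps)
   also have "\<dots> < 0" using I r by (intro mult_pos_neg) auto
   finally show False using q[of t] by simp
  qed
  then show ?thesis by (simp add: I_def)
 qed
 have iprod: "integrable M (%x. g x * u x)" if "u \<in> V" for u
  by (rule Cauchy_Schwarz_integral(1)[OF g(1) m[OF that] g(2) sq[OF that]])
 define \<beta> where "\<beta> = (\<integral>x. g x * w x \<partial>M)"
 have rep: "(\<integral>x. g x * u x \<partial>M) = lf u * \<beta>" if u: "u \<in> V" for u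
 proof -
  have "(%x. 1 * u x + (- lf u) * w x) \<in> V" by (rule lin[OF u KV(1)[OF wK]])
  moreover have "lf (%x. 1 * u x + (- lf u) * w x) = 0"
   unfolding l[OF u KV(1)[OF wK]] using KV(2)[OF wK] by simp
  ultimately have "(\<integral>x. g x * (1 * u x + (- lf u) * w x) \<partial>M) = 0" by (rule orth)
  then have "(\<integral>x. g x * u x - lf u * (g x * w x) \<partial>M) = 0" by (simp add: algebra_simps)
  then show ?thesis using iprod[OF u] iprod[OF KV(1)[OF wK]] by (simp add: \<beta>_def)
 qed
 have "\<beta> ~= 0"
 proof
  assume b0: "\<beta> = 0"
  have z: "(\<integral>x. g x * v n x \<partial>M) = 0" for n using rep[OF KV(1)[OF v(1)]] b0 by simp
  have vn: "(\<integral>x. (v n x)\<^sup>2 \<partial>M) <= (\<integral>x. (v n x - g x)\<^sup>2 \<partial>M)" for n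
  proof -
   have e: "(\<integral>x. (v n x - g x)\<^sup>2 \<partial>M) = (\<integral>x. (v n x)\<^sup>2 + (g x)\<^sup>2 - 2 * (g x * v n x) \<partial>M)"
    by (rule b_integral_cong) (auto simp: power2_eq_square algebra_simps)
   show ?thesis unfolding e using z[of n] vm(2)[of n] g(2) iprod[OF KV(1)[OF v(1)], of n] by simp
  qed
  have "(%n. \<integral>x. (v n x)\<^sup>2 \<partial>M) \<longlonglongrightarrow> 0"
   by (rule tendsto_sandwich[OF _ _ tendsto_const g(3)]) (use vn in auto)
  then have "(%n. C * sqrt (\<integral>x. (v n x)\<^sup>2 \<partial>M)) \<longlonglongrightarrow> C * sqrt 0" by (intro tendsto_intros)
  moreover have "1 <= C * sqrt (\<integral>x. (v n x)\<^sup>2 \<partial>M)" for n using bd[OF KV(1)[OF v(1)], of n] KV(2)[OF v(1), of n] by simp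
  ultimately have "1 <= C * sqrt 0" by (intro LIMSEQ_le_const) auto
  then show False by simp
 qed
 then show ?thesis
  using g rep by (intro exI[of _ "%x. inverse \<beta> * g x"]) (auto simp: power_mult_distrib mult.assoc)
qed

lemma DERIV_pos_part_square:
 "((%t::real. (max (t - k) 0)\<^sup>2) has_real_derivative 2 * max (t - k) 0) (at t)"
proof -
 consider "t > k" | "t < k" | "t = k" by linarith
 then show ?thesis
 proof cases
  case 1
  have "((%t. (t - k)\<^sup>2) has_real_derivative 2 * max (t - k) 0) (at t)"
   using 1 by (auto intro!: derivative_eq_intros)
  then show ?thesis
  proof (rule DERIV_cong_ev[OF refl _ refl, THEN iffD1, rotated])
   have "\<forall>\<^sub>F x in nhds t. x > k" using 1 by (rule eventually_nhds_in_open[OF open_greaterThan, of t k, simplified])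
   then show "\<forall>\<^sub>F x in nhds t. (x - k)\<^sup>2 = (max (x - k) 0)\<^sup>2" by eventually_elim simp
  qed
 next
  case 2
  have "((%t. 0) has_real_derivative 2 * max (t - k) 0) (at t)" using 2 by simp
  then show ?thesis
  proof (rule DERIV_cong_ev[OF refl _ refl, THEN iffD1, rotated])
   have "\<forall>\<^sub>F x in nhds t. x < k" using 2 by (rule eventually_nhds_in_open[OF open_lessThan, of t k, simplified])
   then show "\<forall>\<^sub>F x in nhds t. 0 = (max (x - k) 0)\<^sup>2" by eventually_elim simp
  qed
 next
  case 3
  have "((%h. (max h 0)\<^sup>2 / h) \<longlongrightarrow> 0) (at (0::real))"
  proof (rule Lim_null_comparison)
   show "\<forall>\<^sub>F h in at (0::real). norm ((max h 0)\<^sup>2 / h) <= \<bar>h\<bar>"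
    by (rule always_eventually) (auto simp: max_def power2_eq_square)
   show "((%h::real. \<bar>h\<bar>) \<longlongrightarrow> 0) (at 0)" by (rule tendsto_rabs_zero) (rule tendsto_ident_at)
  qed
  then show ?thesis by (simp add: DERIV_def 3)
 qed
qed

text \<open>A continuously differentiable approximation of the positive part vanishing on \<open>{..k}\<close>.\<close>
definition soft :: "real => real => real" where
 "soft k t = sqrt ((max (t - k) 0)\<^sup>2 + k\<^sup>2) - k"

definition soft' :: "real => real => real" where
 "soft' k t = max (t - k) 0 / sqrt ((max (t - k) 0)\<^sup>2 + k\<^sup>2)"

lemma soft:
 assumes k: "k > 0"
 shows "(soft k has_real_derivative soft' k t) (at t)" and "0 <= soft' k t" and "soft' k t <= 1"
  and "t <= k ==> soft k t = 0" and "0 <= soft k t" and "\<bar>max 0 t - soft k t\<bar> <= 2 * k" and "soft k t <= \<bar>t\<bar>"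
  and "cont (soft' k)"
proof -
 have pos: "0 < (max (t - k) 0)\<^sup>2 + k\<^sup>2" for t using k by (simp add: add_nonneg_pos)
 show "(soft k has_real_derivative soft' k t) (at t)"
 proof -
  have q: "((%t. (max (t - k) 0)\<^sup>2 + k\<^sup>2) has_real_derivative 2 * max (t - k) 0) (at t)"
   using DERIV_add[OF DERIV_pos_part_square DERIV_const] by simp
  from DERIV_diff[OF DERIV_chain2[OF DERIV_real_sqrt[OF pos] q] DERIV_const[of k]]
  show ?thesis unfolding soft_def[abs_def] soft'_def by (rule DERIV_cong) (simp add: field_simps)
 qed
 let ?p = "max (t - k) 0"
 have p0: "0 <= ?p" by simp
 show "0 <= soft' k t" using pos[of t] by (simp add: soft'_def)
 have "?p <= sqrt (?p\<^sup>2 + k\<^sup>2)" by (rule real_le_rsqrt) simp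
 then show "soft' k t <= 1" unfolding soft'_def using pos[of t] by (simp add: divide_le_eq)
 show "soft k t = 0" if "t <= k" using that k by (simp add: soft_def)
 have "k <= sqrt (?p\<^sup>2 + k\<^sup>2)" by (rule real_le_rsqrt) simp
 then show s0: "0 <= soft k t" by (simp add: soft_def)
 have lo: "?p - k <= soft k t" using \<open>?p <= sqrt (?p\<^sup>2 + k\<^sup>2)\<close> by (simp add: soft_def)
 have "sqrt (?p\<^sup>2 + k\<^sup>2) <= ?p + k"
  using k p0 by (intro real_le_lsqrt) (auto simp: power2_eq_square algebra_simps)
 then have hi: "soft k t <= ?p" by (simp add: soft_def)
 show "\<bar>max 0 t - soft k t\<bar> <= 2 * k" using lo hi s0 k by (auto simp: max_def abs_le_iff split: if_splits)
 show "soft k t <= \<bar>t\<bar>" using hi k by (auto simp: max_def split: if_splits)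
 show "cont (soft' k)" unfolding soft'_def[abs_def]
  by (intro continuous_intros) (use pos in \<open>metis less_irrefl real_sqrt_gt_0_iff\<close>)
qed

lemma pd_compose:
 assumes "(S has_real_derivative s) (at (f x))" "f differentiable (at x)"
 shows "pd (%x. S (f x)) b x = s * pd f b x" and "(%x. S (f x)) differentiable (at x)"
proof -
 have "(f has_derivative (%h. pd f h x)) (at x)" unfolding pd_def using assms(2) frechet_derivative_works by blast
 from has_derivative_compose[OF this assms(1)[unfolded has_field_derivative_def]]
 have "((%x. S (f x)) has_derivative (%h. s * pd f h x)) (at x)" .
 then show "pd (%x. S (f x)) b x = s * pd f b x" "(%x. S (f x)) differentiable (at x)"
  by (auto intro: pd_eq simp: differentiable_def)
qed

context corkscrew_domain begin

lemma C0dom_uniformly_continuous: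
 assumes y: "C0dom y" and e: "e > 0"
 shows "\<exists>d>0. ALL x x'. norm (x - x') < d --> \<bar>y x - y x'\<bar> < e"
proof -
 have "uniformly_continuous_on (cball 0 (rad + 1)) y"
  using y by (intro compact_uniformly_continuous) (auto simp: C0dom_def intro: continuous_on_subset)
 then obtain d where d: "d > 0" "!!x x'. norm x <= rad + 1 ==> norm x' <= rad + 1 ==> dist x x' < d ==> \<bar>y x - y x'\<bar> < e"
  unfolding uniformly_continuous_on_def dist_real_def using e by (metis mem_cball_0)
 have z: "y x = 0" if "norm x > rad" for x using y rad(3)[of x] that by (force simp: C0dom_def)
 show ?thesis
 proof (intro exI[of _ "min d 1"] conjI allI impI)
  fix x x' :: 'a assume xx: "norm (x - x') < min d 1"
  show "\<bar>y x - y x'\<bar> < e"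
  proof (cases "norm x <= rad + 1 & norm x' <= rad + 1")
   case True
   then show ?thesis using d(2)[of x x'] xx by (simp add: dist_norm)
  next
   case False
   have "norm x <= norm x' + 1" "norm x' <= norm x + 1"
    using norm_triangle_ineq2[of x x'] norm_triangle_ineq2[of x' x] xx by (auto simp: norm_minus_commute)
   then have "norm x > rad" "norm x' > rad" using False by auto
   then show ?thesis using z e by simp
  qed
 qed (use d in auto)
qed

lemma L1_mollify:
 assumes f: "L2supp f" and \<rho>: "cont \<rho>" "!!x. 0 <= \<rho> x" "!!x. norm x > r ==> \<rho> x = 0" "(LBINT x. \<rho> (x::'a)) = 1"
 shows "integrable lborel (%x. \<integral>z. f z * \<rho> (x - z) \<partial>lborel)"
  and "(LBINT x. \<bar>LBINT z. f z * \<rho> (x - z)\<bar>) <= (LBINT x. \<bar>f x\<bar>)"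
proof -
 note [measurable] = L2supp_measurable[OF f] borel_measurable_UNIV[OF \<rho>(1)]
 have i\<rho>: "integrable lborel \<rho>" by (rule integrable_compact_support[OF \<rho>(1) compact_cball[of 0 r]]) (use \<rho>(3) in auto)
 have is\<rho>: "integrable lborel (%x. \<rho> (x - z))" for z
  using lborel_integrable_affine[OF i\<rho>, of 1 "- z"] by (simp add: add.commute)
 have s1: "(LBINT x. \<rho> (x - z)) = 1" for z using lborel_integral_shift[of \<rho> "- z"] \<rho>(4) by simp
 have P: "integrable (lborel \<Otimes>\<^sub>M lborel) (%(z, x). h z * \<rho> (x - z))" if h: "integrable lborel h" for h
 proof (rule lborel_pair.Fubini_integrable)
  note [measurable] = borel_measurable_integrable[OF h]
  show "(%(z, x). h z * \<rho> (x - z)) \<in> borel_measurable (lborel \<Otimes>\<^sub>M lborel)" by measurable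
  show "AE z in lborel. integrable lborel (%x. case (z, x) of (z, x) => h z * \<rho> (x - z))" using is\<rho> by simp
  have "(LBINT x. norm (case (z, x) of (z, x) => h z * \<rho> (x - z))) = \<bar>h z\<bar>" for z
   using s1[of z] by (simp add: abs_mult abs_of_nonneg[OF \<rho>(2)])
  then show "integrable lborel (%z. \<integral>x. norm (case (z, x) of (z, x) => h z * \<rho> (x - z)) \<partial>lborel)" using h by simp
 qed
 note Pf = P[OF L2supp_integrable[OF f]] and Pa = P[OF integrable_abs[OF L2supp_integrable[OF f]]]
 show i: "integrable lborel (%x. \<integral>z. f z * \<rho> (x - z) \<partial>lborel)" by (rule lborel_pair.integrable_snd[OF Pf])
 have "(LBINT x. \<bar>LBINT z. f z * \<rho> (x - z)\<bar>) <= (LBINT x. (LBINT z. \<bar>f z\<bar> * \<rho> (x - z)))"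
 proof (rule integral_mono[OF integrable_abs[OF i] lborel_pair.integrable_snd[OF Pa]])
  show "\<bar>LBINT z. f z * \<rho> (x - z)\<bar> <= (LBINT z. \<bar>f z\<bar> * \<rho> (x - z))" for x
   using integral_abs_bound[of lborel "%z. f z * \<rho> (x - z)"] by (simp add: abs_mult abs_of_nonneg[OF \<rho>(2)])
 qed
 also have "\<dots> = (LBINT z. (LBINT x. \<bar>f z\<bar> * \<rho> (x - z)))"
  by (rule trans[OF lborel_pair.integral_snd[OF Pa] lborel_pair.integral_fst[OF Pa, symmetric]])
 also have "\<dots> = (LBINT x. \<bar>f x\<bar>)" by (simp add: s1)
 finally show "(LBINT x. \<bar>LBINT z. f z * \<rho> (x - z)\<bar>) <= (LBINT x. \<bar>f x\<bar>)" .
qed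

lemma test_fun_mollifier:
 assumes "\<epsilon> > 0" "cball x \<epsilon> \<subseteq> D" shows "test_fun D (%z. mollifier \<epsilon> (x - z))"
proof (rule test_funI[OF _ compact_cball assms(2)])
 show "smooth (%z. mollifier \<epsilon> (x - z))" using smooth_affine[OF mollifier(1)[OF assms(1)], of 1 "-1" x] by simp
 show "mollifier \<epsilon> (x - z) = 0" if "z ~: cball x \<epsilon>" for z
  using mollifier(3)[OF assms(1), of "x - z"] that by (simp add: dist_norm)
qed

text \<open>Testing the mollified equation with a truncation of the mollified solution bounds the
 gradient of the positive part.\<close>
lemma gradient_bound_pos:
 assumes y: "linsol 0 f y" and f: "L2supp f" and Y: "!!x. \<bar>y x\<bar> <= Y" and \<phi>: "test_fun \<Omega> \<phi>" and b: "b \<in> Basis"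
 shows "\<bar>LBINT x. max 0 (y x) * pd \<phi> b x\<bar> <= sqrt (Y * (LBINT x. \<bar>f x\<bar>)) * sqrt (LBINT x. (\<phi> x)\<^sup>2)"
proof -
 obtain K where K: "smooth \<phi>" "compact K" "K \<subseteq> \<Omega>" "!!x. x ~: K ==> \<phi> x = 0" "!!x b. x ~: K ==> pd \<phi> b x = 0"
  by (rule test_funE[OF \<phi>]) (rule that, assumption+)
 have cy: "cont y" by (rule linsol_cont[OF y])
 have Y0: "0 <= Y" by (rule order_trans[OF abs_ge_zero Y])
 define E where "E = Y * (LBINT x. \<bar>f x\<bar>)"
 have spd: "smooth (pd \<phi> b)" using K(1) b by (rule smooth_pd)
 have ipd: "integrable lborel (pd \<phi> b)"
  by (rule integrable_compact_support[OF smooth_continuous[OF spd] K(2)]) (rule K(5))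
 define I where "I = (LBINT x. \<bar>pd \<phi> b x\<bar>)"
 have main: "\<bar>LBINT x. max 0 (y x) * pd \<phi> b x\<bar> <= sqrt E * sqrt (LBINT x. (\<phi> x)\<^sup>2) + 3 * k * I" if k: "k > 0" for k
 proof -
  obtain d where d: "d > 0" "!!x x'. norm (x - x') < d ==> \<bar>y x - y x'\<bar> < k"
   using C0dom_uniformly_continuous[of y k] y k by (auto simp: linsol_def)
  define \<epsilon> where "\<epsilon> = d / 3"
  have \<epsilon>: "\<epsilon> > 0" "2 * \<epsilon> < d" using d by (auto simp: \<epsilon>_def)
  note mol = mollifier[OF \<epsilon>(1), where 'a = 'a]
  have mz: "mollifier \<epsilon> x = 0" if "norm x > \<epsilon>" for x :: 'a using mol(3)[of x] that by simp
  define w where "w = conv y (mollifier \<epsilon>)"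
  have sw: "smooth w" unfolding w_def by (rule smooth_conv[OF cy mol(1)]) (rule mz)
  have wy: "\<bar>w x - y x\<bar> <= k" for x
  proof -
   have "y z <= y x + k" "y x - k <= y z" if "norm (x - z) <= \<epsilon>" for z
    using d(2)[of x z] that \<epsilon> by (auto simp: abs_less_iff)
   then have "w x <= y x + k" "y x - k <= w x" unfolding w_def
    by (intro conv_mollifier_le[OF cy \<epsilon>(1)] conv_mollifier_ge[OF cy \<epsilon>(1)]; simp)+
   then show ?thesis by (simp add: abs_le_iff)
  qed
  have wY: "\<bar>w x\<bar> <= Y" for x
  proof -
   have "w x <= Y" "- Y <= w x" unfolding w_def
    by (intro conv_mollifier_le[OF cy \<epsilon>(1)] conv_mollifier_ge[OF cy \<epsilon>(1)]; use Y in \<open>simp add: abs_le_iff minus_le_iff\<close>)+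
   then show ?thesis by (simp add: abs_le_iff)
  qed
  have inside: "cball x \<epsilon> \<subseteq> \<Omega>" if "w x > k" for x
  proof
   fix z assume z: "z \<in> cball x \<epsilon>"
   show "z \<in> \<Omega>"
   proof (rule ccontr)
    assume "z ~: \<Omega>"
    then have yz: "y z = 0" by (rule linsol_outside[OF y])
    have "w x <= k" unfolding w_def
    proof (rule conv_mollifier_le[OF cy \<epsilon>(1)])
     fix z' assume "norm (x - z') <= \<epsilon>"
     then have "norm (z' - z) < d"
      using norm_triangle_ineq[of "z' - x" "x - z"] z \<epsilon> by (simp add: dist_norm norm_minus_commute)
     from d(2)[OF this] show "y z' <= k" using yz by simp
    qed
    with that show False by simp
   qed
  qed
  have lw: "lap w x = - (LBINT z. f z * mollifier \<epsilon> (x - z))" if "w x > k" for x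
  proof -
   have "lap w x = (LBINT z. y z * lap (%z. mollifier \<epsilon> (x - z)) z)"
    unfolding w_def by (rule lap_conv[OF cy mol(1)]) (rule mz)
   then show ?thesis
    using linsol_weak[OF y test_fun_mollifier[OF \<epsilon>(1) inside[OF that]]] by (simp add: wpair_def)
  qed
  note so = soft[OF k]
  define s where "s x = soft k (w x)" for x
  have ds: "pd s b x = soft' k (w x) * pd w b x" "s differentiable (at x)" for b x
   unfolding s_def[abs_def] by (rule pd_compose[OF so(1) smooth_differentiable[OF sw]])+
  have cw: "cont w" by (rule smooth_continuous[OF sw])
  have cs': "cont (%x. soft' k (w x))" by (rule continuous_on_compose2[OF so(8) cw]) auto
  have cs: "cont s"
   using ds(2) by (simp add: continuous_at_imp_continuous_on differentiable_imp_continuous_within)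
  have cds: "cont (pd s b)" if "b \<in> Basis" for b
   unfolding ds(1)[abs_def] by (intro continuous_intros cs' smooth_continuous smooth_pd sw that)
  have sz: "s x = 0" if "x ~: closure \<Omega>" for x
  proof -
   have "\<not> w x > k"
   proof
    assume "w x > k"
    from subsetD[OF inside[OF this], of x] have "x \<in> \<Omega>" using \<epsilon>(1) by simp
    then show False using that closure_subset[of \<Omega>] by blast
   qed
   then show ?thesis by (simp add: s_def so(4))
  qed
  have cO: "compact (closure \<Omega>)" using bounded_dom by (simp add: compact_closure)
  have sY: "0 <= s x" "s x <= Y" for x using so(5,7)[of "w x"] wY[of x] by (auto simp: s_def)
  have ibp: "(LBINT x. s x * pd (pd w b) b x) = - (LBINT x. soft' k (w x) * (pd w b x)\<^sup>2)"
    "integrable lborel (%x. s x * pd (pd w b) b x)" "integrable lborel (%x. soft' k (w x) * (pd w b x)\<^sup>2)" if b: "b \<in> Basis" for b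
  proof -
   have spw: "smooth (pd w b)" by (rule smooth_pd[OF sw b])
   note ip = integration_by_parts[of s b "pd w b" "closure \<Omega>", OF ds(2) cds[OF b] smooth_differentiable[OF spw]
     smooth_continuous[OF smooth_pd[OF spw b]] cO]
   have e: "pd s b x * pd w b x = soft' k (w x) * (pd w b x)\<^sup>2" for x by (simp add: ds(1) power2_eq_square)
   show "(LBINT x. s x * pd (pd w b) b x) = - (LBINT x. soft' k (w x) * (pd w b x)\<^sup>2)"
    "integrable lborel (%x. s x * pd (pd w b) b x)" "integrable lborel (%x. soft' k (w x) * (pd w b x)\<^sup>2)"
    using ip(1) ip(2) ip(3) sz unfolding e by blast+
  qed
  have energy: "(LBINT x. soft' k (w x) * (pd w b x)\<^sup>2) <= E"
  proof -
   have "(LBINT x. soft' k (w x) * (pd w b x)\<^sup>2) <= (\<Sum>b\<in>Basis. \<integral>x. soft' k (w x) * (pd w b x)\<^sup>2 \<partial>lborel)"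
    by (rule member_le_sum[OF b]) (auto intro!: integral_nonneg_AE AE_I2 simp: so(2))
   also have "\<dots> = - (\<Sum>b\<in>Basis. \<integral>x. s x * pd (pd w b) b x \<partial>lborel)" by (simp add: ibp(1) sum_negf)
   also have "\<dots> = (LBINT x. - (s x * lap w x))"
    unfolding lap_def sum_distrib_left using ibp(2) by (simp add: b_integral_sum)
   also have "\<dots> <= (LBINT x. Y * \<bar>LBINT z. f z * mollifier \<epsilon> (x - z)\<bar>)"
   proof (rule integral_mono)
    show "integrable lborel (%x. - (s x * lap w x))"
     by (intro integrable_minus integrable_compact_support[OF _ cO] continuous_intros cs smooth_lap sw) (simp add: sz)
    show "integrable lborel (%x. Y * \<bar>LBINT z. f z * mollifier \<epsilon> (x - z)\<bar>)"
     by (intro integrable_mult_right integrable_abs L1_mollify(1)[OF f smooth_continuous[OF mol(1)] mol(2) _ mol(4)]) (rule mz)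
    show "- (s x * lap w x) <= Y * \<bar>LBINT z. f z * mollifier \<epsilon> (x - z)\<bar>" for x
    proof (cases "w x > k")
     case True
     have "- (s x * lap w x) = s x * (LBINT z. f z * mollifier \<epsilon> (x - z))" by (simp add: lw[OF True])
     also have "\<dots> <= s x * \<bar>LBINT z. f z * mollifier \<epsilon> (x - z)\<bar>" using sY by (intro mult_left_mono) auto
     also have "\<dots> <= Y * \<bar>LBINT z. f z * mollifier \<epsilon> (x - z)\<bar>" using sY by (intro mult_right_mono) auto
     finally show ?thesis .
    next
     case False
     then have "s x = 0" by (simp add: s_def so(4))
     then show ?thesis using Y0 by simp
    qed
   qed
   also have "\<dots> = Y * (LBINT x. \<bar>LBINT z. f z * mollifier \<epsilon> (x - z)\<bar>)" by simp
   also have "\<dots> <= E" unfolding E_def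
    by (intro mult_left_mono Y0 L1_mollify(2)[OF f smooth_continuous[OF mol(1)] mol(2) _ mol(4)]) (rule mz)
   finally show ?thesis .
  qed
  have ibp2: "(LBINT x. s x * pd \<phi> b x) = - (LBINT x. pd s b x * \<phi> x)" "integrable lborel (%x. s x * pd \<phi> b x)"
   by (rule integration_by_parts[OF ds(2) cds[OF b] smooth_differentiable[OF K(1)] smooth_continuous[OF spd] K(2)]; use K(4) in blast)+
  have 1: "\<bar>LBINT x. s x * pd \<phi> b x\<bar> <= sqrt E * sqrt (LBINT x. (\<phi> x)\<^sup>2)"
  proof -
   have m[measurable]: "pd s b \<in> borel_measurable borel" "\<phi> \<in> borel_measurable borel"
    using cds[OF b] smooth_continuous[OF K(1)] by (auto intro: borel_measurable_UNIV)
   have le: "(pd s b x)\<^sup>2 <= soft' k (w x) * (pd w b x)\<^sup>2" for x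
   proof -
    have "(soft' k (w x))\<^sup>2 <= soft' k (w x)" using so(2,3)[of "w x"] by (simp add: power2_eq_square mult_left_le)
    then show ?thesis unfolding ds(1) power_mult_distrib by (intro mult_right_mono) auto
   qed
   have i1: "integrable lborel (%x. (pd s b x)\<^sup>2)"
    by (rule b_integrable_bound[OF ibp(3)[OF b]])
     (use le so(2) in \<open>auto intro!: AE_I2 simp: abs_of_nonneg\<close>)
   have i2: "integrable lborel (%x. (\<phi> x)\<^sup>2)"
    by (rule integrable_compact_support[OF _ K(2)]) (auto intro!: continuous_on_power smooth_continuous[OF K(1)] simp: K(4))
   have "\<bar>LBINT x. pd s b x * \<phi> x\<bar> <= sqrt (LBINT x. (pd s b x)\<^sup>2) * sqrt (LBINT x. (\<phi> x)\<^sup>2)"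
    by (rule Cauchy_Schwarz_integral(2)) (use m i1 i2 in auto)
   also have "\<dots> <= sqrt E * sqrt (LBINT x. (\<phi> x)\<^sup>2)"
   proof (intro mult_right_mono real_sqrt_le_mono)
    have "(LBINT x. (pd s b x)\<^sup>2) <= (LBINT x. soft' k (w x) * (pd w b x)\<^sup>2)"
     by (rule integral_mono[OF i1 ibp(3)[OF b] le])
    then show "(LBINT x. (pd s b x)\<^sup>2) <= E" using energy by linarith
   qed simp
   finally show ?thesis using ibp2(1) by simp
  qed
  have iy: "integrable lborel (%x. max 0 (y x) * pd \<phi> b x)"
   by (rule integrable_compact_support[OF _ K(2)])
    (auto intro!: continuous_on_mult continuous_on_max continuous_on_const cy smooth_continuous[OF spd] simp: K(5))
  have "\<bar>(LBINT x. max 0 (y x) * pd \<phi> b x) - (LBINT x. s x * pd \<phi> b x)\<bar> = \<bar>LBINT x. (max 0 (y x) - s x) * pd \<phi> b x\<bar>"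
   using iy ibp2(2) by (simp add: left_diff_distrib)
  also have "\<dots> <= (LBINT x. 3 * k * \<bar>pd \<phi> b x\<bar>)"
  proof (rule order_trans[OF integral_abs_bound], rule integral_mono)
   show "integrable lborel (%x. \<bar>(max 0 (y x) - s x) * pd \<phi> b x\<bar>)"
    using integrable_abs[OF b_integrable_diff[OF iy ibp2(2)]] by (simp add: left_diff_distrib)
   show "integrable lborel (%x. 3 * k * \<bar>pd \<phi> b x\<bar>)" using ipd by (intro integrable_mult_right integrable_abs)
   fix x
   have "\<bar>max 0 (y x) - max 0 (w x)\<bar> <= k" using wy[of x] k by (auto simp: max_def abs_le_iff)
   then have "\<bar>max 0 (y x) - s x\<bar> <= k + 2 * k"
    using so(6)[of "w x"] abs_triangle_ineq[of "max 0 (y x) - max 0 (w x)" "max 0 (w x) - soft k (w x)"] unfolding s_def by simp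
   then have "\<bar>max 0 (y x) - s x\<bar> <= 3 * k" by simp
   then show "\<bar>(max 0 (y x) - s x) * pd \<phi> b x\<bar> <= 3 * k * \<bar>pd \<phi> b x\<bar>"
    unfolding abs_mult by (intro mult_right_mono) auto
  qed
  also have "\<dots> = 3 * k * I" by (simp add: I_def)
  finally show ?thesis using 1 by linarith
 qed
 have I0: "0 <= I" by (simp add: I_def)
 have "\<bar>LBINT x. max 0 (y x) * pd \<phi> b x\<bar> <= sqrt E * sqrt (LBINT x. (\<phi> x)\<^sup>2) + e" if e: "e > 0" for e
 proof -
  define k where "k = e / (3 * (I + 1))"
  have k: "k > 0" using e I0 by (simp add: k_def)
  have "3 * k = e / (I + 1)" unfolding k_def using nonzero_mult_divide_mult_cancel_left[of 3 e "I + 1"] by simp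
  then have "3 * k * I = e * (I / (I + 1))" by simp
  also have "\<dots> <= e * 1" using e I0 by (intro mult_left_mono) (auto simp: divide_le_eq)
  finally show ?thesis using main[OF k] by simp
 qed
 then show ?thesis unfolding E_def[symmetric] by (rule field_le_epsilon)
qed

lemma gradient_exists:
 assumes y: "linsol 0 f y" and f: "L2supp f" and b: "b \<in> Basis"
 shows "EX g. g \<in> borel_measurable lborel & integrable lborel (%x. (g x)\<^sup>2) \<and>
  (ALL \<phi>. test_fun \<Omega> \<phi> --> (LBINT x. g x * \<phi> x) = - (LBINT x. y x * pd \<phi> b x))"
proof -
 obtain Y where Y: "!!x. \<bar>y x\<bar> <= Y" using C0dom_bounded[of y] y by (auto simp: linsol_def bounded_iff)
 have cy: "cont y" by (rule linsol_cont[OF y])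
 define C where "C = 2 * sqrt (Y * (LBINT x. \<bar>f x\<bar>))"
 have ic: "integrable lborel (%x. h x * pd \<phi> b x)" if "test_fun \<Omega> \<phi>" "cont h" for \<phi> h
  by (rule integrable_times_test(1)[OF that(2) test_fun_pd[OF that(1) b]])
 have bd: "\<bar>- (LBINT x. y x * pd \<phi> b x)\<bar> <= C * sqrt (LBINT x. (\<phi> x)\<^sup>2)" if \<phi>: "test_fun \<Omega> \<phi>" for \<phi>
 proof -
  have "y x * pd \<phi> b x = max 0 (y x) * pd \<phi> b x - max 0 (- y x) * pd \<phi> b x" for x by (simp add: max_def)
  then have "(LBINT x. y x * pd \<phi> b x) = (LBINT x. max 0 (y x) * pd \<phi> b x) - (LBINT x. max 0 (- y x) * pd \<phi> b x)"
   using ic[OF \<phi>, of "%x. max 0 (y x)"] ic[OF \<phi>, of "%x. max 0 (- y x)"] cy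
   by (simp add: continuous_on_max continuous_on_minus)
  moreover have "\<bar>LBINT x. max 0 (y x) * pd \<phi> b x\<bar> <= sqrt (Y * (LBINT x. \<bar>f x\<bar>)) * sqrt (LBINT x. (\<phi> x)\<^sup>2)"
   by (rule gradient_bound_pos[OF y f Y \<phi> b])
  moreover have "\<bar>LBINT x. max 0 (- y x) * pd \<phi> b x\<bar> <= sqrt (Y * (LBINT x. \<bar>- f x\<bar>)) * sqrt (LBINT x. (\<phi> x)\<^sup>2)"
   by (rule gradient_bound_pos[OF linsol_uminus[OF y f] L2supp_uminus[OF f] _ \<phi> b]) (use Y in simp)
  ultimately have "\<bar>LBINT x. y x * pd \<phi> b x\<bar> <= sqrt (Y * (LBINT x. \<bar>f x\<bar>)) * sqrt (LBINT x. (\<phi> x)\<^sup>2) +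
    sqrt (Y * (LBINT x. \<bar>f x\<bar>)) * sqrt (LBINT x. (\<phi> x)\<^sup>2)"
   using abs_triangle_ineq4[of "\<integral>x. max 0 (y x) * pd \<phi> b x \<partial>lborel" "\<integral>x. max 0 (- y x) * pd \<phi> b x \<partial>lborel"] by simp
  then show ?thesis by (simp add: C_def)
 qed
 have "EX g. g \<in> borel_measurable lborel & integrable lborel (%x. (g x)\<^sup>2) \<and>
  (\<forall>u\<in>{\<phi>. test_fun \<Omega> \<phi>}. (LBINT x. g x * u x) = - (LBINT x. y x * pd u b x))"
 proof (rule riesz_representation[where C = C])
  fix u assume "u \<in> {\<phi>. test_fun \<Omega> \<phi>}"
  then have u: "test_fun \<Omega> u" by simp
  have cu: "cont u" by (rule smooth_continuous[OF test_fun_smooth[OF u]])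
  show "u \<in> borel_measurable lborel" using cu by (simp add: borel_measurable_UNIV)
  show "integrable lborel (%x. (u x)\<^sup>2)" using integrable_times_test(1)[OF cu u] by (simp add: power2_eq_square)
  show "\<bar>- (LBINT x. y x * pd u b x)\<bar> <= C * sqrt (LBINT x. (u x)\<^sup>2)" by (rule bd[OF u])
  fix w a c assume "w \<in> {\<phi>. test_fun \<Omega> \<phi>}"
  then have w: "test_fun \<Omega> w" by simp
  show "(%x. a * u x + c * w x) \<in> {\<phi>. test_fun \<Omega> \<phi>}" using test_fun_add[OF test_fun_cmult[OF u] test_fun_cmult[OF w]] by simp
  have "pd (%x. a * u x + c * w x) b = (%x. a * pd u b x + c * pd w b x)"
   using test_fun_smooth[OF u] test_fun_smooth[OF w] by (simp add: pd_add pd_cmult smooth_cmult)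
  then have "(LBINT x. y x * pd (%x. a * u x + c * w x) b x) = (LBINT x. a * (y x * pd u b x) + c * (y x * pd w b x))"
   by (simp add: algebra_simps)
  then show "- (LBINT x. y x * pd (%x. a * u x + c * w x) b x) = a * - (LBINT x. y x * pd u b x) + c * - (LBINT x. y x * pd w b x)"
   using ic[OF u cy] ic[OF w cy] by simp
 qed
 then show ?thesis by auto
qed

end

lemma borel_measurable_completion_AE:
 fixes k :: "'b => real"
 assumes h: "h \<in> borel_measurable M" and ae: "AE x in M. k x = h x"
 shows "k \<in> borel_measurable (completion M)"
proof (rule measurableI)
 fix A :: "real set" assume A: "A \<in> sets borel"
 show "k -` A \<inter> space (completion M) \<in> sets (completion M)"
 proof (rule completion.in_sets_AE)
  show "h -` A \<inter> space (completion M) \<in> sets (completion M)"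
   using measurable_sets[OF measurable_completion[OF h] A] .
  show "AE x in completion M. (x \<in> h -` A \<inter> space (completion M)) = (x \<in> k -` A \<inter> space (completion M))"
   using AE_completion[OF ae] by eventually_elim simp
 qed auto
qed auto

context corkscrew_domain begin

lemma lebesgue_dom:
 fixes h k :: "'a => real"
 assumes h: "h \<in> borel_measurable borel" "!!x. x ~: \<Omega> ==> h x = 0" and ae: "AE x in lborel. x \<in> \<Omega> --> k x = h x"
 shows "(LINT x:\<Omega>|lebesgue. k x) = (LBINT x. h x)"
  and "set_integrable lebesgue \<Omega> k \<longleftrightarrow> integrable lborel h"
proof -
 have hl: "h \<in> borel_measurable lborel" using h by simp
 have e: "AE x in lborel. indicator \<Omega> x *\<^sub>R k x = h x" using ae by eventually_elim (use h(2) in \<open>auto simp: indicator_def\<close>)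
 note e' = AE_completion[OF e]
 have mk: "(%x. indicator \<Omega> x *\<^sub>R k x) \<in> borel_measurable lebesgue" by (rule borel_measurable_completion_AE[OF hl e])
 have mh: "h \<in> borel_measurable lebesgue" using hl by (rule measurable_completion)
 show "(LINT x:\<Omega>|lebesgue. k x) = (LBINT x. h x)"
  unfolding set_lebesgue_integral_def integral_cong_AE[OF mk mh e'] by (rule integral_completion[OF hl])
 show "set_integrable lebesgue \<Omega> k \<longleftrightarrow> integrable lborel h"
  unfolding set_integrable_def integrable_cong_AE[OF mk mh e'] by (rule integrable_completion[OF hl])
qed

definition rep :: "('a => real) => ('a => real) => bool" where
 "rep f f' \<longleftrightarrow> L2supp f' & (AE x in lborel. x \<in> \<Omega> --> f x = f' x)"

lemma rep_self: "L2supp f ==> rep f f" by (simp add: rep_def)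

lemma rep_L2: "rep f f' ==> L2supp f'" by (simp add: rep_def)

lemma rep_linear: assumes "rep f f'" "rep g g'" shows "rep (%x. a * f x + b * g x) (%x. a * f' x + b * g' x)"
 using assms unfolding rep_def by (auto simp: L2supp_add elim: eventually_elim2)

lemma rep_diff: assumes "rep f f'" "rep g g'" shows "rep (%x. f x - g x) (%x. f' x - g' x)"
 using rep_linear[OF assms, of 1 "-1"] by simp

lemma L2fun_rep: assumes "L2fun \<Omega> f" obtains f' where "rep f f'"
proof -
 obtain g where g: "g \<in> borel_measurable lborel" "AE x in lborel. f x = g x"
  using completion_ex_borel_measurable_real[of f lborel] assms by (auto simp: L2fun_def)
 define f' where "f' x = indicator \<Omega> x * g x" for x
 have m[measurable]: "f' \<in> borel_measurable borel" using g(1) open_dom unfolding f'_def by (auto intro!: borel_measurable_times)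
 have ae: "AE x in lborel. x \<in> \<Omega> --> f x = f' x" using g(2) by eventually_elim (simp add: f'_def)
 have "integrable lborel (%x. (f' x)\<^sup>2)"
 proof (rule lebesgue_dom(2)[THEN iffD1])
  show "AE x in lborel. x \<in> \<Omega> --> (f x)\<^sup>2 = (f' x)\<^sup>2" using ae by eventually_elim simp
  show "set_integrable lebesgue \<Omega> (%x. (f x)\<^sup>2)" using assms by (simp add: L2fun_def)
  show "(%x. (f' x)\<^sup>2) \<in> borel_measurable borel" by measurable
  show "(f' x)\<^sup>2 = 0" if "x ~: \<Omega>" for x using that by (simp add: f'_def)
 qed
 then have "rep f f'" using ae m by (auto simp: rep_def L2supp_def f'_def)
 then show ?thesis by (rule that)
qed

lemma rep_L2norm: assumes "rep f f'" shows "L2norm \<Omega> f = sqrt (LBINT x. (f' x)\<^sup>2)"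
proof -
 have "(LINT x:\<Omega>|lebesgue. (f x)\<^sup>2) = (LBINT x. (f' x)\<^sup>2)"
  by (rule lebesgue_dom(1)) (use assms in \<open>auto simp: rep_def L2supp_def elim: eventually_mono\<close>)
 then show ?thesis by (simp add: L2norm_def)
qed

lemma weak_dirichlet_identity:
 assumes y: "C0dom y" and Ny: "C0dom (%x. N x (y x))"
  and G: "G \<in> borel_measurable lebesgue" "set_integrable lebesgue \<Omega> (%x. (norm (G x))\<^sup>2)" "weak_grad \<Omega> y G" and \<phi>: "test_fun \<Omega> \<phi>"
 shows "(LINT x:\<Omega>|lebesgue. (\<Sum>b\<in>Basis. (G x \<bullet> b) * pd \<phi> b x) + N x (y x) * \<phi> x) = wpair 0 y \<phi> + (LBINT x. N x (y x) * \<phi> x)"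
proof -
 have cy: "cont y" and cN: "cont (%x. N x (y x))" using y Ny by (auto simp: C0dom_def)
 have tb: "test_fun \<Omega> (pd \<phi> b)" if "b \<in> Basis" for b by (rule test_fun_pd[OF \<phi> that])
 have O: "\<Omega> \<in> sets lebesgue" using open_dom by (simp add: borel_open)
 have iG: "set_integrable lebesgue \<Omega> (%x. (G x \<bullet> b) * pd \<phi> b x)" if b: "b \<in> Basis" for b
 proof -
  have mi: "(indicator \<Omega> :: 'a => real) \<in> borel_measurable lebesgue" using O by simp
  have mG: "(%x. G x \<bullet> b) \<in> borel_measurable lebesgue" using G(1) by simp
  have ct: "cont (pd \<phi> b)" by (rule smooth_continuous[OF test_fun_smooth[OF tb[OF b]]])
  have mt: "pd \<phi> b \<in> borel_measurable lborel" using borel_measurable_UNIV[OF ct] by simp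
  have m1: "(%x. indicator \<Omega> x * (G x \<bullet> b)) \<in> borel_measurable lebesgue" by (rule borel_measurable_times[OF mi mG])
  have "integrable lebesgue (%x. (indicator \<Omega> x * (G x \<bullet> b)) * pd \<phi> b x)"
  proof (rule Cauchy_Schwarz_integral(1)[OF m1 measurable_completion[OF mt]])
   show "integrable lebesgue (%x. (indicator \<Omega> x * (G x \<bullet> b))\<^sup>2)"
   proof (rule b_integrable_bound[OF G(2)[unfolded set_integrable_def]])
    show "AE x in lebesgue. norm ((indicator \<Omega> x * (G x \<bullet> b))\<^sup>2) <= norm (indicator \<Omega> x *\<^sub>R (norm (G x))\<^sup>2)"
    proof (rule AE_I2)
     fix x
     have "\<bar>G x \<bullet> b\<bar> <= norm (G x)" by (rule Basis_le_norm[OF b])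
     then have "(G x \<bullet> b)\<^sup>2 <= (norm (G x))\<^sup>2" using power_mono[of "\<bar>G x \<bullet> b\<bar>" "norm (G x)" 2] by simp
     then show "norm ((indicator \<Omega> x * (G x \<bullet> b))\<^sup>2) <= norm (indicator \<Omega> x *\<^sub>R (norm (G x))\<^sup>2)"
      by (auto simp: indicator_def)
    qed
    show "(%x. (indicator \<Omega> x * (G x \<bullet> b))\<^sup>2) \<in> borel_measurable lebesgue" by (rule borel_measurable_power[OF m1])
   qed
   show "integrable lebesgue (%x. (pd \<phi> b x)\<^sup>2)"
    using integrable_times_test(1)[OF ct tb[OF b]] mt by (simp add: power2_eq_square integrable_completion)
  qed
  then show ?thesis by (simp add: set_integrable_def mult.assoc)
 qed
 have mN: "(%x. N x (y x) * \<phi> x) \<in> borel_measurable borel"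
  by (intro borel_measurable_UNIV continuous_on_mult cN smooth_continuous[OF test_fun_smooth[OF \<phi>]])
 note dN = lebesgue_dom[OF mN, of "%x. N x (y x) * \<phi> x"]
 have iN: "set_integrable lebesgue \<Omega> (%x. N x (y x) * \<phi> x)" "(LINT x:\<Omega>|lebesgue. N x (y x) * \<phi> x) = (LBINT x. N x (y x) * \<phi> x)"
  using dN test_fun_outside[OF \<phi>] integrable_times_test(1)[OF cN \<phi>] by simp_all
 have gb: "(LINT x:\<Omega>|lebesgue. (G x \<bullet> b) * pd \<phi> b x) = - (LBINT x. y x * pd (pd \<phi> b) b x)" if b: "b \<in> Basis" for b
 proof -
  have "(%x. y x * pd (pd \<phi> b) b x) \<in> borel_measurable borel"
   by (intro borel_measurable_UNIV continuous_on_mult cy smooth_continuous[OF test_fun_smooth[OF test_fun_pd[OF tb[OF b] b]]])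
  then have "(LINT x:\<Omega>|lebesgue. y x * pd (pd \<phi> b) b x) = (LBINT x. y x * pd (pd \<phi> b) b x)"
   by (rule lebesgue_dom(1)) (use y in \<open>auto simp: C0dom_def\<close>)
  moreover have "(LINT x:\<Omega>|lebesgue. y x * pd (pd \<phi> b) b x) = - (LINT x:\<Omega>|lebesgue. (G x \<bullet> b) * pd \<phi> b x)"
   using G(3) tb[OF b] b unfolding weak_grad_def by blast
  ultimately show ?thesis by simp
 qed
 have iS: "set_integrable lebesgue \<Omega> (%x. \<Sum>b\<in>Basis. (G x \<bullet> b) * pd \<phi> b x)"
  unfolding set_integrable_def scaleR_sum_right using iG by (intro b_integrable_sum) (simp add: set_integrable_def)
 have "(LINT x:\<Omega>|lebesgue. (\<Sum>b\<in>Basis. (G x \<bullet> b) * pd \<phi> b x)) = (\<Sum>b\<in>Basis. LINT x:\<Omega>|lebesgue. (G x \<bullet> b) * pd \<phi> b x)"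
  unfolding set_lebesgue_integral_def scaleR_sum_right
  using iG by (intro b_integral_sum) (simp add: set_integrable_def)
 also have "\<dots> = (\<Sum>b\<in>Basis. - (LBINT x. y x * pd (pd \<phi> b) b x))" by (simp add: gb)
 also have "\<dots> = - (LBINT x. (\<Sum>b\<in>Basis. y x * pd (pd \<phi> b) b x))"
  using integrable_times_test(1)[OF cy test_fun_pd[OF tb]] by (subst b_integral_sum) (auto simp: sum_negf)
 also have "\<dots> = wpair 0 y \<phi>" by (simp add: wpair_def lap_def sum_distrib_left)
 finally show ?thesis using set_integral_add(2)[OF iS iN(1)] iN(2) by simp
qed

lemma weak_dirichlet_iff:
 assumes f: "rep f f'" and N0: "!!y. C0dom y ==> C0dom (%x. N x (y x))"
 shows "weak_dirichlet \<Omega> N f y \<longleftrightarrow> linsol 0 (%x. f' x - N x (y x)) y"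
proof -
 have rhs: "(LINT x:\<Omega>|lebesgue. f x * \<phi> x) = (LBINT x. f' x * \<phi> x)" if \<phi>: "test_fun \<Omega> \<phi>" for \<phi>
 proof (rule lebesgue_dom(1))
  have "f' \<in> borel_measurable borel" "\<phi> \<in> borel_measurable borel"
   using f smooth_continuous[OF test_fun_smooth[OF \<phi>]] by (auto simp: rep_def L2supp_def borel_measurable_UNIV)
  then show "(%x. f' x * \<phi> x) \<in> borel_measurable borel" by simp
  show "AE x in lborel. x \<in> \<Omega> --> f x * \<phi> x = f' x * \<phi> x" using f unfolding rep_def by (auto elim: eventually_mono)
 qed (use test_fun_outside[OF \<phi>] in auto)
 have split: "(LBINT x. (f' x - N x (y x)) * \<phi> x) = (LBINT x. f' x * \<phi> x) - (LBINT x. N x (y x) * \<phi> x)"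
  if y: "C0dom y" and \<phi>: "test_fun \<Omega> \<phi>" for \<phi>
  unfolding left_diff_distrib
  by (rule b_integral_diff[OF integrable_L2supp_test[OF rep_L2[OF f] \<phi>] integrable_L2supp_test[OF C0dom_L2supp[OF N0[OF y]] \<phi>]])
 show ?thesis
 proof
  assume w: "weak_dirichlet \<Omega> N f y"
  then have y: "C0dom y" by (simp add: weak_dirichlet_def C0dom_def)
  from w obtain G where G: "G \<in> borel_measurable lebesgue" "set_integrable lebesgue \<Omega> (%x. (norm (G x))\<^sup>2)" "weak_grad \<Omega> y G"
   "!!\<phi>. test_fun \<Omega> \<phi> ==> (LINT x:\<Omega>|lebesgue. (\<Sum>b\<in>Basis. (G x \<bullet> b) * pd \<phi> b x) + N x (y x) * \<phi> x) = (LINT x:\<Omega>|lebesgue. f x * \<phi> x)"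
   unfolding weak_dirichlet_def by blast
  show "linsol 0 (%x. f' x - N x (y x)) y" unfolding linsol_def
  proof (intro conjI allI impI y)
   fix \<phi> assume \<phi>: "test_fun \<Omega> \<phi>"
   show "wpair 0 y \<phi> = (LBINT x. (f' x - N x (y x)) * \<phi> x)"
    using weak_dirichlet_identity[of y N G \<phi>, OF y N0[OF y] G(1-3) \<phi>] G(4)[OF \<phi>] rhs[OF \<phi>] split[OF y \<phi>] by simp
  qed
 next
  assume l: "linsol 0 (%x. f' x - N x (y x)) y"
  then have y: "C0dom y" by (simp add: linsol_def)
  have L: "L2supp (%x. f' x - N x (y x))" by (rule L2supp_diff[OF rep_L2[OF f] C0dom_L2supp[OF N0[OF y]]])
  have "\<forall>b\<in>Basis. EX g. g \<in> borel_measurable lborel & integrable lborel (%x. (g x)\<^sup>2) \<and>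
   (ALL \<phi>. test_fun \<Omega> \<phi> --> (LBINT x. g x * \<phi> x) = - (LBINT x. y x * pd \<phi> b x))"
   using gradient_exists[OF l L] by blast
  from bchoice[OF this] obtain g where "\<forall>b\<in>Basis. g b \<in> borel_measurable lborel & integrable lborel (%x. (g b x)\<^sup>2) \<and>
   (ALL \<phi>. test_fun \<Omega> \<phi> --> (LBINT x. g b x * \<phi> x) = - (LBINT x. y x * pd \<phi> b x))" ..
  then have g: "!!b. b \<in> Basis ==> g b \<in> borel_measurable lborel" "!!b. b \<in> Basis ==> integrable lborel (%x. (g b x)\<^sup>2)"
   "!!b \<phi>. b \<in> Basis ==> test_fun \<Omega> \<phi> ==> (LBINT x. g b x * \<phi> x) = - (LBINT x. y x * pd \<phi> b x)"
   by blast+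
  define G where "G x = (\<Sum>b\<in>Basis. g b x *\<^sub>R b)" for x
  have Gb: "G x \<bullet> b = g b x" if "b \<in> Basis" for x b using that by (simp add: G_def inner_sum_left inner_Basis if_distrib cong: if_cong)
  have mG: "G \<in> borel_measurable lborel" unfolding G_def using g(1) by (intro borel_measurable_sum borel_measurable_scaleR) auto
  have nG: "(norm (G x))\<^sup>2 = (\<Sum>b\<in>Basis. (g b x)\<^sup>2)" for x
   by (subst power2_norm_eq_inner, subst euclidean_inner) (simp add: Gb power2_eq_square)
  have O: "\<Omega> \<in> sets lebesgue" using open_dom by (simp add: borel_open)
  have G: "G \<in> borel_measurable lebesgue" "set_integrable lebesgue \<Omega> (%x. (norm (G x))\<^sup>2)" "weak_grad \<Omega> y G"
  proof -
   show "G \<in> borel_measurable lebesgue" using mG by (rule measurable_completion)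
   have "integrable lborel (%x. (norm (G x))\<^sup>2)" unfolding nG using g(2) by (intro b_integrable_sum)
   then have "integrable lebesgue (%x. (norm (G x))\<^sup>2)" using mG by (subst integrable_completion) auto
   then show "set_integrable lebesgue \<Omega> (%x. (norm (G x))\<^sup>2)" unfolding set_integrable_def by (rule integrable_mult_indicator[OF O])
   show "weak_grad \<Omega> y G" unfolding weak_grad_def
   proof (intro allI impI ballI)
    fix \<phi> and b :: 'a assume \<phi>: "test_fun \<Omega> \<phi>" and b: "b \<in> Basis"
    have m: "(%x. y x * pd \<phi> b x) \<in> borel_measurable borel"
     using y by (intro borel_measurable_UNIV continuous_on_mult smooth_continuous[OF test_fun_smooth[OF test_fun_pd[OF \<phi> b]]]) (simp add: C0dom_def)
    have 1: "(LINT x:\<Omega>|lebesgue. y x * pd \<phi> b x) = (LBINT x. y x * pd \<phi> b x)"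
     using m by (rule lebesgue_dom(1)) (use y in \<open>auto simp: C0dom_def\<close>)
    have m2: "(%x. g b x * \<phi> x) \<in> borel_measurable borel"
     using g(1)[OF b] borel_measurable_UNIV[OF smooth_continuous[OF test_fun_smooth[OF \<phi>]]] by simp
    have 2: "(LINT x:\<Omega>|lebesgue. (G x \<bullet> b) * \<phi> x) = (LBINT x. g b x * \<phi> x)"
     using m2 by (rule lebesgue_dom(1)) (use test_fun_outside[OF \<phi>] in \<open>auto simp: Gb[OF b]\<close>)
    show "(LINT x:\<Omega>|lebesgue. y x * pd \<phi> b x) = - (LINT x:\<Omega>|lebesgue. (G x \<bullet> b) * \<phi> x)"
     unfolding 1 2 g(3)[OF b \<phi>] by simp
   qed
  qed
  have "(LINT x:\<Omega>|lebesgue. (\<Sum>b\<in>Basis. (G x \<bullet> b) * pd \<phi> b x) + N x (y x) * \<phi> x) = (LINT x:\<Omega>|lebesgue. f x * \<phi> x)"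
   if \<phi>: "test_fun \<Omega> \<phi>" for \<phi>
   using weak_dirichlet_identity[of y N G \<phi>, OF y N0[OF y] G(1-3) \<phi>] linsol_weak[OF l \<phi>] rhs[OF \<phi>] split[OF y \<phi>] by simp
  then show "weak_dirichlet \<Omega> N f y" unfolding weak_dirichlet_def using y G
   by (intro conjI exI[of _ G]) (auto simp: C0dom_def)
 qed
qed

lemma sol_eqI:
 assumes f: "rep f f'" and N0: "!!y. C0dom y ==> C0dom (%x. N x (y x))"
  and mono: "!!x s t. s <= t ==> N x s <= N x t" and y: "linsol 0 (%x. f' x - N x (y x)) y"
 shows "sol \<Omega> N f = y"
 unfolding sol_def
proof (rule the_equality)
 show "weak_dirichlet \<Omega> N f y" using weak_dirichlet_iff[OF f, of N y] N0 y by blast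
 fix z assume "weak_dirichlet \<Omega> N f z"
 then have z: "linsol 0 (%x. f' x - N x (z x)) z" using weak_dirichlet_iff[OF f, of N z] N0 by blast
 have L: "L2supp (%x. f' x - N x (w x))" if "linsol 0 (%x. f' x - N x (w x)) w" for w
  using that by (intro L2supp_diff[OF rep_L2[OF f]] C0dom_L2supp N0) (simp add: linsol_def)
 show "z = y" using z L[OF z] y L[OF y] mono by (rule semilinear_unique[where N = N])
qed

lemma linear_exists:
 assumes q: "C0dom q" and f: "L2supp f"
 shows "EX z. linsol 0 (%x. f x - 3 * (q x)\<^sup>2 * z x) z"
proof -
 obtain Y where Y: "!!x. \<bar>q x\<bar> <= Y" using C0dom_bounded[OF q] by (auto simp: bounded_iff)
 have q2: "(q x)\<^sup>2 <= Y\<^sup>2" for x using power_mono[OF Y[of x], of 2] by simp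
 show ?thesis
 proof (rule semilinear_exists[where N = "%x t. 3 * (q x)\<^sup>2 * t" and \<Lambda> = "3 * Y\<^sup>2 + 1", OF f])
  show "0 <= 3 * (q x)\<^sup>2 * t - 3 * (q x)\<^sup>2 * s" if "s <= t" for x s t using that by (simp add: mult_left_mono)
  show "3 * (q x)\<^sup>2 * t - 3 * (q x)\<^sup>2 * s <= (3 * Y\<^sup>2 + 1) * (t - s)" if "s <= t" for x s t
  proof -
   have "3 * (q x)\<^sup>2 * (t - s) <= (3 * Y\<^sup>2 + 1) * (t - s)" using that q2[of x] by (intro mult_right_mono) auto
   then show ?thesis by (simp add: algebra_simps)
  qed
  show "(%x. 3 * (q x)\<^sup>2 * y x) \<in> borel_measurable borel" if "cont y" for y
   using q that by (intro borel_measurable_UNIV continuous_intros) (auto simp: C0dom_def)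
 qed (auto simp: add_nonneg_pos)
qed

definition cstate :: "('a => real) => ('a => real) => bool" where
 "cstate u y \<longleftrightarrow> linsol 0 (%x. u x - (y x) ^ 3) y"

lemma C0dom_cube: "C0dom y ==> C0dom (%x. (y x) ^ 3)"
 by (auto simp: C0dom_def intro!: continuous_intros)

lemma cstate_C0dom: "cstate u y ==> C0dom y" by (simp add: cstate_def linsol_def)

lemma cstate_rhs: "cstate u y ==> L2supp u ==> L2supp (%x. u x - (y x) ^ 3)"
 by (rule L2supp_diff) (simp_all add: C0dom_L2supp C0dom_cube cstate_C0dom)

lemma cstate_bound:
 assumes y: "cstate u y" and u: "L2supp u" "!!x. \<bar>u x\<bar> <= F" shows "\<bar>y x\<bar> <= F * Kdom"
proof (rule poisson_abs[OF y[unfolded cstate_def] cstate_rhs[OF y u(1)]])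
 show "0 <= F" by (rule order_trans[OF abs_ge_zero u(2)])
 show "u x - (y x) ^ 3 <= F" if "0 < y x" for x
  using u(2)[of x] zero_le_power[OF less_imp_le[OF that], of 3] unfolding abs_le_iff by linarith
 show "- F <= u x - (y x) ^ 3" if "y x < 0" for x
 proof -
  have "0 <= - y x" using that by simp
  from zero_le_power[OF this, of 3] have "y x ^ 3 <= 0" by simp
  then show ?thesis using u(2)[of x] unfolding abs_le_iff by linarith
 qed
qed

lemma cube_diff: "b ^ 3 - a ^ 3 = (b - a) * (b\<^sup>2 + a * b + a\<^sup>2)" for a b :: real
 by (simp add: power2_eq_square power3_eq_cube algebra_simps)

lemma cube_factor_nonneg: "0 <= b\<^sup>2 + a * b + a\<^sup>2" for a b :: real
proof -
 have "b\<^sup>2 + a * b + a\<^sup>2 = (b + a / 2)\<^sup>2 + 3 / 4 * a\<^sup>2" by (simp add: power2_eq_square algebra_simps)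
 then show ?thesis by simp
qed

lemma cube_mono: "s <= t ==> s ^ 3 <= t ^ 3" for s t :: real
 using mult_nonneg_nonneg[OF _ cube_factor_nonneg, of "t - s" t s] unfolding cube_diff[symmetric] by simp

lemma cstate_exists:
 assumes u: "L2supp u" "!!x. \<bar>u x\<bar> <= F" shows "EX y. cstate u y"
proof -
 have F: "0 <= F" by (rule order_trans[OF abs_ge_zero u(2)])
 define M where "M = F * Kdom + 1"
 have M: "M > 0" using F Kdom_nonneg by (simp add: M_def add_nonneg_pos)
 define T where "T t = max (- M) (min M t)" for t
 have Tm: "T s <= T t" "T t - T s <= t - s" if "s <= t" for s t using that by (auto simp: T_def)
 have Tb: "\<bar>T t\<bar> <= M" for t using M by (auto simp: T_def)
 have "EX y. linsol 0 (%x. u x - (T (y x)) ^ 3) y"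
 proof (rule semilinear_exists[where N = "%x t. (T t) ^ 3" and \<Lambda> = "3 * M\<^sup>2", OF u(1)])
  show "0 <= (T t) ^ 3 - (T s) ^ 3" if "s <= t" for s t using cube_mono[OF Tm(1)[OF that]] by simp
  show "(T t) ^ 3 - (T s) ^ 3 <= 3 * M\<^sup>2 * (t - s)" if st: "s <= t" for s t
  proof -
   have "(T t)\<^sup>2 <= M\<^sup>2" "(T s)\<^sup>2 <= M\<^sup>2" using power_mono[OF Tb[of t], of 2] power_mono[OF Tb[of s], of 2] by auto
   moreover have "T s * T t <= M\<^sup>2"
   proof -
    have "\<bar>T s * T t\<bar> <= M * M" unfolding abs_mult using Tb M by (intro mult_mono) auto
    then show ?thesis by (simp add: power2_eq_square)
   qed
   ultimately have "(T t)\<^sup>2 + T s * T t + (T s)\<^sup>2 <= 3 * M\<^sup>2" by simp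
   then have "(T t - T s) * ((T t)\<^sup>2 + T s * T t + (T s)\<^sup>2) <= (t - s) * (3 * M\<^sup>2)"
    using Tm[OF st] cube_factor_nonneg[of "T t" "T s"] st by (intro mult_mono) auto
   then show ?thesis unfolding cube_diff by (simp add: mult.commute)
  qed
  show "(%x. (T (y x)) ^ 3) \<in> borel_measurable borel" if "cont y" for y :: "'a => real"
   unfolding T_def using that by (intro borel_measurable_UNIV continuous_intros)
 qed (use M in \<open>auto simp: T_def\<close>)
 then obtain y where y: "linsol 0 (%x. u x - (T (y x)) ^ 3) y" by blast
 have "C0dom (%x. (T (y x)) ^ 3)" unfolding C0dom_def T_def
  using linsol_cont[OF y] linsol_outside[OF y] M by (auto intro!: continuous_intros)
 then have L: "L2supp (%x. u x - (T (y x)) ^ 3)" by (intro L2supp_diff u(1) C0dom_L2supp)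
 have "\<bar>y x\<bar> <= F * Kdom" for x
 proof (rule poisson_abs[OF y L F])
  show "u x - (T (y x)) ^ 3 <= F" if "0 < y x" for x
  proof -
   have "0 <= T (y x)" using that M by (auto simp: T_def)
   then have "0 <= T (y x) ^ 3" by (rule zero_le_power)
   then show ?thesis using u(2)[of x] unfolding abs_le_iff by linarith
  qed
  show "- F <= u x - (T (y x)) ^ 3" if "y x < 0" for x
  proof -
   have "0 <= - T (y x)" using that M by (auto simp: T_def)
   from zero_le_power[OF this, of 3] have "T (y x) ^ 3 <= 0" by simp
   then show ?thesis using u(2)[of x] unfolding abs_le_iff by linarith
  qed
 qed
 then have "T (y x) = y x" for x
 proof -
  have "\<bar>y x\<bar> <= M" unfolding M_def using \<open>!!x. \<bar>y x\<bar> <= F * Kdom\<close>[of x] by linarith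
  then show ?thesis by (auto simp: T_def)
 qed
 then show ?thesis using y by (auto simp: cstate_def)
qed

lemma cstate_unique: assumes "cstate u y" "cstate u z" "L2supp u" shows "y = z"
 using assms(1)[unfolded cstate_def] cstate_rhs[OF assms(1,3)] assms(2)[unfolded cstate_def] cstate_rhs[OF assms(2,3)] cube_mono
 by (rule semilinear_unique[where N = "%x t. t ^ 3"])

lemma state_eqI: assumes "rep u u'" "cstate u' y" shows "state \<Omega> u = y"
 unfolding state_def
proof (rule sol_eqI[where N = "%x t. t ^ 3", OF assms(1)])
 show "linsol 0 (%x. u' x - y x ^ 3) y" using assms(2) by (simp add: cstate_def)
qed (rule C0dom_cube, assumption, rule cube_mono)

lemma linear_sol_eqI:
 assumes q: "C0dom q" and f: "rep f f'" and z: "linsol 0 (%x. f' x - 3 * (q x)\<^sup>2 * z x) z"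
 shows "sol \<Omega> (%x t. 3 * (q x)\<^sup>2 * t) f = z"
proof (rule sol_eqI[where N = "%x t. 3 * (q x)\<^sup>2 * t", OF f _ _ z])
 show "C0dom (%x. 3 * (q x)\<^sup>2 * y x)" if "C0dom y" for y
  using q that by (auto simp: C0dom_def intro!: continuous_intros)
qed (simp add: mult_left_mono)

end

text \<open>Above the graph the complement contains a cone with axis \<open>e\<close>.\<close>
lemma lipschitz_domain_corkscrew:
 fixes \<Omega> :: "'a::euclidean_space set"
 assumes dom: "lipschitz_domain \<Omega>"
 shows "\<exists>\<sigma>>0. \<exists>\<tau>0>0. \<sigma> <= 1 & (ALL x. x ~: \<Omega> -->
   (ALL \<tau>. 0 < \<tau> & \<tau> <= \<tau>0 --> (EX c. norm (c - x) = \<tau> & ball c (\<sigma> * \<tau>) \<inter> \<Omega> = {})))"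
proof -
 have loc: "\<exists>r>0. \<exists>\<sigma>>0. \<sigma> <= 1 & (\<forall>x\<in>ball x0 (r / 2). x ~: \<Omega> -->
   (ALL \<tau>. 0 < \<tau> & \<tau> <= r / 4 --> (EX c. norm (c - x) = \<tau> & ball c (\<sigma> * \<tau>) \<inter> \<Omega> = {})))" if x0: "x0 \<in> frontier \<Omega>" for x0
 proof -
  have fr: "\<forall>x\<in>frontier \<Omega>. \<exists>r>0. \<exists>e::'a. \<exists>\<gamma>::'a => real. EX L. norm e = 1 & L-lipschitz_on {q. q \<bullet> e = 0} \<gamma> \<and>
    \<Omega> \<inter> ball x r = {p \<in> ball x r. p \<bullet> e < \<gamma> (p - (p \<bullet> e) *\<^sub>R e)}"
   using dom unfolding lipschitz_domain_def by (elim conjE)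
  obtain r e \<gamma> L where r: "r > 0" and e: "norm e = 1" and L: "L-lipschitz_on {q. q \<bullet> e = 0} \<gamma>"
   and O: "\<Omega> \<inter> ball x0 r = {p \<in> ball x0 r. p \<bullet> e < \<gamma> (p - (p \<bullet> e) *\<^sub>R e)}"
   using bspec[OF fr x0] by (elim exE conjE) (rule that, assumption+)
  have L0: "L >= 0" using L by (rule lipschitz_on_nonneg)
  have ee: "e \<bullet> e = 1" using e by (simp add: norm_eq_1)
  define \<sigma> where "\<sigma> = 1 / (1 + L)"
  have \<sigma>: "\<sigma> > 0" "\<sigma> <= 1" "\<sigma> * (1 + L) = 1" using L0 by (auto simp: \<sigma>_def)
  have perp: "(p - (p \<bullet> e) *\<^sub>R e) \<bullet> e = 0" for p by (simp add: inner_diff_left ee)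
  have "EX c. norm (c - x) = \<tau> & ball c (\<sigma> * \<tau>) \<inter> \<Omega> = {}"
   if x: "x \<in> ball x0 (r / 2)" "x ~: \<Omega>" and \<tau>: "0 < \<tau>" "\<tau> <= r / 4" for x \<tau>
  proof (intro exI[of _ "x + \<tau> *\<^sub>R e"] conjI)
   show "norm (x + \<tau> *\<^sub>R e - x) = \<tau>" using \<tau> e by simp
   have xg: "\<gamma> (x - (x \<bullet> e) *\<^sub>R e) <= x \<bullet> e"
   proof (rule ccontr)
    assume "\<not> ?thesis"
    moreover have "x \<in> ball x0 r" using x(1) r by auto
    ultimately have "x \<in> \<Omega> \<inter> ball x0 r" unfolding O by simp
    then show False using x(2) by simp
   qed
   have "p ~: \<Omega>" if p: "p \<in> ball (x + \<tau> *\<^sub>R e) (\<sigma> * \<tau>)" for p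
   proof
    assume pO: "p \<in> \<Omega>"
    define h where "h = p - (x + \<tau> *\<^sub>R e)"
    have ph: "p = x + \<tau> *\<^sub>R e + h" by (simp add: h_def)
    have nh: "norm h < \<sigma> * \<tau>" using p by (simp add: h_def dist_norm norm_minus_commute)
    have "\<sigma> * \<tau> <= \<tau>" using \<sigma>(2) \<tau>(1) by simp
    then have nh2: "norm h < \<tau>" using nh by linarith
    have "dist x0 p <= dist x0 x + norm (\<tau> *\<^sub>R e) + norm h"
     unfolding ph using norm_triangle_ineq[of "x - x0" "\<tau> *\<^sub>R e + h"] norm_triangle_ineq[of "\<tau> *\<^sub>R e" h]
     by (simp add: dist_norm norm_minus_commute[of x0] algebra_simps)
    also have "\<dots> < r / 2 + \<tau> + \<tau>" using x(1) nh2 \<tau> e by simp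
    finally have "dist x0 p < r" using \<tau> by linarith
    then have "p \<in> \<Omega> \<inter> ball x0 r" using pO by simp
    then have lt: "p \<bullet> e < \<gamma> (p - (p \<bullet> e) *\<^sub>R e)" unfolding O by simp
    have l1: "dist (\<gamma> (p - (p \<bullet> e) *\<^sub>R e)) (\<gamma> (x - (x \<bullet> e) *\<^sub>R e)) <= L * dist (p - (p \<bullet> e) *\<^sub>R e) (x - (x \<bullet> e) *\<^sub>R e)"
     by (rule lipschitz_onD[OF L]) (simp_all add: perp)
    have l2: "dist (p - (p \<bullet> e) *\<^sub>R e) (x - (x \<bullet> e) *\<^sub>R e) = norm (h - (h \<bullet> e) *\<^sub>R e)"
     unfolding ph dist_norm by (rule arg_cong[of _ _ norm]) (simp add: inner_add_left ee algebra_simps)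
    have l3: "norm (h - (h \<bullet> e) *\<^sub>R e) <= norm h"
    proof -
     have "(norm (h - (h \<bullet> e) *\<^sub>R e))\<^sup>2 = (norm h)\<^sup>2 - (h \<bullet> e)\<^sup>2"
      unfolding power2_norm_eq_inner by (simp add: inner_diff_left inner_diff_right ee inner_commute power2_eq_square)
     then show ?thesis by (intro power2_le_imp_le[of "norm (h - (h \<bullet> e) *\<^sub>R e)" "norm h"]) auto
    qed
    have "\<gamma> (p - (p \<bullet> e) *\<^sub>R e) <= \<gamma> (x - (x \<bullet> e) *\<^sub>R e) + L * norm h"
     using order_trans[OF l1[unfolded l2] mult_left_mono[OF l3 L0]] unfolding dist_real_def abs_le_iff by linarith
    moreover have "p \<bullet> e = x \<bullet> e + \<tau> + h \<bullet> e" by (simp add: ph inner_add_left ee)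
    moreover have "- norm h <= h \<bullet> e" using Cauchy_Schwarz_ineq2[of h e] e by simp
    ultimately have "\<tau> < (1 + L) * norm h" using lt xg by (simp add: algebra_simps)
    also have "\<dots> <= (1 + L) * (\<sigma> * \<tau>)" using nh L0 by (intro mult_left_mono) auto
    also have "\<dots> = \<sigma> * (1 + L) * \<tau>" by simp
    finally show False using \<sigma>(3) by simp
   qed
   then show "ball (x + \<tau> *\<^sub>R e) (\<sigma> * \<tau>) \<inter> \<Omega> = {}" by blast
  qed
  then show ?thesis using r \<sigma> by (intro exI[of _ r] conjI exI[of _ \<sigma>]) auto
 qed
 define P where "P x0 r s \<longleftrightarrow> r > 0 & s > 0 & s <= 1 & (\<forall>x\<in>ball x0 (r / 2). x ~: \<Omega> -->
   (ALL \<tau>. 0 < \<tau> & \<tau> <= r / 4 --> (EX c. norm (c - x) = \<tau> & ball c (s * \<tau>) \<inter> \<Omega> = {})))" for x0 and r s :: real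
 have "\<forall>x0\<in>frontier \<Omega>. EX q. P x0 (fst q) (snd q)" using loc unfolding P_def by fastforce
 from bchoice[OF this] obtain q where q: "\<forall>x0\<in>frontier \<Omega>. P x0 (fst (q x0)) (snd (q x0))" ..
 define r where "r x0 = fst (q x0)" for x0
 define s where "s x0 = snd (q x0)" for x0
 have rs: "!!x0. x0 \<in> frontier \<Omega> ==> r x0 > 0" "!!x0. x0 \<in> frontier \<Omega> ==> s x0 > 0 & s x0 <= 1"
  "!!x0 x \<tau>. x0 \<in> frontier \<Omega> ==> x \<in> ball x0 (r x0 / 2) ==> x ~: \<Omega> ==> 0 < \<tau> ==> \<tau> <= r x0 / 4 ==>
   EX c. norm (c - x) = \<tau> & ball c (s x0 * \<tau>) \<inter> \<Omega> = {}" using q unfolding P_def r_def s_def by blast+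
 have bd: "bounded \<Omega>" using dom by (simp add: lipschitz_domain_def)
 have cf: "compact (frontier \<Omega>)" using bd by (simp add: compact_frontier_bounded)
 have "frontier \<Omega> \<subseteq> (\<Union>x0\<in>frontier \<Omega>. ball x0 (r x0 / 4))" using rs(1) by fastforce
 then obtain T where T: "T \<subseteq> frontier \<Omega>" "finite T" "frontier \<Omega> \<subseteq> (\<Union>x0\<in>T. ball x0 (r x0 / 4))"
  by (rule compactE_image[OF cf open_ball])
 define \<tau>0 where "\<tau>0 = Min (insert 1 ((%x0. r x0 / 8) ` T))"
 define \<sigma> where "\<sigma> = Min (insert 1 (s ` T))"
 have fin: "finite (insert 1 ((%x0. r x0 / 8) ` T))" "finite (insert 1 (s ` T))" using T(2) by auto
 have \<tau>0: "\<tau>0 > 0" unfolding \<tau>0_def using fin(1) T(1) rs(1) by (subst Min_gr_iff) auto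
 have \<tau>0le: "\<tau>0 <= r x0 / 8" if "x0 \<in> T" for x0 unfolding \<tau>0_def using that by (intro Min_le[OF fin(1)]) simp
 have \<sigma>: "\<sigma> > 0" "\<sigma> <= 1" unfolding \<sigma>_def using fin(2) T(1) rs(2) by (auto simp: Min_gr_iff intro: Min_le)
 have \<sigma>le: "\<sigma> <= s x0" if "x0 \<in> T" for x0 unfolding \<sigma>_def using that by (intro Min_le[OF fin(2)]) simp
 obtain b :: 'a where b: "norm b = 1" using vector_choose_size[of 1] by auto
 have "EX c. norm (c - x) = \<tau> & ball c (\<sigma> * \<tau>) \<inter> \<Omega> = {}" if x: "x ~: \<Omega>" and \<tau>: "0 < \<tau>" "\<tau> <= \<tau>0" for x \<tau>
 proof (cases "\<exists>z\<in>frontier \<Omega>. dist x z <= 2 * \<tau>")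
  case True
  then obtain z where z: "z \<in> frontier \<Omega>" "dist x z <= 2 * \<tau>" by blast
  then obtain x0 where x0: "x0 \<in> T" "dist x0 z < r x0 / 4" using T(3) by auto
  have t8: "\<tau> <= r x0 / 8" using \<tau>(2) \<tau>0le[OF x0(1)] by linarith
  have "dist x0 x < r x0 / 2" using dist_triangle[of x0 x z] x0(2) z(2) t8 by (simp add: dist_commute)
  moreover have "\<tau> <= r x0 / 4" using t8 \<tau>(1) by linarith
  ultimately obtain c where c: "norm (c - x) = \<tau>" "ball c (s x0 * \<tau>) \<inter> \<Omega> = {}"
   using rs(3)[of x0 x \<tau>] x0(1) T(1) x \<tau>(1) by auto
  have "ball c (\<sigma> * \<tau>) \<subseteq> ball c (s x0 * \<tau>)" using \<sigma>le[OF x0(1)] \<tau>(1) by (intro subset_ball mult_right_mono) auto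
  then show ?thesis using c by blast
 next
  case False
  have "ball (x + \<tau> *\<^sub>R b) (\<sigma> * \<tau>) \<inter> \<Omega> = {}"
  proof (rule ccontr)
   assume "\<not> ?thesis"
   then obtain p where p: "p \<in> \<Omega>" "dist (x + \<tau> *\<^sub>R b) p < \<sigma> * \<tau>" by auto
   have "dist x p <= dist x (x + \<tau> *\<^sub>R b) + dist (x + \<tau> *\<^sub>R b) p" by (rule dist_triangle)
   moreover have "dist x (x + \<tau> *\<^sub>R b) = \<tau>" using b \<tau> by (simp add: dist_norm)
   moreover have "\<sigma> * \<tau> <= \<tau>" using \<sigma>(2) \<tau>(1) by simp
   ultimately have d: "dist x p <= 2 * \<tau>" using p(2) by linarith
   have "closed_segment x p \<inter> frontier \<Omega> ~= {}"
    by (rule connected_Int_frontier[OF connected_segment(1)]) (use p(1) x in auto)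
   then obtain z where z: "z \<in> closed_segment x p" "z \<in> frontier \<Omega>" by blast
   have "dist x z <= dist x p" using segment_bound1[OF z(1)] by (simp add: dist_norm norm_minus_commute)
   then show False using False z(2) d by force
  qed
  moreover have "norm (x + \<tau> *\<^sub>R b - x) = \<tau>" using b \<tau> by simp
  ultimately show ?thesis by blast
 qed
 then show ?thesis using \<sigma> \<tau>0 by blast
qed

context corkscrew_domain begin

definition ip :: "('a => real) => ('a => real) => real" where
 "ip f g = (LBINT x. f x * g x)"

definition n2 :: "('a => real) => real" where
 "n2 f = (LBINT x. (f x)\<^sup>2)"

lemma n2_nonneg: "0 <= n2 f" by (simp add: n2_def)

lemma ip_commute: "ip f g = ip g f" by (simp add: ip_def mult.commute)

lemma ip_diff: "L2supp f ==> L2supp g ==> L2supp h ==> ip (%x. f x - g x) h = ip f h - ip g h"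
 unfolding ip_def left_diff_distrib by (rule b_integral_diff) (rule integrable_L2_product, assumption+)+

lemma ip_cmult: "ip (%x. c * f x) g = c * ip f g" by (simp add: ip_def mult.assoc)

lemma n2_cmult: "n2 (%x. c * f x) = c\<^sup>2 * n2 f" by (simp add: n2_def power_mult_distrib)

lemma ip_self: "ip f f = n2 f" by (simp add: n2_def ip_def power2_eq_square)

lemma ip_bound: "L2supp f ==> L2supp g ==> \<bar>ip f g\<bar> <= sqrt (n2 f) * sqrt (n2 g)"
 unfolding ip_def n2_def by (rule L2_product_bound)

lemma n2_diff:
 assumes "L2supp f" "L2supp g" shows "n2 (%x. f x - g x) = n2 f - 2 * ip f g + n2 g"
 using ip_diff[OF assms L2supp_diff[OF assms]] ip_diff[OF assms assms(1)] ip_diff[OF assms assms(2)]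
  ip_commute[of f "%x. f x - g x"] ip_commute[of g "%x. f x - g x"] ip_commute[of f g]
 by (simp add: ip_self)

lemma n2_le:
 assumes f: "L2supp f" and g: "integrable lborel g" "!!x. (f x)\<^sup>2 <= g x" shows "n2 f <= (LBINT x. g x)"
 unfolding n2_def by (rule integral_mono[OF L2supp_square[OF f] g])

lemma n2_sup_bound:
 assumes f: "L2supp f" "!!x. \<bar>f x\<bar> <= B" shows "n2 f <= B\<^sup>2 * vol"
proof -
 have "n2 f <= (LBINT x. B\<^sup>2 * indicator \<Omega> x)"
 proof (rule n2_le[OF f(1)])
  show "(f x)\<^sup>2 <= B\<^sup>2 * indicator \<Omega> x" for x
   using power_mono[OF f(2)[of x], of 2] L2supp_outside[OF f(1), of x] by (cases "x \<in> \<Omega>") auto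
 qed (intro integrable_mult_right indicator_dom_integrable)
 then show ?thesis by (simp add: vol_def)
qed

lemma n2_tendsto:
 assumes Y: "!!n. L2supp (Y n)" "!!n x. \<bar>Y n x\<bar> <= B" and y: "L2supp y" "!!x. (%n. Y n x) \<longlonglongrightarrow> y x" and q: "L2supp q"
 shows "(%n. n2 (%x. Y n x - q x)) \<longlonglongrightarrow> n2 (%x. y x - q x)"
 unfolding n2_def
proof (rule integral_dominated_convergence)
 note [measurable] = L2supp_measurable[OF y(1)] L2supp_measurable[OF q] L2supp_measurable[OF Y(1)]
 show "(%x. (y x - q x)\<^sup>2) \<in> borel_measurable lborel" "(%x. (Y n x - q x)\<^sup>2) \<in> borel_measurable lborel" for n
  by measurable
 show "integrable lborel (%x. 2 * (B\<^sup>2 * indicator \<Omega> x) + 2 * (q x)\<^sup>2)"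
  by (intro b_integrable_add integrable_mult_right indicator_dom_integrable L2supp_square[OF q])
 show "AE x in lborel. (%n. (Y n x - q x)\<^sup>2) \<longlonglongrightarrow> (y x - q x)\<^sup>2"
  by (rule AE_I2) (intro tendsto_intros y(2))
 show "AE x in lborel. norm ((Y n x - q x)\<^sup>2) <= 2 * (B\<^sup>2 * indicator \<Omega> x) + 2 * (q x)\<^sup>2" for n
 proof (rule AE_I2)
  fix x
  have "(Y n x)\<^sup>2 <= B\<^sup>2 * indicator \<Omega> x"
   using power_mono[OF Y(2)[of n x], of 2] L2supp_outside[OF Y(1)[of n], of x] by (cases "x \<in> \<Omega>") auto
  moreover have "(Y n x - q x)\<^sup>2 <= 2 * (Y n x)\<^sup>2 + 2 * (q x)\<^sup>2"
   using zero_le_power2[of "Y n x + q x"] by (simp add: power2_eq_square algebra_simps)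
  ultimately show "norm ((Y n x - q x)\<^sup>2) <= 2 * (B\<^sup>2 * indicator \<Omega> x) + 2 * (q x)\<^sup>2" by simp
 qed
qed

lemma cstate_cong_AE:
 assumes y: "cstate u y" and u: "L2supp u" "L2supp u'" and ae: "AE x in lborel. x \<in> \<Omega> --> u x = u' x"
 shows "cstate u' y"
 unfolding cstate_def linsol_def
proof (intro conjI allI impI)
 show "C0dom y" by (rule cstate_C0dom[OF y])
 fix \<phi> assume \<phi>: "test_fun \<Omega> \<phi>"
 note [measurable] = L2supp_measurable[OF cstate_rhs[OF y u(1)]] borel_measurable_UNIV[OF smooth_continuous[OF test_fun_smooth[OF \<phi>]]]
  L2supp_measurable[OF L2supp_diff[OF u(2) C0dom_L2supp[OF C0dom_cube[OF cstate_C0dom[OF y]]]]]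
 have "wpair 0 y \<phi> = (LBINT x. (u x - y x ^ 3) * \<phi> x)" by (rule linsol_weak[OF y[unfolded cstate_def] \<phi>])
 also have "\<dots> = (LBINT x. (u' x - y x ^ 3) * \<phi> x)"
 proof (rule integral_cong_AE)
  show "AE x in lborel. (u x - y x ^ 3) * \<phi> x = (u' x - y x ^ 3) * \<phi> x"
   using ae by eventually_elim (use test_fun_outside[OF \<phi>] in fastforce)
 qed measurable
 finally show "wpair 0 y \<phi> = (LBINT x. (u' x - y x ^ 3) * \<phi> x)" .
qed

end

locale control_problem = corkscrew_domain +
 fixes \<alpha> \<beta> :: real
 assumes ab: "\<alpha> < \<beta>"
begin

definition adm :: "('a => real) => bool" where
 "adm u \<longleftrightarrow> u \<in> borel_measurable borel & (\<forall>x\<in>\<Omega>. \<alpha> <= u x & u x <= \<beta>) & (ALL x. x ~: \<Omega> --> u x = 0)"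

definition Fb :: real where "Fb = \<bar>\<alpha>\<bar> + \<bar>\<beta>\<bar>"

definition Yb :: real where "Yb = Fb * Kdom"

lemma Fb_nonneg: "0 <= Fb" by (simp add: Fb_def)

lemma Yb_nonneg: "0 <= Yb" using Fb_nonneg Kdom_nonneg by (simp add: Yb_def)

lemma adm_bound: assumes "adm u" shows "\<bar>u x\<bar> <= Fb"
proof (cases "x \<in> \<Omega>")
 case True
 then have "\<alpha> <= u x" "u x <= \<beta>" using assms by (auto simp: adm_def)
 then show ?thesis by (auto simp: Fb_def)
qed (use assms Fb_nonneg in \<open>auto simp: adm_def\<close>)

lemma adm_L2supp: assumes "adm u" shows "L2supp u"
 by (rule L2supp_bounded[OF _ _ adm_bound[OF assms]]) (use assms in \<open>auto simp: adm_def\<close>)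

lemma adm_exists_state: assumes "adm u" obtains y where "cstate u y"
 using cstate_exists[OF adm_L2supp[OF assms] adm_bound[OF assms]] by blast

lemma adm_state_bound: "adm u ==> cstate u y ==> \<bar>y x\<bar> <= Yb"
 unfolding Yb_def by (rule cstate_bound[OF _ adm_L2supp adm_bound])

lemma adm_ex: "EX u. adm u"
proof -
 have "(%x. \<alpha> * indicator \<Omega> x) \<in> borel_measurable borel" using L2supp_measurable[OF L2supp_const] .
 then have "adm (%x. \<alpha> * indicator \<Omega> x)" using ab by (auto simp: adm_def)
 then show ?thesis by (rule exI[of adm])
qed

lemma states_uniform_limit:
 assumes U: "!!n. adm (U n)" "!!n. cstate (U n) (Y n)"
 obtains k y where "strict_mono (k :: nat => nat)" "C0dom y" "!!e. e > 0 ==> \<forall>\<^sub>F n in sequentially. ALL x. \<bar>Y (k n) x - y x\<bar> <= e"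
  "!!x. (%n. Y (k n) x) \<longlonglongrightarrow> y x"
proof -
 have Yz: "Y n x = 0" if "x ~: \<Omega>" for n x using cstate_C0dom[OF U(2)[of n]] that by (simp add: C0dom_def)
 have Yc: "cont (Y n)" for n using cstate_C0dom[OF U(2)[of n]] by (simp add: C0dom_def)
 define M where "M = Fb + Yb ^ 3"
 have M: "0 <= M" using Fb_nonneg Yb_nonneg by (simp add: M_def)
 have g: "\<bar>U n x - (Y n x) ^ 3\<bar> <= M" for n x
 proof -
  have "\<bar>Y n x\<bar> ^ 3 <= Yb ^ 3" by (rule power_mono[OF adm_state_bound[OF U]]) simp
  then show ?thesis using adm_bound[OF U(1), of n x] abs_triangle_ineq4[of "U n x" "(Y n x) ^ 3"] by (simp add: M_def power_abs)
 qed
 have eq: "\<exists>d>0. ALL n x x'. norm (x - x') < d --> \<bar>Y n x - Y n x'\<bar> < e" if e: "e > 0" for e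
 proof -
  obtain d where d: "d > 0" "!!g y. linsol 0 g y ==> L2supp g ==> (ALL x. \<bar>g x\<bar> <= M) ==> (ALL x x'. norm (x - x') < d --> \<bar>y x - y x'\<bar> <= e / 2)"
   using poisson_equicontinuous[OF M, of "e / 2"] e by auto
  have "\<bar>Y n x - Y n x'\<bar> < e" if "norm (x - x') < d" for n x x'
  proof -
   have "\<bar>Y n x - Y n x'\<bar> <= e / 2"
    using d(2)[OF U(2)[of n, unfolded cstate_def] cstate_rhs[OF U(2) adm_L2supp[OF U(1)]]] g that by blast
   then show ?thesis using e by linarith
  qed
  then show ?thesis using d(1) by blast
 qed
 have cO: "compact (closure \<Omega>)" using bounded_dom by (simp add: compact_closure)
 obtain h and k :: "nat => nat" where k: "strict_mono k" "!!e. 0 < e ==> EX N. ALL n x. n >= N & x \<in> closure \<Omega> --> norm (Y (k n) x - h x) < e"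
 proof (rule Arzela_Ascoli[OF cO, of Y Yb])
  show "norm (Y n x) <= Yb" for n x using adm_state_bound[OF U] by simp
  show "EX d. 0 < d & (ALL n y. y \<in> closure \<Omega> & norm (x - y) < d --> norm (Y n x - Y n y) < e)" if "0 < e" for x e
   using eq[OF that] unfolding real_norm_def by blast
 qed (rule that, assumption+)
 have cau: "EX N. \<forall>i\<ge>N. \<forall>j\<ge>N. ALL x. \<bar>Y (k i) x - Y (k j) x\<bar> <= e" if e: "e > 0" for e
 proof -
  obtain N where N: "!!n x. n >= N ==> x \<in> closure \<Omega> ==> norm (Y (k n) x - h x) < e / 2" using k(2)[of "e / 2"] e by auto
  have "\<bar>Y (k i) x - Y (k j) x\<bar> <= e" if "i >= N" "j >= N" for i j x
  proof (cases "x \<in> closure \<Omega>")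
   case True
   have "\<bar>Y (k i) x - h x\<bar> < e / 2" "\<bar>Y (k j) x - h x\<bar> < e / 2" using N[OF that(1) True] N[OF that(2) True] by auto
   moreover have "\<bar>Y (k i) x - Y (k j) x\<bar> <= \<bar>Y (k i) x - h x\<bar> + \<bar>Y (k j) x - h x\<bar>" by linarith
   ultimately have "\<bar>Y (k i) x - Y (k j) x\<bar> <= e / 2 + e / 2" by linarith
   then show ?thesis by simp
  next
   case False
   then have "x ~: \<Omega>" using closure_subset[of \<Omega>] by blast
   then show ?thesis using Yz e by simp
  qed
  then show ?thesis by blast
 qed
 obtain y where y: "cont y" "!!e. e > 0 ==> \<forall>\<^sub>F n in sequentially. ALL x. \<bar>Y (k n) x - y x\<bar> <= e"
   "!!x. (%n. Y (k n) x) \<longlonglongrightarrow> y x"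
  by (rule uniformly_Cauchy_limit[of "%n. Y (k n)"]) (rule Yc, erule cau, rule that, assumption+)
 have "y x = 0" if "x ~: \<Omega>" for x using y(3)[of x] Yz[OF that] LIMSEQ_unique[OF _ tendsto_const] by simp
 then have "C0dom y" using y(1) by (simp add: C0dom_def)
 from that[OF k(1) this y(2,3)] show ?thesis .
qed

text \<open>The weak limit of the controls is obtained as the limit of almost minimal elements of a
 decreasing sequence of convex sets, without weak compactness.\<close>
lemma state_limit:
 assumes U: "!!n. adm (U n)" "!!n. cstate (U n) (Y n)" and y: "C0dom y"
  and unif: "!!e. e > 0 ==> \<forall>\<^sub>F n in sequentially. ALL x. \<bar>Y n x - y x\<bar> <= e" and pw: "!!x. (%n. Y n x) \<longlonglongrightarrow> y x"
 shows "EX u. adm u & cstate u y"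
proof -
 define l where "l \<phi> = wpair 0 y \<phi> + (LBINT x. (y x) ^ 3 * \<phi> x)" for \<phi>
 have Yc: "cont (Y n)" for n using cstate_C0dom[OF U(2)[of n]] by (simp add: C0dom_def)
 have yc: "cont y" using y by (simp add: C0dom_def)
 have lim: "(%n. \<integral>x. U n x * \<phi> x \<partial>lborel) \<longlonglongrightarrow> l \<phi>" if \<phi>: "test_fun \<Omega> \<phi>" for \<phi>
 proof -
  have e: "(LBINT x. U n x * \<phi> x) = wpair 0 (Y n) \<phi> + (LBINT x. (Y n x) ^ 3 * \<phi> x)" for n
  proof -
   have "wpair 0 (Y n) \<phi> = (LBINT x. (U n x - Y n x ^ 3) * \<phi> x)" by (rule linsol_weak[OF U(2)[unfolded cstate_def] \<phi>])
   also have "\<dots> = (LBINT x. U n x * \<phi> x) - (LBINT x. (Y n x) ^ 3 * \<phi> x)" unfolding left_diff_distrib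
    by (intro b_integral_diff integrable_L2supp_test[OF _ \<phi>] adm_L2supp U(1) C0dom_L2supp C0dom_cube cstate_C0dom[OF U(2)])
   finally show ?thesis by simp
  qed
  have c\<phi>: "cont \<phi>" by (rule smooth_continuous[OF test_fun_smooth[OF \<phi>]])
  have "(%n. \<integral>x. (Y n x) ^ 3 * \<phi> x \<partial>lborel) \<longlonglongrightarrow> (LBINT x. (y x) ^ 3 * \<phi> x)"
  proof (rule integral_dominated_convergence[where w = "%x. Yb ^ 3 * \<bar>\<phi> x\<bar>"])
   note [measurable] = borel_measurable_UNIV[OF yc] borel_measurable_UNIV[OF Yc] borel_measurable_UNIV[OF c\<phi>]
   show "(%x. (y x) ^ 3 * \<phi> x) \<in> borel_measurable lborel" "(%x. (Y n x) ^ 3 * \<phi> x) \<in> borel_measurable lborel" for n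
    by measurable
   show "integrable lborel (%x. Yb ^ 3 * \<bar>\<phi> x\<bar>)" by (intro integrable_mult_right integrable_abs integrable_times_test(4)[OF yc \<phi>])
   show "AE x in lborel. (%n. (Y n x) ^ 3 * \<phi> x) \<longlonglongrightarrow> (y x) ^ 3 * \<phi> x" by (rule AE_I2) (intro tendsto_intros pw)
   show "AE x in lborel. norm ((Y n x) ^ 3 * \<phi> x) <= Yb ^ 3 * \<bar>\<phi> x\<bar>" for n
    by (rule AE_I2) (use adm_state_bound[OF U] in \<open>auto simp: abs_mult power_abs intro!: mult_right_mono power_mono\<close>)
  qed
  then show ?thesis unfolding e l_def by (intro tendsto_add wpair_uniform_limit[OF Yc yc \<phi>]) (rule unif)
 qed
 define K where "K n = {v. adm v & (ALL \<phi> e. test_fun \<Omega> \<phi> --> (\<forall>m\<ge>n. \<bar>(LBINT x. U m x * \<phi> x) - l \<phi>\<bar> <= e) -->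
   \<bar>(LBINT x. v x * \<phi> x) - l \<phi>\<bar> <= e)}" for n :: nat
 have Ka: "adm v" if "v \<in> K n" for v n using that by (simp add: K_def)
 have Kd: "\<bar>(LBINT x. v x * \<phi> x) - l \<phi>\<bar> <= e"
  if "v \<in> K n" "test_fun \<Omega> \<phi>" "!!m. m >= n ==> \<bar>(LBINT x. U m x * \<phi> x) - l \<phi>\<bar> <= e" for v n \<phi> e using that by (simp add: K_def)
 obtain v d where v: "!!n. v n \<in> K n" and cau: "!!e. e > 0 ==> EX N. \<forall>j\<ge>N. \<forall>k\<ge>N. (LBINT x. (v j x - v k x)\<^sup>2) <= e"
 proof (rule almost_minimal_Cauchy[of K lborel "Fb\<^sup>2 * vol"])
  show "u \<in> borel_measurable lborel" if "u \<in> K n" for n u using L2supp_measurable[OF adm_L2supp[OF Ka[OF that]]] by simp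
  show "integrable lborel (%x. (u x)\<^sup>2)" if "u \<in> K n" for n u by (rule L2supp_square[OF adm_L2supp[OF Ka[OF that]]])
  show "K (Suc n) \<subseteq> K n" for n
  proof
   fix w assume w: "w \<in> K (Suc n)"
   have "\<bar>(LBINT x. w x * \<phi> x) - l \<phi>\<bar> <= e" if "test_fun \<Omega> \<phi>" "\<forall>m\<ge>n. \<bar>(LBINT x. U m x * \<phi> x) - l \<phi>\<bar> <= e" for \<phi> e
    by (rule Kd[OF w that(1)]) (use that(2) in simp)
   then show "w \<in> K n" using Ka[OF w] by (simp add: K_def)
  qed
  show "\<exists>u\<in>K n. (LBINT x. (u x)\<^sup>2) <= Fb\<^sup>2 * vol" for n
  proof
   show "U n \<in> K n" using U(1) by (simp add: K_def)
   show "(LBINT x. (U n x)\<^sup>2) <= Fb\<^sup>2 * vol" using n2_sup_bound[OF adm_L2supp[OF U(1)] adm_bound[OF U(1)], of n] by (simp add: n2_def)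
  qed
  show "(%x. (u x + w x) / 2) \<in> K n" if uw: "u \<in> K n" "w \<in> K n" for n u w
  proof -
   have a: "adm u" "adm w" using Ka[OF uw(1)] Ka[OF uw(2)] .
   then have "adm (%x. (u x + w x) / 2)" by (fastforce simp: adm_def)
   moreover have "\<bar>(LBINT x. (u x + w x) / 2 * \<phi> x) - l \<phi>\<bar> <= e"
    if \<phi>: "test_fun \<Omega> \<phi>" and e: "\<forall>m\<ge>n. \<bar>(LBINT x. U m x * \<phi> x) - l \<phi>\<bar> <= e" for \<phi> e
   proof -
    have "(LBINT x. (u x + w x) / 2 * \<phi> x) = (LBINT x. (u x * \<phi> x) / 2 + (w x * \<phi> x) / 2)" by (simp add: algebra_simps add_divide_distrib)
    also have "\<dots> = (LBINT x. u x * \<phi> x) / 2 + (LBINT x. w x * \<phi> x) / 2"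
     using integrable_L2supp_test[OF adm_L2supp[OF a(1)] \<phi>] integrable_L2supp_test[OF adm_L2supp[OF a(2)] \<phi>] by simp
    finally have i: "(LBINT x. (u x + w x) / 2 * \<phi> x) = (LBINT x. u x * \<phi> x) / 2 + (LBINT x. w x * \<phi> x) / 2" .
    have "\<bar>(LBINT x. u x * \<phi> x) - l \<phi>\<bar> <= e" "\<bar>(LBINT x. w x * \<phi> x) - l \<phi>\<bar> <= e" using Kd[OF uw(1) \<phi>] Kd[OF uw(2) \<phi>] e by auto
    then show ?thesis unfolding i by (simp add: abs_le_iff field_simps)
   qed
   ultimately show ?thesis by (simp add: K_def)
  qed
 qed (rule that, assumption+)
 have va: "adm (v n)" for n by (rule Ka[OF v])
 obtain g r where g: "g \<in> borel_measurable lborel" "integrable lborel (%x. (g x)\<^sup>2)"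
  "(%k. \<integral>x. (v k x - g x)\<^sup>2 \<partial>lborel) \<longlonglongrightarrow> 0" "AE x in lborel. (%k. v (r k) x) \<longlonglongrightarrow> g x"
 proof (rule L2_complete[of v lborel])
  show "v k \<in> borel_measurable lborel" for k using L2supp_measurable[OF adm_L2supp[OF va]] by simp
  show "integrable lborel (%x. (v k x)\<^sup>2)" for k by (rule L2supp_square[OF adm_L2supp[OF va]])
 qed (erule cau, rule that, assumption+)
 note [measurable] = g(1)
 define u where "u x = (if x \<in> \<Omega> then max \<alpha> (min \<beta> (g x)) else 0)" for x
 have Om[measurable]: "\<Omega> \<in> sets borel" using open_dom by (rule borel_open)
 have um: "u \<in> borel_measurable borel" unfolding u_def by measurable
 have ua: "adm u" using um ab by (auto simp: adm_def u_def)
 have ug: "AE x in lborel. g x = u x" using g(4)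
 proof eventually_elim
  fix x assume x: "(%k. v (r k) x) \<longlonglongrightarrow> g x"
  show "g x = u x"
  proof (cases "x \<in> \<Omega>")
   case True
   then have b: "\<alpha> <= v k x" "v k x <= \<beta>" for k using va[of k] by (auto simp: adm_def)
   have "\<alpha> <= g x" "g x <= \<beta>" using LIMSEQ_le_const[OF x] LIMSEQ_le_const2[OF x] b by blast+
   then show ?thesis using True by (simp add: u_def)
  next
   case False
   then have "v k x = 0" for k using va[of k] by (simp add: adm_def)
   then show ?thesis using x False LIMSEQ_unique[OF _ tendsto_const] by (simp add: u_def)
  qed
 qed
 have eq: "(LBINT x. u x * \<phi> x) = l \<phi>" if \<phi>: "test_fun \<Omega> \<phi>" for \<phi>
 proof -
  have c\<phi>: "cont \<phi>" by (rule smooth_continuous[OF test_fun_smooth[OF \<phi>]])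
  have m\<phi>: "\<phi> \<in> borel_measurable lborel" using borel_measurable_UNIV[OF c\<phi>] by simp
  have s\<phi>: "integrable lborel (%x. (\<phi> x)\<^sup>2)" using integrable_times_test(1)[OF c\<phi> \<phi>] by (simp add: power2_eq_square)
  have vm: "v k \<in> borel_measurable lborel" for k using L2supp_measurable[OF adm_L2supp[OF va]] by simp
  have 1: "(%k. \<integral>x. v k x * \<phi> x \<partial>lborel) \<longlonglongrightarrow> (LBINT x. g x * \<phi> x)"
   by (rule L2_pairing_tendsto[OF vm g(1) m\<phi> L2supp_square[OF adm_L2supp[OF va]] g(2) s\<phi> g(3)])
  have "(%k. \<integral>x. v k x * \<phi> x \<partial>lborel) \<longlonglongrightarrow> l \<phi>"
  proof (rule LIMSEQ_I)
   fix e :: real assume e: "e > 0"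
   then obtain N where N: "!!n. n >= N ==> \<bar>(LBINT x. U n x * \<phi> x) - l \<phi>\<bar> <= e / 2"
    using LIMSEQ_D[OF lim[OF \<phi>], of "e / 2"] by (auto intro: less_imp_le)
   have "norm ((LBINT x. v n x * \<phi> x) - l \<phi>) < e" if "n >= N" for n
   proof -
    have "\<bar>(LBINT x. v n x * \<phi> x) - l \<phi>\<bar> <= e / 2" by (rule Kd[OF v \<phi>]) (use N that in simp)
    then show ?thesis using e by simp
   qed
   then show "EX no. \<forall>n\<ge>no. norm ((LBINT x. v n x * \<phi> x) - l \<phi>) < e" by blast
  qed
  then have "(LBINT x. g x * \<phi> x) = l \<phi>" using 1 by (rule LIMSEQ_unique[rotated])
  moreover have "(LBINT x. g x * \<phi> x) = (LBINT x. u x * \<phi> x)"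
  proof (rule integral_cong_AE)
   show "AE x in lborel. g x * \<phi> x = u x * \<phi> x" using ug by eventually_elim simp
  qed (use m\<phi> um g(1) in auto)
  ultimately show ?thesis by simp
 qed
 have "cstate u y" unfolding cstate_def linsol_def
 proof (intro conjI allI impI y)
  fix \<phi> assume \<phi>: "test_fun \<Omega> \<phi>"
  have "(LBINT x. (u x - y x ^ 3) * \<phi> x) = (LBINT x. u x * \<phi> x) - (LBINT x. (y x) ^ 3 * \<phi> x)" unfolding left_diff_distrib
   by (intro b_integral_diff integrable_L2supp_test[OF _ \<phi>] adm_L2supp ua C0dom_L2supp C0dom_cube y)
  then show "wpair 0 y \<phi> = (LBINT x. (u x - y x ^ 3) * \<phi> x)" using eq[OF \<phi>] by (simp add: l_def)
 qed
 then show ?thesis using ua by blast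
qed

lemma states_compact:
 assumes U: "!!n. adm (U n)" "!!n. cstate (U n) (Y n)"
 obtains k u y where "strict_mono (k :: nat => nat)" "adm u" "cstate u y"
  "!!q. L2supp q ==> (%n. n2 (%x. Y (k n) x - q x)) \<longlonglongrightarrow> n2 (%x. y x - q x)"
proof -
 obtain k y where k: "strict_mono (k :: nat => nat)" "C0dom y" "!!e. e > 0 ==> \<forall>\<^sub>F n in sequentially. ALL x. \<bar>Y (k n) x - y x\<bar> <= e"
  "!!x. (%n. Y (k n) x) \<longlonglongrightarrow> y x" by (rule states_uniform_limit[OF U]) (rule that, assumption+)
 obtain u where u: "adm u" "cstate u y"
 proof -
  have "EX u. adm u & cstate u y"
   by (rule state_limit[of "%n. U (k n)" "%n. Y (k n)"]) (rule U(1), rule U(2), rule k(2), erule k(3), rule k(4))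
  then show ?thesis using that by blast
 qed
 have "(%n. n2 (%x. Y (k n) x - q x)) \<longlonglongrightarrow> n2 (%x. y x - q x)" if "L2supp q" for q
  by (rule n2_tendsto[OF C0dom_L2supp[OF cstate_C0dom[OF U(2)]] adm_state_bound[OF U] C0dom_L2supp[OF k(2)] k(4) that])
 from that[OF k(1) u this] show ?thesis .
qed

lemma minimiser_exists:
 assumes q: "L2supp q"
 shows "EX u y. adm u & cstate u y & (ALL u' y'. adm u' --> cstate u' y' --> n2 (%x. y x - q x) <= n2 (%x. y' x - q x))"
proof -
 define V where "V = {n2 (%x. y x - q x) | u y. adm u & cstate u y}"
 obtain u0 where u0: "adm u0" using adm_ex ..
 obtain y0 where "cstate u0 y0" by (rule adm_exists_state[OF u0])
 then have ne: "V ~= {}" using u0 by (auto simp: V_def)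
 have bb: "bdd_below V" by (rule bdd_belowI[of _ 0]) (auto simp: V_def n2_nonneg)
 have "EX p. adm (fst p) & cstate (fst p) (snd p) & n2 (%x. snd p x - q x) < Inf V + 1 / real (Suc n)" for n
 proof -
  have "Inf V < Inf V + 1 / real (Suc n)" by simp
  then obtain a where a: "a \<in> V" "a < Inf V + 1 / real (Suc n)" using cInf_lessD[OF ne] by blast
  then obtain u y where "adm u" "cstate u y" "a = n2 (%x. y x - q x)" by (auto simp: V_def)
  then show ?thesis using a by (intro exI[of _ "(u, y)"]) simp
 qed
 from choice[OF allI[OF this]] obtain p where p: "ALL n. adm (fst (p n)) & cstate (fst (p n)) (snd (p n)) \<and>
   n2 (%x. snd (p n) x - q x) < Inf V + 1 / real (Suc n)" ..
 obtain k u y where k: "strict_mono (k :: nat => nat)" "adm u" "cstate u y"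
  "!!q. L2supp q ==> (%n. n2 (%x. snd (p (k n)) x - q x)) \<longlonglongrightarrow> n2 (%x. y x - q x)"
  by (rule states_compact[of "%n. fst (p n)" "%n. snd (p n)"]) (use p in \<open>blast\<close>, use p in \<open>blast\<close>, rule that, assumption+)
 have le: "n2 (%x. snd (p (k n)) x - q x) <= Inf V + 1 / real (Suc n)" for n
 proof -
  have "n2 (%x. snd (p (k n)) x - q x) < Inf V + 1 / real (Suc (k n))" using p by blast
  moreover have "1 / real (Suc (k n)) <= 1 / real (Suc n)" using seq_suble[OF k(1), of n] by (simp add: frac_le)
  ultimately show ?thesis by linarith
 qed
 have "(%n. Inf V + 1 / real (Suc n)) \<longlonglongrightarrow> Inf V + 0" by (intro tendsto_intros LIMSEQ_Suc lim_1_over_n)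
 from LIMSEQ_le[OF k(4)[OF q] this] le have "n2 (%x. y x - q x) <= Inf V" by auto
 moreover have "Inf V <= n2 (%x. y' x - q x)" if "adm u'" "cstate u' y'" for u' y'
  by (rule cInf_lower[OF _ bb]) (use that in \<open>auto simp: V_def\<close>)
 ultimately show ?thesis using k(2,3) by (meson order_trans)
qed

lemma strict_minimiser_gap:
 assumes ub: "adm ub" "cstate ub yb" and q: "L2supp q"
  and strict: "!!u y. adm u ==> cstate u y ==> \<not> (AE x in lborel. x \<in> \<Omega> --> u x = ub x) ==> n2 (%x. yb x - q x) < n2 (%x. y x - q x)"
  and e: "e > 0"
 shows "\<exists>m>0. ALL u y. adm u --> cstate u y --> e <= n2 (%x. y x - yb x) --> n2 (%x. yb x - q x) + m <= n2 (%x. y x - q x)"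
proof (rule ccontr)
 assume neg: "\<not> ?thesis"
 have "EX p. adm (fst p) & cstate (fst p) (snd p) & e <= n2 (%x. snd p x - yb x) \<and>
   n2 (%x. snd p x - q x) <= n2 (%x. yb x - q x) + 1 / real (Suc n)" for n
 proof -
  have "0 < 1 / real (Suc n)" by simp
  then obtain u y where "adm u" "cstate u y" "e <= n2 (%x. y x - yb x)" "\<not> n2 (%x. yb x - q x) + 1 / real (Suc n) <= n2 (%x. y x - q x)"
   using neg by blast
  then show ?thesis by (intro exI[of _ "(u, y)"]) simp
 qed
 from choice[OF allI[OF this]] obtain p where p: "ALL n. adm (fst (p n)) & cstate (fst (p n)) (snd (p n)) & e <= n2 (%x. snd (p n) x - yb x) \<and>
   n2 (%x. snd (p n) x - q x) <= n2 (%x. yb x - q x) + 1 / real (Suc n)" ..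
 obtain k u y where k: "strict_mono (k :: nat => nat)" "adm u" "cstate u y"
  "!!q. L2supp q ==> (%n. n2 (%x. snd (p (k n)) x - q x)) \<longlonglongrightarrow> n2 (%x. y x - q x)"
  by (rule states_compact[of "%n. fst (p n)" "%n. snd (p n)"]) (use p in \<open>blast\<close>, use p in \<open>blast\<close>, rule that, assumption+)
 have le: "n2 (%x. snd (p (k n)) x - q x) <= n2 (%x. yb x - q x) + 1 / real (Suc n)" for n
 proof -
  have "n2 (%x. snd (p (k n)) x - q x) <= n2 (%x. yb x - q x) + 1 / real (Suc (k n))" using p by blast
  moreover have "1 / real (Suc (k n)) <= 1 / real (Suc n)" using seq_suble[OF k(1), of n] by (simp add: frac_le)
  ultimately show ?thesis by linarith
 qed
 have "(%n. n2 (%x. yb x - q x) + 1 / real (Suc n)) \<longlonglongrightarrow> n2 (%x. yb x - q x) + 0" by (intro tendsto_intros LIMSEQ_Suc lim_1_over_n)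
 from LIMSEQ_le[OF k(4)[OF q] this] le have "n2 (%x. y x - q x) <= n2 (%x. yb x - q x)" by auto
 then have "AE x in lborel. x \<in> \<Omega> --> u x = ub x" using strict[OF k(2,3)] by force
 then have "cstate ub y" by (rule cstate_cong_AE[OF k(3) adm_L2supp[OF k(2)] adm_L2supp[OF ub(1)]])
 then have "y = yb" by (rule cstate_unique[OF _ ub(2) adm_L2supp[OF ub(1)]])
 then have "(%n. n2 (%x. snd (p (k n)) x - yb x)) \<longlonglongrightarrow> 0"
  using k(4)[OF C0dom_L2supp[OF cstate_C0dom[OF ub(2)]]] by (simp add: n2_def)
 from LIMSEQ_le_const[OF this, of e] have "e <= 0" using p by blast
 then show False using e by simp
qed

end

context corkscrew_domain begin

lemma C0dom_mult: "C0dom f ==> cont g ==> C0dom (%x. g x * f x)"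
 by (auto simp: C0dom_def intro!: continuous_on_mult)

lemma C0dom_diff: "C0dom f ==> C0dom g ==> C0dom (%x. f x - g x)"
 by (auto simp: C0dom_def intro!: continuous_on_diff)

lemma poisson_symmetric:
 assumes f: "L2supp f" and g: "L2supp g" and y: "linsol 0 f y" and z: "linsol 0 g z"
 shows "ip f z = ip g y"
proof -
 have Ly: "L2supp y" and Lz: "L2supp z" using linsol_L2supp[OF y] linsol_L2supp[OF z] .
 have 1: "L2supp (%x. f x + (1 - 0) * y x)" "L2supp (%x. g x + (1 - 0) * z x)"
  using L2supp_add[OF f Ly, of 1 1] L2supp_add[OF g Lz, of 1 1] by simp_all
 have "(LBINT x. (f x + (1 - 0) * y x) * z x) = (LBINT x. (g x + (1 - 0) * z x) * y x)"
  by (rule linsol_symmetric[OF zero_less_one 1 linsol_change[OF y f] linsol_change[OF z g]])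
 then have "(LBINT x. f x * z x + y x * z x) = (LBINT x. g x * y x + z x * y x)" by (simp add: distrib_right)
 then show ?thesis
  using integrable_L2_product[OF f Lz] integrable_L2_product[OF Ly Lz] integrable_L2_product[OF g Ly] integrable_L2_product[OF Lz Ly]
  by (simp add: ip_def mult.commute[of "y _" "z _"])
qed

text \<open>A lower-order term of good sign does not affect the \<open>L\<^sup>2\<close>--sup estimate.\<close>
lemma poisson_L2_abs:
 assumes y: "linsol 0 g y" and g: "L2supp g" and h: "L2supp h" "!!x. 0 <= h x"
  and le: "!!x. 0 < y x ==> g x <= h x" "!!x. y x < 0 ==> - h x <= g x"
 shows "\<bar>y x\<bar> <= CL2 * sqrt (n2 h)"
proof -
 have "y x <= CL2 * sqrt (n2 h)" unfolding n2_def by (rule poisson_L2_upper[OF y g h le(1)])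
 moreover have "- y x <= CL2 * sqrt (n2 h)" unfolding n2_def
 proof (rule poisson_L2_upper[OF linsol_uminus[OF y g] L2supp_uminus[OF g] h])
  show "- g x <= h x" if "0 < - y x" for x using le(2)[of x] that by simp
 qed
 ultimately show ?thesis by (simp add: abs_le_iff)
qed

lemma small_L2_small_sup:
 assumes M: "M >= 0" and s: "s > 0"
 shows "\<exists>e>0. ALL g y. linsol 0 g y --> L2supp g --> (ALL x. 0 < y x --> g x <= M) --> (ALL x. y x < 0 --> - M <= g x) -->
  n2 y <= e --> (ALL x. \<bar>y x\<bar> <= s)"
proof -
 define \<mu> where "\<mu> = 2 * M / s + 1"
 have \<mu>: "\<mu> > 0" using M s by (simp add: \<mu>_def add_nonneg_pos)
 have "M <= s / 2 * \<mu>" using s by (simp add: \<mu>_def field_simps)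
 then have M2: "M / \<mu> <= s / 2" using \<mu> by (simp add: pos_divide_le_eq)
 define t where "t = s / (2 * (\<mu> * Cres \<mu> + 1))"
 have c: "0 <= \<mu> * Cres \<mu>" using \<mu> Cres_nonneg[of \<mu>] by simp
 have t: "t > 0" using s c by (simp add: t_def)
 have t2: "\<mu> * (Cres \<mu> * t) <= s / 2"
 proof -
  have "(\<mu> * Cres \<mu>) * t <= (\<mu> * Cres \<mu> + 1) * t" using t by simp
  also have "\<dots> = s / 2" using c by (simp add: t_def field_simps)
  finally show ?thesis by (simp add: mult.assoc)
 qed
 show ?thesis
 proof (intro exI[of _ "t\<^sup>2"] conjI allI impI)
  show "0 < t\<^sup>2" using t by simp
  fix g y x assume y: "linsol 0 g y" and g: "L2supp g" and le: "ALL x. 0 < y x --> g x <= M" "ALL x. y x < 0 --> - M <= g x" and n: "n2 y <= t\<^sup>2"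
  have "sqrt (n2 y) <= t" using real_sqrt_le_mono[OF n] t by simp
  from order_trans[OF mult_left_mono[OF mult_left_mono[OF this Cres_nonneg] less_imp_le[OF \<mu>]] t2]
  have q: "\<mu> * (Cres \<mu> * sqrt (n2 y)) <= s / 2" .
  have "y x <= M / \<mu> + \<mu> * (Cres \<mu> * sqrt (LBINT x. (y x)\<^sup>2))"
   by (rule poisson_interpolation_upper[OF y g \<mu> M]) (use le(1) in blast)
  moreover have "- y x <= M / \<mu> + \<mu> * (Cres \<mu> * sqrt (LBINT x. (- y x)\<^sup>2))"
   by (rule poisson_interpolation_upper[OF linsol_uminus[OF y g] L2supp_uminus[OF g] \<mu> M]) (use le(2) in force)
  ultimately have "y x <= M / \<mu> + \<mu> * (Cres \<mu> * sqrt (n2 y))" "- y x <= M / \<mu> + \<mu> * (Cres \<mu> * sqrt (n2 y))"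
   by (simp_all add: n2_def)
  from order_trans[OF this(1) add_mono[OF M2 q]] order_trans[OF this(2) add_mono[OF M2 q]]
  have "y x <= s / 2 + s / 2" "- y x <= s / 2 + s / 2" .
  then show "\<bar>y x\<bar> <= s" by (simp add: abs_le_iff)
 qed
qed

end

locale optimal_control = control_problem +
 fixes yd ub yb p :: "'a => real"
 assumes yd: "L2supp yd" and ub: "adm ub" "cstate ub yb"
  and p: "linsol 0 (%x. (yb x - yd x) - 3 * (yb x)\<^sup>2 * p x) p"
  and strict: "!!u y. adm u ==> cstate u y ==> \<not> (AE x in lborel. x \<in> \<Omega> --> u x = ub x) ==>
   n2 (%x. yb x - yd x) < n2 (%x. y x - yd x)"
begin

definition lin :: "('a => real) => ('a => real) => bool" where
 "lin v z \<longleftrightarrow> linsol 0 (%x. v x - 3 * (yb x)\<^sup>2 * z x) z"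

definition Jd :: "('a => real) => real" where
 "Jd y = 1/2 * n2 (%x. y x - yd x) - 1/2 * n2 (%x. yb x - yd x)"

definition Q :: "('a => real) => ('a => real) => real" where
 "Q v z = ip p v + 1/2 * (LBINT x. (1 - 6 * yb x * p x) * (z x)\<^sup>2)"

lemma yb_C0: "C0dom yb" by (rule cstate_C0dom[OF ub(2)])

lemma yb_bound: "\<bar>yb x\<bar> <= Yb" by (rule adm_state_bound[OF ub])

lemma yb_cont: "cont yb" using yb_C0 by (simp add: C0dom_def)

lemma p_C0: "C0dom p" using p by (simp add: linsol_def)

lemma p_cont: "cont p" using p_C0 by (simp add: C0dom_def)

lemma lin_C0: "lin v z ==> C0dom z" by (simp add: lin_def linsol_def)

lemma L2yb: "C0dom z ==> L2supp (%x. 3 * (yb x)\<^sup>2 * z x)"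
 by (intro C0dom_L2supp C0dom_mult continuous_on_mult continuous_on_const continuous_on_power yb_cont)

lemma diff_state:
 assumes "adm u" "cstate u y"
 shows "linsol 0 (%x. (u x - y x ^ 3) - (ub x - yb x ^ 3)) (%x. y x - yb x)"
  and "L2supp (%x. (u x - y x ^ 3) - (ub x - yb x ^ 3))" and "C0dom (%x. y x - yb x)"
 by (rule linsol_diff[OF assms(2)[unfolded cstate_def] ub(2)[unfolded cstate_def] cstate_rhs[OF assms(2) adm_L2supp[OF assms(1)]] cstate_rhs[OF ub(2) adm_L2supp[OF ub(1)]]])
  (intro L2supp_diff cstate_rhs[OF assms(2) adm_L2supp[OF assms(1)]] cstate_rhs[OF ub(2) adm_L2supp[OF ub(1)]]
   C0dom_diff cstate_C0dom[OF assms(2)] yb_C0)+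

lemma diff_lin:
 assumes u: "adm u" "cstate u y" and z: "lin (%x. u x - ub x) z"
 shows "linsol 0 (%x. - (y x ^ 3 - yb x ^ 3) + 3 * (yb x)\<^sup>2 * z x) (%x. (y x - yb x) - z x)"
  and "L2supp (%x. - (y x ^ 3 - yb x ^ 3) + 3 * (yb x)\<^sup>2 * z x)"
proof -
 have L: "L2supp (%x. (u x - ub x) - 3 * (yb x)\<^sup>2 * z x)"
  by (rule L2supp_diff[OF L2supp_diff[OF adm_L2supp[OF u(1)] adm_L2supp[OF ub(1)]] L2yb[OF lin_C0[OF z]]])
 have e: "((u x - y x ^ 3) - (ub x - yb x ^ 3)) - ((u x - ub x) - 3 * (yb x)\<^sup>2 * z x) = - (y x ^ 3 - yb x ^ 3) + 3 * (yb x)\<^sup>2 * z x" for x by simp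
 show "linsol 0 (%x. - (y x ^ 3 - yb x ^ 3) + 3 * (yb x)\<^sup>2 * z x) (%x. (y x - yb x) - z x)"
  using linsol_diff[OF diff_state(1)[OF u] z[unfolded lin_def] diff_state(2)[OF u] L] unfolding e .
 show "L2supp (%x. - (y x ^ 3 - yb x ^ 3) + 3 * (yb x)\<^sup>2 * z x)"
  using L2supp_diff[OF diff_state(2)[OF u] L] unfolding e .
qed

lemma Jd_expansion:
 assumes u: "adm u" "cstate u y"
 shows "Jd y = 1/2 * n2 (%x. y x - yb x) + ip p (%x. u x - ub x) -
  ip (%x. 3 * yb x * (y x - yb x)\<^sup>2 + (y x - yb x) ^ 3) p"
proof -
 define w where "w x = y x - yb x" for x
 define h where "h x = 3 * yb x * (w x)\<^sup>2 + (w x) ^ 3" for x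
 define v where "v x = u x - ub x" for x
 have wC: "C0dom w" using diff_state(3)[OF u] unfolding w_def[abs_def] .
 then have wc: "cont w" and wz: "!!x. x ~: \<Omega> ==> w x = 0" by (auto simp: C0dom_def)
 have hC: "C0dom h" unfolding C0dom_def h_def using wz by (auto intro!: continuous_intros wc yb_cont)
 have Lw: "L2supp w" and Lh: "L2supp h" and Lp: "L2supp p" and Lyb: "L2supp yb"
  by (intro C0dom_L2supp wC hC p_C0 yb_C0)+
 have Lv: "L2supp v" unfolding v_def by (rule L2supp_diff[OF adm_L2supp[OF u(1)] adm_L2supp[OF ub(1)]])
 have Lk: "L2supp (%x. 3 * (yb x)\<^sup>2 * w x)" "L2supp (%x. 3 * (yb x)\<^sup>2 * p x)" by (intro L2yb wC p_C0)+
 have Ld: "L2supp (%x. yb x - yd x)" by (rule L2supp_diff[OF Lyb yd])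
 have e: "(u x - y x ^ 3) - (ub x - yb x ^ 3) = (v x - 3 * (yb x)\<^sup>2 * w x) - h x" for x
  unfolding v_def w_def h_def by (simp add: power2_eq_square power3_eq_cube algebra_simps)
 have W: "linsol 0 (%x. (v x - 3 * (yb x)\<^sup>2 * w x) - h x) w" using diff_state(1)[OF u] unfolding e w_def[symmetric] .
 have "ip (%x. (v x - 3 * (yb x)\<^sup>2 * w x) - h x) p = ip (%x. (yb x - yd x) - 3 * (yb x)\<^sup>2 * p x) w"
  by (rule poisson_symmetric[OF L2supp_diff[OF L2supp_diff[OF Lv Lk(1)] Lh] L2supp_diff[OF Ld Lk(2)] W p])
 then have "ip v p - ip (%x. 3 * (yb x)\<^sup>2 * w x) p - ip h p = ip (%x. yb x - yd x) w - ip (%x. 3 * (yb x)\<^sup>2 * p x) w"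
  by (simp add: ip_diff[OF L2supp_diff[OF Lv Lk(1)] Lh Lp] ip_diff[OF Lv Lk(1) Lp] ip_diff[OF Ld Lk(2) Lw])
 moreover have "ip (%x. 3 * (yb x)\<^sup>2 * w x) p = ip (%x. 3 * (yb x)\<^sup>2 * p x) w" unfolding ip_def by (simp add: ac_simps)
 ultimately have 1: "ip (%x. yb x - yd x) w = ip v p - ip h p" by simp
 have Ld': "L2supp (%x. yd x - yb x)" by (rule L2supp_diff[OF yd Lyb])
 have "n2 (%x. w x - (yd x - yb x)) = n2 w - 2 * ip w (%x. yd x - yb x) + n2 (%x. yd x - yb x)" by (rule n2_diff[OF Lw Ld'])
 moreover have "n2 (%x. yd x - yb x) = n2 (%x. yb x - yd x)" by (simp add: n2_def power2_commute)
 moreover have "ip w (%x. yd x - yb x) = - ip (%x. yb x - yd x) w"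
 proof -
  have "ip w (%x. yd x - yb x) = (LBINT x. - ((yb x - yd x) * w x))" unfolding ip_def by (intro b_integral_cong) (auto simp: algebra_simps)
  then show ?thesis by (simp add: ip_def)
 qed
 moreover have "(%x. w x - (yd x - yb x)) = (%x. y x - yd x)" by (auto simp: w_def)
 ultimately have "Jd y = 1/2 * n2 w + ip (%x. yb x - yd x) w" by (simp add: Jd_def add_divide_distrib)
 then have "Jd y = 1/2 * n2 w + ip p v - ip h p" using 1 ip_commute[of v p] by simp
 then show ?thesis unfolding h_def w_def v_def .
qed

lemma taylor:
 obtains E s0 where "0 <= E" "0 < s0"
  "!!u y z s. adm u ==> cstate u y ==> lin (%x. u x - ub x) z ==> 0 < s ==> s <= s0 ==> (ALL x. \<bar>y x - yb x\<bar> <= s) ==>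
   \<bar>Jd y - Q (%x. u x - ub x) z\<bar> <= E * s * n2 (%x. y x - yb x) \<and>
   n2 (%x. y x - yb x) <= 4 * n2 z & n2 z <= 4 * n2 (%x. y x - yb x)"
proof -
 obtain P where P: "!!x. \<bar>p x\<bar> <= P" using C0dom_bounded[OF p_C0] by (auto simp: bounded_iff)
 have P0: "0 <= P" by (rule order_trans[OF abs_ge_zero P])
 define A where "A = 1/2 + 3 * Yb * P"
 have A0: "0 <= A" using P0 Yb_nonneg by (simp add: A_def)
 have vol0: "0 <= vol" by (simp add: vol_def)
 define D where "D = CL2\<^sup>2 * (3 * Yb + 1)\<^sup>2 * vol"
 have D0: "0 <= D" using vol0 by (simp add: D_def)
 define E where "E = A * (1 + 2 * D) + P"
 define s0 where "s0 = 1 / (2 * D + 2)"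
 have E0: "0 <= E" using A0 D0 P0 by (simp add: E_def)
 have s00: "0 < s0" "s0 <= 1" "D * s0 <= 1/2" using D0 by (auto simp: s0_def field_simps)
 have main: "\<bar>Jd y - Q (%x. u x - ub x) z\<bar> <= E * s * n2 (%x. y x - yb x) \<and>
   n2 (%x. y x - yb x) <= 4 * n2 z & n2 z <= 4 * n2 (%x. y x - yb x)"
  if u: "adm u" "cstate u y" and z: "lin (%x. u x - ub x) z" and s: "0 < s" "s <= s0" and ws: "ALL x. \<bar>y x - yb x\<bar> <= s" for u y z s
 proof -
  have s1: "s <= 1" using s s00 by linarith
  define w where "w x = y x - yb x" for x
  define h where "h x = 3 * yb x * (w x)\<^sup>2 + (w x) ^ 3" for x
  define d where "d x = w x - z x" for x
  have ws: "\<bar>w x\<bar> <= s" for x using ws by (simp add: w_def)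
  have wC: "C0dom w" using diff_state(3)[OF u] unfolding w_def[abs_def] .
  have zC: "C0dom z" by (rule lin_C0[OF z])
  have wc: "cont w" and wz: "!!x. x ~: \<Omega> ==> w x = 0" and zc: "cont z" and zz: "!!x. x ~: \<Omega> ==> z x = 0"
   using wC zC by (auto simp: C0dom_def)
  have hC: "C0dom h" unfolding C0dom_def h_def using wz by (auto intro!: continuous_intros wc yb_cont)
  have dC: "C0dom d" unfolding d_def by (rule C0dom_diff[OF wC zC])
  have Lw: "L2supp w" and Lh: "L2supp h" and Lz: "L2supp z" and Ld: "L2supp d" by (intro C0dom_L2supp wC hC zC dC)+
  have habs: "\<bar>h x\<bar> <= (3 * Yb + 1) * s * \<bar>w x\<bar>" for x
  proof -
   have "h x = (3 * yb x + w x) * w x * w x" unfolding h_def by (simp add: power2_eq_square power3_eq_cube algebra_simps)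
   then have "\<bar>h x\<bar> = \<bar>3 * yb x + w x\<bar> * \<bar>w x\<bar> * \<bar>w x\<bar>" by (simp add: abs_mult)
   also have "\<dots> <= (3 * Yb + 1) * s * \<bar>w x\<bar>"
   proof (intro mult_mono)
    show "\<bar>3 * yb x + w x\<bar> <= 3 * Yb + 1" using yb_bound[of x] ws[of x] s1 by linarith
   qed (use ws[of x] Yb_nonneg s in auto)
   finally show ?thesis .
  qed
  have e: "- (y x ^ 3 - yb x ^ 3) + 3 * (yb x)\<^sup>2 * z x = - h x - 3 * (yb x)\<^sup>2 * d x" for x
   unfolding d_def h_def w_def by (simp add: power2_eq_square power3_eq_cube algebra_simps)
  have dsol: "linsol 0 (%x. - h x - 3 * (yb x)\<^sup>2 * d x) d" "L2supp (%x. - h x - 3 * (yb x)\<^sup>2 * d x)"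
   using diff_lin[OF u z] unfolding e d_def w_def by simp_all
  have dle: "\<bar>d x\<bar> <= CL2 * sqrt (n2 (%x. \<bar>h x\<bar>))" for x
  proof (rule poisson_L2_abs[OF dsol L2supp_abs[OF Lh]])
   show "- h x - 3 * (yb x)\<^sup>2 * d x <= \<bar>h x\<bar>" if "0 < d x" for x
   proof -
    have "0 <= 3 * (yb x)\<^sup>2 * d x" using that by simp
    then show ?thesis by linarith
   qed
   show "- \<bar>h x\<bar> <= - h x - 3 * (yb x)\<^sup>2 * d x" if "d x < 0" for x
   proof -
    have "3 * (yb x)\<^sup>2 * d x <= 0" using that by (intro mult_nonneg_nonpos) auto
    then show ?thesis by linarith
   qed
  qed simp
  have nh: "n2 (%x. \<bar>h x\<bar>) <= ((3 * Yb + 1) * s)\<^sup>2 * n2 w"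
  proof -
   have "n2 (%x. \<bar>h x\<bar>) <= (LBINT x. ((3 * Yb + 1) * s)\<^sup>2 * (w x)\<^sup>2)"
   proof (rule n2_le[OF L2supp_abs[OF Lh]])
    show "(\<bar>h x\<bar>)\<^sup>2 <= ((3 * Yb + 1) * s)\<^sup>2 * (w x)\<^sup>2" for x
     using power_mono[OF habs[of x], of 2] by (simp add: power_mult_distrib)
   qed (intro integrable_mult_right L2supp_square[OF Lw])
   then show ?thesis by (simp add: n2_def)
  qed
  have nd: "n2 d <= D * s\<^sup>2 * n2 w"
  proof -
   have "n2 d <= (CL2 * sqrt (n2 (%x. \<bar>h x\<bar>)))\<^sup>2 * vol" by (rule n2_sup_bound[OF Ld dle])
   also have "\<dots> = CL2\<^sup>2 * vol * n2 (%x. \<bar>h x\<bar>)" using n2_nonneg by (simp add: power_mult_distrib)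
   also have "\<dots> <= CL2\<^sup>2 * vol * (((3 * Yb + 1) * s)\<^sup>2 * n2 w)" using vol0 by (intro mult_left_mono[OF nh]) simp
   finally show ?thesis by (simp add: D_def power_mult_distrib ac_simps)
  qed
  have nw0: "0 <= n2 w" by (rule n2_nonneg)
  have Ds: "D * s\<^sup>2 <= 1/4"
  proof -
   have "D * s <= 1/2" using s00(3) mult_left_mono[OF s(2) D0] by linarith
   then have "D * s * s <= 1/2 * s" using s by (intro mult_right_mono) auto
   moreover have "s0 <= 1/2" unfolding s0_def using D0 by (intro frac_le) auto
   then have "s <= 1/2" using s(2) by linarith
   ultimately show ?thesis by (simp add: power2_eq_square)
  qed
  have nd4: "n2 d <= 1/4 * n2 w" using nd mult_right_mono[OF Ds nw0] by linarith
  have sq2: "n2 f <= 2 * n2 g + 2 * n2 k" if "L2supp f" "L2supp g" "L2supp k" "!!x. f x = g x + k x" for f g k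
  proof -
   have "n2 f <= (LBINT x. 2 * (g x)\<^sup>2 + 2 * (k x)\<^sup>2)"
   proof (rule n2_le[OF that(1)])
    show "(f x)\<^sup>2 <= 2 * (g x)\<^sup>2 + 2 * (k x)\<^sup>2" for x
     using zero_le_power2[of "g x - k x"] unfolding that(4) by (simp add: power2_eq_square algebra_simps)
   qed (intro b_integrable_add integrable_mult_right L2supp_square that)
   also have "\<dots> = 2 * n2 g + 2 * n2 k" using L2supp_square[OF that(2)] L2supp_square[OF that(3)] by (simp add: n2_def)
   finally show ?thesis .
  qed
  have wz4: "n2 w <= 4 * n2 z" using sq2[OF Lw Lz Ld] nd4 by (simp add: d_def)
  have "n2 z <= 2 * n2 w + 2 * n2 (%x. - d x)" by (rule sq2[OF Lz Lw L2supp_uminus[OF Ld]]) (simp add: d_def)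
  then have zw4: "n2 z <= 4 * n2 w" using nd4 nw0 n2_cmult[of "-1" d] by simp
  define R where "R x = (1/2 * (w x)\<^sup>2 - h x * p x) - 1/2 * ((1 - 6 * yb x * p x) * (z x)\<^sup>2)" for x
  have CI: "integrable lborel f" if "cont f" "!!x. x ~: \<Omega> ==> f x = 0" for f :: "'a => real"
   using that by (intro L2supp_integrable C0dom_L2supp) (simp add: C0dom_def)
  have hc: "cont h" using hC by (simp add: C0dom_def)
  have i1: "integrable lborel (%x. 1/2 * (w x)\<^sup>2)" by (rule CI) (auto intro!: continuous_intros wc simp: wz)
  have i2: "integrable lborel (%x. h x * p x)" by (rule integrable_L2_product[OF Lh C0dom_L2supp[OF p_C0]])
  have i3: "integrable lborel (%x. 1/2 * ((1 - 6 * yb x * p x) * (z x)\<^sup>2))"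
   by (rule CI) (auto intro!: continuous_intros zc yb_cont p_cont simp: zz)
  have iR: "integrable lborel R" unfolding R_def using i1 i2 i3 by (intro b_integrable_diff)
  have "Jd y - Q (%x. u x - ub x) z = 1/2 * n2 w - ip h p - 1/2 * (LBINT x. (1 - 6 * yb x * p x) * (z x)\<^sup>2)"
   unfolding Jd_expansion[OF u] Q_def h_def w_def by simp
  also have "\<dots> = (LBINT x. R x)" unfolding R_def
   by (simp only: b_integral_diff[OF b_integrable_diff[OF i1 i2] i3]
     b_integral_diff[OF i1 i2]) (simp add: n2_def ip_def)
  finally have JR: "Jd y - Q (%x. u x - ub x) z = (LBINT x. R x)" .
  have Rle: "\<bar>R x\<bar> <= (A * s + P * s) * (w x)\<^sup>2 + A * (1 / s + 1) * (d x)\<^sup>2" for x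
  proof -
   have zd: "z x = w x - d x" by (simp add: d_def)
   have "R x = (1/2 - 3 * yb x * p x) * (2 * (d x * w x) - (d x)\<^sup>2) - p x * (w x * (w x)\<^sup>2)"
    unfolding R_def h_def zd by (simp add: power2_eq_square power3_eq_cube algebra_simps)
   also have "\<bar>\<dots>\<bar> <= \<bar>1/2 - 3 * yb x * p x\<bar> * \<bar>2 * (d x * w x) - (d x)\<^sup>2\<bar> + \<bar>p x\<bar> * (\<bar>w x\<bar> * (w x)\<^sup>2)"
    by (rule order_trans[OF abs_triangle_ineq4]) (simp add: abs_mult)
   also have "\<dots> <= A * (s * (w x)\<^sup>2 + (d x)\<^sup>2 / s + (d x)\<^sup>2) + P * (s * (w x)\<^sup>2)"
   proof (intro add_mono mult_mono)
    have "\<bar>3 * yb x * p x\<bar> <= 3 * Yb * P" unfolding abs_mult using yb_bound[of x] P[of x] Yb_nonneg by (intro mult_mono) auto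
    then show "\<bar>1/2 - 3 * yb x * p x\<bar> <= A" unfolding A_def by linarith
    have a: "0 <= (s * w x - d x)\<^sup>2 / s" "0 <= (s * w x + d x)\<^sup>2 / s" using s by auto
    have "(s * w x - d x)\<^sup>2 / s = s * (w x)\<^sup>2 - 2 * (d x * w x) + (d x)\<^sup>2 / s" "(s * w x + d x)\<^sup>2 / s = s * (w x)\<^sup>2 + 2 * (d x * w x) + (d x)\<^sup>2 / s"
     using s by (simp_all add: power2_eq_square field_simps)
    then have "\<bar>2 * (d x * w x)\<bar> <= s * (w x)\<^sup>2 + (d x)\<^sup>2 / s" using a by (simp add: abs_le_iff)
    then show "\<bar>2 * (d x * w x) - (d x)\<^sup>2\<bar> <= s * (w x)\<^sup>2 + (d x)\<^sup>2 / s + (d x)\<^sup>2"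
     using abs_triangle_ineq4[of "2 * (d x * w x)" "(d x)\<^sup>2"] by simp
   qed (use A0 P P0 ws s in auto)
   also have "\<dots> = (A * s + P * s) * (w x)\<^sup>2 + A * (1 / s + 1) * (d x)\<^sup>2" by (simp add: algebra_simps)
   finally show ?thesis .
  qed
  have "\<bar>LBINT x. R x\<bar> <= (LBINT x. (A * s + P * s) * (w x)\<^sup>2 + A * (1 / s + 1) * (d x)\<^sup>2)"
   by (rule order_trans[OF integral_abs_bound integral_mono[OF integrable_abs[OF iR] _ Rle]])
    (intro b_integrable_add integrable_mult_right L2supp_square Lw Ld)
  also have "\<dots> = (A * s + P * s) * n2 w + A * (1 / s + 1) * n2 d"
   using L2supp_square[OF Lw] L2supp_square[OF Ld] by (simp add: n2_def)
  also have "\<dots> <= (A * s + P * s) * n2 w + A * (1 / s + 1) * (D * s\<^sup>2 * n2 w)"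
   using A0 s by (intro add_left_mono mult_left_mono[OF nd]) simp
  also have "\<dots> = (A * s + P * s + A * D * (s + s * s)) * n2 w" using s by (simp add: power2_eq_square field_simps)
  also have "\<dots> <= E * s * n2 w"
  proof (rule mult_right_mono[OF _ nw0])
   have "s * s <= s" using s s1 by (simp add: mult_left_le)
   then have "A * D * (s + s * s) <= A * D * (s + s)" using A0 D0 by (intro mult_left_mono) auto
   then show "A * s + P * s + A * D * (s + s * s) <= E * s" by (simp add: E_def algebra_simps)
  qed
  finally show ?thesis unfolding JR using wz4 zw4 by (simp add: w_def[abs_def])
 qed
 show ?thesis by (rule that[OF E0 s00(1)]) (rule main, assumption+)
qed

lemma diff_sup_small:
 assumes s: "s > 0"
 shows "\<exists>e>0. ALL u y. adm u --> cstate u y --> n2 (%x. y x - yb x) <= e --> (ALL x. \<bar>y x - yb x\<bar> <= s)"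
proof -
 have F: "0 <= 2 * Fb" using Fb_nonneg by simp
 obtain e where e: "e > 0" "ALL g y. linsol 0 g y --> L2supp g --> (ALL x. 0 < y x --> g x <= 2 * Fb) --> (ALL x. y x < 0 --> - (2 * Fb) <= g x) -->
  n2 y <= e --> (ALL x. \<bar>y x\<bar> <= s)" using small_L2_small_sup[OF F s] by blast
 have "ALL x. \<bar>y x - yb x\<bar> <= s" if u: "adm u" "cstate u y" and n: "n2 (%x. y x - yb x) <= e" for u y
 proof -
  have b: "\<bar>u x\<bar> <= Fb" "\<bar>ub x\<bar> <= Fb" for x by (rule adm_bound[OF u(1)], rule adm_bound[OF ub(1)])
  have 1: "(u x - y x ^ 3) - (ub x - yb x ^ 3) <= 2 * Fb" if "0 < y x - yb x" for x
   using cube_mono[of "yb x" "y x"] that b[of x] by linarith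
  have 2: "- (2 * Fb) <= (u x - y x ^ 3) - (ub x - yb x ^ 3)" if "y x - yb x < 0" for x
   using cube_mono[of "y x" "yb x"] that b[of x] by linarith
  show ?thesis using e(2)[rule_format, OF diff_state(1,2)[OF u] 1 2 n] by blast
 qed
 then show ?thesis using e(1) by blast
qed

lemma lin_sup_small:
 assumes s: "s > 0"
 shows "\<exists>e>0. ALL u y z. adm u --> cstate u y --> lin (%x. u x - ub x) z --> n2 z <= e --> (ALL x. \<bar>y x - yb x\<bar> <= s)"
proof -
 define C where "C = 6 * Yb\<^sup>2 * Kdom + 1"
 have C: "C > 0" using Kdom_nonneg by (simp add: C_def add_nonneg_pos)
 define t where "t = s / C"
 have t: "t > 0" "C * t = s" using s C by (auto simp: t_def)
 have F: "0 <= 2 * Fb" using Fb_nonneg by simp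
 obtain e where e: "e > 0" "ALL g y. linsol 0 g y --> L2supp g --> (ALL x. 0 < y x --> g x <= 2 * Fb) --> (ALL x. y x < 0 --> - (2 * Fb) <= g x) -->
  n2 y <= e --> (ALL x. \<bar>y x\<bar> <= t)" using small_L2_small_sup[OF F t(1)] by blast
 have "\<bar>y x - yb x\<bar> <= s" if u: "adm u" "cstate u y" and z: "lin (%x. u x - ub x) z" and n: "n2 z <= e" for u y z x
 proof -
  have b: "\<bar>u x\<bar> <= Fb" "\<bar>ub x\<bar> <= Fb" for x by (rule adm_bound[OF u(1)], rule adm_bound[OF ub(1)])
  have L: "L2supp (%x. (u x - ub x) - 3 * (yb x)\<^sup>2 * z x)"
   by (rule L2supp_diff[OF L2supp_diff[OF adm_L2supp[OF u(1)] adm_L2supp[OF ub(1)]] L2yb[OF lin_C0[OF z]]])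
  have 1: "(u x - ub x) - 3 * (yb x)\<^sup>2 * z x <= 2 * Fb" if "0 < z x" for x
  proof -
   have "0 <= 3 * (yb x)\<^sup>2 * z x" using that by simp
   then show ?thesis using b[of x] by linarith
  qed
  have 2: "- (2 * Fb) <= (u x - ub x) - 3 * (yb x)\<^sup>2 * z x" if "z x < 0" for x
  proof -
   have "3 * (yb x)\<^sup>2 * z x <= 0" using that by (intro mult_nonneg_nonpos) auto
   then show ?thesis using b[of x] by linarith
  qed
  have zt: "\<bar>z x\<bar> <= t" for x using e(2)[rule_format, OF z[unfolded lin_def] L 1 2 n] .
  define a where "a x = (y x)\<^sup>2 + yb x * y x + (yb x)\<^sup>2" for x
  have a0: "0 <= a x" for x unfolding a_def by (rule cube_factor_nonneg)
  have sq: "(y x)\<^sup>2 <= Yb\<^sup>2" "(yb x)\<^sup>2 <= Yb\<^sup>2" "yb x * y x <= Yb\<^sup>2" for x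
  proof -
   show "(y x)\<^sup>2 <= Yb\<^sup>2" "(yb x)\<^sup>2 <= Yb\<^sup>2"
    using power_mono[OF adm_state_bound[OF u, of x], of 2] power_mono[OF yb_bound[of x], of 2] by auto
   have "\<bar>yb x * y x\<bar> <= Yb * Yb" unfolding abs_mult using adm_state_bound[OF u, of x] yb_bound[of x] Yb_nonneg by (intro mult_mono) auto
   then show "yb x * y x <= Yb\<^sup>2" by (simp add: power2_eq_square)
  qed
  have k: "\<bar>3 * (yb x)\<^sup>2 - a x\<bar> <= 6 * Yb\<^sup>2" for x
  proof -
   have "a x <= 3 * Yb\<^sup>2" using sq[of x] by (simp add: a_def)
   then show ?thesis using a0[of x] sq(2)[of x] zero_le_power2[of "yb x"] unfolding abs_le_iff by linarith
  qed
  have q: "\<bar>(3 * (yb x)\<^sup>2 - a x) * z x\<bar> <= 6 * Yb\<^sup>2 * t" for x unfolding abs_mult using k[of x] zt[of x] by (intro mult_mono) auto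
  have e: "- (y x ^ 3 - yb x ^ 3) + 3 * (yb x)\<^sup>2 * z x = (3 * (yb x)\<^sup>2 - a x) * z x - a x * ((y x - yb x) - z x)" for x
   unfolding cube_diff a_def by (simp add: algebra_simps)
  have "\<bar>(y x - yb x) - z x\<bar> <= 6 * Yb\<^sup>2 * t * Kdom"
  proof (rule poisson_abs[OF diff_lin[OF u z]])
   show "0 <= 6 * Yb\<^sup>2 * t" using t by simp
   show "- (y x ^ 3 - yb x ^ 3) + 3 * (yb x)\<^sup>2 * z x <= 6 * Yb\<^sup>2 * t" if "0 < (y x - yb x) - z x" for x
    unfolding e using q[of x] mult_nonneg_nonneg[OF a0[of x] less_imp_le[OF that]] unfolding abs_le_iff by linarith
   show "- (6 * Yb\<^sup>2 * t) <= - (y x ^ 3 - yb x ^ 3) + 3 * (yb x)\<^sup>2 * z x" if "(y x - yb x) - z x < 0" for x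
    unfolding e using q[of x] mult_nonneg_nonpos[OF a0[of x] less_imp_le[OF that]] unfolding abs_le_iff by linarith
  qed
  then have "\<bar>y x - yb x\<bar> <= 6 * Yb\<^sup>2 * t * Kdom + t" using zt[of x] by linarith
  also have "\<dots> = C * t" by (simp add: C_def algebra_simps)
  finally show ?thesis using t(2) by simp
 qed
 then show ?thesis using e(1) by blast
qed

definition growth :: bool where
 "growth \<longleftrightarrow> (\<exists>c>0. ALL u y. adm u --> cstate u y --> c * n2 (%x. y x - yb x) <= Jd y)"

lemma lin_exists: "adm u ==> EX z. lin (%x. u x - ub x) z"
 unfolding lin_def by (rule linear_exists[OF yb_C0 L2supp_diff[OF adm_L2supp adm_L2supp[OF ub(1)]]])

lemma growth_imp_second_order:
 assumes growth
 shows "\<exists>\<delta>>0. \<exists>c>0. ALL u z. adm u --> lin (%x. u x - ub x) z --> sqrt (n2 z) <= \<delta> --> c * n2 z <= Q (%x. u x - ub x) z"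
proof -
 obtain c where c: "c > 0" "!!u y. adm u ==> cstate u y ==> c * n2 (%x. y x - yb x) <= Jd y" using assms unfolding growth_def by blast
 obtain E s0 where E: "0 <= E" "0 < s0"
  "!!u y z s. adm u ==> cstate u y ==> lin (%x. u x - ub x) z ==> 0 < s ==> s <= s0 ==> (ALL x. \<bar>y x - yb x\<bar> <= s) ==>
   \<bar>Jd y - Q (%x. u x - ub x) z\<bar> <= E * s * n2 (%x. y x - yb x) \<and>
   n2 (%x. y x - yb x) <= 4 * n2 z & n2 z <= 4 * n2 (%x. y x - yb x)" by (rule taylor) (rule that, assumption+)
 define s where "s = min s0 (c / 2 / (E + 1))"
 have s: "0 < s" "s <= s0" using E c by (auto simp: s_def)
 have Es: "E * s <= c / 2"
 proof -
  have ne: "E + 1 ~= 0" using E(1) by linarith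
  have g: "(E + 1) * (a / (E + 1)) = a" for a using ne by simp
  have "s <= c / 2 / (E + 1)" unfolding s_def by (rule min.cobounded2)
  then have "E * s <= (E + 1) * (c / 2 / (E + 1))" using E(1) s(1) by (intro mult_mono) auto
  then show ?thesis unfolding g .
 qed
 obtain e where e: "e > 0" "!!u y z. adm u ==> cstate u y ==> lin (%x. u x - ub x) z ==> n2 z <= e ==> (ALL x. \<bar>y x - yb x\<bar> <= s)"
  using lin_sup_small[OF s(1)] by blast
 have "c / 8 * n2 z <= Q (%x. u x - ub x) z" if u: "adm u" and z: "lin (%x. u x - ub x) z" and n: "sqrt (n2 z) <= sqrt e" for u z
 proof -
  obtain y where y: "cstate u y" by (rule adm_exists_state[OF u])
  have ne: "n2 z <= e" using n by simp
  have T: "\<bar>Jd y - Q (%x. u x - ub x) z\<bar> <= E * s * n2 (%x. y x - yb x)" "n2 z <= 4 * n2 (%x. y x - yb x)"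
   using E(3)[OF u y z s] e(2)[OF u y z ne] by blast+
  have "E * s * n2 (%x. y x - yb x) <= c / 2 * n2 (%x. y x - yb x)" by (rule mult_right_mono[OF Es n2_nonneg])
  then have "c / 2 * n2 (%x. y x - yb x) <= Q (%x. u x - ub x) z" using T(1) c(2)[OF u y] by (simp add: abs_le_iff)
  moreover have "c / 8 * n2 z <= c / 8 * (4 * n2 (%x. y x - yb x))" using c(1) by (intro mult_left_mono[OF T(2)]) simp
  ultimately show ?thesis by simp
 qed
 then show ?thesis using e(1) c(1) by (intro exI[of _ "sqrt e"] conjI exI[of _ "c / 8"]) auto
qed

lemma second_order_imp_growth:
 assumes "\<exists>\<delta>>0. \<exists>c>0. ALL u z. adm u --> lin (%x. u x - ub x) z --> sqrt (n2 z) <= \<delta> --> c * n2 z <= Q (%x. u x - ub x) z"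
 shows growth
proof -
 obtain \<delta> c where c: "\<delta> > 0" "c > 0" "!!u z. adm u ==> lin (%x. u x - ub x) z ==> sqrt (n2 z) <= \<delta> ==> c * n2 z <= Q (%x. u x - ub x) z"
  using assms by blast
 obtain E s0 where E: "0 <= E" "0 < s0"
  "!!u y z s. adm u ==> cstate u y ==> lin (%x. u x - ub x) z ==> 0 < s ==> s <= s0 ==> (ALL x. \<bar>y x - yb x\<bar> <= s) ==>
   \<bar>Jd y - Q (%x. u x - ub x) z\<bar> <= E * s * n2 (%x. y x - yb x) \<and>
   n2 (%x. y x - yb x) <= 4 * n2 z & n2 z <= 4 * n2 (%x. y x - yb x)" by (rule taylor) (rule that, assumption+)
 define s where "s = min s0 (c / 8 / (E + 1))"
 have s: "0 < s" "s <= s0" using E c by (auto simp: s_def)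
 have Es: "E * s <= c / 8"
 proof -
  have ne: "E + 1 ~= 0" using E(1) by linarith
  have g: "(E + 1) * (a / (E + 1)) = a" for a using ne by simp
  have "s <= c / 8 / (E + 1)" unfolding s_def by (rule min.cobounded2)
  then have "E * s <= (E + 1) * (c / 8 / (E + 1))" using E(1) s(1) by (intro mult_mono) auto
  then show ?thesis unfolding g .
 qed
 obtain e0 where e0: "e0 > 0" "!!u y. adm u ==> cstate u y ==> n2 (%x. y x - yb x) <= e0 ==> (ALL x. \<bar>y x - yb x\<bar> <= s)"
  using diff_sup_small[OF s(1)] by blast
 define e where "e = min e0 (\<delta>\<^sup>2 / 4)"
 have e: "e > 0" "e <= e0" "4 * e <= \<delta>\<^sup>2" using e0 c by (auto simp: e_def)
 have local: "c / 8 * n2 (%x. y x - yb x) <= Jd y" if u: "adm u" and y: "cstate u y" and n: "n2 (%x. y x - yb x) <= e" for u y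
 proof -
  obtain z where z: "lin (%x. u x - ub x) z" using lin_exists[OF u] by blast
  have T: "\<bar>Jd y - Q (%x. u x - ub x) z\<bar> <= E * s * n2 (%x. y x - yb x)" "n2 z <= 4 * n2 (%x. y x - yb x)" "n2 (%x. y x - yb x) <= 4 * n2 z"
   using E(3)[OF u y z s] e0(2)[OF u y order_trans[OF n e(2)]] by blast+
  have "n2 z <= \<delta>\<^sup>2" using T(2) n e(3) by linarith
  then have "sqrt (n2 z) <= \<delta>" using real_sqrt_le_mono[of "n2 z" "\<delta>\<^sup>2"] c(1) by simp
  from c(3)[OF u z this] have 1: "c * n2 z <= Q (%x. u x - ub x) z" .
  have 2: "E * s * n2 (%x. y x - yb x) <= c / 8 * n2 (%x. y x - yb x)" by (rule mult_right_mono[OF Es n2_nonneg])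
  have 3: "c / 4 * n2 (%x. y x - yb x) <= c / 4 * (4 * n2 z)" using c(2) by (intro mult_left_mono[OF T(3)]) simp
  have "c / 4 * n2 (%x. y x - yb x) = c / 8 * n2 (%x. y x - yb x) + c / 8 * n2 (%x. y x - yb x)" by simp
  then show ?thesis using 1 2 3 T(1) by (simp add: abs_le_iff)
 qed
 obtain m where m: "m > 0" "!!u y. adm u ==> cstate u y ==> e <= n2 (%x. y x - yb x) ==> n2 (%x. yb x - yd x) + m <= n2 (%x. y x - yd x)"
 proof -
  have "\<exists>m>0. ALL u y. adm u --> cstate u y --> e <= n2 (%x. y x - yb x) --> n2 (%x. yb x - yd x) + m <= n2 (%x. y x - yd x)"
   by (rule strict_minimiser_gap[OF ub yd _ e(1)]) (rule strict)
  then show ?thesis using that by blast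
 qed
 define W where "W = (2 * Yb)\<^sup>2 * vol + 1"
 have W: "W > 0" by (simp add: W_def vol_def add_nonneg_pos)
 have far: "m / (2 * W) * n2 (%x. y x - yb x) <= Jd y" if u: "adm u" and y: "cstate u y" and n: "e <= n2 (%x. y x - yb x)" for u y
 proof -
  have "n2 (%x. y x - yb x) <= (2 * Yb)\<^sup>2 * vol"
  proof (rule n2_sup_bound[OF C0dom_L2supp[OF diff_state(3)[OF u y]]])
   show "\<bar>y x - yb x\<bar> <= 2 * Yb" for x using adm_state_bound[OF u y, of x] yb_bound[of x] by linarith
  qed
  then have "n2 (%x. y x - yb x) <= W" by (simp add: W_def)
  then have "m / (2 * W) * n2 (%x. y x - yb x) <= m / (2 * W) * W" using m(1) W by (intro mult_left_mono) auto
  also have "\<dots> = m / 2" using W by simp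
  also have "\<dots> <= Jd y" using m(2)[OF u y n] by (simp add: Jd_def)
  finally show ?thesis .
 qed
 define k where "k = min (c / 8) (m / (2 * W))"
 have k: "k > 0" "k <= c / 8" "k <= m / (2 * W)" using c m W by (auto simp: k_def)
 have "k * n2 (%x. y x - yb x) <= Jd y" if u: "adm u" and y: "cstate u y" for u y
 proof (cases "n2 (%x. y x - yb x) <= e")
  case True
  show ?thesis using local[OF u y True] mult_right_mono[OF k(2) n2_nonneg] by (rule order_trans[rotated])
 next
  case False
  then have "e <= n2 (%x. y x - yb x)" by simp
  from far[OF u y this] mult_right_mono[OF k(3) n2_nonneg] show ?thesis by (rule order_trans[rotated])
 qed
 then show growth unfolding growth_def using k(1) by blast
qed

definition stable :: "real => bool" where
 "stable \<kappa> \<longleftrightarrow> (ALL \<eta> u y. L2supp \<eta> --> adm u --> cstate u y -->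
  (ALL u' y'. adm u' --> cstate u' y' --> n2 (%x. y x - (yd x + \<eta> x)) <= n2 (%x. y' x - (yd x + \<eta> x))) -->
  sqrt (n2 (%x. y x - yb x)) <= \<kappa> * sqrt (n2 \<eta>))"

lemma perturbed_expansion:
 assumes y: "L2supp y" and y': "L2supp y'" and \<eta>: "L2supp \<eta>"
 shows "n2 (%x. y x - (yd x + \<eta> x)) - n2 (%x. y' x - (yd x + \<eta> x)) =
  n2 (%x. y x - yd x) - n2 (%x. y' x - yd x) - 2 * ip (%x. y x - y' x) \<eta>"
proof -
 have e: "n2 (%x. q x - (yd x + \<eta> x)) = n2 (%x. q x - yd x) - 2 * (ip q \<eta> - ip yd \<eta>) + n2 \<eta>" if "L2supp q" for q
 proof -
  have "(%x. q x - (yd x + \<eta> x)) = (%x. (q x - yd x) - \<eta> x)" by (auto simp: algebra_simps)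
  then show ?thesis using n2_diff[OF L2supp_diff[OF that yd] \<eta>] ip_diff[OF that yd \<eta>] by simp
 qed
 show ?thesis unfolding e[OF y] e[OF y'] ip_diff[OF y y' \<eta>] by simp
qed

lemma growth_imp_stable: assumes growth shows "\<exists>\<kappa>>0. stable \<kappa>"
proof -
 obtain c where c: "c > 0" "!!u y. adm u ==> cstate u y ==> c * n2 (%x. y x - yb x) <= Jd y" using assms unfolding growth_def by blast
 have "sqrt (n2 (%x. y x - yb x)) <= 1 / c * sqrt (n2 \<eta>)"
  if \<eta>: "L2supp \<eta>" and u: "adm u" "cstate u y" and m: "n2 (%x. y x - (yd x + \<eta> x)) <= n2 (%x. yb x - (yd x + \<eta> x))" for \<eta> u y
 proof -
  define r where "r = sqrt (n2 (%x. y x - yb x))"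
  have r: "0 <= r" "r * r = n2 (%x. y x - yb x)" by (simp_all add: r_def n2_nonneg)
  have Ly: "L2supp y" "L2supp yb" by (rule C0dom_L2supp[OF cstate_C0dom[OF u(2)]], rule C0dom_L2supp[OF yb_C0])
  have "Jd y <= ip (%x. y x - yb x) \<eta>" using perturbed_expansion[OF Ly \<eta>] m by (simp add: Jd_def)
  also have "\<dots> <= r * sqrt (n2 \<eta>)" unfolding r_def using ip_bound[OF L2supp_diff[OF Ly] \<eta>] by (simp add: abs_le_iff)
  finally have "r * (c * r) <= r * sqrt (n2 \<eta>)" using c(2)[OF u] r(2) by (simp add: mult.left_commute)
  then have "r = 0 \<or> c * r <= sqrt (n2 \<eta>)" using r(1) by (auto simp: mult_le_cancel_left)
  then have "c * r <= sqrt (n2 \<eta>)" using n2_nonneg by auto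
  then show ?thesis unfolding r_def[symmetric] using c(1) by (simp add: field_simps)
 qed
 then have "stable (1 / c)" unfolding stable_def using ub by blast
 then show ?thesis using c(1) by (intro exI[of _ "1 / c"]) simp
qed

lemma Jd_nonneg: assumes u: "adm u" "cstate u y" shows "0 <= Jd y"
proof (cases "AE x in lborel. x \<in> \<Omega> --> u x = ub x")
 case True
 then have "cstate ub y" by (rule cstate_cong_AE[OF u(2) adm_L2supp[OF u(1)] adm_L2supp[OF ub(1)]])
 then have "y = yb" by (rule cstate_unique[OF _ ub(2) adm_L2supp[OF ub(1)]])
 then show ?thesis by (simp add: Jd_def)
next
 case False
 then show ?thesis using strict[OF u] by (simp add: Jd_def)
qed

text \<open>Apply stability to the perturbation \<open>(y - yb) / (2 \<kappa>)\<close> and compare with \<open>y\<close>.\<close>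
lemma stable_imp_growth: assumes \<kappa>: "\<kappa> > 0" and st: "stable \<kappa>" shows growth
proof -
 have "1 / (4 * \<kappa>) * n2 (%x. y x - yb x) <= Jd y" if u: "adm u" "cstate u y" for u y
 proof -
  define t where "t = 1 / (2 * \<kappa>)"
  have t: "t > 0" using \<kappa> by (simp add: t_def)
  define w where "w x = y x - yb x" for x
  have Ly: "L2supp y" "L2supp yb" by (rule C0dom_L2supp[OF cstate_C0dom[OF u(2)]], rule C0dom_L2supp[OF yb_C0])
  have Lw: "L2supp w" unfolding w_def by (rule L2supp_diff[OF Ly])
  have L\<eta>: "L2supp (%x. t * w x)" using L2supp_add[OF Lw Lw, of t 0] by simp
  have "L2supp (%x. yd x + t * w x)" using L2supp_add[OF yd Lw, of 1 t] by simp
  from minimiser_exists[OF this] obtain v q where v: "adm v" "cstate v q"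
   "ALL u' y'. adm u' --> cstate u' y' --> n2 (%x. q x - (yd x + t * w x)) <= n2 (%x. y' x - (yd x + t * w x))" by blast
  have Lq: "L2supp q" by (rule C0dom_L2supp[OF cstate_C0dom[OF v(2)]])
  have Lqb: "L2supp (%x. q x - yb x)" by (rule L2supp_diff[OF Lq Ly(2)])
  have "sqrt (n2 (%x. q x - yb x)) <= \<kappa> * sqrt (n2 (%x. t * w x))" using st[unfolded stable_def, rule_format, OF L\<eta> v(1,2)] v(3) by blast
  also have "\<dots> = (\<kappa> * t) * sqrt (n2 w)" using t by (simp add: n2_cmult real_sqrt_mult)
  also have "\<kappa> * t = 1 / 2" using \<kappa> by (simp add: t_def)
  finally have "sqrt (n2 (%x. q x - yb x)) * sqrt (n2 w) <= (1 / 2 * sqrt (n2 w)) * sqrt (n2 w)" by (rule mult_right_mono) (simp add: n2_nonneg)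
  then have 1: "ip (%x. q x - yb x) w <= 1 / 2 * n2 w" using ip_bound[OF Lqb Lw] by (simp add: abs_le_iff n2_nonneg)
  have "n2 (%x. q x - (yd x + t * w x)) <= n2 (%x. y x - (yd x + t * w x))" using v(3) u by blast
  then have 2: "Jd q - ip (%x. q x - y x) (%x. t * w x) <= Jd y" using perturbed_expansion[OF Lq Ly(1) L\<eta>] by (simp add: Jd_def)
  have "(%x. q x - y x) = (%x. (q x - yb x) - w x)" by (auto simp: w_def)
  then have 3: "ip (%x. q x - y x) (%x. t * w x) = t * (ip (%x. q x - yb x) w - n2 w)"
   using ip_diff[OF Lqb Lw Lw] ip_cmult[of t w] by (simp add: ip_commute[of _ "%x. t * w x"] ip_commute[of w] ip_self)
  have "t * (ip (%x. q x - yb x) w - n2 w) <= t * (- (1 / 2 * n2 w))" using t 1 by (intro mult_left_mono) auto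
  also have "\<dots> = - (1 / (4 * \<kappa>) * n2 w)" by (simp add: t_def)
  finally have "1 / (4 * \<kappa>) * n2 w <= Jd y" using 2 3 Jd_nonneg[OF v(1,2)] by linarith
  then show ?thesis unfolding w_def .
 qed
 then show growth unfolding growth_def using \<kappa> by (intro exI[of _ "1 / (4 * \<kappa>)"]) auto
qed

lemma second_order_iff_stable:
 "(\<exists>\<delta>>0. \<exists>c>0. ALL u z. adm u --> lin (%x. u x - ub x) z --> sqrt (n2 z) <= \<delta> --> c * n2 z <= Q (%x. u x - ub x) z) \<longleftrightarrow> (\<exists>\<kappa>>0. stable \<kappa>)"
 (is "?L \<longleftrightarrow> ?R")
proof
 assume ?L
 from growth_imp_stable[OF second_order_imp_growth[OF this]] show ?R .
next
 assume ?R
 then obtain \<kappa> where "\<kappa> > 0" "stable \<kappa>" by blast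
 from growth_imp_second_order[OF stable_imp_growth[OF this]] show ?L .
qed

end

context corkscrew_domain begin

lemma L2supp_L2fun: assumes "L2supp f" shows "L2fun \<Omega> f"
proof -
 have m: "f \<in> borel_measurable borel" by (rule L2supp_measurable[OF assms])
 have "f \<in> borel_measurable lebesgue" using m by (intro measurable_completion) simp
 moreover have "set_integrable lebesgue \<Omega> (%x. (f x)\<^sup>2)"
 proof (rule lebesgue_dom(2)[THEN iffD2])
  show "(%x. (f x)\<^sup>2) \<in> borel_measurable borel" using m by simp
  show "(f x)\<^sup>2 = 0" if "x ~: \<Omega>" for x using L2supp_outside[OF assms that] by simp
  show "integrable lborel (%x. (f x)\<^sup>2)" by (rule L2supp_square[OF assms])
 qed simp
 ultimately show ?thesis by (simp add: L2fun_def)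
qed

lemma Jfun_eq:
 assumes u: "rep u u'" and y: "cstate u' y" and q: "rep q q'"
 shows "Jfun \<Omega> q u = 1/2 * n2 (%x. y x - q' x)"
proof -
 have r: "rep (%x. y x - q x) (%x. y x - q' x)" by (rule rep_diff[OF rep_self[OF C0dom_L2supp[OF cstate_C0dom[OF y]]] q])
 note [measurable] = L2supp_measurable[OF rep_L2[OF r]]
 have "(LINT x:\<Omega>|lebesgue. (y x - q x)\<^sup>2) = (LBINT x. (y x - q' x)\<^sup>2)"
 proof (rule lebesgue_dom(1))
  show "(%x. (y x - q' x)\<^sup>2) \<in> borel_measurable borel" by measurable
  show "(y x - q' x)\<^sup>2 = 0" if "x ~: \<Omega>" for x using L2supp_outside[OF rep_L2[OF r] that] by simp
  show "AE x in lborel. x \<in> \<Omega> --> (y x - q x)\<^sup>2 = (y x - q' x)\<^sup>2" using r unfolding rep_def by (auto elim: eventually_mono)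
 qed
 then show ?thesis unfolding Jfun_def state_eqI[OF u y] by (simp add: n2_def)
qed

end

context control_problem begin

lemma Uad_rep: assumes "u \<in> Uad \<Omega> \<alpha> \<beta>" obtains u' where "adm u'" "rep u u'"
proof -
 obtain g where g: "g \<in> borel_measurable lborel" "AE x in lborel. u x = g x"
  using completion_ex_borel_measurable_real[of u lborel] assms by (auto simp: Uad_def)
 note [measurable] = g(1)
 have Om[measurable]: "\<Omega> \<in> sets borel" using open_dom by (rule borel_open)
 define u' where "u' x = (if x \<in> \<Omega> then max \<alpha> (min \<beta> (g x)) else 0)" for x
 have m: "u' \<in> borel_measurable borel" unfolding u'_def by measurable
 have a: "adm u'" using m ab by (auto simp: adm_def u'_def)
 have "AE x in lborel. x \<in> \<Omega> --> u x \<in> {\<alpha>..\<beta>}" using assms by (simp add: Uad_def AE_completion_iff)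
 then have "AE x in lborel. x \<in> \<Omega> --> u x = u' x" using g(2) by eventually_elim (auto simp: u'_def)
 then have "rep u u'" using adm_L2supp[OF a] by (simp add: rep_def)
 with a show ?thesis by (rule that)
qed

lemma adm_Uad: assumes "adm u" shows "u \<in> Uad \<Omega> \<alpha> \<beta>"
proof -
 have m: "u \<in> borel_measurable borel" using assms by (simp add: adm_def)
 have "u \<in> borel_measurable lebesgue" using m by (intro measurable_completion) simp
 moreover have "set_integrable lebesgue \<Omega> u"
  by (rule lebesgue_dom(2)[THEN iffD2, OF m]) (use assms L2supp_integrable[OF adm_L2supp[OF assms]] in \<open>auto simp: adm_def\<close>)
 ultimately show ?thesis using assms by (auto simp: Uad_def adm_def)
qed

end

context optimal_control begin

lemma lin_state_eq:
 assumes ubar: "rep ubar ub" and u: "rep u u'" and z: "lin (%x. u' x - ub x) z"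
 shows "lin_state \<Omega> ubar (%x. u x - ubar x) = z"
 unfolding lin_state_def state_eqI[OF ubar ub(2)]
 by (rule linear_sol_eqI[OF yb_C0 rep_diff[OF u ubar] z[unfolded lin_def]])

lemma adjoint_eq:
 assumes ubar: "rep ubar ub" and q: "rep q yd"
 shows "adjoint \<Omega> q ubar = p"
 unfolding adjoint_def state_eqI[OF ubar ub(2)]
 by (rule linear_sol_eqI[OF yb_C0 rep_diff[OF rep_self[OF C0dom_L2supp[OF yb_C0]] q] p])

lemma second_order_eq:
 assumes ubar: "rep ubar ub" and q: "rep q yd" and u: "rep u u'" and z: "lin (%x. u' x - ub x) z"
 shows "J1 \<Omega> q ubar (%x. u x - ubar x) + 1/2 * J2 \<Omega> q ubar (%x. u x - ubar x) = Q (%x. u' x - ub x) z"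
proof -
 have r: "rep (%x. u x - ubar x) (%x. u' x - ub x)" by (rule rep_diff[OF u ubar])
 have zC: "C0dom z" by (rule lin_C0[OF z])
 note [measurable] = L2supp_measurable[OF rep_L2[OF r]] borel_measurable_UNIV[OF p_cont] borel_measurable_UNIV[OF yb_cont]
  L2supp_measurable[OF C0dom_L2supp[OF zC]]
 have "(LINT x:\<Omega>|lebesgue. p x * (u x - ubar x)) = (LBINT x. p x * (u' x - ub x))"
 proof (rule lebesgue_dom(1))
  show "(%x. p x * (u' x - ub x)) \<in> borel_measurable borel" by measurable
  show "p x * (u' x - ub x) = 0" if "x ~: \<Omega>" for x using L2supp_outside[OF rep_L2[OF r] that] by simp
  show "AE x in lborel. x \<in> \<Omega> --> p x * (u x - ubar x) = p x * (u' x - ub x)" using r unfolding rep_def by (auto elim: eventually_mono)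
 qed
 moreover have "(LINT x:\<Omega>|lebesgue. (1 - 6 * yb x * p x) * (z x)\<^sup>2) = (LBINT x. (1 - 6 * yb x * p x) * (z x)\<^sup>2)"
 proof (rule lebesgue_dom(1))
  show "(%x. (1 - 6 * yb x * p x) * (z x)\<^sup>2) \<in> borel_measurable borel" by measurable
  show "(1 - 6 * yb x * p x) * (z x)\<^sup>2 = 0" if "x ~: \<Omega>" for x using zC that by (simp add: C0dom_def)
 qed simp
 ultimately show ?thesis
  unfolding J1_def J2_def adjoint_eq[OF ubar q] lin_state_eq[OF ubar u z] state_eqI[OF ubar ub(2)] by (simp add: Q_def ip_def)
qed

lemma perturbed_Jfun_eq:
 assumes q: "rep q yd" and \<eta>: "rep \<eta> \<eta>'" and u: "rep u u'" and y: "cstate u' y"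
 shows "Jfun \<Omega> (%x. q x + \<eta> x) u = 1/2 * n2 (%x. y x - (yd x + \<eta>' x))"
 using Jfun_eq[OF u y rep_linear[OF q \<eta>, of 1 1]] by simp

lemma second_order_condition_iff:
 assumes ubar: "rep ubar ub" and q: "rep q yd"
 shows "(\<exists>\<delta>>0. \<exists>c>0. \<forall>u\<in>Uad \<Omega> \<alpha> \<beta>. L2norm \<Omega> (lin_state \<Omega> ubar (%x. u x - ubar x)) <= \<delta> -->
   J1 \<Omega> q ubar (%x. u x - ubar x) + 1/2 * J2 \<Omega> q ubar (%x. u x - ubar x) >= c * (L2norm \<Omega> (lin_state \<Omega> ubar (%x. u x - ubar x)))\<^sup>2) \<longleftrightarrow>
  (\<exists>\<delta>>0. \<exists>c>0. ALL u z. adm u --> lin (%x. u x - ub x) z --> sqrt (n2 z) <= \<delta> --> c * n2 z <= Q (%x. u x - ub x) z)"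
  (is "?L \<longleftrightarrow> ?R")
proof -
 have nz: "L2norm \<Omega> (lin_state \<Omega> ubar (%x. u x - ubar x)) = sqrt (n2 z)" if "rep u u'" "lin (%x. u' x - ub x) z" for u u' z
  unfolding lin_state_eq[OF ubar that] rep_L2norm[OF rep_self[OF C0dom_L2supp[OF lin_C0[OF that(2)]]]] by (simp add: n2_def)
 show ?thesis
 proof
  assume ?L
  then obtain \<delta> c where c: "\<delta> > 0" "c > 0" "!!u. u \<in> Uad \<Omega> \<alpha> \<beta> ==> L2norm \<Omega> (lin_state \<Omega> ubar (%x. u x - ubar x)) <= \<delta> ==>
   c * (L2norm \<Omega> (lin_state \<Omega> ubar (%x. u x - ubar x)))\<^sup>2 <= J1 \<Omega> q ubar (%x. u x - ubar x) + 1/2 * J2 \<Omega> q ubar (%x. u x - ubar x)" by blast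
  have "c * n2 z <= Q (%x. u x - ub x) z" if u: "adm u" and z: "lin (%x. u x - ub x) z" and n: "sqrt (n2 z) <= \<delta>" for u z
   using c(3)[OF adm_Uad[OF u]] n
   unfolding nz[OF rep_self[OF adm_L2supp[OF u]] z] second_order_eq[OF ubar q rep_self[OF adm_L2supp[OF u]] z] by (simp add: n2_nonneg)
  then show ?R using c(1,2) by blast
 next
  assume ?R
  then obtain \<delta> c where c: "\<delta> > 0" "c > 0" "!!u z. adm u ==> lin (%x. u x - ub x) z ==> sqrt (n2 z) <= \<delta> ==> c * n2 z <= Q (%x. u x - ub x) z" by blast
  have "c * (L2norm \<Omega> (lin_state \<Omega> ubar (%x. u x - ubar x)))\<^sup>2 <= J1 \<Omega> q ubar (%x. u x - ubar x) + 1/2 * J2 \<Omega> q ubar (%x. u x - ubar x)"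
   if u: "u \<in> Uad \<Omega> \<alpha> \<beta>" and n: "L2norm \<Omega> (lin_state \<Omega> ubar (%x. u x - ubar x)) <= \<delta>" for u
  proof -
   obtain u' where u': "adm u'" "rep u u'" by (rule Uad_rep[OF u])
   obtain z where z: "lin (%x. u' x - ub x) z" using lin_exists[OF u'(1)] by blast
   show ?thesis using c(3)[OF u'(1) z] n unfolding nz[OF u'(2) z] second_order_eq[OF ubar q u'(2) z] by (simp add: n2_nonneg)
  qed
  then show ?L using c(1,2) by blast
 qed
qed

lemma stability_iff:
 assumes ubar: "rep ubar ub" and q: "rep q yd"
 shows "(ALL \<eta>. L2fun \<Omega> \<eta> --> (\<forall>u\<eta>\<in>Uad \<Omega> \<alpha> \<beta>.
   (\<forall>u\<in>Uad \<Omega> \<alpha> \<beta>. Jfun \<Omega> (%x. q x + \<eta> x) u\<eta> <= Jfun \<Omega> (%x. q x + \<eta> x) u) -->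
   L2norm \<Omega> (%x. state \<Omega> u\<eta> x - state \<Omega> ubar x) <= \<kappa> * L2norm \<Omega> \<eta>)) \<longleftrightarrow> stable \<kappa>" (is "?L \<longleftrightarrow> ?R")
proof -
 have sb: "state \<Omega> ubar = yb" by (rule state_eqI[OF ubar ub(2)])
 have nd: "L2norm \<Omega> (%x. state \<Omega> u x - state \<Omega> ubar x) = sqrt (n2 (%x. y x - yb x))" if "rep u u'" "cstate u' y" for u u' y
  unfolding sb state_eqI[OF that] n2_def
  by (rule rep_L2norm[OF rep_self[OF C0dom_L2supp[OF C0dom_diff[OF cstate_C0dom[OF that(2)] yb_C0]]]])
 show ?thesis
 proof
  assume L: ?L
  show ?R unfolding stable_def
  proof (intro allI impI)
   fix \<eta> u y assume \<eta>: "L2supp \<eta>" and u: "adm u" "cstate u y"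
    and m: "ALL u' y'. adm u' --> cstate u' y' --> n2 (%x. y x - (yd x + \<eta> x)) <= n2 (%x. y' x - (yd x + \<eta> x))"
   have ru: "rep u u" and r\<eta>: "rep \<eta> \<eta>" by (rule rep_self[OF adm_L2supp[OF u(1)]], rule rep_self[OF \<eta>])
   have "Jfun \<Omega> (%x. q x + \<eta> x) u <= Jfun \<Omega> (%x. q x + \<eta> x) w" if w: "w \<in> Uad \<Omega> \<alpha> \<beta>" for w
   proof -
    obtain w' where w': "adm w'" "rep w w'" by (rule Uad_rep[OF w])
    obtain y' where y': "cstate w' y'" by (rule adm_exists_state[OF w'(1)])
    show ?thesis unfolding perturbed_Jfun_eq[OF q r\<eta> ru u(2)] perturbed_Jfun_eq[OF q r\<eta> w'(2) y'] using m w'(1) y' by simp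
   qed
   then have "L2norm \<Omega> (%x. state \<Omega> u x - state \<Omega> ubar x) <= \<kappa> * L2norm \<Omega> \<eta>" using L L2supp_L2fun[OF \<eta>] adm_Uad[OF u(1)] by blast
   then show "sqrt (n2 (%x. y x - yb x)) <= \<kappa> * sqrt (n2 \<eta>)" unfolding nd[OF ru u(2)] rep_L2norm[OF r\<eta>] n2_def .
  qed
 next
  assume R: ?R
  show ?L
  proof (intro allI impI ballI)
   fix \<eta> u assume \<eta>: "L2fun \<Omega> \<eta>" and u: "u \<in> Uad \<Omega> \<alpha> \<beta>"
    and m: "\<forall>w\<in>Uad \<Omega> \<alpha> \<beta>. Jfun \<Omega> (%x. q x + \<eta> x) u <= Jfun \<Omega> (%x. q x + \<eta> x) w"
   obtain \<eta>' where \<eta>': "rep \<eta> \<eta>'" by (rule L2fun_rep[OF \<eta>])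
   obtain u' where u': "adm u'" "rep u u'" by (rule Uad_rep[OF u])
   obtain y where y: "cstate u' y" by (rule adm_exists_state[OF u'(1)])
   have "n2 (%x. y x - (yd x + \<eta>' x)) <= n2 (%x. y' x - (yd x + \<eta>' x))" if w: "adm w" "cstate w y'" for w y'
   proof -
    have "Jfun \<Omega> (%x. q x + \<eta> x) u <= Jfun \<Omega> (%x. q x + \<eta> x) w" using m adm_Uad[OF w(1)] by blast
    then show ?thesis unfolding perturbed_Jfun_eq[OF q \<eta>' u'(2) y] perturbed_Jfun_eq[OF q \<eta>' rep_self[OF adm_L2supp[OF w(1)]] w(2)] by simp
   qed
   then have "sqrt (n2 (%x. y x - yb x)) <= \<kappa> * sqrt (n2 \<eta>')" using R rep_L2[OF \<eta>'] u'(1) y unfolding stable_def by blast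
   then show "L2norm \<Omega> (%x. state \<Omega> u x - state \<Omega> ubar x) <= \<kappa> * L2norm \<Omega> \<eta>" unfolding nd[OF u'(2) y] rep_L2norm[OF \<eta>'] n2_def .
  qed
 qed
qed

end

theorem theorem5p3:
  fixes \<Omega> :: "'a::euclidean_space set" and \<alpha> \<beta> :: real and yd ubar :: "'a \<Rightarrow> real"
  assumes dim: "DIM('a) \<in> {2, 3}"
    and dom: "lipschitz_domain \<Omega>"
    and ab: "\<alpha> < \<beta>"
    and yd: "L2fun \<Omega> yd"
    and ubar: "ubar \<in> Uad \<Omega> \<alpha> \<beta>"
    and strict_min: "\<forall>u\<in>Uad \<Omega> \<alpha> \<beta>. \<not> (AE x in lebesgue. x \<in> \<Omega> \<longrightarrow> u x = ubar x) \<longrightarrow>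
                        Jfun \<Omega> yd ubar < Jfun \<Omega> yd u"
  shows "(\<exists>\<delta>>0. \<exists>c>0. \<forall>u\<in>Uad \<Omega> \<alpha> \<beta>.
            L2norm \<Omega> (lin_state \<Omega> ubar (\<lambda>x. u x - ubar x)) \<le> \<delta> \<longrightarrow>
            J1 \<Omega> yd ubar (\<lambda>x. u x - ubar x) + 1/2 * J2 \<Omega> yd ubar (\<lambda>x. u x - ubar x)
              \<ge> c * (L2norm \<Omega> (lin_state \<Omega> ubar (\<lambda>x. u x - ubar x)))\<^sup>2)
         \<longleftrightarrow>
         (\<exists>\<kappa>>0. \<forall>\<eta>. L2fun \<Omega> \<eta> \<longrightarrow>
            (\<forall>u\<eta>\<in>Uad \<Omega> \<alpha> \<beta>.
               (\<forall>u\<in>Uad \<Omega> \<alpha> \<beta>. Jfun \<Omega> (\<lambda>x. yd x + \<eta> x) u\<eta> \<le> Jfun \<Omega> (\<lambda>x. yd x + \<eta> x) u) \<longrightarrow>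
               L2norm \<Omega> (\<lambda>x. state \<Omega> u\<eta> x - state \<Omega> ubar x) \<le> \<kappa> * L2norm \<Omega> \<eta>))"
proof -
 interpret control_problem \<Omega> \<alpha> \<beta>
 proof
  show "open \<Omega>" "bounded \<Omega>" using dom by (auto simp: lipschitz_domain_def)
 qed (rule dim lipschitz_domain_corkscrew[OF dom] ab)+
 obtain yd' where ydr: "rep yd yd'" by (rule L2fun_rep[OF yd])
 obtain ub where ur: "adm ub" "rep ubar ub" by (rule Uad_rep[OF ubar])
 obtain yb where yb: "cstate ub yb" by (rule adm_exists_state[OF ur(1)])
 have yb0: "C0dom yb" by (rule cstate_C0dom[OF yb])
 obtain p where p: "linsol 0 (%x. (yb x - yd' x) - 3 * (yb x)\<^sup>2 * p x) p"
  using linear_exists[OF yb0 L2supp_diff[OF C0dom_L2supp[OF yb0] rep_L2[OF ydr]]] by blast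
 interpret optimal_control \<Omega> \<alpha> \<beta> yd' ub yb p
 proof
  fix u y assume u: "adm u" "cstate u y" and ne: "\<not> (AE x in lborel. x \<in> \<Omega> --> u x = ub x)"
  have "\<not> (AE x in lborel. x \<in> \<Omega> --> u x = ubar x)"
  proof
   assume "AE x in lborel. x \<in> \<Omega> --> u x = ubar x"
   moreover have "AE x in lborel. x \<in> \<Omega> --> ubar x = ub x" using ur(2) by (simp add: rep_def)
   ultimately have "AE x in lborel. x \<in> \<Omega> --> u x = ub x" by eventually_elim simp
   with ne show False ..
  qed
  then have "Jfun \<Omega> yd ubar < Jfun \<Omega> yd u" using strict_min adm_Uad[OF u(1)] by (simp add: AE_completion_iff)
  then show "n2 (%x. yb x - yd' x) < n2 (%x. y x - yd' x)"
   unfolding Jfun_eq[OF ur(2) yb ydr] Jfun_eq[OF rep_self[OF adm_L2supp[OF u(1)]] u(2) ydr] by simp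
 qed (rule rep_L2[OF ydr] ur(1) yb p)+
 show ?thesis
  unfolding second_order_condition_iff[OF ur(2) ydr] stability_iff[OF ur(2) ydr] by (rule second_order_iff_stable)
qed

end
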